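(* Let $\psi: \mathbb{N} \rightarrow [0,\infty)$ be a function. Assume that $$\sum_{n=1}^\infty \frac{\psi(n) \varphi(n)}{n} = \infty.$$ Assume additionally that there exists a constant $\eta > 0$ such that $$ \sum_{\substack{2^h < n \leq 2^h h^\eta, \\ r^{-1} h^{-\eta} < \psi(n) \leq r^{-1}}} \frac{\psi(n) \varphi(n)}{n} \ll \frac{1}{\log \log h} $$ for all positive integers $h$, uniformly in $r \geq 1$ (that is, with an implied constant independent of $h$ and of the real number $r \ge 1$). Then $\lambda(W(\psi))=1$.
   Context: $\mathbb{N}$ is the set of positive integers, $\varphi$ is the Euler totient function, and $\lambda$ is Lebesgue measure. Convention: $\log x$ is understood as $\max(1,\log x)$ (also in iterated logarithms), so that all logarithms and iterated logarithms are positive and well-defined. $A \ll B$ means $A \le C B$ for some constant $C>0$. For a function $\psi:\mathbb{N}\to[0,\infty)$ and $n \in \mathbb{N}$, define the set $\mathcal{E}_n \subset \mathbb{R}/\mathbb{Z}$ by $$\mathcal{E}_n := \bigcup_{\substack{1 \leq a \leq n,\\ \gcd(a,n)=1}} \left( \frac{a - \psi(n)}{n},\frac{a+\psi(n)}{n} \right),$$ and let $W(\psi)$ be the set of those $x \in [0,1]$ which are contained (modulo 1) in infinitely many of the sets $\mathcal{E}_n$. *)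

theory Defs
  imports "HOL-Analysis.Analysis" "HOL-Number_Theory.Number_Theory"
begin

(* The convention that every logarithm, iterated ones included, is truncated below at 1. *)
definition Log :: "real \<Rightarrow> real" where
  "Log x = max 1 (ln x)"

(* Real representatives of the subset of the circle R/Z; the reduction modulo 1 is made in
   limsup_set. Only values of psi at positive arguments are ever used. *)
definition approx_set :: "(nat \<Rightarrow> real) \<Rightarrow> nat \<Rightarrow> real set" where
  "approx_set \<psi> n =
     (\<Union>a\<in>{a. 1 \<le> a \<and> a \<le> n \<and> coprime a n}.
        {(real a - \<psi> n) / real n <..< (real a + \<psi> n) / real n})"

definition limsup_set :: "(nat \<Rightarrow> real) \<Rightarrow> real set" where
  "limsup_set \<psi> =
     {x \<in> {0..1}. infinite {n. n \<ge> 1 \<and> (\<exists>k::int. x + of_int k \<in> approx_set \<psi> n)}}"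

end

theory Submission
  imports Defs "HOL-Real_Asymp.Real_Asymp"
begin

text \<open>
  The divergence of the series alone suffices (this is the theorem of Koukoulopoulos and Maynard). Truncating
  \<open>\<psi> n\<close> at \<open>sqrt n\<close> keeps the series divergent. The measure of the overlap of two approximation sets is
  controlled by a sieve: it is at most a constant times the product of the measures, inflated by
  \<open>exp (\<Sum> 1 / p)\<close> over the primes \<open>p\<close> that exceed the overlap scale \<open>D = max (m \<psi> n) (n \<psi> m) / gcd m n\<close>
  and divide \<open>m\<close> and \<open>n\<close> to different powers. For each dyadic range of \<open>D\<close> the average of this inflation is
  bounded by induction over primes: at each prime the pairs are split according to their valuations, the
  powers of the prime are divided out, and the loss is a factor \<open>1 + O(p powr (-5/4))\<close>, plus a term for the
  inflation. Hence the second moment is bounded by the square of the first, and Cauchy--Schwarz gives a limsup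
  set of positive measure. Finally Gallagher's zero-one law applies: for each prime \<open>p\<close> the denominators are
  split by whether \<open>p\<close> divides them not at all, exactly once, or at least twice; the first two classes
  are handled by the maps \<open>x \<mapsto> p x\<close> and \<open>x \<mapsto> p x + 1 / p\<close>, and the third is periodic
  with period \<open>1 / p\<close>.
\<close>

subsection \<open>Weighted edge counts: the real inequality for one prime\<close>

text \<open>The sieve saves only at primes up to the overlap scale \<open>D\<close>; the loss at
  larger primes is unbounded for single pairs and is controlled only on average. Raising the weight
  to \<open>exp (t / p)\<close> over primes \<open>p \<ge> t\<close> keeps this average bounded
  uniformly in \<open>t\<close>, since the sum of \<open>t / p ^ 2\<close> over these primes is
  bounded, while a pair whose large-prime sum exceeds 1 then carries a surplus of
  \<open>exp (t - 1)\<close>. For \<open>t\<close> comparable to \<open>D\<close> this beats the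
  factor \<open>sqrt D\<close> lost in rescaling by \<open>D\<close> under the exponent 3/4. The
  obstacle is that every removed prime multiplies the constant, so a cost of 1 + O(1/p) would
  diverge. The terms of order 1/p must cancel with exact coefficients: Young's inequality charges
  1/(2p) for the edges between a dominant valuation and lower ones, and the totient factor
  \<open>1 - 1 / p\<close> on both sides returns
  \<open>sqrt (1 - 1 / p) \<le> 1 - 1 / (2 * p)\<close>. What survives is of order
  \<open>p powr (-5/4)\<close>, apart from the inflation.\<close>

lemma powr_quarter:
  fixes z :: real
  assumes "0 \<le> z"
  shows "(z powr (1/4)) ^ 4 = z" "z powr (3/4) = (z powr (1/4)) ^ 3" "sqrt z = (z powr (1/4))\<^sup>2"
proof -
  show "(z powr (1/4)) ^ 4 = z"
    using assms by (cases "z = 0") (simp_all add: powr_power)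
  show "z powr (3/4) = (z powr (1/4)) ^ 3"
    using assms by (cases "z = 0") (simp_all add: powr_power)
  show "sqrt z = (z powr (1/4))\<^sup>2"
    using assms by (cases "z = 0") (simp_all add: powr_power powr_half_sqrt[symmetric])
qed

text \<open>With \<open>w = (1 - z) powr (1/4)\<close> the tangent-line bound at
  \<open>z = 0\<close> becomes \<open>3 * w ^ 4 - 4 * w ^ 3 + 1 \<ge> 0\<close>, a polynomial with
  the double root \<open>w = 1\<close>.\<close>

lemma one_minus_powr_le:
  fixes z :: real
  assumes "0 \<le> z" "z \<le> 1"
  shows "(1 - z) powr (3/4) \<le> 1 - 3/4 * z"
proof -
  define w where "w = (1 - z) powr (1/4)"
  have w: "w ^ 4 = 1 - z" "(1 - z) powr (3/4) = w ^ 3"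
    using powr_quarter[of "1 - z"] assms by (auto simp: w_def)
  have "0 \<le> (w - 1)\<^sup>2 * (2 * w\<^sup>2 + (w + 1)\<^sup>2)" by simp
  also have "\<dots> = 3 * w ^ 4 - 4 * w ^ 3 + 1" by (simp add: power2_eq_square power3_eq_cube power4_eq_xxxx algebra_simps)
  finally show ?thesis using w by simp
qed

text \<open>Young's inequality with exponents 4 and 4/3. The coefficient 3/4 of \<open>s\<close> is
  the slope in \<open>one_minus_powr_le\<close>, so that the linear terms cancel exactly when both
  are used in \<open>one_prime_inequality\<close>.\<close>

lemma powr_three_quarters_le:
  fixes B s :: real
  assumes "0 \<le> s"
  shows "B * s powr (3/4) \<le> B ^ 4 / 4 + 3/4 * s"
proof -
  define w where "w = s powr (1/4)"
  have w: "w ^ 4 = s" "s powr (3/4) = w ^ 3"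
    using powr_quarter[of s] assms by (auto simp: w_def)
  have "0 \<le> (B - w)\<^sup>2 * ((B + w)\<^sup>2 + 2 * w\<^sup>2)" by simp
  also have "\<dots> = B ^ 4 - 4 * B * w ^ 3 + 3 * w ^ 4" by (simp add: power2_eq_square power3_eq_cube power4_eq_xxxx algebra_simps)
  finally show ?thesis using w by simp
qed

text \<open>AM-GM for \<open>x powr (3/2)\<close> and \<open>y powr (3/2)\<close>. It separates the
  variables for Schur's test, and the exponent 3/2 > 1 makes small masses contribute superlinearly
  little.\<close>

lemma powr_product_le:
  fixes x y :: real
  assumes "0 \<le> x" "0 \<le> y"
  shows "(x * y) powr (3/4) \<le> (x * sqrt x + y * sqrt y) / 2"
proof -
  define u where "u = x powr (1/4)"
  define v where "v = y powr (1/4)"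
  have u: "u ^ 4 = x" "x powr (3/4) = u ^ 3" "sqrt x = u\<^sup>2"
    using powr_quarter[of x] assms by (auto simp: u_def)
  have v: "v ^ 4 = y" "y powr (3/4) = v ^ 3" "sqrt y = v\<^sup>2"
    using powr_quarter[of y] assms by (auto simp: v_def)
  have "0 \<le> (u ^ 3 - v ^ 3)\<^sup>2" by simp
  also have "\<dots> = u ^ 4 * u\<^sup>2 + v ^ 4 * v\<^sup>2 - 2 * (u ^ 3 * v ^ 3)" by (simp add: power2_eq_square power3_eq_cube power4_eq_xxxx algebra_simps)
  finally show ?thesis using u v assms by (simp add: powr_mult)
qed

lemma sum_power_below_le:
  fixes r :: real
  assumes "0 < r" "r < 1"
  shows "(\<Sum>j<i. r ^ (i - j)) \<le> r / (1 - r)"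
proof -
  have "(\<Sum>j<i. r ^ (i - j)) = (\<Sum>j<i. r * r ^ (i - Suc j))"
    by (intro sum.cong refl) (auto simp: power_Suc[symmetric] Suc_diff_Suc simp del: power_Suc)
  also have "\<dots> = r * (\<Sum>j<i. r ^ j)"
    by (simp add: sum_distrib_left[symmetric] sum.nat_diff_reindex[of "\<lambda>j. r ^ j"])
  also have "\<dots> = r * ((1 - r ^ i) / (1 - r))"
    using assms by (simp add: sum_gp_strict)
  also have "\<dots> \<le> r * (1 / (1 - r))"
    using assms by (intro mult_left_mono divide_right_mono) auto
  finally show ?thesis by simp
qed

lemma sum_power_above_le:
  fixes r :: real
  assumes "0 < r" "r < 1"
  shows "(\<Sum>j\<in>{i<..n}. r ^ (j - i)) \<le> r / (1 - r)"
proof -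
  have "(\<Sum>j\<in>{i<..n}. r ^ (j - i)) = (\<Sum>j<n-i. r * r ^ j)"
    by (rule sum.reindex_bij_witness[of _ "\<lambda>j. i + Suc j" "\<lambda>j. j - Suc i"])
       (auto simp: power_Suc[symmetric] Suc_diff_Suc simp del: power_Suc)
  also have "\<dots> = r * ((1 - r ^ (n - i)) / (1 - r))"
    using assms by (simp add: sum_gp_strict sum_distrib_left[symmetric])
  also have "\<dots> \<le> r * (1 / (1 - r))"
    using assms by (intro mult_left_mono divide_right_mono) auto
  finally show ?thesis by simp
qed

lemma sum_Un_le:
  fixes f :: "'a \<Rightarrow> real"
  assumes "finite A" "finite B" "\<And>x. x \<in> A \<union> B \<Longrightarrow> 0 \<le> f x" "C \<subseteq> A \<union> B"
  shows "sum f C \<le> sum f A + sum f B"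
proof -
  have "sum f C \<le> sum f (A \<union> B)" using assms by (intro sum_mono2) auto
  also have "\<dots> \<le> sum f A + sum f B"
    using sum_Un[of A B f] sum_nonneg[of "A \<inter> B" f] assms by auto
  finally show ?thesis .
qed

lemma sum_le_sum_Un:
  fixes f :: "'a \<Rightarrow> real"
  assumes "finite A" "finite B" "\<And>x. x \<in> C \<union> A \<union> B \<Longrightarrow> 0 \<le> f x" "C \<subseteq> A \<union> B"
     "sum f A \<le> a" "sum f B \<le> b"
  shows "sum f C \<le> a + b"
  using sum_Un_le[of A B f C] assms by fastforce

text \<open>One of the truncated differences vanishes, so this is the distance of \<open>i\<close>
  and \<open>j\<close>. The split form lets \<open>p ^ gap i j\<close> factor into the rescalings
  \<open>p ^ (j - i)\<close> and \<open>p ^ (i - j)\<close> of the two functions.\<close>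

definition gap :: "nat \<Rightarrow> nat \<Rightarrow> nat" where "gap i j = (i - j) + (j - i)"

lemma sum_power_gap_le:
  fixes r :: real
  assumes "0 < r" "r < 1" "finite J"
  shows "(\<Sum>j\<in>J. if j = i then 0 else r ^ gap i j) \<le> 2 * r / (1 - r)"
proof -
  obtain n where n: "J \<subseteq> {..n}" "i \<le> n"
  proof
    show "J \<subseteq> {..Max (insert i J)}" "i \<le> Max (insert i J)" using assms by auto
  qed
  have "(\<Sum>j\<in>J. if j = i then 0 else r ^ gap i j) \<le> (\<Sum>j\<le>n. if j = i then 0 else r ^ gap i j)"
    using n assms by (intro sum_mono2) auto
  also have "\<dots> = (\<Sum>j\<in>{..n}-{i}. r ^ gap i j)"
    by (intro sum.mono_neutral_cong_right) auto
  also have "\<dots> \<le> (\<Sum>j<i. r ^ gap i j) + (\<Sum>j\<in>{i<..n}. r ^ gap i j)"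
    using assms by (intro sum_Un_le) (auto simp: not_less)
  also have "(\<Sum>j<i. r ^ gap i j) = (\<Sum>j<i. r ^ (i - j))"
    by (intro sum.cong) (auto simp: gap_def)
  also have "(\<Sum>j\<in>{i<..n}. r ^ gap i j) = (\<Sum>j\<in>{i<..n}. r ^ (j - i))"
    by (intro sum.cong) (auto simp: gap_def)
  finally show ?thesis
    using sum_power_below_le[of r i] sum_power_above_le[of r i n] assms by simp
qed

lemma gap_commute: "gap i j = gap j i" by (simp add: gap_def)

text \<open>Schur's test: once \<open>powr_product_le\<close> has separated the variables, each row
  and each column of the kernel \<open>r ^ gap i j\<close> without its diagonal sums to at most
  \<open>2 * r / (1 - r)\<close>.\<close>

lemma Schur_offdiagonal:
  fixes x y :: "nat \<Rightarrow> real"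
  assumes r: "0 < r" "r < 1" and fin: "finite I" "finite J"
    and x: "\<And>i. i \<in> I \<Longrightarrow> 0 \<le> x i" and y: "\<And>i. i \<in> J \<Longrightarrow> 0 \<le> y i"
  shows "(\<Sum>(i,j)\<in>{(i,j)\<in>I\<times>J. i \<noteq> j}. r ^ gap i j * (x i * y j) powr (3/4))
     \<le> r / (1 - r) * ((\<Sum>i\<in>I. x i * sqrt (x i)) + (\<Sum>j\<in>J. y j * sqrt (y j)))"
proof -
  let ?c = "\<lambda>i j. if j = i then 0 else r ^ gap i j"
  have c: "0 \<le> ?c i j" for i j using r by auto
  have "(\<Sum>(i,j)\<in>{(i,j)\<in>I\<times>J. i \<noteq> j}. r ^ gap i j * (x i * y j) powr (3/4))
      = (\<Sum>(i,j)\<in>I\<times>J. ?c i j * (x i * y j) powr (3/4))"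
    by (rule sum.mono_neutral_cong_left) (use fin in \<open>auto split: if_splits\<close>)
  also have "\<dots> \<le> (\<Sum>(i,j)\<in>I\<times>J. ?c i j * ((x i * sqrt (x i) + y j * sqrt (y j)) / 2))"
    using powr_product_le x y c by (intro sum_mono) (auto intro!: mult_left_mono simp del: times_divide_eq_right)
  also have "\<dots> = (\<Sum>i\<in>I. \<Sum>j\<in>J. ?c i j * (x i * sqrt (x i)) / 2 + ?c i j * (y j * sqrt (y j)) / 2)"
    by (simp add: sum.cartesian_product[symmetric] algebra_simps add_divide_distrib)
  also have "\<dots> = (\<Sum>i\<in>I. \<Sum>j\<in>J. ?c i j * (x i * sqrt (x i)) / 2) + (\<Sum>j\<in>J. \<Sum>i\<in>I. ?c i j * (y j * sqrt (y j)) / 2)"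
    by (simp only: sum.distrib) (simp only: sum.swap[of _ I J])
  also have "\<dots> = (\<Sum>i\<in>I. (\<Sum>j\<in>J. ?c i j) * (x i * sqrt (x i) / 2)) + (\<Sum>j\<in>J. (\<Sum>i\<in>I. ?c i j) * (y j * sqrt (y j) / 2))"
    by (simp only: sum_distrib_right times_divide_eq_right sum_divide_distrib)
  also have "\<dots> \<le> (\<Sum>i\<in>I. (2 * r / (1 - r)) * (x i * sqrt (x i) / 2)) + (\<Sum>j\<in>J. (2 * r / (1 - r)) * (y j * sqrt (y j) / 2))"
  proof (intro add_mono sum_mono mult_right_mono)
    show "(\<Sum>j\<in>J. ?c i j) \<le> 2 * r / (1 - r)" for i
      using sum_power_gap_le[OF r fin(2)] by simp
    show "(\<Sum>i\<in>I. ?c i j) \<le> 2 * r / (1 - r)" for j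
    proof -
      have "(\<Sum>i\<in>I. ?c i j) = (\<Sum>i\<in>I. ?c j i)"
        by (intro sum.cong) (auto simp: gap_commute)
      thus ?thesis using sum_power_gap_le[OF r fin(1), of j] by simp
    qed
  qed (use x y in auto)
  also have "\<dots> = r / (1 - r) * ((\<Sum>i\<in>I. x i * sqrt (x i)) + (\<Sum>j\<in>J. y j * sqrt (y j)))"
  proof -
    have "(2 * r / (1 - r)) * (t / 2) = r / (1 - r) * t" for t using r by (simp add: field_simps)
    thus ?thesis by (simp only: distrib_left sum_distrib_left)
  qed
  finally show ?thesis .
qed

text \<open>Here \<open>e i j\<close> is the normalised weight of the edges between vertices of \<open>p\<close>-adic valuations \<open>i\<close> and
  \<open>j\<close>, with \<open>r = p powr (-1/4)\<close>. If the total exceeds 1, the decay in \<open>gap i j\<close> forces almost all of \<open>x\<close> and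
  of \<open>y\<close> onto one common valuation \<open>k\<close>; the factor \<open>sqrt (1 - r ^ 4)\<close> at \<open>k\<close> then absorbs the cross terms
  with the other valuations.\<close>

lemma one_prime_inequality:
  fixes x y :: "nat \<Rightarrow> real" and e :: "nat \<Rightarrow> nat \<Rightarrow> real" and r kap :: real and n :: nat
  assumes r: "0 < r" "r \<le> 1/100000" and kap: "1 \<le> kap" "kap \<le> 3"
    and x: "\<And>i. 0 \<le> x i" "(\<Sum>i\<le>n. x i) = 1"
    and y: "\<And>i. 0 \<le> y i" "(\<Sum>i\<le>n. y i) = 1"
    and e: "\<And>i j. 0 \<le> e i j"
    and F1: "\<And>i j. i \<le> n \<Longrightarrow> j \<le> n \<Longrightarrow>
       e i j \<le> (if i = j then 1 else kap) * (r ^ gap i j * (x i * y j) powr (3/4))"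
    and F2_0: "(\<Sum>(i,j)\<in>{(i,j)\<in>{..n}\<times>{..n}. min i j = 0}. e i j) \<le> 1"
    and F2: "\<And>k. 1 \<le> k \<Longrightarrow> k \<le> n \<Longrightarrow>
      (\<Sum>(i,j)\<in>{(i,j)\<in>{..n}\<times>{..n}. min i j = k}. e i j)
       \<le> sqrt (1 - r ^ 4) * ((\<Sum>i\<in>{k..n}. x i) * (\<Sum>i\<in>{k..n}. y i)) powr (3/4)
         + r ^ 4 * (\<Sum>(i,j)\<in>{(i,j)\<in>{..n}\<times>{..n}. min i j = k \<and> i \<noteq> j}. e i j)"
  shows "(\<Sum>(i,j)\<in>{..n}\<times>{..n}. e i j) \<le> 1 + 1000000 * (r ^ 5 + r ^ 4 * (kap - 1))"
proof -
  define I where "I = {..n}"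
  define T where "T = (\<Sum>(i,j)\<in>I\<times>I. e i j)"
  have finI: "finite I" by (simp add: I_def)
  have r1: "0 < r" "r < 1" using r by auto
  define \<rho> where "\<rho> = r / (1 - r)"
  have \<rho>: "0 < \<rho>" "\<rho> \<le> 101/100 * r"
    using r by (auto simp: \<rho>_def field_simps)
  have x1: "x i \<le> 1" if "i \<le> n" for i
    using member_le_sum[of i "{..n}" x] x that by auto
  have y1: "y i \<le> 1" if "i \<le> n" for i
    using member_le_sum[of i "{..n}" y] y that by auto
  have F1': "e i j \<le> kap * (r ^ gap i j * (x i * y j) powr (3/4))" if "i \<le> n" "j \<le> n" for i j
  proof (cases "i = j")
    case True
    have "1 * (r ^ gap i j * (x i * y j) powr (3/4)) \<le> kap * (r ^ gap i j * (x i * y j) powr (3/4))"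
      using kap r by (intro mult_right_mono) auto
    thus ?thesis using F1[OF that] True by simp
  qed (use F1[OF that] in auto)
  have xs: "x i * sqrt (x i) \<le> x i" if "i \<le> n" for i
    using x1[OF that] x(1)[of i] by (simp add: mult_left_le)
  have ys: "y i * sqrt (y i) \<le> y i" if "i \<le> n" for i
    using y1[OF that] y(1)[of i] by (simp add: mult_left_le)

  have off_gen: "(\<Sum>(i,j)\<in>{(i,j)\<in>J\<times>J'. i \<noteq> j}. e i j)
      \<le> kap * (\<rho> * ((\<Sum>i\<in>J. x i * sqrt (x i)) + (\<Sum>j\<in>J'. y j * sqrt (y j))))"
    if "J \<subseteq> I" "J' \<subseteq> I" for J J'
  proof -
    have fin: "finite J" "finite J'" using that finI finite_subset by auto
    have "(\<Sum>(i,j)\<in>{(i,j)\<in>J\<times>J'. i \<noteq> j}. e i j)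
        \<le> (\<Sum>(i,j)\<in>{(i,j)\<in>J\<times>J'. i \<noteq> j}. kap * (r ^ gap i j * (x i * y j) powr (3/4)))"
      using that F1' by (intro sum_mono) (auto simp: I_def subset_iff)
    also have "\<dots> = kap * (\<Sum>(i,j)\<in>{(i,j)\<in>J\<times>J'. i \<noteq> j}. r ^ gap i j * (x i * y j) powr (3/4))"
      by (simp add: sum_distrib_left case_prod_unfold)
    also have "\<dots> \<le> kap * (\<rho> * ((\<Sum>i\<in>J. x i * sqrt (x i)) + (\<Sum>j\<in>J'. y j * sqrt (y j))))"
      unfolding \<rho>_def using kap
      by (intro mult_left_mono Schur_offdiagonal) (use r1 fin x y in auto)
    finally show ?thesis .
  qed

  have off_all: "(\<Sum>(i,j)\<in>{(i,j)\<in>I\<times>I. i \<noteq> j}. e i j) \<le> 7 * r"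
  proof -
    have "(\<Sum>i\<in>I. x i * sqrt (x i)) \<le> 1" "(\<Sum>i\<in>I. y i * sqrt (y i)) \<le> 1"
      using sum_mono[of I "\<lambda>i. x i * sqrt (x i)" x] sum_mono[of I "\<lambda>i. y i * sqrt (y i)" y] xs ys x y
      by (auto simp: I_def)
    hence "(\<Sum>i\<in>I. x i * sqrt (x i)) + (\<Sum>i\<in>I. y i * sqrt (y i)) \<le> 2" by simp
    hence "kap * (\<rho> * ((\<Sum>i\<in>I. x i * sqrt (x i)) + (\<Sum>j\<in>I. y j * sqrt (y j)))) \<le> 3 * (\<rho> * 2)"
      using kap \<rho> x y by (intro mult_mono) (auto intro!: mult_nonneg_nonneg add_nonneg_nonneg sum_nonneg)
    also have "\<dots> \<le> 7 * r" using \<rho> r by simp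
    finally show ?thesis using off_gen[of I I] by simp
  qed

  \<comment> \<open>The largest diagonal product locates the valuation \<open>k\<close> that will
    carry almost all of both masses.\<close>
  define M where "M = Max ((\<lambda>i. x i * y i) ` I)"
  have "M \<in> (\<lambda>i. x i * y i) ` I" unfolding M_def by (intro Max_in) (auto simp: I_def)
  then obtain k where k: "k \<in> I" "M = x k * y k" by auto
  have kn: "k \<le> n" using k by (simp add: I_def)
  have Mge: "x i * y i \<le> M" if "i \<in> I" for i
    unfolding M_def using that finI by auto
  have M0: "0 \<le> M" using k x y by simp
  \<comment> \<open>Split 3/4 = 1/4 + 1/2: the first part is at most \<open>M powr (1/4)\<close>,
    and the square root is averaged by AM-GM to a total of 1.\<close>
  have diag: "(\<Sum>i\<in>I. e i i) \<le> M powr (1/4)"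
  proof -
    have "e i i \<le> M powr (1/4) * ((x i + y i) / 2)" if "i \<in> I" for i
    proof -
      have "e i i \<le> (x i * y i) powr (3/4)"
        using F1[of i i] that by (simp add: I_def gap_def)
      also have "\<dots> = (x i * y i) powr (1/4) * (x i * y i) powr (1/2)"
        by (simp add: powr_add[symmetric])
      also have "\<dots> \<le> M powr (1/4) * ((x i + y i) / 2)"
        using Mge[OF that] x y arith_geo_mean_sqrt[of "x i" "y i"]
        by (intro mult_mono powr_mono2) (auto simp: powr_half_sqrt)
      finally show ?thesis .
    qed
    hence "(\<Sum>i\<in>I. e i i) \<le> (\<Sum>i\<in>I. M powr (1/4) * ((x i + y i) / 2))" by (intro sum_mono) auto
    also have "\<dots> = M powr (1/4) * (((\<Sum>i\<in>I. x i) + (\<Sum>i\<in>I. y i)) / 2)"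
      by (simp add: sum_distrib_left[symmetric] sum_divide_distrib[symmetric] sum.distrib)
    finally show ?thesis using x y by (simp add: I_def)
  qed
  have T_split: "T \<le> M powr (1/4) + 7 * r"
  proof -
    have "T = (\<Sum>(i,j)\<in>{(i,j)\<in>I\<times>I. i = j} \<union> {(i,j)\<in>I\<times>I. i \<noteq> j}. e i j)"
      unfolding T_def by (intro sum.cong) auto
    also have "\<dots> = (\<Sum>(i,j)\<in>{(i,j)\<in>I\<times>I. i = j}. e i j) + (\<Sum>(i,j)\<in>{(i,j)\<in>I\<times>I. i \<noteq> j}. e i j)"
      by (intro sum.union_disjoint) (auto intro!: finite_subset[OF _ finite_cartesian_product[OF finI finI]])
    also have "(\<Sum>(i,j)\<in>{(i,j)\<in>I\<times>I. i = j}. e i j) = (\<Sum>i\<in>I. e i i)"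
      by (rule sum.reindex_bij_witness[of _ "\<lambda>i. (i,i)" fst]) auto
    finally show ?thesis using diag off_all by simp
  qed
  have goal0: ?thesis if "T \<le> 1"
  proof -
    have "0 \<le> 1000000 * (r ^ 5 + r ^ 4 * (kap - 1))" using r kap by simp
    thus ?thesis using that unfolding T_def I_def by simp
  qed
  show ?thesis
  proof (cases "T \<le> 1")
    case True thus ?thesis by (rule goal0)
  next
    case False
    \<comment> \<open>A total above 1 leaves at least \<open>1 - 7 * r\<close> to the diagonal, and
      Bernoulli turns the fourth power into \<open>1 - 28 * r\<close>; so \<open>x k\<close> and
      \<open>y k\<close> both lie within \<open>28 * r\<close> of 1.\<close>
    have "1 - 7 * r \<le> M powr (1/4)" using T_split False by simp
    hence "(1 - 7 * r) ^ 4 \<le> (M powr (1/4)) ^ 4" using r by (intro power_mono) auto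
    hence "(1 - 7 * r) ^ 4 \<le> M" using powr_quarter(1)[OF M0] by simp
    moreover have "1 - 28 * r \<le> (1 - 7 * r) ^ 4"
      using Bernoulli_inequality[of "- 7 * r" 4] r by simp
    ultimately have M1: "1 - 28 * r \<le> x k * y k" using k by simp
    define z where "z = 1 - x k"
    define z' where "z' = 1 - y k"
    have "x k * y k \<le> x k" "x k * y k \<le> y k"
      using x1[OF kn] y1[OF kn] x(1)[of k] y(1)[of k] by (simp_all add: mult_left_le mult_left_le_one_le)
    hence z: "0 \<le> z" "z \<le> 28 * r" "0 \<le> z'" "z' \<le> 28 * r"
      using M1 x1[OF kn] y1[OF kn] by (auto simp: z_def z'_def)
    define I' where "I' = I - {k}"
    have I': "I' \<subseteq> I" "finite I'" "insert k I' = I" using finI k by (auto simp: I'_def)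
    have sx: "(\<Sum>i\<in>I'. x i) = z" "(\<Sum>i\<in>I'. y i) = z'"
      using x y k finI by (simp_all add: I'_def z_def z'_def sum_diff1 I_def)
    have xz: "x i \<le> z" "y i \<le> z'" if "i \<in> I'" for i
      using member_le_sum[of i I' x] member_le_sum[of i I' y] x y that I' sx by auto
    have sxs: "(\<Sum>i\<in>I'. x i * sqrt (x i)) \<le> z * sqrt z"
    proof -
      have "(\<Sum>i\<in>I'. x i * sqrt (x i)) \<le> (\<Sum>i\<in>I'. x i * sqrt z)"
        using xz x by (intro sum_mono mult_left_mono) auto
      thus ?thesis by (simp add: sum_distrib_right[symmetric] sx)
    qed
    have sys: "(\<Sum>i\<in>I'. y i * sqrt (y i)) \<le> z' * sqrt z'"
    proof -
      have "(\<Sum>i\<in>I'. y i * sqrt (y i)) \<le> (\<Sum>i\<in>I'. y i * sqrt z')"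
        using xz y by (intro sum_mono mult_left_mono) auto
      thus ?thesis by (simp add: sum_distrib_right[symmetric] sx)
    qed
    define S where "S = (\<Sum>(i,j)\<in>I'\<times>I'. e i j)"
    have S: "S \<le> z * sqrt z + z' * sqrt z'"
    proof -
      have "S \<le> (\<Sum>(i,j)\<in>{(i,j)\<in>I'\<times>I'. i = j}. e i j) + (\<Sum>(i,j)\<in>{(i,j)\<in>I'\<times>I'. i \<noteq> j}. e i j)"
        unfolding S_def
        by (intro sum_Un_le) (use e I' in \<open>auto intro!: finite_subset[OF _ finite_cartesian_product[OF I'(2) I'(2)]]\<close>)
      also have "(\<Sum>(i,j)\<in>{(i,j)\<in>I'\<times>I'. i = j}. e i j) = (\<Sum>i\<in>I'. e i i)"
        by (rule sum.reindex_bij_witness[of _ "\<lambda>i. (i,i)" fst]) auto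
      also have "\<dots> \<le> (\<Sum>i\<in>I'. (x i * sqrt (x i) + y i * sqrt (y i)) / 2)"
      proof (intro sum_mono)
        fix i assume "i \<in> I'"
        hence "e i i \<le> (x i * y i) powr (3/4)"
          using F1[of i i] I' by (auto simp: I_def gap_def)
        thus "e i i \<le> (x i * sqrt (x i) + y i * sqrt (y i)) / 2"
          using powr_product_le[of "x i" "y i"] x y by simp
      qed
      also have "\<dots> \<le> (z * sqrt z + z' * sqrt z') / 2"
        using sxs sys by (simp add: sum_divide_distrib[symmetric] sum.distrib)
      also have "(\<Sum>(i,j)\<in>{(i,j)\<in>I'\<times>I'. i \<noteq> j}. e i j) \<le> kap * (\<rho> * (z * sqrt z + z' * sqrt z'))"
        using off_gen[OF I'(1) I'(1)] sxs sys kap \<rho>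
        by (smt (verit, best) mult_left_mono)
      also have "\<dots> = kap * \<rho> * (z * sqrt z + z' * sqrt z')" by simp
      also have "\<dots> \<le> (1/2) * (z * sqrt z + z' * sqrt z')"
      proof (rule mult_right_mono)
        have "kap * \<rho> \<le> 3 * (101/100 * r)" using kap \<rho> by (intro mult_mono) auto
        thus "kap * \<rho> \<le> 1/2" using r by simp
      qed (use z in simp)
      finally show ?thesis by simp
    qed
    have ekk: "e k k \<le> (1 - 3/4 * z) * (1 - 3/4 * z')"
    proof -
      have "e k k \<le> (x k * y k) powr (3/4)" using F1[OF kn kn] by (simp add: gap_def)
      also have "\<dots> = (1 - z) powr (3/4) * (1 - z') powr (3/4)"
        using x y by (simp add: z_def z'_def powr_mult)
      also have "\<dots> \<le> (1 - 3/4 * z) * (1 - 3/4 * z')"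
        using z r by (intro mult_mono one_minus_powr_le) auto
      finally show ?thesis .
    qed
    have rowk: "(\<Sum>i\<in>J. e i k) \<le> kap * (\<Sum>i\<in>J. r ^ gap i k) * s powr (3/4)"
      if "J \<subseteq> I'" "\<And>i. i \<in> J \<Longrightarrow> x i \<le> s" for J s
    proof -
      have "(\<Sum>i\<in>J. e i k) \<le> (\<Sum>i\<in>J. kap * (r ^ gap i k * s powr (3/4)))"
      proof (intro sum_mono)
        fix i assume i: "i \<in> J"
        hence "i \<le> n" using that I' by (auto simp: I_def)
        have "x i * y k \<le> s"
          using that(2)[OF i] y1[OF kn] x(1)[of i] y(1)[of k] mult_left_le[of "y k" "x i"] by linarith
        hence "(x i * y k) powr (3/4) \<le> s powr (3/4)"
          using x(1)[of i] y(1)[of k] by (intro powr_mono2) auto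
        hence "kap * (r ^ gap i k * (x i * y k) powr (3/4)) \<le> kap * (r ^ gap i k * s powr (3/4))"
          using r kap by (intro mult_left_mono) auto
        thus "e i k \<le> kap * (r ^ gap i k * s powr (3/4))" using F1'[OF \<open>i \<le> n\<close> kn] by simp
      qed
      thus ?thesis by (simp add: sum_distrib_left sum_distrib_right mult_ac)
    qed
    have colk: "(\<Sum>i\<in>J. e k i) \<le> kap * (\<Sum>i\<in>J. r ^ gap i k) * s powr (3/4)"
      if "J \<subseteq> I'" "\<And>i. i \<in> J \<Longrightarrow> y i \<le> s" for J s
    proof -
      have "(\<Sum>i\<in>J. e k i) \<le> (\<Sum>i\<in>J. kap * (r ^ gap i k * s powr (3/4)))"
      proof (intro sum_mono)
        fix i assume i: "i \<in> J"
        hence "i \<le> n" using that I' by (auto simp: I_def)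
        have "x k * y i \<le> s"
          using that(2)[OF i] x1[OF kn] y(1)[of i] x(1)[of k] mult_left_le_one_le[of "y i" "x k"] by linarith
        hence "(x k * y i) powr (3/4) \<le> s powr (3/4)"
          using y(1)[of i] x(1)[of k] by (intro powr_mono2) auto
        hence "kap * (r ^ gap i k * (x k * y i) powr (3/4)) \<le> kap * (r ^ gap i k * s powr (3/4))"
          using r kap by (intro mult_left_mono) auto
        thus "e k i \<le> kap * (r ^ gap i k * s powr (3/4))" using F1'[OF kn \<open>i \<le> n\<close>] by (simp add: gap_commute)
      qed
      thus ?thesis by (simp add: sum_distrib_left sum_distrib_right mult_ac)
    qed
    have gapsum: "(\<Sum>i\<in>I'. r ^ gap i k) \<le> 2 * \<rho>"
    proof -
      have "(\<Sum>i\<in>I'. r ^ gap i k) = (\<Sum>i\<in>I'. if i = k then 0 else r ^ gap k i)"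
        by (intro sum.cong) (auto simp: I'_def gap_commute)
      thus ?thesis using sum_power_gap_le[OF r1 I'(2), of k] by (simp add: \<rho>_def)
    qed
    have B2: "kap * (\<Sum>i\<in>J. r ^ gap i k) \<le> 7 * r" if "J \<subseteq> I'" for J
    proof -
      have "(\<Sum>i\<in>J. r ^ gap i k) \<le> (\<Sum>i\<in>I'. r ^ gap i k)"
        using that I' r by (intro sum_mono2) auto
      hence "kap * (\<Sum>i\<in>J. r ^ gap i k) \<le> 3 * (2 * (101/100 * r))"
        using kap gapsum \<rho> r by (intro mult_mono) (auto intro!: sum_nonneg)
      thus ?thesis using r by simp
    qed
    define w where "w = z powr (1/4)"
    define w' where "w' = z' powr (1/4)"
    have w: "0 \<le> w" "w ^ 4 = z" "z powr (3/4) = w ^ 3" "sqrt z = w\<^sup>2"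
      using powr_quarter[OF z(1)] by (auto simp: w_def)
    have w': "0 \<le> w'" "w' ^ 4 = z'" "z' powr (3/4) = w' ^ 3" "sqrt z' = w'\<^sup>2"
      using powr_quarter[OF z(3)] by (auto simp: w'_def)
    show ?thesis
    proof (cases "w < 28 * r \<and> w' < 28 * r")
      case False
      have "T \<le> e k k + (\<Sum>i\<in>I'. e i k) + ((\<Sum>i\<in>I'. e k i) + S)"
      proof -
        have "T = (\<Sum>i\<in>insert k I'. \<Sum>j\<in>insert k I'. e i j)"
          unfolding T_def I' by (simp add: sum.cartesian_product)
        also have "\<dots> = e k k + (\<Sum>i\<in>I'. e i k) + ((\<Sum>i\<in>I'. e k i) + S)"
        proof -
          have "k \<notin> I'" by (simp add: I'_def)
          thus ?thesis using I'(2) by (simp add: S_def sum.cartesian_product[symmetric] sum.distrib)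
        qed
        finally show ?thesis by simp
      qed
      also have "(\<Sum>i\<in>I'. e i k) \<le> 7 * r * w ^ 3"
      proof -
        have "(\<Sum>i\<in>I'. e i k) \<le> kap * (\<Sum>i\<in>I'. r ^ gap i k) * z powr (3/4)"
          by (rule rowk) (use xz in auto)
        also have "\<dots> \<le> 7 * r * w ^ 3" unfolding w using B2[of I'] w by (intro mult_right_mono) auto
        finally show ?thesis .
      qed
      also have "(\<Sum>i\<in>I'. e k i) \<le> 7 * r * w' ^ 3"
      proof -
        have "(\<Sum>i\<in>I'. e k i) \<le> kap * (\<Sum>i\<in>I'. r ^ gap i k) * z' powr (3/4)"
          by (rule colk) (use xz in auto)
        also have "\<dots> \<le> 7 * r * w' ^ 3" unfolding w' using B2[of I'] w' by (intro mult_right_mono) auto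
        finally show ?thesis .
      qed
      also note ekk
      also note S
      finally have T1: "T \<le> (1 - 3/4 * z) * (1 - 3/4 * z') + 7 * r * w ^ 3 + (7 * r * w' ^ 3 + (z * sqrt z + z' * sqrt z'))"
        by simp
      have small: "sqrt z \<le> 1/16" "sqrt z' \<le> 1/16"
      proof -
        have "z \<le> (1/16)\<^sup>2" "z' \<le> (1/16)\<^sup>2" using z r by (simp_all add: power2_eq_square)
        hence "sqrt z \<le> sqrt ((1/16)\<^sup>2)" "sqrt z' \<le> sqrt ((1/16)\<^sup>2)" by (simp_all only: real_sqrt_le_iff)
        thus "sqrt z \<le> 1/16" "sqrt z' \<le> 1/16" by simp_all
      qed
      have "z * z' \<le> z * (1/16)" using z r by (intro mult_left_mono) auto
      moreover have "z * sqrt z \<le> z * (1/16)" "z' * sqrt z' \<le> z' * (1/16)"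
        using mult_left_mono[OF small(1) z(1)] mult_left_mono[OF small(2) z(3)] by simp_all
      ultimately have T2: "T \<le> 1 + (7 * r * w ^ 3 - z / 2) + (7 * r * w' ^ 3 - z' / 2)"
        using T1 z by (simp add: algebra_simps)
      have p: "7 * r * u ^ 3 - u ^ 4 / 2 \<le> 19208 * r ^ 4" if "0 \<le> u" for u :: real
      proof (cases "u \<le> 14 * r")
        case True
        have "7 * r * u ^ 3 \<le> 7 * r * (14 * r) ^ 3" using True that r by (intro mult_left_mono power_mono) auto
        also have "\<dots> = 19208 * r ^ 4" by (simp add: power_mult_distrib eval_nat_numeral)
        finally show ?thesis using zero_le_power[OF that, of 4] by linarith
      next
        case False
        hence "0 \<le> u ^ 3 * (u / 2 - 7 * r)" using that by (intro mult_nonneg_nonneg) auto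
        also have "\<dots> = u ^ 4 / 2 - 7 * r * u ^ 3" by (simp add: algebra_simps eval_nat_numeral)
        finally have "7 * r * u ^ 3 \<le> u ^ 4 / 2" by simp
        moreover have "0 \<le> r ^ 4" by simp
        ultimately show ?thesis by linarith
      qed
      have q: "7 * r * u ^ 3 - u ^ 4 / 2 \<le> - 19208 * r ^ 4" if "28 * r \<le> u" for u :: real
      proof -
        have u0: "0 \<le> u" using that r by linarith
        have "(28 * r) ^ 3 * (28 * r / 2 - 7 * r) \<le> u ^ 3 * (u / 2 - 7 * r)"
          using that r u0 by (intro mult_mono power_mono) auto
        also have "\<dots> = u ^ 4 / 2 - 7 * r * u ^ 3" by (simp add: algebra_simps eval_nat_numeral)
        also have "(28 * r) ^ 3 * (28 * r / 2 - 7 * r) = 153664 * r ^ 4"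
          by (simp add: power_mult_distrib eval_nat_numeral)
        finally have "153664 * r ^ 4 \<le> u ^ 4 / 2 - 7 * r * u ^ 3" .
        moreover have "0 \<le> r ^ 4" by simp
        ultimately show ?thesis by linarith
      qed
      have "(7 * r * w ^ 3 - z / 2) + (7 * r * w' ^ 3 - z' / 2) \<le> 0"
        using False p[OF w(1)] p[OF w'(1)] q[of w] q[of w'] w w' by (auto simp: not_less)
      hence "T \<le> 1" using T2 by simp
      thus ?thesis by (rule goal0)
    next
      case True
      \<comment> \<open>Here \<open>614656 = 28 ^ 4\<close> and \<open>784 = 28 ^ 2\<close>: the
        masses away from \<open>k\<close> are now of order \<open>r ^ 4\<close>, and the edges
        avoiding \<open>k\<close> on both sides of order \<open>r ^ 6\<close>.\<close>
      have zr: "z \<le> 614656 * r ^ 4" "z' \<le> 614656 * r ^ 4"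
        using power_mono[of w "28 * r" 4] power_mono[of w' "28 * r" 4] w w' True
        by (auto simp: power_mult_distrib)
      have sq: "sqrt z \<le> 784 * r\<^sup>2" "sqrt z' \<le> 784 * r\<^sup>2"
        using power_mono[of w "28 * r" 2] power_mono[of w' "28 * r" 2] w w' True
        by (auto simp: power_mult_distrib)
      have S5: "S \<le> 20000 * r ^ 5"
      proof -
        have "z * sqrt z \<le> (614656 * r ^ 4) * (784 * r\<^sup>2)" "z' * sqrt z' \<le> (614656 * r ^ 4) * (784 * r\<^sup>2)"
          by (rule mult_mono; use zr sq z in simp)+
        hence "S \<le> 2 * ((614656 * r ^ 4) * (784 * r\<^sup>2))" using S by linarith
        \<comment> \<open>The constant is \<open>2 * 28 ^ 6\<close>; one factor
          \<open>r \<le> 1/100000\<close> is spent on bringing it below 20000.\<close>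
        also have "\<dots> = (963780608 * r) * r ^ 5" by (simp add: eval_nat_numeral)
        also have "\<dots> \<le> 20000 * r ^ 5" using r by (intro mult_right_mono) auto
        finally show ?thesis .
      qed
      show ?thesis
      proof (cases "k = 0")
        case True
        \<comment> \<open>With \<open>k = 0\<close>, every edge touching \<open>k\<close> has
          minimum valuation 0, and all of these together are at most 1 by \<open>F2_0\<close>; only
          the edges in \<open>S\<close> remain.\<close>
        have "T \<le> 1 + 20000 * r ^ 5"
          unfolding T_def
        proof (rule sum_le_sum_Un[of "{(i,j)\<in>{..n}\<times>{..n}. min i j = 0}" "I' \<times> I'"])
          show "I \<times> I \<subseteq> {(i, j). (i, j) \<in> {..n} \<times> {..n} \<and> min i j = 0} \<union> I' \<times> I'"
            using True by (auto simp: I'_def I_def)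
          show "(\<Sum>(x, y)\<in>I'\<times>I'. e x y) \<le> 20000 * r ^ 5" using S5 by (simp add: S_def)
        qed (use F2_0 e I' in \<open>auto intro!: finite_subset[OF _ finite_cartesian_product[of "{..n}" "{..n}"]]\<close>)
        moreover have "0 \<le> r ^ 4 * (kap - 1)" "0 \<le> r ^ 5" using r kap by auto
        moreover have "t \<le> 1 + 1000000 * (R + P)" if "t \<le> 1 + 20000 * R" "0 \<le> P" "0 \<le> R" for t R P :: real
          using that by argo
        ultimately have "T \<le> 1 + 1000000 * (r ^ 5 + r ^ 4 * (kap - 1))" by blast
        thus ?thesis by (simp only: T_def I_def)
      next
        case False
        define s where "s = (\<Sum>i<k. x i)"
        define s' where "s' = (\<Sum>i<k. y i)"
        have sub: "{..<k} \<subseteq> I'" "{k<..n} \<subseteq> I'" using kn by (auto simp: I'_def I_def)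
        have sz: "0 \<le> s" "s \<le> z" "0 \<le> s'" "s' \<le> z'"
          using sum_mono2[of I' "{..<k}" x] sum_mono2[of I' "{..<k}" y] sub I' x y sx
          by (auto simp: s_def s'_def intro!: sum_nonneg)
        have tail: "(\<Sum>i\<in>{k..n}. x i) = 1 - s" "(\<Sum>i\<in>{k..n}. y i) = 1 - s'"
        proof -
          have U: "{..n} = {..<k} \<union> {k..n}" using kn by auto
          show "(\<Sum>i\<in>{k..n}. x i) = 1 - s" "(\<Sum>i\<in>{k..n}. y i) = 1 - s'"
            using x(2) y(2) unfolding U s_def s'_def by (subst (asm) sum.union_disjoint; force)+
        qed
        \<comment> \<open>An edge has minimum valuation \<open>k\<close> and counts in
          \<open>G\<close>, or joins \<open>k\<close> to a lower valuation, or avoids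
          \<open>k\<close> on both sides and counts in \<open>S\<close>. Only the middle kind costs
          order 1/p.\<close>
        define G where "G = (\<Sum>(i,j)\<in>{(i,j)\<in>{..n}\<times>{..n}. min i j = k}. e i j)"
        define Up where "Up = (\<Sum>(i,j)\<in>{(i,j)\<in>{..n}\<times>{..n}. min i j = k \<and> i \<noteq> j}. e i j)"
        have "T \<le> G + ((\<Sum>i<k. e i k) + ((\<Sum>i<k. e k i) + S))"
        proof -
          have *: "(\<Sum>i<k. e i k) = (\<Sum>(i,j)\<in>{..<k}\<times>{k}. e i j)"
            "(\<Sum>i<k. e k i) = (\<Sum>(i,j)\<in>{k}\<times>{..<k}. e i j)"
            by (simp_all add: sum.cartesian_product[symmetric])
          define GS where "GS = {(i,j)\<in>{..n}\<times>{..n}. min i j = k}"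
          define L where "L = {..<k}\<times>{k}"
          define R where "R = {k}\<times>{..<k}"
          have fin: "finite GS" "finite L" "finite R" "finite (I' \<times> I')"
            using I' by (auto simp: GS_def L_def R_def intro!: finite_subset[OF _ finite_cartesian_product[of "{..n}" "{..n}"]])
          have nn: "0 \<le> (case p of (i, j) \<Rightarrow> e i j)" for p using e by (cases p) auto
          have c: "I \<times> I \<subseteq> GS \<union> (L \<union> (R \<union> I' \<times> I'))"
            by (auto simp: GS_def L_def R_def I_def I'_def)
          have s1: "(\<Sum>(i,j)\<in>R \<union> I' \<times> I'. e i j) \<le> (\<Sum>(i,j)\<in>R. e i j) + (\<Sum>(i,j)\<in>I'\<times>I'. e i j)"
            by (rule sum_Un_le) (use fin nn in auto)
          have s2: "(\<Sum>(i,j)\<in>L \<union> (R \<union> I' \<times> I'). e i j)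
            \<le> (\<Sum>(i,j)\<in>L. e i j) + ((\<Sum>(i,j)\<in>R. e i j) + (\<Sum>(i,j)\<in>I'\<times>I'. e i j))"
            by (rule sum_le_sum_Un[of L "R \<union> I' \<times> I'"]) (use fin nn s1 in auto)
          have "(\<Sum>(i,j)\<in>I\<times>I. e i j)
            \<le> (\<Sum>(i,j)\<in>GS. e i j) + ((\<Sum>(i,j)\<in>L. e i j) + ((\<Sum>(i,j)\<in>R. e i j) + (\<Sum>(i,j)\<in>I'\<times>I'. e i j)))"
            by (rule sum_le_sum_Un[OF _ _ _ c]) (use fin nn s2 in auto)
          thus ?thesis
            unfolding T_def G_def S_def * GS_def L_def R_def .
        qed
        also have "(\<Sum>i<k. e i k) \<le> kap * \<rho> * s powr (3/4)"
        proof -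
          have "(\<Sum>i<k. e i k) \<le> kap * (\<Sum>i<k. r ^ gap i k) * s powr (3/4)"
          proof (rule rowk[OF sub(1)])
            show "x i \<le> s" if "i \<in> {..<k}" for i
              unfolding s_def using that x by (intro member_le_sum) auto
          qed
          also have "(\<Sum>i<k. r ^ gap i k) = (\<Sum>i<k. r ^ (k - i))" by (intro sum.cong) (auto simp: gap_def)
          also have "kap * (\<Sum>i<k. r ^ (k - i)) * s powr (3/4) \<le> kap * \<rho> * s powr (3/4)"
            using sum_power_below_le[OF r1, of k] kap by (intro mult_right_mono mult_left_mono) (auto simp: \<rho>_def)
          finally show ?thesis .
        qed
        also have "kap * \<rho> * s powr (3/4) \<le> (kap * \<rho>) ^ 4 / 4 + 3/4 * s"
          using powr_three_quarters_le sz by simp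
        also have "(\<Sum>i<k. e k i) \<le> kap * \<rho> * s' powr (3/4)"
        proof -
          have "(\<Sum>i<k. e k i) \<le> kap * (\<Sum>i<k. r ^ gap i k) * s' powr (3/4)"
          proof (rule colk[OF sub(1)])
            show "y i \<le> s'" if "i \<in> {..<k}" for i
              unfolding s'_def using that y by (intro member_le_sum) auto
          qed
          also have "(\<Sum>i<k. r ^ gap i k) = (\<Sum>i<k. r ^ (k - i))" by (intro sum.cong) (auto simp: gap_def)
          also have "kap * (\<Sum>i<k. r ^ (k - i)) * s' powr (3/4) \<le> kap * \<rho> * s' powr (3/4)"
            using sum_power_below_le[OF r1, of k] kap by (intro mult_right_mono mult_left_mono) (auto simp: \<rho>_def)
          finally show ?thesis .
        qed
        also have "kap * \<rho> * s' powr (3/4) \<le> (kap * \<rho>) ^ 4 / 4 + 3/4 * s'"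
          using powr_three_quarters_le sz by simp
        also note S5
        finally have "T \<le> G + ((kap * \<rho>) ^ 4 / 4 + 3 / 4 * s + ((kap * \<rho>) ^ 4 / 4 + 3 / 4 * s' + 20000 * r ^ 5))"
          by simp
        \<comment> \<open>The term \<open>(kap * \<rho>) ^ 4 / 2\<close> is about 1/(2p), which is
          not affordable over all primes; it has to be cancelled by the loss
          \<open>r ^ 4 / 2\<close> inside \<open>G\<close>.\<close>
        hence T3: "T \<le> G + (kap * \<rho>) ^ 4 / 2 + 3/4 * (s + s') + 20000 * r ^ 5" by argo
        have Up: "Up \<le> 14 * r"
        proof -
          have "Up \<le> (\<Sum>i\<in>{k<..n}. e i k) + (\<Sum>i\<in>{k<..n}. e k i)"
          proof -
            have *: "(\<Sum>i\<in>{k<..n}. e i k) = (\<Sum>(i,j)\<in>{k<..n}\<times>{k}. e i j)"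
              "(\<Sum>i\<in>{k<..n}. e k i) = (\<Sum>(i,j)\<in>{k}\<times>{k<..n}. e i j)"
              by (simp_all add: sum.cartesian_product[symmetric])
            show ?thesis unfolding Up_def *
              by (intro sum_Un_le) (use e in \<open>auto simp: min_def split: if_splits\<close>)
          qed
          also have "(\<Sum>i\<in>{k<..n}. e i k) \<le> kap * (\<Sum>i\<in>{k<..n}. r ^ gap i k) * 1 powr (3/4)"
            by (rule rowk[OF sub(2)]) (use x1 in auto)
          also have "(\<Sum>i\<in>{k<..n}. e k i) \<le> kap * (\<Sum>i\<in>{k<..n}. r ^ gap i k) * 1 powr (3/4)"
            by (rule colk[OF sub(2)]) (use y1 in auto)
          finally show ?thesis using B2[OF sub(2)] by simp
        qed
        have s1: "s \<le> 1" "s' \<le> 1" using sz z r by auto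
        have r4: "r ^ 4 \<le> 1" using r by (simp add: power_le_one)
        have "G \<le> sqrt (1 - r ^ 4) * ((1 - s) * (1 - s')) powr (3/4) + r ^ 4 * Up"
          using F2[of k] False kn unfolding G_def Up_def tail by simp
        also have "((1 - s) * (1 - s')) powr (3/4) = (1 - s) powr (3/4) * (1 - s') powr (3/4)"
          using s1 by (simp add: powr_mult)
        also have "sqrt (1 - r ^ 4) * ((1 - s) powr (3/4) * (1 - s') powr (3/4))
            \<le> (1 - r ^ 4 / 2) * ((1 - 3/4 * s) * (1 - 3/4 * s'))"
        proof (intro mult_mono one_minus_powr_le)
          have "1 - r ^ 4 \<le> (1 - r ^ 4 / 2)\<^sup>2" by (simp add: power2_eq_square algebra_simps)
          thus "sqrt (1 - r ^ 4) \<le> 1 - r ^ 4 / 2" using r4 by (intro real_le_lsqrt) auto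
        qed (use s1 sz r4 in auto)
        also have "r ^ 4 * Up \<le> r ^ 4 * (14 * r)" using Up r by (intro mult_left_mono) auto
        finally have G: "G \<le> (1 - r ^ 4 / 2) * ((1 - 3/4 * s) * (1 - 3/4 * s')) + r ^ 4 * (14 * r)"
          by simp
        have "(1 - r ^ 4 / 2) * ((1 - 3/4 * s) * (1 - 3/4 * s'))
            = 1 - r ^ 4 / 2 - 3/4 * (s + s') + r ^ 4 / 2 * (3/4 * (s + s')) + (1 - r ^ 4 / 2) * (9/16 * (s * s'))"
          by (simp add: field_simps)
        also have "r ^ 4 / 2 * (3/4 * (s + s')) \<le> r ^ 4 / 2 * (3/4 * (614656 * r ^ 4 + 614656 * r ^ 4))"
          using sz zr r by (intro mult_left_mono add_mono) auto
        also have "(1 - r ^ 4 / 2) * (9/16 * (s * s')) \<le> 1 * (1 * ((614656 * r ^ 4) * (614656 * r ^ 4)))"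
          using sz zr r r4 z by (intro mult_mono) auto
        \<comment> \<open>The coefficient of \<open>r ^ 8\<close> is
          \<open>28 ^ 8 + 3/4 * 28 ^ 4\<close>, from \<open>s * s'\<close> and from the product of
          \<open>r ^ 4 / 2\<close> with \<open>3/4 * (s + s')\<close>.\<close>
        finally have "(1 - r ^ 4 / 2) * ((1 - 3/4 * s) * (1 - 3/4 * s'))
          \<le> 1 - r ^ 4 / 2 - 3/4 * (s + s') + 377802459328 * r ^ 8"
          by (simp add: power_mult_distrib power_add[symmetric])
        moreover have "0 \<le> r ^ 8" by simp
        ultimately have G2: "(1 - r ^ 4 / 2) * ((1 - 3/4 * s) * (1 - 3/4 * s'))
          \<le> 1 - r ^ 4 / 2 - 3/4 * (s + s') + 377802460000 * r ^ 8"
          by argo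
        have r8: "377802460000 * r ^ 8 \<le> r ^ 5"
        proof -
          have "r ^ 3 \<le> (1/100000) ^ 3" using r by (intro power_mono) auto
          hence "377802460000 * r ^ 3 \<le> 1" by (simp add: eval_nat_numeral)
          hence "377802460000 * r ^ 3 * r ^ 5 \<le> 1 * r ^ 5" using r by (intro mult_right_mono) auto
          thus ?thesis by (simp add: mult.assoc power_add[symmetric])
        qed
        \<comment> \<open>Since \<open>\<rho>\<close> is \<open>r\<close> up to order
          \<open>r ^ 2\<close>, the leading coefficient of the fourth power is exactly 1. The excess
          of \<open>kap\<close> over 1 is kept as a separate error because it is summable by
          itself.\<close>
        have kr: "(kap * \<rho>) ^ 4 \<le> r ^ 4 + 1000 * (r ^ 5 + r ^ 4 * (kap - 1))"
        proof -
          have "\<rho> ^ 4 \<le> (r * (1 + 2 * r)) ^ 4"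
          proof (rule power_mono)
            show "\<rho> \<le> r * (1 + 2 * r)" unfolding \<rho>_def using r
              by (simp add: field_simps)
          qed (use \<rho> in auto)
          also have "\<dots> = r ^ 4 * (1 + 2 * r) ^ 4" by (rule power_mult_distrib)
          also have "(1 + 2 * r) ^ 4 \<le> 1 + 100 * r"
          proof -
            have *: "r ^ m \<le> r" if "m \<ge> 1" for m using power_decreasing[of 1 m r] that r by simp
            have "(1 + 2 * r) ^ 4 = 1 + 8 * r + 24 * r ^ 2 + 32 * r ^ 3 + 16 * r ^ 4" by (simp add: power2_eq_square power3_eq_cube power4_eq_xxxx algebra_simps)
            thus ?thesis using *[of 2] *[of 3] *[of 4] r by linarith
          qed
          finally have \<rho>4: "\<rho> ^ 4 \<le> r ^ 4 * (1 + 100 * r)" using r by simp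
          have "kap ^ 4 - 1 = (kap - 1) * (kap ^ 3 + kap ^ 2 + kap + 1)" by (simp add: power2_eq_square power3_eq_cube power4_eq_xxxx algebra_simps)
          also have "\<dots> \<le> (kap - 1) * (3 ^ 3 + 3 ^ 2 + 3 + 1)"
            using kap by (intro mult_left_mono add_mono power_mono) auto
          finally have kap4: "kap ^ 4 \<le> 1 + 40 * (kap - 1)" by simp
          have "(kap * \<rho>) ^ 4 \<le> (1 + 40 * (kap - 1)) * (r ^ 4 * (1 + 100 * r))"
            unfolding power_mult_distrib using kap4 \<rho>4 kap \<rho> by (intro mult_mono) auto
          also have "\<dots> = r ^ 4 + 100 * r ^ 5 + 40 * (r ^ 4 * (kap - 1)) * (1 + 100 * r)"
            by (simp add: algebra_simps eval_nat_numeral)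
          also have "40 * (r ^ 4 * (kap - 1)) * (1 + 100 * r) \<le> 40 * (r ^ 4 * (kap - 1)) * 2"
            using r kap by (intro mult_left_mono) auto
          finally have *: "(kap * \<rho>) ^ 4 \<le> r ^ 4 + 100 * r ^ 5 + 40 * (r ^ 4 * (kap - 1)) * 2" by simp
          have "0 \<le> r ^ 4 * (kap - 1)" "0 \<le> r ^ 5" using r kap by auto
          moreover have "q \<le> a + 1000 * (R + P)"
            if "q \<le> a + 100 * R + 40 * P * 2" "0 \<le> P" "0 \<le> R" for q a P R :: real
            using that by argo
          ultimately show ?thesis using * by blast
        qed
        have "0 \<le> r ^ 4 * (kap - 1)" "0 \<le> r ^ 5" using r kap by auto
        moreover have "r ^ 4 * (14 * r) = 14 * r ^ 5" by (simp add: eval_nat_numeral)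
        \<comment> \<open>With \<open>a = r ^ 4\<close> and \<open>u = 3/4 * (s + s')\<close>, the
          terms \<open>a / 2\<close> and \<open>u\<close> from Young's inequality meet
          \<open>- a / 2\<close> and \<open>- u\<close> from \<open>G\<close>; only
          \<open>R = r ^ 5\<close> and \<open>P = r ^ 4 * (kap - 1)\<close> are left.\<close>
        moreover have fin: "t \<le> 1 + 1000000 * (R + P)"
          if "t \<le> g + q / 2 + u + 20000 * R" "g \<le> v + c" "v \<le> 1 - a / 2 - u + w8" "w8 \<le> R"
            "q \<le> a + 1000 * (R + P)" "0 \<le> P" "0 \<le> R" "c = 14 * R" for t g q u R P v a w8 c :: real
          using that by argo
        ultimately have "T \<le> 1 + 1000000 * (r ^ 5 + r ^ 4 * (kap - 1))"
          using T3 G G2 r8 kr fin by metis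
        thus ?thesis by (simp only: T_def I_def)
      qed
    qed
  qed
qed


text \<open>Serves the finitely many small primes, for which \<open>r\<close> is too large for the
  cancellation argument; there any bounded cost is acceptable.\<close>

lemma one_prime_crude:
  fixes x y :: "nat \<Rightarrow> real" and e :: "nat \<Rightarrow> nat \<Rightarrow> real" and r kap :: real and n :: nat
  assumes r: "0 < r" "r < 1" and kap: "1 \<le> kap"
    and x: "\<And>i. 0 \<le> x i" "(\<Sum>i\<le>n. x i) = 1"
    and y: "\<And>i. 0 \<le> y i" "(\<Sum>i\<le>n. y i) = 1"
    and F1: "\<And>i j. i \<le> n \<Longrightarrow> j \<le> n \<Longrightarrow>
       e i j \<le> (if i = j then 1 else kap) * (r ^ gap i j * (x i * y j) powr (3/4))"
  shows "(\<Sum>(i,j)\<in>{..n}\<times>{..n}. e i j) \<le> 1 + kap * (2 * r / (1 - r))"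
proof -
  have x1: "x i \<le> 1" "y i \<le> 1" if "i \<le> n" for i
    using member_le_sum[of i "{..n}" x] member_le_sum[of i "{..n}" y] x y that by auto
  have "x i * sqrt (x i) \<le> x i" "y i * sqrt (y i) \<le> y i" if "i \<le> n" for i
    using x1[OF that] x(1)[of i] y(1)[of i] by (simp_all add: mult_left_le)
  hence xs: "(\<Sum>i\<le>n. x i * sqrt (x i)) \<le> 1" "(\<Sum>i\<le>n. y i * sqrt (y i)) \<le> 1"
    using sum_mono[of "{..n}" "\<lambda>i. x i * sqrt (x i)" x] sum_mono[of "{..n}" "\<lambda>i. y i * sqrt (y i)" y] x y
    by auto
  define D where "D = {(i,j)\<in>{..n}\<times>{..n}. i = j}"
  define N where "N = {(i,j)\<in>{..n}\<times>{..n}. i \<noteq> j}"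
  have DN: "{..n}\<times>{..n} = D \<union> N" "finite D" "finite N" "D \<inter> N = {}"
    by (auto simp: D_def N_def intro!: finite_subset[OF _ finite_cartesian_product[of "{..n}" "{..n}"]])
  have "(\<Sum>(i,j)\<in>D. e i j) = (\<Sum>i\<le>n. e i i)"
    unfolding D_def by (rule sum.reindex_bij_witness[of _ "\<lambda>i. (i,i)" fst]) auto
  also have "\<dots> \<le> (\<Sum>i\<le>n. (x i * sqrt (x i) + y i * sqrt (y i)) / 2)"
  proof (intro sum_mono)
    fix i assume "i \<in> {..n}"
    hence "e i i \<le> (x i * y i) powr (3/4)"
      using F1[of i i] by (auto simp: gap_def)
    thus "e i i \<le> (x i * sqrt (x i) + y i * sqrt (y i)) / 2"
      using powr_product_le[of "x i" "y i"] x y by simp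
  qed
  also have "\<dots> \<le> 1"
    using xs by (simp add: sum_divide_distrib[symmetric] sum.distrib)
  finally have 1: "(\<Sum>(i,j)\<in>D. e i j) \<le> 1" .
  have "(\<Sum>(i,j)\<in>N. e i j) \<le> (\<Sum>(i,j)\<in>N. kap * (r ^ gap i j * (x i * y j) powr (3/4)))"
  proof (intro sum_mono, clarify)
    fix i j assume "(i,j) \<in> N"
    thus "e i j \<le> kap * (r ^ gap i j * (x i * y j) powr (3/4))"
      using F1[of i j] by (simp add: N_def)
  qed
  also have "\<dots> = kap * (\<Sum>(i,j)\<in>N. r ^ gap i j * (x i * y j) powr (3/4))"
    by (simp add: sum_distrib_left case_prod_unfold)
  also have "\<dots> \<le> kap * (r / (1 - r) * ((\<Sum>i\<le>n. x i * sqrt (x i)) + (\<Sum>j\<le>n. y j * sqrt (y j))))"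
    unfolding N_def using kap by (intro mult_left_mono Schur_offdiagonal) (use r x y in auto)
  also have "\<dots> \<le> kap * (r / (1 - r) * 2)"
    using kap r xs by (intro mult_left_mono) auto
  finally have 2: "(\<Sum>(i,j)\<in>N. e i j) \<le> kap * (2 * r / (1 - r))" by (simp add: mult_ac)
  show ?thesis using 1 2 unfolding DN(1) by (subst sum.union_disjoint) (use DN in auto)
qed

subsection \<open>Weighted edge counts: removing one prime\<close>

definition tot_ratio :: "nat \<Rightarrow> real" where
  "tot_ratio n = real (totient n) / real n"

text \<open>These are the primes dividing \<open>m * n / (gcd m n)\<^sup>2\<close>. The formulation
  by valuations makes it evident what happens when powers of one prime are divided out.\<close>

definition diff_primes :: "nat \<Rightarrow> nat \<Rightarrow> nat set" where
  "diff_primes v w = {p. prime p \<and> multiplicity p v \<noteq> multiplicity p w}"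

definition pair_weight :: "(nat \<Rightarrow> real) \<Rightarrow> nat \<Rightarrow> nat \<Rightarrow> real" where
  "pair_weight \<kappa> v w = (\<Prod>p\<in>diff_primes v w. \<kappa> p)"

text \<open>Half the total length of the intervals making up the approximation sets with
  denominators in \<open>V\<close>.\<close>

definition mass :: "(nat \<Rightarrow> real) \<Rightarrow> nat set \<Rightarrow> real" where
  "mass \<psi> V = (\<Sum>v\<in>V. tot_ratio v * \<psi> v)"

definition edge_mass :: "(nat \<Rightarrow> real) \<Rightarrow> (nat \<Rightarrow> real) \<Rightarrow> (nat \<Rightarrow> real) \<Rightarrow> (nat \<times> nat) set \<Rightarrow> real" where
  "edge_mass \<kappa> \<psi> \<theta> E =
     (\<Sum>(v,w)\<in>E. (tot_ratio v * \<psi> v) * (tot_ratio w * \<theta> w) * pair_weight \<kappa> v w)"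

text \<open>An edge is a pair of denominators whose gcd is so large that \<open>max (w * \<psi> v) (v * \<theta> w) / gcd v w \<le> 1\<close>.
  The set \<open>A\<close> collects the primes allowed in the gcd; it is enlarged one prime at a time. Two functions \<open>\<psi>\<close>
  and \<open>\<theta>\<close> are needed because dividing the two sides of the graph by different powers of a prime rescales them
  differently.\<close>

definition admissible ::
  "nat set \<Rightarrow> (nat \<Rightarrow> real) \<Rightarrow> (nat \<Rightarrow> real) \<Rightarrow> nat set \<Rightarrow> nat set \<Rightarrow> (nat \<times> nat) set \<Rightarrow> bool" where
  "admissible A \<psi> \<theta> V W E \<longleftrightarrow> finite V \<and> finite W \<and>
     (\<forall>v\<in>V. 0 < v \<and> 0 \<le> \<psi> v) \<and> (\<forall>w\<in>W. 0 < w \<and> 0 \<le> \<theta> w) \<and> E \<subseteq> V \<times> W \<and>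
     (\<forall>(v,w)\<in>E. real w * \<psi> v \<le> real (gcd v w) \<and> real v * \<theta> w \<le> real (gcd v w) \<and>
        (\<forall>p. prime p \<longrightarrow> p dvd gcd v w \<longrightarrow> p \<in> A))"

text \<open>The exponent lies strictly between the value 1/2 of the Schur test and the trivial value 1; this
  leaves room for the cost \<open>1 + O(p powr (-5/4))\<close> of one prime, whose product converges.\<close>

definition bounded_by :: "nat set \<Rightarrow> (nat \<Rightarrow> real) \<Rightarrow> real \<Rightarrow> bool" where
  "bounded_by A \<kappa> Q \<longleftrightarrow> (\<forall>\<psi> \<theta> V W E. admissible A \<psi> \<theta> V W E \<longrightarrow>
     edge_mass \<kappa> \<psi> \<theta> E \<le> Q * (mass \<psi> V * mass \<theta> W) powr (3/4))"

lemma tot_ratio_nonneg [simp]: "0 \<le> tot_ratio n"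
  by (simp add: tot_ratio_def)

lemma tot_ratio_le_1: "tot_ratio n \<le> 1"
  by (cases "n = 0") (simp_all add: tot_ratio_def totient_le)

lemma tot_ratio_prime_power_mult:
  assumes "prime p" "\<not> p dvd v" "v > 0"
  shows "tot_ratio (p ^ i * v) = (if i = 0 then 1 else 1 - 1 / real p) * tot_ratio v"
proof (cases "i = 0")
  case False
  have p: "p > 0" "p > 1" using assms prime_gt_0_nat prime_gt_1_nat by auto
  have cop: "coprime (p ^ i) v"
    using assms by (simp add: prime_imp_coprime)
  have t: "real (totient (p ^ i)) = real p ^ i * (1 - 1 / real p)"
  proof -
    obtain j where j: "i = Suc j" using False not0_implies_Suc by blast
    have "totient (p ^ i) = p ^ j * (p - 1)"
      using assms(1) False totient_prime_power[of p i] j by (simp add: mult_ac)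
    thus ?thesis using p j by (simp add: of_nat_diff field_simps)
  qed
  have "tot_ratio (p ^ i * v) = (real p ^ i * (1 - 1 / real p)) * real (totient v) / (real p ^ i * real v)"
    by (simp add: tot_ratio_def totient_mult_coprime[OF cop] t)
  also have "\<dots> = (1 - 1 / real p) * tot_ratio v"
    using p by (simp add: tot_ratio_def)
  finally show ?thesis using False by simp
qed auto

lemma finite_diff_primes:
  assumes "0 < v" "0 < w"
  shows "finite (diff_primes v w)"
proof (rule finite_subset)
  show "diff_primes v w \<subseteq> prime_factors v \<union> prime_factors w"
  proof
    fix p assume "p \<in> diff_primes v w"
    hence "prime p" "multiplicity p v > 0 \<or> multiplicity p w > 0" by (auto simp: diff_primes_def)
    thus "p \<in> prime_factors v \<union> prime_factors w"
      using assms by (auto simp: prime_factors_multiplicity)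
  qed
qed auto

lemma prime_not_dvd_prime_power:
  assumes "prime (p::nat)" "prime q" "q \<noteq> p" shows "\<not> q dvd p ^ i"
  using assms prime_dvd_power primes_dvd_imp_eq by blast

lemma multiplicity_prime_power_mult:
  assumes "prime (p::nat)" "prime q" "v > 0"
  shows "multiplicity q (p ^ i * v) = (if q = p then i else 0) + multiplicity q v"
proof -
  have "multiplicity q (p ^ i * v) = multiplicity q (p ^ i) + multiplicity q v"
    using assms by (intro prime_elem_multiplicity_mult_distrib) (auto simp: prime_gt_0_nat)
  moreover have "multiplicity q (p ^ i) = (if q = p then i else 0)"
    using assms prime_not_dvd_prime_power[of p q i] by (auto simp: not_dvd_imp_multiplicity_0 prime_gt_1_nat)
  ultimately show ?thesis by simp
qed

lemma diff_primes_scale: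
  assumes "prime p" "0 < v" "0 < w"
  shows "diff_primes (p ^ i * v) (p ^ i * w) = diff_primes v w"
  using assms by (auto simp: diff_primes_def multiplicity_prime_power_mult)

lemma pair_weight_prime_power:
  assumes "prime p" "\<not> p dvd v" "\<not> p dvd w" "0 < v" "0 < w"
  shows "pair_weight \<kappa> (p ^ i * v) (p ^ j * w) = (if i = j then 1 else \<kappa> p) * pair_weight \<kappa> v w"
proof (cases "i = j")
  case True
  thus ?thesis using assms by (simp add: pair_weight_def diff_primes_scale)
next
  case False
  have "diff_primes (p ^ i * v) (p ^ j * w) = insert p (diff_primes v w)"
    using assms False by (auto simp: diff_primes_def multiplicity_prime_power_mult not_dvd_imp_multiplicity_0 split: if_splits)
  moreover have "p \<notin> diff_primes v w"
    using assms by (simp add: diff_primes_def not_dvd_imp_multiplicity_0)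
  ultimately show ?thesis using False assms finite_diff_primes by (simp add: pair_weight_def)
qed

lemma gcd_prime_power_mult_le:
  assumes "prime (p::nat)" "\<not> p dvd v" "\<not> p dvd w"
  shows "gcd (p ^ i * v) (p ^ j * w) = p ^ min i j * gcd v w"
proof -
  have *: "gcd (p ^ i * v) (p ^ j * w) = p ^ i * gcd v w"
    if "i \<le> j" "\<not> p dvd v" for i j v w
  proof -
    have "p ^ j * w = p ^ i * (p ^ (j - i) * w)" using that by (simp flip: power_add mult.assoc)
    hence "gcd (p ^ i * v) (p ^ j * w) = p ^ i * gcd v (p ^ (j - i) * w)"
      by (simp only: gcd_mult_distrib_nat)
    also have "gcd v (p ^ (j - i) * w) = gcd v w"
    proof (rule gcd_mult_right_left_cancel)
      have "coprime (p ^ (j - i)) v" using assms(1) that(2) by (simp add: prime_imp_coprime)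
      thus "coprime v (p ^ (j - i))" by (simp add: coprime_commute)
    qed
    finally show ?thesis .
  qed
  show ?thesis
  proof (cases "i \<le> j")
    case True thus ?thesis using *[of i j v w] assms by simp
  next
    case False thus ?thesis using *[of j i w v] assms by (simp add: gcd.commute)
  qed
qed

lemma edge_mass_nonneg:
  assumes "\<And>v w. (v,w) \<in> E \<Longrightarrow> 0 \<le> \<psi> v \<and> 0 \<le> \<theta> w" "\<And>p. 0 \<le> \<kappa> p"
  shows "0 \<le> edge_mass \<kappa> \<psi> \<theta> E"
  unfolding edge_mass_def pair_weight_def using assms
  by (intro sum_nonneg) (auto intro!: mult_nonneg_nonneg prod_nonneg)

lemma mass_nonneg: "(\<And>v. v \<in> V \<Longrightarrow> 0 \<le> \<psi> v) \<Longrightarrow> 0 \<le> mass \<psi> V"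
  unfolding mass_def by (intro sum_nonneg) auto

text \<open>Dividing out \<open>p ^ i\<close> and \<open>p ^ j\<close> lowers the gcd by
  \<open>p ^ min i j\<close> only. Rescaling \<open>\<psi>\<close> and \<open>\<theta>\<close>
  restores the edge condition, and multiplies the product of the masses as well as each edge weight
  by \<open>p ^ gap i j\<close>. Under the exponent 3/4 this leaves the decay
  \<open>p ^ gap i j\<close> to the power -1/4.\<close>

lemma bounded_by_fixed_valuations:
  assumes bd: "bounded_by A \<kappa> Q" and Q: "Q > 0" and p: "prime p" and kap: "0 \<le> \<kappa> p"
    and adm: "admissible (insert p A) \<psi> \<theta> V W E"
    and V: "\<And>v. v \<in> V \<Longrightarrow> multiplicity p v = i" and W: "\<And>w. w \<in> W \<Longrightarrow> multiplicity p w = j"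
  shows "edge_mass \<kappa> \<psi> \<theta> E \<le> Q * ((if i = j then 1 else \<kappa> p) *
     (real p powr (-1/4)) ^ gap i j * (mass \<psi> V * mass \<theta> W) powr (3/4))"
proof -
  define V' where "V' = (\<lambda>v. v div p ^ i) ` V"
  define W' where "W' = (\<lambda>w. w div p ^ j) ` W"
  define E' where "E' = (\<lambda>(v,w). (v div p ^ i, w div p ^ j)) ` E"
  \<comment> \<open>Truncated subtraction enlarges only the function on the side with the smaller
    valuation; the other factor is 1.\<close>
  define \<psi>' where "\<psi>' = (\<lambda>v. real p ^ (j - i) * \<psi> (p ^ i * v))"
  define \<theta>' where "\<theta>' = (\<lambda>w. real p ^ (i - j) * \<theta> (p ^ j * w))"
  define F where "F = (\<lambda>i::nat. if i = 0 then 1 else 1 - 1 / real p)"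
  have p2: "p \<ge> 2" "p > 0" using p prime_ge_2_nat prime_gt_0_nat by auto
  have F: "0 < F k" "F k \<le> 1" for k using p2 by (auto simp: F_def)
  have adm': "finite V" "finite W" "\<And>v. v \<in> V \<Longrightarrow> 0 < v \<and> 0 \<le> \<psi> v" "\<And>w. w \<in> W \<Longrightarrow> 0 < w \<and> 0 \<le> \<theta> w"
    "E \<subseteq> V \<times> W" "\<And>v w. (v,w) \<in> E \<Longrightarrow> real w * \<psi> v \<le> real (gcd v w)"
    "\<And>v w. (v,w) \<in> E \<Longrightarrow> real v * \<theta> w \<le> real (gcd v w)"
    "\<And>v w q. (v,w) \<in> E \<Longrightarrow> prime q \<Longrightarrow> q dvd gcd v w \<Longrightarrow> q = p \<or> q \<in> A"
    using adm by (auto simp: admissible_def)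
  have dec: "p ^ multiplicity p v * (v div p ^ multiplicity p v) = v" for v
    by (simp add: multiplicity_dvd)
  have nd: "\<not> p dvd v div p ^ multiplicity p v" "0 < v div p ^ multiplicity p v" if "v > 0" for v
  proof -
    show "\<not> p dvd v div p ^ multiplicity p v"
      using that p multiplicity_decompose[of v p] p2 by simp
    show "0 < v div p ^ multiplicity p v" using dec[of v] that by (metis mult_0_right neq0_conv)
  qed
  have decV: "p ^ i * (v div p ^ i) = v" "\<not> p dvd v div p ^ i" "0 < v div p ^ i" if "v \<in> V" for v
    using dec[of v] nd[of v] V[OF that] adm'(3)[OF that] by auto
  have decW: "p ^ j * (w div p ^ j) = w" "\<not> p dvd w div p ^ j" "0 < w div p ^ j" if "w \<in> W" for w
    using dec[of w] nd[of w] W[OF that] adm'(4)[OF that] by auto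
  have injV: "inj_on (\<lambda>v. v div p ^ i) V"
    by (rule inj_on_inverseI[where g = "\<lambda>v. p ^ i * v"]) (use decV(1) in simp)
  have injW: "inj_on (\<lambda>w. w div p ^ j) W"
    by (rule inj_on_inverseI[where g = "\<lambda>v. p ^ j * v"]) (use decW(1) in simp)
  have injE: "inj_on (\<lambda>(v,w). (v div p ^ i, w div p ^ j)) E"
  proof (rule inj_onI, clarify)
    fix v w v' w' assume *: "(v, w) \<in> E" "(v', w') \<in> E" "v div p ^ i = v' div p ^ i" "w div p ^ j = w' div p ^ j"
    hence "v \<in> V" "v' \<in> V" "w \<in> W" "w' \<in> W" using adm'(5) by auto
    thus "v = v' \<and> w = w'" using decV(1) decW(1) * by metis
  qed
  have trV: "tot_ratio v = F i * tot_ratio (v div p ^ i)" if "v \<in> V" for v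
    using tot_ratio_prime_power_mult[OF p decV(2,3)[OF that], of i] decV(1)[OF that] by (simp add: F_def)
  have trW: "tot_ratio w = F j * tot_ratio (w div p ^ j)" if "w \<in> W" for w
    using tot_ratio_prime_power_mult[OF p decW(2,3)[OF that], of j] decW(1)[OF that] by (simp add: F_def)
  have psi': "\<psi>' (v div p ^ i) = real p ^ (j - i) * \<psi> v" if "v \<in> V" for v
    using decV[OF that] by (simp add: \<psi>'_def)
  have theta': "\<theta>' (w div p ^ j) = real p ^ (i - j) * \<theta> w" if "w \<in> W" for w
    using decW[OF that] by (simp add: \<theta>'_def)
  have massV: "mass \<psi>' V' = real p ^ (j - i) / F i * mass \<psi> V"
  proof -
    have "mass \<psi>' V' = (\<Sum>v\<in>V. tot_ratio (v div p ^ i) * \<psi>' (v div p ^ i))"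
      unfolding mass_def V'_def by (subst sum.reindex[OF injV]) simp
    also have "\<dots> = (\<Sum>v\<in>V. real p ^ (j - i) / F i * (tot_ratio v * \<psi> v))"
      using trV psi' F(1)[of i] by (intro sum.cong) auto
    finally show ?thesis by (simp add: mass_def sum_distrib_left)
  qed
  have massW: "mass \<theta>' W' = real p ^ (i - j) / F j * mass \<theta> W"
  proof -
    have "mass \<theta>' W' = (\<Sum>w\<in>W. tot_ratio (w div p ^ j) * \<theta>' (w div p ^ j))"
      unfolding mass_def W'_def by (subst sum.reindex[OF injW]) simp
    also have "\<dots> = (\<Sum>w\<in>W. real p ^ (i - j) / F j * (tot_ratio w * \<theta> w))"
      using trW theta' F(1)[of j] by (intro sum.cong) auto
    finally show ?thesis by (simp add: mass_def sum_distrib_left)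
  qed
  define k where "k = (if i = j then 1 else \<kappa> p)"
  have k0: "0 \<le> k" using kap by (simp add: k_def)
  have edge: "edge_mass \<kappa> \<psi> \<theta> E = F i * F j * k / real p ^ gap i j * edge_mass \<kappa> \<psi>' \<theta>' E'"
  proof -
    have "edge_mass \<kappa> \<psi>' \<theta>' E' = (\<Sum>(v,w)\<in>E. (tot_ratio (v div p ^ i) * \<psi>' (v div p ^ i)) *
         (tot_ratio (w div p ^ j) * \<theta>' (w div p ^ j)) * pair_weight \<kappa> (v div p ^ i) (w div p ^ j))"
      unfolding edge_mass_def E'_def by (subst sum.reindex[OF injE]) (simp add: case_prod_unfold)
    also have "F i * F j * k / real p ^ gap i j * \<dots> =
       (\<Sum>(v,w)\<in>E. (tot_ratio v * \<psi> v) * (tot_ratio w * \<theta> w) * pair_weight \<kappa> v w)"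
      unfolding sum_distrib_left
    proof (intro sum.cong refl, clarify)
      fix v w assume "(v,w) \<in> E"
      hence vw: "v \<in> V" "w \<in> W" using adm'(5) by auto
      have pw: "pair_weight \<kappa> v w = k * pair_weight \<kappa> (v div p ^ i) (w div p ^ j)"
        using pair_weight_prime_power[OF p decV(2)[OF vw(1)] decW(2)[OF vw(2)] decV(3)[OF vw(1)] decW(3)[OF vw(2)], of \<kappa> i j]
          decV(1)[OF vw(1)] decW(1)[OF vw(2)] by (simp add: k_def)
      have pg: "real p ^ gap i j = real p ^ (j - i) * real p ^ (i - j)"
        by (simp add: gap_def power_add)
      show "F i * F j * k / real p ^ gap i j * ((tot_ratio (v div p ^ i) * \<psi>' (v div p ^ i)) *
         (tot_ratio (w div p ^ j) * \<theta>' (w div p ^ j)) * pair_weight \<kappa> (v div p ^ i) (w div p ^ j))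
         = (tot_ratio v * \<psi> v) * (tot_ratio w * \<theta> w) * pair_weight \<kappa> v w"
        unfolding pw psi'[OF vw(1)] theta'[OF vw(2)] trV[OF vw(1)] trW[OF vw(2)] pg using p2
        by (simp add: field_simps)
    qed
    finally show ?thesis by (simp add: edge_mass_def)
  qed
  have "admissible A \<psi>' \<theta>' V' W' E'"
    unfolding admissible_def
  proof (intro conjI ballI, safe)
    show "finite V'" "finite W'" using adm' by (auto simp: V'_def W'_def)
    show "0 < v" if "v \<in> V'" for v using that decV by (auto simp: V'_def)
    show "0 < w" if "w \<in> W'" for w using that decW by (auto simp: W'_def)
    show "0 \<le> \<psi>' v" if "v \<in> V'" for v using that psi' adm' by (auto simp: V'_def)
    show "0 \<le> \<theta>' w" if "w \<in> W'" for w using that theta' adm' by (auto simp: W'_def)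
    fix v' w' assume "(v', w') \<in> E'"
    then obtain v w where vw: "(v,w) \<in> E" "v' = v div p ^ i" "w' = w div p ^ j" by (auto simp: E'_def)
    hence VW: "v \<in> V" "w \<in> W" using adm'(5) by auto
    show "v' \<in> V'" "w' \<in> W'" using vw VW by (auto simp: V'_def W'_def)
    have v: "v = p ^ i * v'" "\<not> p dvd v'" "0 < v'" using decV[OF VW(1)] vw by auto
    have w: "w = p ^ j * w'" "\<not> p dvd w'" "0 < w'" using decW[OF VW(2)] vw by auto
    have g: "gcd v w = p ^ min i j * gcd v' w'"
      unfolding v(1) w(1) by (rule gcd_prime_power_mult_le[OF p v(2) w(2)])
    have pm: "real p ^ j = real p ^ min i j * real p ^ (j - i)" "real p ^ i = real p ^ min i j * real p ^ (i - j)"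
      by (auto simp: power_add[symmetric] min_def)
    have ps: "\<psi>' v' = real p ^ (j - i) * \<psi> v" "\<theta>' w' = real p ^ (i - j) * \<theta> w"
      using psi'[OF VW(1)] theta'[OF VW(2)] vw by auto
    have rg: "real (gcd v w) = real p ^ min i j * real (gcd v' w')" unfolding g by simp
    have rv: "real v = real p ^ min i j * real p ^ (i - j) * real v'"
      using v(1) pm(2) by (metis of_nat_mult of_nat_power)
    have rw: "real w = real p ^ min i j * real p ^ (j - i) * real w'"
      using w(1) pm(1) by (metis of_nat_mult of_nat_power)
    have "real p ^ min i j * (real w' * \<psi>' v') \<le> real p ^ min i j * real (gcd v' w')"
      using adm'(6)[OF vw(1)] unfolding rg rw ps by (simp only: mult_ac)
    thus "real w' * \<psi>' v' \<le> real (gcd v' w')" using p2 by simp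
    have "real p ^ min i j * (real v' * \<theta>' w') \<le> real p ^ min i j * real (gcd v' w')"
      using adm'(7)[OF vw(1)] unfolding rg rv ps by (simp only: mult_ac)
    thus "real v' * \<theta>' w' \<le> real (gcd v' w')" using p2 by simp
    fix q assume q: "prime q" "q dvd gcd v' w'"
    hence "q dvd gcd v w" using g by simp
    moreover have "q \<noteq> p" using q v by auto
    ultimately show "q \<in> A" using adm'(8)[OF vw(1) q(1)] by auto
  qed
  hence "edge_mass \<kappa> \<psi>' \<theta>' E' \<le> Q * (mass \<psi>' V' * mass \<theta>' W') powr (3/4)"
    using bd by (auto simp: bounded_by_def)
  hence "edge_mass \<kappa> \<psi> \<theta> E \<le> F i * F j * k / real p ^ gap i j * (Q * (mass \<psi>' V' * mass \<theta>' W') powr (3/4))"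
    unfolding edge using F(1)[of i] F(1)[of j] k0 p2 by (intro mult_left_mono) auto
  also have "mass \<psi>' V' * mass \<theta>' W' = (real p ^ gap i j / (F i * F j)) * (mass \<psi> V * mass \<theta> W)"
    unfolding massV massW gap_def by (simp add: power_add field_simps)
  also have "(\<dots>) powr (3/4) = (real p ^ gap i j / (F i * F j)) powr (3/4) * (mass \<psi> V * mass \<theta> W) powr (3/4)"
    by (rule powr_mult)
  \<comment> \<open>Writing 3/4 = 1 - 1/4, the first power cancels the prefactor of the edge mass
    exactly. In the second the totient factors \<open>F \<le> 1\<close> only help and are
    dropped.\<close>
  also have "(real p ^ gap i j / (F i * F j)) powr (3/4) =
      (real p ^ gap i j / (F i * F j)) * (real p ^ gap i j / (F i * F j)) powr (-1/4)"
    using F(1)[of i] F(1)[of j] p2 powr_add[of "real p ^ gap i j / (F i * F j)" 1 "-1/4"] by simp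
  also have "(real p ^ gap i j / (F i * F j)) powr (-1/4) \<le> (real p ^ gap i j) powr (-1/4)"
  proof (rule powr_mono2')
    have "F i * F j \<le> 1 * 1" using F(1)[of i] F(1)[of j] F(2)[of i] F(2)[of j] by (intro mult_mono) auto
    thus "real p ^ gap i j \<le> real p ^ gap i j / (F i * F j)"
      using F(1)[of i] F(1)[of j] p2 by (simp add: field_simps mult_left_le)
  qed (use p2 in auto)
  also have "(real p ^ gap i j) powr (-1/4) = (real p powr (-1/4)) ^ gap i j"
    using p2 by (simp add: powr_realpow[symmetric] powr_powr mult.commute)
  finally have "edge_mass \<kappa> \<psi> \<theta> E \<le> F i * F j * k / real p ^ gap i j * (Q * (real p ^ gap i j / (F i * F j) *
     (real p powr (-1/4)) ^ gap i j * (mass \<psi> V * mass \<theta> W) powr (3/4)))"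
    using F(1)[of i] F(1)[of j] k0 p2 Q by (simp add: mult_left_mono mult_right_mono)
  also have "\<dots> = Q * (k * (real p powr (-1/4)) ^ gap i j * (mass \<psi> V * mass \<theta> W) powr (3/4))"
    using F(1)[of i] F(1)[of j] p2 by (simp add: field_simps)
  finally show ?thesis by (simp add: k_def)
qed

lemma tot_ratio_prime_power_mult_dvd:
  assumes "prime p" "p dvd v" "v > 0"
  shows "tot_ratio (p ^ k * v) = tot_ratio v"
proof -
  define m where "m = multiplicity p v"
  obtain u where u: "v = p ^ m * u" unfolding m_def using multiplicity_dvd by blast
  have p2: "p \<ge> 2" using assms prime_ge_2_nat by blast
  have m: "m \<noteq> 0" using assms p2 by (simp add: m_def multiplicity_eq_zero_iff)
  have "\<not> p dvd u"
  proof -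
    have "u > 0" using u assms by (cases u) auto
    hence "multiplicity p u = 0"
    proof -
      assume "u > 0"
      hence "multiplicity p (p ^ m * u) = m + multiplicity p u"
        using multiplicity_prime_power_mult[OF assms(1,1)] by simp
      thus ?thesis unfolding u[symmetric] m_def[symmetric] by simp
    qed
    thus ?thesis using \<open>u > 0\<close> p2 assms by (simp add: multiplicity_eq_zero_iff)
  qed
  moreover have "u > 0" using u assms by (cases u) auto
  ultimately show ?thesis
    using tot_ratio_prime_power_mult[of p u m] tot_ratio_prime_power_mult[of p u "k + m"] assms(1) m u
    by (simp add: power_add mult_ac)
qed

text \<open>The gain comes from the vertices \<open>v = p ^ k * v'\<close> with \<open>v'\<close> prime to \<open>p\<close>, for which
  \<open>tot_ratio v = (1 - 1 / p) * tot_ratio v'\<close>.\<close>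

lemma bounded_by_min_valuation:
  assumes bd: "bounded_by A \<kappa> Q" and Q: "Q > 0" and p: "prime p" and kap: "\<And>q. 0 \<le> \<kappa> q"
    and adm: "admissible (insert p A) \<psi> \<theta> V W E"
    and V: "\<And>v. v \<in> V \<Longrightarrow> p ^ k dvd v" and W: "\<And>w. w \<in> W \<Longrightarrow> p ^ k dvd w"
    and E: "\<And>v w. (v,w) \<in> E \<Longrightarrow> min (multiplicity p v) (multiplicity p w) = k" and k: "k \<ge> 1"
  shows "edge_mass \<kappa> \<psi> \<theta> E \<le> Q * (sqrt (1 - 1 / real p) * (mass \<psi> V * mass \<theta> W) powr (3/4))
     + 1 / real p * edge_mass \<kappa> \<psi> \<theta> {(v,w)\<in>E. multiplicity p v \<noteq> multiplicity p w}"
proof -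
  define V' where "V' = (\<lambda>v. v div p ^ k) ` V"
  define W' where "W' = (\<lambda>w. w div p ^ k) ` W"
  define E' where "E' = (\<lambda>(v,w). (v div p ^ k, w div p ^ k)) ` E"
  define \<psi>' where "\<psi>' = (\<lambda>v. \<psi> (p ^ k * v))"
  define \<theta>' where "\<theta>' = (\<lambda>w. \<theta> (p ^ k * w))"
  define a where "a = 1 / real p"
  have p2: "p \<ge> 2" "p > 0" using p prime_ge_2_nat prime_gt_0_nat by auto
  have a: "0 < a" "a \<le> 1/2" using p2 by (auto simp: a_def field_simps)
  have adm': "finite V" "finite W" "\<And>v. v \<in> V \<Longrightarrow> 0 < v \<and> 0 \<le> \<psi> v" "\<And>w. w \<in> W \<Longrightarrow> 0 < w \<and> 0 \<le> \<theta> w"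
    "E \<subseteq> V \<times> W" "\<And>v w. (v,w) \<in> E \<Longrightarrow> real w * \<psi> v \<le> real (gcd v w)"
    "\<And>v w. (v,w) \<in> E \<Longrightarrow> real v * \<theta> w \<le> real (gcd v w)"
    "\<And>v w q. (v,w) \<in> E \<Longrightarrow> prime q \<Longrightarrow> q dvd gcd v w \<Longrightarrow> q = p \<or> q \<in> A"
    using adm by (auto simp: admissible_def)
  have finE: "finite E" using adm' finite_subset by blast
  have dec: "p ^ k * (v div p ^ k) = v" "0 < v div p ^ k" if "v \<in> V \<or> v \<in> W" for v
  proof -
    show *: "p ^ k * (v div p ^ k) = v" using that V W by auto
    show "0 < v div p ^ k" using * that adm'(3,4) by (metis mult_0_right neq0_conv)
  qed
  have mult: "multiplicity p v = k + multiplicity p (v div p ^ k)" if "v \<in> V \<or> v \<in> W" for v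
    using multiplicity_prime_power_mult[OF p p dec(2)[OF that], of k] dec(1)[OF that] by simp
  have injV: "inj_on (\<lambda>v. v div p ^ k) V"
    by (rule inj_on_inverseI[where g = "\<lambda>v. p ^ k * v"]) (use dec(1) in simp)
  have injW: "inj_on (\<lambda>w. w div p ^ k) W"
    by (rule inj_on_inverseI[where g = "\<lambda>v. p ^ k * v"]) (use dec(1) in simp)
  have injE: "inj_on (\<lambda>(v,w). (v div p ^ k, w div p ^ k)) E"
    by (rule inj_on_inverseI[where g = "\<lambda>(v,w). (p ^ k * v, p ^ k * w)"]) (use dec(1) adm'(5) in auto)
  have tr0: "tot_ratio v = (1 - a) * tot_ratio (v div p ^ k)" if "v \<in> V \<or> v \<in> W" "\<not> p dvd v div p ^ k" for v
    using tot_ratio_prime_power_mult[OF p that(2) dec(2)[OF that(1)], of k] dec(1)[OF that(1)] k by (simp add: a_def)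
  have tr1: "tot_ratio v = tot_ratio (v div p ^ k)" if "v \<in> V \<or> v \<in> W" "p dvd v div p ^ k" for v
    using tot_ratio_prime_power_mult_dvd[OF p that(2) dec(2)[OF that(1)], of k] dec(1)[OF that(1)] by simp
  have tr: "(1 - a) * tot_ratio (v div p ^ k) \<le> tot_ratio v" if "v \<in> V \<or> v \<in> W" for v
    using tr0[OF that] tr1[OF that] a by (cases "p dvd v div p ^ k") (auto simp: mult_left_le_one_le)
  have psi': "\<psi>' (v div p ^ k) = \<psi> v" if "v \<in> V" for v using dec[of v] that by (simp add: \<psi>'_def)
  have theta': "\<theta>' (v div p ^ k) = \<theta> v" if "v \<in> W" for v using dec[of v] that by (simp add: \<theta>'_def)
  have massV: "(1 - a) * mass \<psi>' V' \<le> mass \<psi> V"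
  proof -
    have "(1 - a) * mass \<psi>' V' = (\<Sum>v\<in>V. (1 - a) * tot_ratio (v div p ^ k) * \<psi> v)"
      unfolding mass_def V'_def by (subst sum.reindex[OF injV]) (simp add: psi' sum_distrib_left mult_ac)
    also have "\<dots> \<le> mass \<psi> V"
      unfolding mass_def using tr adm'(3) by (intro sum_mono mult_right_mono) auto
    finally show ?thesis .
  qed
  have massW: "(1 - a) * mass \<theta>' W' \<le> mass \<theta> W"
  proof -
    have "(1 - a) * mass \<theta>' W' = (\<Sum>w\<in>W. (1 - a) * tot_ratio (w div p ^ k) * \<theta> w)"
      unfolding mass_def W'_def by (subst sum.reindex[OF injW]) (simp add: theta' sum_distrib_left mult_ac)
    also have "\<dots> \<le> mass \<theta> W"
      unfolding mass_def using tr adm'(4) by (intro sum_mono mult_right_mono) auto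
    finally show ?thesis .
  qed
  define N where "N = {(v,w)\<in>E. multiplicity p v \<noteq> multiplicity p w}"
  \<comment> \<open>If both endpoints have valuation \<open>k\<close>, both totient ratios pick up
    \<open>1 - a\<close> and the rescaled graph accounts for the edge exactly. If only one has, a
    single factor is picked up, and the deficit is \<open>a\<close> times the weight of the edge:
    this is the term with \<open>N\<close>.\<close>
  have edge: "edge_mass \<kappa> \<psi> \<theta> E = (1 - a)\<^sup>2 * edge_mass \<kappa> \<psi>' \<theta>' E' + a * edge_mass \<kappa> \<psi> \<theta> N"
  proof -
    let ?t = "\<lambda>v w. (tot_ratio v * \<psi> v) * (tot_ratio w * \<theta> w) * pair_weight \<kappa> v w"
    have "edge_mass \<kappa> \<psi> \<theta> N = (\<Sum>(v,w)\<in>E. if multiplicity p v \<noteq> multiplicity p w then ?t v w else 0)"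
      unfolding edge_mass_def N_def using finE by (intro sum.mono_neutral_cong_left) auto
    moreover have "edge_mass \<kappa> \<psi>' \<theta>' E' = (\<Sum>(v,w)\<in>E. (tot_ratio (v div p ^ k) * \<psi>' (v div p ^ k)) *
         (tot_ratio (w div p ^ k) * \<theta>' (w div p ^ k)) * pair_weight \<kappa> (v div p ^ k) (w div p ^ k))"
      unfolding edge_mass_def E'_def by (subst sum.reindex[OF injE]) (simp add: case_prod_unfold)
    ultimately have "(1 - a)\<^sup>2 * edge_mass \<kappa> \<psi>' \<theta>' E' + a * edge_mass \<kappa> \<psi> \<theta> N =
      (\<Sum>(v,w)\<in>E. (1 - a)\<^sup>2 * ((tot_ratio (v div p ^ k) * \<psi>' (v div p ^ k)) *
         (tot_ratio (w div p ^ k) * \<theta>' (w div p ^ k)) * pair_weight \<kappa> (v div p ^ k) (w div p ^ k))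
        + a * (if multiplicity p v \<noteq> multiplicity p w then ?t v w else 0))"
      by (simp add: sum_distrib_left sum.distrib case_prod_unfold)
    also have "\<dots> = (\<Sum>(v,w)\<in>E. ?t v w)"
    proof (intro sum.cong refl, clarify)
      fix v w assume vw: "(v,w) \<in> E"
      hence VW: "v \<in> V" "w \<in> W" using adm'(5) by auto
      have pw: "pair_weight \<kappa> v w = pair_weight \<kappa> (v div p ^ k) (w div p ^ k)"
        using diff_primes_scale[OF p dec(2)[of v] dec(2)[of w], of k] dec(1)[of v] dec(1)[of w] VW
        by (simp add: pair_weight_def)
      have mv: "multiplicity p v = k \<longleftrightarrow> \<not> p dvd v div p ^ k"
        using mult[of v] VW dec(2)[of v] p2 p by (auto simp: multiplicity_eq_zero_iff)
      have mw: "multiplicity p w = k \<longleftrightarrow> \<not> p dvd w div p ^ k"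
        using mult[of w] VW dec(2)[of w] p2 p by (auto simp: multiplicity_eq_zero_iff)
      have mn: "min (multiplicity p v) (multiplicity p w) = k" using E[OF vw] .
      consider "multiplicity p v = k" "multiplicity p w = k" | "multiplicity p v = k" "multiplicity p w \<noteq> k"
        | "multiplicity p v \<noteq> k" "multiplicity p w = k" using mn by (auto simp: min_def split: if_splits)
      hence "(1 - a)\<^sup>2 * (tot_ratio (v div p ^ k) * tot_ratio (w div p ^ k)) =
        (if multiplicity p v \<noteq> multiplicity p w then 1 - a else 1) * (tot_ratio v * tot_ratio w)"
      proof cases
        case 1 thus ?thesis using tr0[of v] tr0[of w] mv mw VW by (simp add: power2_eq_square)
      next
        case 2 thus ?thesis using tr0[of v] tr1[of w] mv mw VW by (simp add: power2_eq_square)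
      next
        case 3 thus ?thesis using tr1[of v] tr0[of w] mv mw VW by (simp add: power2_eq_square)
      qed
      hence "(1 - a)\<^sup>2 * ((tot_ratio (v div p ^ k) * \<psi> v) * (tot_ratio (w div p ^ k) * \<theta> w) * pair_weight \<kappa> v w) =
        (if multiplicity p v \<noteq> multiplicity p w then 1 - a else 1) * ?t v w"
        (is "?l = ?r")
      proof -
        assume *: "(1 - a)\<^sup>2 * (tot_ratio (v div p ^ k) * tot_ratio (w div p ^ k)) =
          (if multiplicity p v \<noteq> multiplicity p w then 1 - a else 1) * (tot_ratio v * tot_ratio w)"
        have "?l = ((1 - a)\<^sup>2 * (tot_ratio (v div p ^ k) * tot_ratio (w div p ^ k))) * (\<psi> v * \<theta> w * pair_weight \<kappa> v w)"
          by (simp only: mult_ac)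
        also have "\<dots> = ?r" unfolding * by (simp only: mult_ac)
        finally show ?thesis .
      qed
      note eq = this
      have aux: "l + a * (if c then t else 0) = t" if "l = (if c then 1 - a else 1) * t" for l t :: real and c
        using that by (cases c) (simp_all add: left_diff_distrib)
      show "(1 - a)\<^sup>2 * ((tot_ratio (v div p ^ k) * \<psi>' (v div p ^ k)) *
         (tot_ratio (w div p ^ k) * \<theta>' (w div p ^ k)) * pair_weight \<kappa> (v div p ^ k) (w div p ^ k))
        + a * (if multiplicity p v \<noteq> multiplicity p w then ?t v w else 0) = ?t v w"
        unfolding psi'[OF VW(1)] theta'[OF VW(2)] pw[symmetric]
        by (rule aux) (rule eq)
    qed
    finally show ?thesis by (simp add: edge_mass_def)
  qed
  have "admissible A \<psi>' \<theta>' V' W' E'"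
    unfolding admissible_def
  proof (intro conjI ballI, safe)
    show "finite V'" "finite W'" using adm' by (auto simp: V'_def W'_def)
    show "0 < v" if "v \<in> V'" for v using that dec by (auto simp: V'_def)
    show "0 < w" if "w \<in> W'" for w using that dec by (auto simp: W'_def)
    show "0 \<le> \<psi>' v" if "v \<in> V'" for v using that psi' adm' by (auto simp: V'_def)
    show "0 \<le> \<theta>' w" if "w \<in> W'" for w using that theta' adm' by (auto simp: W'_def)
    fix v' w' assume "(v', w') \<in> E'"
    then obtain v w where vw: "(v,w) \<in> E" "v' = v div p ^ k" "w' = w div p ^ k" by (auto simp: E'_def)
    hence VW: "v \<in> V" "w \<in> W" using adm'(5) by auto
    show "v' \<in> V'" "w' \<in> W'" using vw VW by (auto simp: V'_def W'_def)
    have v: "v = p ^ k * v'" "0 < v'" using dec[of v] VW vw by auto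
    have w: "w = p ^ k * w'" "0 < w'" using dec[of w] VW vw by auto
    have g: "gcd v w = p ^ k * gcd v' w'"
      unfolding v(1) w(1) by (simp only: gcd_mult_distrib_nat)
    have ps: "\<psi>' v' = \<psi> v" "\<theta>' w' = \<theta> w" using psi'[OF VW(1)] theta'[OF VW(2)] vw by auto
    have rg: "real (gcd v w) = real p ^ k * real (gcd v' w')" unfolding g by simp
    have rv: "real v = real p ^ k * real v'" using v(1) by (metis of_nat_mult of_nat_power)
    have rw: "real w = real p ^ k * real w'" using w(1) by (metis of_nat_mult of_nat_power)
    have "real p ^ k * (real w' * \<psi>' v') \<le> real p ^ k * real (gcd v' w')"
      using adm'(6)[OF vw(1)] unfolding rg rw ps by (simp only: mult_ac)
    thus "real w' * \<psi>' v' \<le> real (gcd v' w')" using p2 by simp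
    have "real p ^ k * (real v' * \<theta>' w') \<le> real p ^ k * real (gcd v' w')"
      using adm'(7)[OF vw(1)] unfolding rg rv ps by (simp only: mult_ac)
    thus "real v' * \<theta>' w' \<le> real (gcd v' w')" using p2 by simp
    fix q assume q: "prime q" "q dvd gcd v' w'"
    hence "q dvd gcd v w" using g by simp
    moreover have "q \<noteq> p"
    proof
      assume "q = p"
      hence "p dvd v'" "p dvd w'" using q by auto
      hence "multiplicity p v' > 0" "multiplicity p w' > 0" using v w p
        by (auto simp: prime_multiplicity_gt_zero_iff)
      thus False using E[OF vw(1)] mult[of v] mult[of w] VW vw by (auto simp: min_def split: if_splits)
    qed
    ultimately show "q \<in> A" using adm'(8)[OF vw(1) q(1)] by auto
  qed
  hence "edge_mass \<kappa> \<psi>' \<theta>' E' \<le> Q * (mass \<psi>' V' * mass \<theta>' W') powr (3/4)"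
    using bd by (auto simp: bounded_by_def)
  also have "\<dots> \<le> Q * ((mass \<psi> V * mass \<theta> W) / (1 - a)\<^sup>2) powr (3/4)"
  proof (intro mult_left_mono powr_mono2)
    have n: "0 \<le> mass \<psi>' V'" "0 \<le> mass \<theta>' W'" "0 \<le> mass \<psi> V" "0 \<le> mass \<theta> W"
      using psi' theta' adm' by (auto intro!: mass_nonneg simp: V'_def W'_def)
    show "0 \<le> mass \<psi>' V' * mass \<theta>' W'" using n by simp
    have "((1 - a) * mass \<psi>' V') * ((1 - a) * mass \<theta>' W') \<le> mass \<psi> V * mass \<theta> W"
      using massV massW n a by (intro mult_mono) auto
    thus "mass \<psi>' V' * mass \<theta>' W' \<le> mass \<psi> V * mass \<theta> W / (1 - a)\<^sup>2"
      using a by (simp only: pos_le_divide_eq power2_eq_square mult_ac mult_pos_pos diff_gt_0_iff_gt)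
  qed (use Q in auto)
  also have "((mass \<psi> V * mass \<theta> W) / (1 - a)\<^sup>2) powr (3/4)
      = (mass \<psi> V * mass \<theta> W) powr (3/4) / ((1 - a)\<^sup>2) powr (3/4)"
    by (rule powr_divide)
  finally have "(1 - a)\<^sup>2 * edge_mass \<kappa> \<psi>' \<theta>' E' \<le>
      (1 - a)\<^sup>2 * (Q * ((mass \<psi> V * mass \<theta> W) powr (3/4) / ((1 - a)\<^sup>2) powr (3/4)))"
    using a by (intro mult_left_mono) auto
  \<comment> \<open>Each mass may grow by \<open>1 / (1 - a)\<close>, which costs the power 3/2 of
    \<open>1 - a\<close> against the square gained on the edges; the difference is the factor
    \<open>sqrt (1 - a)\<close>.\<close>
  also have "((1 - a)\<^sup>2) powr (3/4) = (1 - a) * sqrt (1 - a)"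
  proof -
    have "((1 - a)\<^sup>2) powr (3/4) = (1 - a) powr (1 + 1/2)"
    proof -
      have "(1 - a)\<^sup>2 = (1 - a) powr 2" using a by simp
      hence "((1 - a)\<^sup>2) powr (3/4) = (1 - a) powr (2 * (3/4))" by (simp only: powr_powr)
      thus ?thesis by simp
    qed
    also have "\<dots> = (1 - a) * sqrt (1 - a)"
      using a unfolding powr_add by (simp add: powr_half_sqrt)
    finally show ?thesis .
  qed
  also have "(1 - a)\<^sup>2 * (Q * ((mass \<psi> V * mass \<theta> W) powr (3/4) / ((1 - a) * sqrt (1 - a))))
     = Q * (sqrt (1 - a) * (mass \<psi> V * mass \<theta> W) powr (3/4))"
  proof -
    define s where "s = sqrt (1 - a)"
    have s: "s > 0" "1 - a = s * s" using a by (auto simp: s_def)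
    have "(s * s)\<^sup>2 * (Q * (Z / (s * s * s))) = Q * (s * Z)" for Z
      using s(1) by (simp add: power2_eq_square)
    moreover have "sqrt (s * s) = s" using s(1) by simp
    ultimately show ?thesis unfolding s(2) by metis
  qed
  finally show ?thesis unfolding edge N_def[symmetric] by (simp add: a_def)
qed

lemma edge_mass_group:
  assumes "finite E" "finite P"
  shows "(\<Sum>(i,j)\<in>P. edge_mass \<kappa> \<psi> \<theta> {(v,w)\<in>E. f v = i \<and> f w = j})
    = edge_mass \<kappa> \<psi> \<theta> {(v,w)\<in>E. (f v, f w) \<in> P}"
proof -
  have fin: "finite {(v,w)\<in>E. (f v, f w) \<in> P}" using assms(1) by (rule rev_finite_subset) auto
  have "(\<Sum>(i,j)\<in>P. edge_mass \<kappa> \<psi> \<theta> {(v,w)\<in>E. f v = i \<and> f w = j})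
    = (\<Sum>y\<in>P. sum (\<lambda>(v,w). (tot_ratio v * \<psi> v) * (tot_ratio w * \<theta> w) * pair_weight \<kappa> v w)
        {x \<in> {(v,w)\<in>E. (f v, f w) \<in> P}. (\<lambda>(v,w). (f v, f w)) x = y})"
    unfolding edge_mass_def by (intro sum.cong refl) (auto intro!: sum.cong)
  also have "\<dots> = edge_mass \<kappa> \<psi> \<theta> {(v,w)\<in>E. (f v, f w) \<in> P}"
    unfolding edge_mass_def using fin assms by (intro sum.group) auto
  finally show ?thesis .
qed

lemma mass_group:
  assumes "finite V" "finite P"
  shows "(\<Sum>i\<in>P. mass \<psi> {v\<in>V. f v = i}) = mass \<psi> {v\<in>V. f v \<in> P}"
proof -
  have "(\<Sum>i\<in>P. mass \<psi> {v\<in>V. f v = i}) = (\<Sum>i\<in>P. sum (\<lambda>v. tot_ratio v * \<psi> v) {x \<in> {v\<in>V. f v \<in> P}. f x = i})"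
    unfolding mass_def by (intro sum.cong refl) (auto intro!: sum.cong)
  also have "\<dots> = mass \<psi> {v\<in>V. f v \<in> P}"
    unfolding mass_def using assms by (intro sum.group) auto
  finally show ?thesis .
qed

lemma admissible_subset:
  assumes "admissible A \<psi> \<theta> V W E" "V' \<subseteq> V" "W' \<subseteq> W" "E' \<subseteq> E" "E' \<subseteq> V' \<times> W'"
  shows "admissible A \<psi> \<theta> V' W' E'"
proof -
  have a: "finite V" "finite W" "\<And>v. v \<in> V \<Longrightarrow> 0 < v \<and> 0 \<le> \<psi> v" "\<And>w. w \<in> W \<Longrightarrow> 0 < w \<and> 0 \<le> \<theta> w"
    "\<And>v w. (v,w) \<in> E \<Longrightarrow> real w * \<psi> v \<le> real (gcd v w) \<and> real v * \<theta> w \<le> real (gcd v w) \<and>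
        (\<forall>p. prime p \<longrightarrow> p dvd gcd v w \<longrightarrow> p \<in> A)"
    using assms(1) by (auto simp: admissible_def)
  have "finite V'" "finite W'" using a(1,2) assms(2,3) by (auto intro: finite_subset)
  moreover have "\<forall>v\<in>V'. 0 < v \<and> 0 \<le> \<psi> v" using a(3) assms(2) by (simp add: subset_iff)
  moreover have "\<forall>w\<in>W'. 0 < w \<and> 0 \<le> \<theta> w" using a(4) assms(3) by (simp add: subset_iff)
  moreover have "\<forall>(v,w)\<in>E'. real w * \<psi> v \<le> real (gcd v w) \<and> real v * \<theta> w \<le> real (gcd v w) \<and>
        (\<forall>p. prime p \<longrightarrow> p dvd gcd v w \<longrightarrow> p \<in> A)"
  proof clarify
    fix v w assume "(v,w) \<in> E'"
    hence "(v,w) \<in> E" using assms(4) by (rule set_mp[rotated])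
    thus "real w * \<psi> v \<le> real (gcd v w) \<and> real v * \<theta> w \<le> real (gcd v w) \<and>
        (\<forall>p. prime p \<longrightarrow> p dvd gcd v w \<longrightarrow> p \<in> A)" by (rule a(5))
  qed
  ultimately show ?thesis using assms(5) unfolding admissible_def by simp
qed

text \<open>After division by \<open>Q * (X * Y) powr (3/4)\<close>, the masses of the valuation
  classes become the probability vectors of \<open>one_prime_inequality\<close>, with
  \<open>r ^ 4 = 1 / p\<close>. Its hypotheses on \<open>e\<close> are the bounds for fixed
  valuations and for fixed minimum valuation.\<close>

lemma bounded_by_prime:
  assumes bd: "bounded_by A \<kappa> Q" and Q: "Q > 0" and p: "prime p"
    and kap: "\<And>q. 0 \<le> \<kappa> q" "1 \<le> \<kappa> p" "\<kappa> p \<le> 3"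
  shows "bounded_by (insert p A) \<kappa> (Q * (if real p powr (-1/4) \<le> 1/100000
     then 1 + 1000000 * ((real p powr (-1/4)) ^ 5 + (real p powr (-1/4)) ^ 4 * (\<kappa> p - 1)) else 50))"
  unfolding bounded_by_def
proof (intro allI impI)
  fix \<psi> \<theta> V W E
  assume adm: "admissible (insert p A) \<psi> \<theta> V W E"
  define r where "r = real p powr (-1/4)"
  define M where "M = (if r \<le> 1/100000 then 1 + 1000000 * (r ^ 5 + r ^ 4 * (\<kappa> p - 1)) else 50)"
  have p2: "p \<ge> 2" "p > 0" using p prime_ge_2_nat prime_gt_0_nat by auto
  have r: "0 < r" using p2 by (simp add: r_def)
  have r4: "r ^ 4 = 1 / real p"
  proof -
    have "r ^ 4 = real p powr ((-1/4) * real 4)" unfolding r_def using p2 by (subst powr_power) auto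
    also have "(-1/4) * real 4 = -1" by simp
    also have "real p powr (-1) = 1 / real p" using p2 by (simp add: powr_neg_one)
    finally show ?thesis .
  qed
  have M0: "0 \<le> M" using r kap by (auto simp: M_def)
  have adm': "finite V" "finite W" "\<And>v. v \<in> V \<Longrightarrow> 0 < v \<and> 0 \<le> \<psi> v" "\<And>w. w \<in> W \<Longrightarrow> 0 < w \<and> 0 \<le> \<theta> w"
    "E \<subseteq> V \<times> W" using adm by (auto simp: admissible_def)
  have admE: "\<And>v w. (v,w) \<in> E \<Longrightarrow> real w * \<psi> v \<le> real (gcd v w)"
    "\<And>v w. (v,w) \<in> E \<Longrightarrow> real v * \<theta> w \<le> real (gcd v w)"
    "\<And>v w q. (v,w) \<in> E \<Longrightarrow> prime q \<Longrightarrow> q dvd gcd v w \<Longrightarrow> q = p \<or> q \<in> A"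
    using adm by (auto simp: admissible_def)
  have finE: "finite E" using adm' finite_subset by blast
  define X where "X = mass \<psi> V"
  define Y where "Y = mass \<theta> W"
  have XY: "0 \<le> X" "0 \<le> Y" using adm' by (auto simp: X_def Y_def intro!: mass_nonneg)
  have "edge_mass \<kappa> \<psi> \<theta> E \<le> Q * M * (X * Y) powr (3/4)"
  proof (cases "X = 0 \<or> Y = 0")
    case True
    have "edge_mass \<kappa> \<psi> \<theta> E = 0"
      unfolding edge_mass_def
    proof (intro sum.neutral ballI, clarify)
      fix v w assume "(v,w) \<in> E"
      hence "v \<in> V" "w \<in> W" using adm' by auto
      moreover have "X = 0 \<longleftrightarrow> (\<forall>v\<in>V. tot_ratio v * \<psi> v = 0)" "Y = 0 \<longleftrightarrow> (\<forall>v\<in>W. tot_ratio v * \<theta> v = 0)"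
        unfolding X_def Y_def mass_def by (rule sum_nonneg_eq_0_iff; use adm' in simp)+
      ultimately have "tot_ratio v * \<psi> v = 0 \<or> tot_ratio w * \<theta> w = 0" using True by blast
      thus "tot_ratio v * \<psi> v * (tot_ratio w * \<theta> w) * pair_weight \<kappa> v w = 0" by auto
    qed
    thus ?thesis using Q M0 by simp
  next
    case False
    hence XY: "0 < X" "0 < Y" using XY by auto
    define N where "N = Q * (X * Y) powr (3/4)"
    have N: "N > 0" using XY Q by (simp add: N_def)
    define m where "m = multiplicity p"
    define n where "n = Max (insert 0 (m ` (V \<union> W)))"
    have mn: "m v \<le> n" if "v \<in> V \<or> v \<in> W" for v
      unfolding n_def using that adm' by (intro Max_ge) auto
    define x where "x = (\<lambda>i. mass \<psi> {v\<in>V. m v = i} / X)"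
    define y where "y = (\<lambda>i. mass \<theta> {w\<in>W. m w = i} / Y)"
    define e where "e = (\<lambda>i j. edge_mass \<kappa> \<psi> \<theta> {(v,w)\<in>E. m v = i \<and> m w = j} / N)"
    have x0: "0 \<le> x i" for i unfolding x_def using XY adm' by (auto intro!: divide_nonneg_pos mass_nonneg)
    have y0: "0 \<le> y i" for i unfolding y_def using XY adm' by (auto intro!: divide_nonneg_pos mass_nonneg)
    have e0: "0 \<le> e i j" for i j unfolding e_def using N adm' kap
      by (auto intro!: divide_nonneg_pos edge_mass_nonneg)
    have xsum: "sum x P = mass \<psi> {v\<in>V. m v \<in> P} / X" if "finite P" for P
      unfolding x_def sum_divide_distrib[symmetric] mass_group[OF adm'(1) that] ..
    have ysum: "sum y P = mass \<theta> {v\<in>W. m v \<in> P} / Y" if "finite P" for P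
      unfolding y_def sum_divide_distrib[symmetric] mass_group[OF adm'(2) that] ..
    have esum: "(\<Sum>(i,j)\<in>P. e i j) = edge_mass \<kappa> \<psi> \<theta> {(v,w)\<in>E. (m v, m w) \<in> P} / N" if "finite P" for P
      unfolding e_def using edge_mass_group[OF finE that, of \<kappa> \<psi> \<theta> m]
      by (simp add: sum_divide_distrib[symmetric] case_prod_unfold)
    have "{v\<in>V. m v \<in> {..n}} = V" "{v\<in>W. m v \<in> {..n}} = W" using mn by auto
    hence x1: "sum x {..n} = 1" and y1: "sum y {..n} = 1"
      using xsum[of "{..n}"] ysum[of "{..n}"] XY by (simp_all add: X_def Y_def)
    have F1: "e i j \<le> (if i = j then 1 else \<kappa> p) * (r ^ gap i j * (x i * y j) powr (3/4))" for i j
    proof -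
      have "edge_mass \<kappa> \<psi> \<theta> {(v,w)\<in>E. m v = i \<and> m w = j} \<le> Q * ((if i = j then 1 else \<kappa> p) *
       (real p powr (-1/4)) ^ gap i j * (mass \<psi> {v\<in>V. m v = i} * mass \<theta> {w\<in>W. m w = j}) powr (3/4))"
        by (rule bounded_by_fixed_valuations[OF bd Q p kap(1) admissible_subset[OF adm]])
           (use adm' in \<open>auto simp: m_def\<close>)
      also have "mass \<psi> {v\<in>V. m v = i} * mass \<theta> {w\<in>W. m w = j} = (X * Y) * (x i * y j)"
        using XY by (simp add: x_def y_def)
      also have "((X * Y) * (x i * y j)) powr (3/4) = (X * Y) powr (3/4) * (x i * y j) powr (3/4)"
        by (rule powr_mult)
      finally have "edge_mass \<kappa> \<psi> \<theta> {(v,w)\<in>E. m v = i \<and> m w = j} \<le> 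
          (if i = j then 1 else \<kappa> p) * (r ^ gap i j * (x i * y j) powr (3/4)) * N"
        by (simp only: N_def r_def mult_ac)
      thus ?thesis unfolding e_def using N by (simp only: pos_divide_le_eq)
    qed
    have tot: "(\<Sum>(i,j)\<in>{..n}\<times>{..n}. e i j) = edge_mass \<kappa> \<psi> \<theta> E / N"
    proof -
      have "{(v,w)\<in>E. (m v, m w) \<in> {..n}\<times>{..n}} = E" using mn adm' by auto
      thus ?thesis using esum[of "{..n}\<times>{..n}"] by simp
    qed
    have "(\<Sum>(i,j)\<in>{..n}\<times>{..n}. e i j) \<le> M"
    proof (cases "r \<le> 1/100000")
      case True
      have "(\<Sum>(i,j)\<in>{..n}\<times>{..n}. e i j) \<le> 1 + 1000000 * (r ^ 5 + r ^ 4 * (\<kappa> p - 1))"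
      proof (rule one_prime_inequality[OF r True kap(2,3) x0 x1 y0 y1 e0 F1])
        have fin: "finite {(i,j)\<in>{..n}\<times>{..n}. P i j}" for P
          by (rule finite_subset[of _ "{..n}\<times>{..n}"]) auto
        \<comment> \<open>When one endpoint is prime to \<open>p\<close>, so is the gcd; these edges
          form a graph admissible for \<open>A\<close> itself and are bounded with the old
          constant.\<close>
        define E0 where "E0 = {(v,w)\<in>E. min (m v) (m w) = 0}"
        have "{(v,w)\<in>E. (m v, m w) \<in> {(i,j)\<in>{..n}\<times>{..n}. min i j = 0}} = E0"
          using mn adm' by (auto simp: E0_def)
        hence "(\<Sum>(i,j)\<in>{(i,j)\<in>{..n}\<times>{..n}. min i j = 0}. e i j) = edge_mass \<kappa> \<psi> \<theta> E0 / N"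
          using esum[OF fin[of "\<lambda>i j. min i j = 0"]] by simp
        moreover have "admissible A \<psi> \<theta> V W E0"
        proof -
          have qA: "q \<in> A" if "(v,w) \<in> E0" "prime q" "q dvd gcd v w" for v w q
          proof -
            have e: "(v,w) \<in> E" and m0: "min (m v) (m w) = 0" using that by (auto simp: E0_def)
            have vw: "v > 0" "w > 0" using e adm'(3-5) by auto
            have "q \<noteq> p"
            proof
              assume "q = p"
              hence "p dvd v" "p dvd w" using that by auto
              hence "m v > 0" "m w > 0" using vw p unfolding m_def
                by (simp_all add: prime_multiplicity_gt_zero_iff)
              thus False using m0 by simp
            qed
            thus ?thesis using admE(3)[OF e that(2,3)] by blast
          qed
          have sub: "E0 \<subseteq> E" by (auto simp: E0_def)
          have "E0 \<subseteq> V \<times> W" using sub adm'(5) by (rule subset_trans)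
          moreover have "\<forall>(v,w)\<in>E0. real w * \<psi> v \<le> real (gcd v w) \<and> real v * \<theta> w \<le> real (gcd v w) \<and>
            (\<forall>q. prime q \<longrightarrow> q dvd gcd v w \<longrightarrow> q \<in> A)"
          proof (clarify, intro conjI allI impI)
            fix v w assume vw: "(v,w) \<in> E0"
            hence e: "(v,w) \<in> E" using sub by blast
            show "real w * \<psi> v \<le> real (gcd v w)" "real v * \<theta> w \<le> real (gcd v w)"
              by (rule admE(1)[OF e], rule admE(2)[OF e])
            show "q \<in> A" if "prime q" "q dvd gcd v w" for q using qA[OF vw that] .
          qed
          ultimately show ?thesis using adm'(1-4) unfolding admissible_def by simp
        qed
        hence "edge_mass \<kappa> \<psi> \<theta> E0 \<le> N"
          using bd unfolding bounded_by_def N_def X_def Y_def by blast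
        ultimately show "(\<Sum>(i,j)\<in>{(i,j)\<in>{..n}\<times>{..n}. min i j = 0}. e i j) \<le> 1"
          using N by simp
        fix k assume k: "1 \<le> k" "k \<le> n"
        define Ek where "Ek = {(v,w)\<in>E. min (m v) (m w) = k}"
        define Uk where "Uk = {(v,w)\<in>Ek. multiplicity p v \<noteq> multiplicity p w}"
        define Vk where "Vk = {v\<in>V. m v \<in> {k..n}}"
        define Wk where "Wk = {v\<in>W. m v \<in> {k..n}}"
        have "{(v,w)\<in>E. (m v, m w) \<in> {(i,j)\<in>{..n}\<times>{..n}. min i j = k}} = Ek"
          using mn adm' by (auto simp: Ek_def)
        hence s1: "(\<Sum>(i,j)\<in>{(i,j)\<in>{..n}\<times>{..n}. min i j = k}. e i j) = edge_mass \<kappa> \<psi> \<theta> Ek / N"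
          using esum[OF fin[of "\<lambda>i j. min i j = k"]] by simp
        have "{(v,w)\<in>E. (m v, m w) \<in> {(i,j)\<in>{..n}\<times>{..n}. min i j = k \<and> i \<noteq> j}} = Uk"
          using mn adm' by (auto simp: Ek_def Uk_def m_def)
        hence s2: "(\<Sum>(i,j)\<in>{(i,j)\<in>{..n}\<times>{..n}. min i j = k \<and> i \<noteq> j}. e i j) = edge_mass \<kappa> \<psi> \<theta> Uk / N"
          using esum[OF fin[of "\<lambda>i j. min i j = k \<and> i \<noteq> j"]] by simp
        have dvd: "p ^ k dvd v" if "m v \<in> {k..n}" for v
          using that by (auto simp: m_def multiplicity_dvd')
        have "edge_mass \<kappa> \<psi> \<theta> Ek \<le> Q * (sqrt (1 - 1 / real p) * (mass \<psi> Vk * mass \<theta> Wk) powr (3/4))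
            + 1 / real p * edge_mass \<kappa> \<psi> \<theta> Uk"
          unfolding Uk_def
          by (rule bounded_by_min_valuation[OF bd Q p kap(1) admissible_subset[OF adm] _ _ _ k(1)])
             (use adm' mn dvd in \<open>auto simp: Vk_def Wk_def Ek_def m_def\<close>)
        also have "mass \<psi> Vk * mass \<theta> Wk = (X * Y) * ((\<Sum>i\<in>{k..n}. x i) * (\<Sum>i\<in>{k..n}. y i))"
          using xsum[of "{k..n}"] ysum[of "{k..n}"] XY by (simp add: Vk_def Wk_def)
        also have "\<dots> powr (3/4) = (X * Y) powr (3/4) * ((\<Sum>i\<in>{k..n}. x i) * (\<Sum>i\<in>{k..n}. y i)) powr (3/4)"
          by (rule powr_mult)
        finally have "edge_mass \<kappa> \<psi> \<theta> Ek / N \<le> (N * (sqrt (1 - 1 / real p) *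
            ((\<Sum>i\<in>{k..n}. x i) * (\<Sum>i\<in>{k..n}. y i)) powr (3/4)) + 1 / real p * edge_mass \<kappa> \<psi> \<theta> Uk) / N"
          using N by (intro divide_right_mono) (simp_all add: N_def mult_ac)
        also have "\<dots> = sqrt (1 - 1 / real p) * ((\<Sum>i\<in>{k..n}. x i) * (\<Sum>i\<in>{k..n}. y i)) powr (3/4)
            + 1 / real p * (edge_mass \<kappa> \<psi> \<theta> Uk / N)"
          using N by (simp add: add_divide_distrib)
        finally show "(\<Sum>(i,j)\<in>{(i,j)\<in>{..n}\<times>{..n}. min i j = k}. e i j)
           \<le> sqrt (1 - r ^ 4) * ((\<Sum>i\<in>{k..n}. x i) * (\<Sum>i\<in>{k..n}. y i)) powr (3/4)
             + r ^ 4 * (\<Sum>(i,j)\<in>{(i,j)\<in>{..n}\<times>{..n}. min i j = k \<and> i \<noteq> j}. e i j)"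
          unfolding s1 s2 r4 .
      qed
      thus ?thesis using True by (simp add: M_def)
    next
      case False
      \<comment> \<open>The worst prime is 2, where \<open>r ^ 4 = 1/2 < (17/20) ^ 4\<close>; the
        crude cost is then at most 1 + 3 * 1.7 / 0.15 = 35.\<close>
      have "r ^ 4 \<le> (17/20) ^ 4" unfolding r4 using p2 by (simp add: field_simps eval_nat_numeral)
      hence r17: "r \<le> 17/20" by (rule power_le_imp_le_base[of _ 3, simplified]) simp
      have "(\<Sum>(i,j)\<in>{..n}\<times>{..n}. e i j) \<le> 1 + \<kappa> p * (2 * r / (1 - r))"
        by (rule one_prime_crude[OF r _ kap(2) x0 x1 y0 y1 F1]) (use r17 in auto)
      also have "\<kappa> p * (2 * r / (1 - r)) \<le> 3 * (2 * (17/20) / (1 - 17/20))"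
        using r r17 kap by (intro mult_mono frac_le) auto
      finally show ?thesis using False by (simp add: M_def)
    qed
    hence "edge_mass \<kappa> \<psi> \<theta> E / N \<le> M" using tot by simp
    hence "edge_mass \<kappa> \<psi> \<theta> E \<le> M * N" using N by (simp add: field_simps)
    thus ?thesis by (simp add: N_def mult_ac)
  qed
  thus "edge_mass \<kappa> \<psi> \<theta> E \<le> Q * (if real p powr (-1/4) \<le> 1/100000
     then 1 + 1000000 * ((real p powr (-1/4)) ^ 5 + (real p powr (-1/4)) ^ 4 * (\<kappa> p - 1)) else 50) *
      (mass \<psi> V * mass \<theta> W) powr (3/4)"
    by (simp only: M_def r_def X_def Y_def)
qed

subsection \<open>Weighted edge counts: all primes\<close>

text \<open>The tilted weight: a large-prime sum exceeding 1 is amplified by the factor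
  \<open>t\<close> in the exponent, while the mean stays bounded because the sum of
  \<open>t / p ^ 2\<close> over \<open>p \<ge> t\<close> is bounded uniformly in
  \<open>t\<close>.\<close>

definition scale_weight :: "nat \<Rightarrow> nat \<Rightarrow> real" where
  "scale_weight t p = (if p \<ge> t then exp (real t / real p) else 1)"

lemma sum_inverse_squares_le:
  fixes t :: nat
  assumes "t \<ge> 1" "finite A" "\<And>n. n \<in> A \<Longrightarrow> n \<ge> t"
  shows "(\<Sum>n\<in>A. real t / (real n)\<^sup>2) \<le> 2"
proof -
  have ind: "(\<Sum>n\<in>{t..t+k}. 1 / (real n)\<^sup>2) \<le> 2 / real t - 1 / real (t + k)" for k
  proof (induction k)
    case 0
    have "1 / (real t)\<^sup>2 \<le> 1 / real t" using assms(1) by (simp add: power2_eq_square field_simps)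
    thus ?case by simp
  next
    case (Suc k)
    have "(\<Sum>n\<in>{t..t+Suc k}. 1 / (real n)\<^sup>2) = (\<Sum>n\<in>{t..t+k}. 1 / (real n)\<^sup>2) + 1 / (real (t + Suc k))\<^sup>2"
      by (simp add: sum.cl_ivl_Suc)
    also have "\<dots> \<le> 2 / real t - 1 / real (t + k) + 1 / (real (t + Suc k))\<^sup>2"
      using Suc.IH by simp
    also have "1 / (real (t + Suc k))\<^sup>2 \<le> 1 / real (t + k) - 1 / real (t + Suc k)"
    proof -
      have "1 / (x + 1)\<^sup>2 \<le> 1 / x - 1 / (x + 1)" if "0 < x" for x :: real
      proof -
        have "1 / (x + 1)\<^sup>2 \<le> 1 / (x * (x + 1))"
          using that by (intro frac_le mult_pos_pos) (auto simp: power2_eq_square algebra_simps)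
        also have "\<dots> = 1 / x - 1 / (x + 1)" using that by (simp add: field_simps)
        finally show ?thesis .
      qed
      from this[of "real (t + k)"] show ?thesis using assms(1) by (simp add: add_ac)
    qed
    finally show ?case by simp
  qed
  obtain k where k: "A \<subseteq> {t..t+k}"
  proof
    show "A \<subseteq> {t..t + Max (insert t A)}" using assms(2,3) by (auto intro!: trans_le_add2 Max_ge)
  qed
  have "(\<Sum>n\<in>A. 1 / (real n)\<^sup>2) \<le> (\<Sum>n\<in>{t..t+k}. 1 / (real n)\<^sup>2)"
    using k by (intro sum_mono2) auto
  also have "\<dots> \<le> 2 / real t - 1 / real (t + k)" by (rule ind)
  also have "\<dots> \<le> 2 / real t" by simp
  finally have "real t * (\<Sum>n\<in>A. 1 / (real n)\<^sup>2) \<le> real t * (2 / real t)"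
    by (intro mult_left_mono) auto
  thus ?thesis using assms(1) by (simp add: sum_distrib_left)
qed

lemma sum_inverse_sqrt_le: "(\<Sum>v\<in>{1..N}. 1 / sqrt (real v)) \<le> 2 * sqrt (real N)"
proof (induction N)
  case (Suc N)
  define a where "a = sqrt (real N)"
  define b where "b = sqrt (real (Suc N))"
  have ab: "0 \<le> a" "0 < b" "a\<^sup>2 = real N" "b\<^sup>2 = real N + 1" by (auto simp: a_def b_def)
  have "0 \<le> (b - a)\<^sup>2" by simp
  hence "1 \<le> 2 * b * (b - a)" using ab by (simp add: power2_eq_square algebra_simps)
  hence "1 / b \<le> 2 * b - 2 * a" using ab by (simp add: field_simps)
  moreover have "(\<Sum>v\<in>{1..Suc N}. 1 / sqrt (real v)) = (\<Sum>v\<in>{1..N}. 1 / sqrt (real v)) + 1 / b"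
    by (simp add: b_def)
  ultimately show ?case using Suc.IH unfolding a_def[symmetric] b_def[symmetric] by linarith
qed simp

definition upto_set :: "real \<Rightarrow> nat set" where "upto_set X = {v. 1 \<le> v \<and> real v \<le> X}"

lemma upto_set_eq: "upto_set X = {1..nat \<lfloor>X\<rfloor>}"
proof -
  have "real v \<le> X \<longleftrightarrow> v \<le> nat \<lfloor>X\<rfloor>" if "1 \<le> v" for v
  proof -
    have "real v \<le> X \<longleftrightarrow> int v \<le> \<lfloor>X\<rfloor>" by (simp add: le_floor_iff)
    also have "\<dots> \<longleftrightarrow> v \<le> nat \<lfloor>X\<rfloor>" 
    proof (cases "0 \<le> \<lfloor>X\<rfloor>")
      case True
      thus ?thesis by (simp add: le_nat_iff)
    next
      case False
      hence "\<not> int v \<le> \<lfloor>X\<rfloor>" "nat \<lfloor>X\<rfloor> = 0" by linarith+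
      thus ?thesis using that by simp
    qed
    finally show ?thesis .
  qed
  thus ?thesis by (auto simp: upto_set_def)
qed

lemma finite_upto_set [simp]: "finite (upto_set X)"
  by (simp add: upto_set_eq)

text \<open>Adding a prime \<open>p\<close> adds \<open>g p\<close> times the sum over multiples of
  \<open>p\<close>. With \<open>v = p * u\<close> this is a sum of the old kind up to
  \<open>X / p\<close>; the factors \<open>1 / sqrt p\<close> from the summand and from the range
  combine to \<open>1 / p\<close>.\<close>

lemma sum_divisor_weight_le:
  fixes g :: "nat \<Rightarrow> real"
  assumes "finite A" "\<And>p. p \<in> A \<Longrightarrow> prime p \<and> 0 \<le> g p" "0 \<le> X"
  shows "(\<Sum>v\<in>upto_set X. (\<Prod>p | p \<in> A \<and> p dvd v. 1 + g p) / sqrt (real v))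
    \<le> 2 * sqrt X * (\<Prod>p\<in>A. 1 + g p / real p)"
  using assms
proof (induction A arbitrary: X rule: finite_induct)
  case empty
  have "(\<Sum>v\<in>upto_set X. 1 / sqrt (real v)) \<le> 2 * sqrt (real (nat \<lfloor>X\<rfloor>))"
    unfolding upto_set_eq by (rule sum_inverse_sqrt_le)
  also have "\<dots> \<le> 2 * sqrt X" using empty by simp
  finally show ?case by simp
next
  case (insert p A)
  have p: "prime p" "p > 0" "0 \<le> g p" using insert.prems prime_gt_0_nat by auto
  define P where "P = (\<lambda>v. \<Prod>p | p \<in> A \<and> p dvd v. 1 + g p)"
  have ins: "(\<Prod>q | q \<in> insert p A \<and> q dvd v. 1 + g q) = P v + (if p dvd v then g p * P v else 0)" for v
  proof (cases "p dvd v")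
    case True
    have "{q. q \<in> insert p A \<and> q dvd v} = insert p {q. q \<in> A \<and> q dvd v}" using True by auto
    thus ?thesis using True insert.hyps by (simp add: P_def algebra_simps)
  next
    case False
    hence "{q. q \<in> insert p A \<and> q dvd v} = {q. q \<in> A \<and> q dvd v}" by auto
    thus ?thesis using False by (simp add: P_def)
  qed
  have Pp: "P (p * v) = P v" for v
  proof -
    have "q dvd p * v \<longleftrightarrow> q dvd v" if "q \<in> A" for q
    proof -
      have q: "prime q" "q \<noteq> p" using that insert.prems insert.hyps by auto
      hence "\<not> q dvd p" using p primes_dvd_imp_eq by blast
      thus ?thesis using q by (simp add: prime_dvd_mult_iff)
    qed
    hence "{q. q \<in> A \<and> q dvd p * v} = {q. q \<in> A \<and> q dvd v}" by auto
    thus ?thesis by (simp add: P_def)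
  qed
  have "(\<Sum>v\<in>upto_set X. (\<Prod>q | q \<in> insert p A \<and> q dvd v. 1 + g q) / sqrt (real v))
     = (\<Sum>v\<in>upto_set X. P v / sqrt (real v)) + (\<Sum>v\<in>upto_set X. if p dvd v then g p * P v / sqrt (real v) else 0)"
    unfolding ins sum.distrib[symmetric] by (intro sum.cong) (auto simp: add_divide_distrib)
  also have "(\<Sum>v\<in>upto_set X. if p dvd v then g p * P v / sqrt (real v) else 0)
     = (\<Sum>v\<in>upto_set (X / real p). g p / sqrt (real p) * (P v / sqrt (real v)))"
  proof -
    have "(\<Sum>v\<in>upto_set X. if p dvd v then g p * P v / sqrt (real v) else 0)
      = (\<Sum>v\<in>{v\<in>upto_set X. p dvd v}. g p * P v / sqrt (real v))"
      by (intro sum.mono_neutral_cong_right) auto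
    also have "\<dots> = (\<Sum>v\<in>upto_set (X / real p). g p / sqrt (real p) * (P v / sqrt (real v)))"
    proof (rule sum.reindex_bij_witness[of _ "\<lambda>v. p * v" "\<lambda>v. v div p"])
      fix v assume v: "v \<in> {v\<in>upto_set X. p dvd v}"
      then obtain u where u: "v = p * u" by auto
      show "p * (v div p) = v" using u p by simp
      show "v div p \<in> upto_set (X / real p)" using v u p by (auto simp: upto_set_def field_simps)
      show "g p / sqrt (real p) * (P (v div p) / sqrt (real (v div p))) = g p * P v / sqrt (real v)"
        using u p Pp by (simp add: real_sqrt_mult)
    next
      fix v assume v: "v \<in> upto_set (X / real p)"
      show "p * v div p = v" using p by simp
      show "p * v \<in> {v \<in> upto_set X. p dvd v}" using v p by (auto simp: upto_set_def field_simps)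
    qed
    finally show ?thesis .
  qed
  also have "\<dots> = g p / sqrt (real p) * (\<Sum>v\<in>upto_set (X / real p). P v / sqrt (real v))"
    by (simp add: sum_distrib_left)
  also have "(\<Sum>v\<in>upto_set X. P v / sqrt (real v)) + g p / sqrt (real p) * (\<Sum>v\<in>upto_set (X / real p). P v / sqrt (real v))
      \<le> 2 * sqrt X * (\<Prod>p\<in>A. 1 + g p / real p) +
      g p / sqrt (real p) * (2 * sqrt (X / real p) * (\<Prod>p\<in>A. 1 + g p / real p))"
    unfolding P_def using insert.prems p by (intro add_mono mult_left_mono insert.IH) auto
  also have "2 * sqrt X * (\<Prod>p\<in>A. 1 + g p / real p) +
      g p / sqrt (real p) * (2 * sqrt (X / real p) * (\<Prod>p\<in>A. 1 + g p / real p))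
      = 2 * sqrt X * ((1 + g p / real p) * (\<Prod>p\<in>A. 1 + g p / real p))"
    using p by (simp add: real_sqrt_divide field_simps)
  also have "\<dots> = 2 * sqrt X * (\<Prod>p\<in>insert p A. 1 + g p / real p)"
    using insert.hyps by simp
  finally show ?case .
qed

lemma prod_le_exp_sum:
  fixes f :: "'a \<Rightarrow> real"
  assumes "\<And>x. x \<in> A \<Longrightarrow> 0 \<le> f x"
  shows "(\<Prod>x\<in>A. 1 + f x) \<le> exp (\<Sum>x\<in>A. f x)"
proof (cases "finite A")
  case True
  have "(\<Prod>x\<in>A. 1 + f x) \<le> (\<Prod>x\<in>A. exp (f x))"
    using assms by (intro prod_mono) (auto simp: exp_ge_add_one_self add_nonneg_nonneg)
  thus ?thesis using True by (simp add: exp_sum)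
qed simp

definition prime_weight :: "(nat \<Rightarrow> real) \<Rightarrow> nat \<Rightarrow> real" where
  "prime_weight \<kappa> v = (\<Prod>p\<in>prime_factors v. \<kappa> p)"

lemma scale_weight_ge_1: "1 \<le> scale_weight t p"
  by (simp add: scale_weight_def)

lemma scale_weight_le:
  assumes "t \<ge> 1" "p > 0"
  shows "scale_weight t p \<le> 1 + (if p \<ge> t then 2 * (real t / real p) else 0)" "scale_weight t p \<le> 3"
proof -
  have "exp x \<le> 1 + 2 * x" if "0 \<le> x" "x \<le> 1" for x :: real
  proof -
    have "exp x \<le> 1 + x + x\<^sup>2" using exp_bound[OF that] .
    also have "x\<^sup>2 \<le> x" using that by (simp add: power2_eq_square mult_left_le)
    finally show ?thesis by simp
  qed
  from this[of "real t / real p"] show *: "scale_weight t p \<le> 1 + (if p \<ge> t then 2 * (real t / real p) else 0)"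
    using assms by (auto simp: scale_weight_def)
  moreover have "real t / real p \<le> 1" if "p \<ge> t" using that assms by (simp add: field_simps)
  ultimately show "scale_weight t p \<le> 3" by (auto split: if_splits)
qed

text \<open>The fourth power is what two successive applications of Cauchy--Schwarz in
  \<open>bounded_by_coprime\<close> consume. Since weights are at most 3, \<open>s ^ 4 - 1\<close>
  is at most 40 times \<open>s - 1\<close>, and the Euler product stays bounded independently of
  \<open>t\<close>.\<close>

lemma prime_weight_mean:
  assumes "t \<ge> 1" "0 \<le> X"
  shows "(\<Sum>v\<in>upto_set X. prime_weight (scale_weight t) v ^ 4 / sqrt (real v)) \<le> 2 * exp 320 * sqrt X"
proof -
  define A where "A = {p. prime p \<and> p \<le> nat \<lfloor>X\<rfloor>}"
  define g where "g = (\<lambda>p. scale_weight t p ^ 4 - 1)"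
  have finA: "finite A" by (simp add: A_def)
  have g0: "0 \<le> g p" for p using scale_weight_ge_1[of t p] by (simp add: g_def)
  have gle: "g p / real p \<le> (if p \<ge> t then 160 * (real t / (real p)\<^sup>2) else 0)" if "p \<in> A" for p
  proof -
    have p: "p > 0" using that by (auto simp: A_def prime_gt_0_nat)
    let ?s = "scale_weight t p"
    have "s ^ 4 - 1 = (s - 1) * (s ^ 3 + s\<^sup>2 + s + 1)" for s :: real
      by (simp add: algebra_simps eval_nat_numeral)
    hence "?s ^ 4 - 1 = (?s - 1) * (?s ^ 3 + ?s\<^sup>2 + ?s + 1)" .
    also have "\<dots> \<le> (?s - 1) * (3 ^ 3 + 3\<^sup>2 + 3 + 1)"
      using scale_weight_ge_1[of t p] scale_weight_le(2)[OF assms(1) p]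
      by (intro mult_left_mono add_mono power_mono) auto
    finally have "g p \<le> 40 * (?s - 1)" by (simp add: g_def)
    also have "\<dots> \<le> 40 * (if p \<ge> t then 2 * (real t / real p) else 0)"
      using scale_weight_le(1)[OF assms(1) p] by simp
    finally have "g p \<le> 40 * (if p \<ge> t then 2 * (real t / real p) else 0)" .
    hence "g p / real p \<le> 40 * (if p \<ge> t then 2 * (real t / real p) else 0) / real p"
      using p by (simp add: divide_right_mono)
    also have "\<dots> \<le> (if p \<ge> t then 160 * (real t / (real p)\<^sup>2) else 0)"
      using p by (auto simp: power2_eq_square divide_simps)
    finally show ?thesis .
  qed
  have "(\<Sum>v\<in>upto_set X. prime_weight (scale_weight t) v ^ 4 / sqrt (real v))
     = (\<Sum>v\<in>upto_set X. (\<Prod>p | p \<in> A \<and> p dvd v. 1 + g p) / sqrt (real v))"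
  proof (intro sum.cong refl)
    fix v assume v: "v \<in> upto_set X"
    hence "prime_factors v = {p. p \<in> A \<and> p dvd v}"
      by (auto simp: upto_set_eq A_def prime_factors_dvd dest: dvd_imp_le)
    thus "prime_weight (scale_weight t) v ^ 4 / sqrt (real v) = (\<Prod>p | p \<in> A \<and> p dvd v. 1 + g p) / sqrt (real v)"
      by (simp add: prime_weight_def g_def prod_power_distrib)
  qed
  also have "\<dots> \<le> 2 * sqrt X * (\<Prod>p\<in>A. 1 + g p / real p)"
    using finA g0 assms by (intro sum_divisor_weight_le) (auto simp: A_def)
  finally have main: "(\<Sum>v\<in>upto_set X. prime_weight (scale_weight t) v ^ 4 / sqrt (real v))
    \<le> 2 * sqrt X * (\<Prod>p\<in>A. 1 + g p / real p)" .
  have "(\<Prod>p\<in>A. 1 + g p / real p) \<le> exp (\<Sum>p\<in>A. g p / real p)"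
    using g0 by (intro prod_le_exp_sum) auto
  also have "(\<Sum>p\<in>A. g p / real p) \<le> (\<Sum>p\<in>A. if p \<ge> t then 160 * (real t / (real p)\<^sup>2) else 0)"
    using gle by (intro sum_mono)
  also have "\<dots> = 160 * (\<Sum>p\<in>{p\<in>A. p \<ge> t}. real t / (real p)\<^sup>2)"
    using finA by (auto simp: sum_distrib_left sum.inter_filter intro!: sum.cong)
  also have "\<dots> \<le> 160 * 2"
    using finA assms by (intro mult_left_mono sum_inverse_squares_le) auto
  finally have "(\<Prod>p\<in>A. 1 + g p / real p) \<le> exp 320" by simp
  hence "2 * sqrt X * (\<Prod>p\<in>A. 1 + g p / real p) \<le> 2 * sqrt X * exp 320"
    using assms by (intro mult_left_mono) auto
  from order_trans[OF main this] show ?thesis by (simp only: mult_ac)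
qed

lemma pair_weight_coprime:
  assumes "coprime v w" "v > 0" "w > 0"
  shows "pair_weight \<kappa> v w = prime_weight \<kappa> v * prime_weight \<kappa> w"
proof -
  have "diff_primes v w = prime_factors v \<union> prime_factors w"
  proof -
    have H: "multiplicity p v = 0 \<or> multiplicity p w = 0" if "prime p" for p
    proof (rule ccontr)
      assume "\<not> ?thesis"
      hence "p dvd v" "p dvd w" 
        using not_dvd_imp_multiplicity_0[of p v] not_dvd_imp_multiplicity_0[of p w] by auto
      thus False using assms(1) that by (meson not_prime_unit coprime_common_divisor)
    qed
    show ?thesis
    proof -
      have "p \<in> diff_primes v w \<longleftrightarrow> p \<in> prime_factors v \<union> prime_factors w" for p
        using H[of p] by (cases "prime p") (auto simp: diff_primes_def prime_factors_multiplicity)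
      thus ?thesis by blast
    qed
  qed
  moreover have "prime_factors v \<inter> prime_factors w = {}"
    using assms by (auto simp: prime_factors_dvd dest: coprime_common_divisor not_prime_unit)
  ultimately show ?thesis
    unfolding pair_weight_def prime_weight_def by (simp add: prod.union_disjoint)
qed

lemma sum_mult_le_sqrt:
  fixes f g :: "'a \<Rightarrow> real"
  assumes "\<And>i. i \<in> I \<Longrightarrow> 0 \<le> f i" "\<And>i. i \<in> I \<Longrightarrow> 0 \<le> g i"
  shows "(\<Sum>i\<in>I. sqrt (f i) * sqrt (g i)) \<le> sqrt (sum f I) * sqrt (sum g I)"
proof -
  have "(\<Sum>i\<in>I. sqrt (f i) * sqrt (g i))\<^sup>2 \<le> (\<Sum>i\<in>I. (sqrt (f i))\<^sup>2) * (\<Sum>i\<in>I. (sqrt (g i))\<^sup>2)"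
    by (rule Cauchy_Schwarz_ineq_sum)
  also have "\<dots> = sum f I * sum g I" using assms by simp
  finally have "(\<Sum>i\<in>I. sqrt (f i) * sqrt (g i)) \<le> sqrt (sum f I * sum g I)"
    by (rule real_le_rsqrt)
  thus ?thesis by (simp add: real_sqrt_mult)
qed

text \<open>The Schur test with weights \<open>1 / sqrt v\<close>: an edge forces \<open>w \<le> 1 / x v\<close> and \<open>v \<le> 1 / y w\<close>.\<close>

lemma Schur_half:
  fixes x y k :: "nat \<Rightarrow> real" and E :: "(nat \<times> nat) set"
  assumes E: "E \<subseteq> V \<times> W" "finite V" "finite W" and pos: "\<And>v. v \<in> V \<Longrightarrow> 0 < v" "\<And>w. w \<in> W \<Longrightarrow> 0 < w"
    and x: "\<And>v. v \<in> V \<Longrightarrow> 0 \<le> x v" and y: "\<And>w. w \<in> W \<Longrightarrow> 0 \<le> y w" and k: "\<And>w. 0 \<le> k w"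
    and edge: "\<And>v w. (v,w) \<in> E \<Longrightarrow> real w * x v \<le> 1" "\<And>v w. (v,w) \<in> E \<Longrightarrow> real v * y w \<le> 1"
    and mean: "\<And>X. 0 \<le> X \<Longrightarrow> (\<Sum>w\<in>upto_set X. k w / sqrt (real w)) \<le> K * sqrt X"
  shows "(\<Sum>(v,w)\<in>E. x v * (sqrt (x v * y w * (real v / real w)) * k w)) \<le> K * sum x V"
proof -
  have K: "0 \<le> K"
  proof -
    have "0 \<le> (\<Sum>w\<in>upto_set 1. k w / sqrt (real w))" using k by (intro sum_nonneg) auto
    also have "\<dots> \<le> K" using mean[of 1] by simp
    finally show ?thesis .
  qed
  have finE: "finite E" using E finite_subset by blast
  have "(\<Sum>(v,w)\<in>E. x v * (sqrt (x v * y w * (real v / real w)) * k w))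
     \<le> (\<Sum>(v,w)\<in>E. x v * (sqrt (x v) * (k w / sqrt (real w))))"
  proof (intro sum_mono, clarify)
    fix v w assume vw: "(v,w) \<in> E"
    hence VW: "v \<in> V" "w \<in> W" using E by auto
    have "x v * y w * (real v / real w) = x v * (real v * y w) / real w" by simp
    also have "\<dots> \<le> x v * 1 / real w"
      using edge(2)[OF vw] x[OF VW(1)] by (intro divide_right_mono mult_left_mono) auto
    finally have "sqrt (x v * y w * (real v / real w)) \<le> sqrt (x v / real w)" by simp
    hence "x v * (sqrt (x v * y w * (real v / real w)) * k w) \<le> x v * (sqrt (x v / real w) * k w)"
      using x[OF VW(1)] k by (intro mult_left_mono mult_right_mono) auto
    thus "x v * (sqrt (x v * y w * (real v / real w)) * k w) \<le> x v * (sqrt (x v) * (k w / sqrt (real w)))"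
      by (simp add: real_sqrt_divide)
  qed
  also have "\<dots> = (\<Sum>v\<in>V. \<Sum>w | (v,w) \<in> E. x v * (sqrt (x v) * (k w / sqrt (real w))))"
  proof -
    have eq: "(SIGMA v:V. {w. (v,w) \<in> E}) = E" using E by auto
    have "finite {w. (v,w) \<in> E}" for v using E by (auto intro: finite_subset[of _ W])
    hence "(\<Sum>v\<in>V. \<Sum>w | (v,w) \<in> E. x v * (sqrt (x v) * (k w / sqrt (real w))))
      = (\<Sum>(v,w)\<in>(SIGMA v:V. {w. (v,w) \<in> E}). x v * (sqrt (x v) * (k w / sqrt (real w))))"
      using E by (intro sum.Sigma) auto
    thus ?thesis unfolding eq by simp
  qed
  also have "\<dots> \<le> (\<Sum>v\<in>V. K * x v)"
  proof (intro sum_mono)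
    fix v assume v: "v \<in> V"
    show "(\<Sum>w | (v,w) \<in> E. x v * (sqrt (x v) * (k w / sqrt (real w)))) \<le> K * x v"
    proof (cases "x v = 0")
      case False
      hence x0: "0 < x v" using x[OF v] by simp
      have "(\<Sum>w | (v,w) \<in> E. k w / sqrt (real w)) \<le> (\<Sum>w\<in>upto_set (1 / x v). k w / sqrt (real w))"
      proof (intro sum_mono2)
        show "{w. (v, w) \<in> E} \<subseteq> upto_set (1 / x v)"
          using edge(1) pos(2) E x0 by (auto simp: upto_set_def field_simps Suc_le_eq)
      qed (use k in auto)
      also have "\<dots> \<le> K * sqrt (1 / x v)" using x0 by (intro mean) auto
      finally have "x v * sqrt (x v) * (\<Sum>w | (v,w) \<in> E. k w / sqrt (real w)) \<le> x v * sqrt (x v) * (K * sqrt (1 / x v))"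
        using x0 by (intro mult_left_mono) auto
      also have "\<dots> = K * x v" using x0 by (simp add: real_sqrt_divide)
      finally show ?thesis by (simp add: sum_distrib_left mult_ac)
    qed (use K in simp)
  qed
  also have "\<dots> = K * sum x V" by (simp add: sum_distrib_left)
  finally show ?thesis .
qed

text \<open>Origin of the exponent: without weights the edges contribute at most
  \<open>X * Y\<close> for the two masses, and with squared weights Schur's test gives
  \<open>K * sqrt (X * Y)\<close>. Cauchy--Schwarz takes the geometric mean of these, with exponent
  (1 + 1/2) / 2 = 3/4.\<close>

lemma bounded_by_coprime:
  assumes kap: "\<And>p. 1 \<le> \<kappa> p"
    and mean: "\<And>X. 0 \<le> X \<Longrightarrow> (\<Sum>w\<in>upto_set X. prime_weight \<kappa> w ^ 4 / sqrt (real w)) \<le> K * sqrt X"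
  shows "bounded_by {} \<kappa> (sqrt K)"
  unfolding bounded_by_def
proof (intro allI impI)
  fix \<psi> \<theta> V W E
  assume adm: "admissible {} \<psi> \<theta> V W E"
  have V: "finite V" "finite W" "\<And>v. v \<in> V \<Longrightarrow> 0 < v" "\<And>v. v \<in> V \<Longrightarrow> 0 \<le> \<psi> v"
     "\<And>w. w \<in> W \<Longrightarrow> 0 < w" "\<And>w. w \<in> W \<Longrightarrow> 0 \<le> \<theta> w" "E \<subseteq> V \<times> W"
    using adm by (auto simp: admissible_def)
  define x where "x = (\<lambda>v. tot_ratio v * \<psi> v)"
  define y where "y = (\<lambda>w. tot_ratio w * \<theta> w)"
  define k where "k = prime_weight \<kappa>"
  have x0: "0 \<le> x v" if "v \<in> V" for v using V that by (simp add: x_def)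
  have y0: "0 \<le> y w" if "w \<in> W" for w using V that by (simp add: y_def)
  have k1: "1 \<le> k v" for v unfolding k_def prime_weight_def using kap by (intro prod_ge_1) auto
  have k0: "0 \<le> k v" for v using k1[of v] by simp
  have cop: "coprime v w" and e1: "real w * \<psi> v \<le> 1" and e2: "real v * \<theta> w \<le> 1" if "(v,w) \<in> E" for v w
  proof -
    have a: "real w * \<psi> v \<le> real (gcd v w)" "real v * \<theta> w \<le> real (gcd v w)"
      "\<And>p. prime p \<Longrightarrow> \<not> p dvd gcd v w" using adm that unfolding admissible_def by auto
    have g: "gcd v w = 1" using a(3) prime_factor_nat[of "gcd v w"] by blast
    show "coprime v w" using g by (simp only: coprime_iff_gcd_eq_1)
    show "real w * \<psi> v \<le> 1" "real v * \<theta> w \<le> 1" using a(1,2) unfolding g by simp_all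
  qed
  have xe: "real w * x v \<le> 1" "real v * y w \<le> 1" if "(v,w) \<in> E" for v w
  proof -
    have "v \<in> V" "w \<in> W" using that V by auto
    hence "x v \<le> \<psi> v" "y w \<le> \<theta> w"
      using V tot_ratio_le_1 by (auto simp: x_def y_def intro!: mult_left_le_one_le)
    hence "real w * x v \<le> real w * \<psi> v" "real v * y w \<le> real v * \<theta> w" by (auto intro: mult_left_mono)
    thus "real w * x v \<le> 1" "real v * y w \<le> 1" using e1[OF that] e2[OF that] by linarith+
  qed
  have finE: "finite E" using V finite_subset by blast
  have mass: "mass \<psi> V = sum x V" "mass \<theta> W = sum y W" by (simp_all add: mass_def x_def y_def)
  have XY: "0 \<le> sum x V" "0 \<le> sum y W" using x0 y0 by (auto intro: sum_nonneg)
  have K: "0 \<le> K"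
  proof -
    have "0 \<le> (\<Sum>w\<in>upto_set 1. k w ^ 4 / sqrt (real w))" using k0 by (intro sum_nonneg) auto
    also have "\<dots> \<le> K" using mean[of 1] by (simp add: k_def)
    finally show ?thesis .
  qed
  have edge: "edge_mass \<kappa> \<psi> \<theta> E = (\<Sum>(v,w)\<in>E. x v * y w * (k v * k w))"
    unfolding edge_mass_def
  proof (intro sum.cong refl, clarify)
    fix v w assume vw: "(v,w) \<in> E"
    hence "v > 0" "w > 0" using V by auto
    thus "tot_ratio v * \<psi> v * (tot_ratio w * \<theta> w) * pair_weight \<kappa> v w = x v * y w * (k v * k w)"
      using pair_weight_coprime[OF cop[OF vw]] by (simp add: x_def y_def k_def)
  qed
  have T2: "(\<Sum>(v,w)\<in>E. x v * y w * (k v * k w)\<^sup>2) \<le> K * sqrt (sum x V * sum y W)"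
  proof -
    \<comment> \<open>The factors \<open>v / w\<close> and \<open>w / v\<close> are inverse, so
      \<open>?f * ?g\<close> is the square of the summand, while each of them separately has the
      shape required by \<open>Schur_half\<close>.\<close>
    let ?f = "\<lambda>v w. x v * (sqrt (x v * y w * (real v / real w)) * k w ^ 4)"
    let ?g = "\<lambda>v w. y w * (sqrt (y w * x v * (real w / real v)) * k v ^ 4)"
    have "(\<Sum>(v,w)\<in>E. x v * y w * (k v * k w)\<^sup>2) = (\<Sum>e\<in>E. sqrt (case e of (v,w) \<Rightarrow> ?f v w) * sqrt (case e of (v,w) \<Rightarrow> ?g v w))"
    proof (intro sum.cong refl, clarify)
      fix v w assume vw: "(v,w) \<in> E"
      hence VW: "v \<in> V" "w \<in> W" using V by auto
      have p: "real v > 0" "real w > 0" "0 \<le> x v" "0 \<le> y w" using VW V x0 y0 by auto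
      have "sqrt (x v * y w * (real v / real w)) * sqrt (y w * x v * (real w / real v))
         = sqrt ((x v * y w) * (x v * y w))"
        unfolding real_sqrt_mult[symmetric] using p by (simp add: mult_ac)
      also have "\<dots> = x v * y w" using p by simp
      finally have *: "sqrt (x v * y w * (real v / real w)) * sqrt (y w * x v * (real w / real v)) = x v * y w" .
      have "?f v w * ?g v w = (x v * y w) * (sqrt (x v * y w * (real v / real w)) * sqrt (y w * x v * (real w / real v)))
         * (k w ^ 4 * k v ^ 4)" by (simp only: mult_ac)
      also have "\<dots> = (x v * y w * (k v * k w)\<^sup>2)\<^sup>2"
      proof -
        have "A * A * (d ^ 4 * c ^ 4) = (A * (c * d)\<^sup>2)\<^sup>2" for A c d :: real
          by (simp add: power_mult_distrib power2_eq_square eval_nat_numeral)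
        thus ?thesis unfolding * .
      qed
      finally have "sqrt (?f v w * ?g v w) = x v * y w * (k v * k w)\<^sup>2" using p by simp
      thus "x v * y w * (k v * k w)\<^sup>2 = sqrt (?f v w) * sqrt (?g v w)" by (simp only: real_sqrt_mult)
    qed
    also have "\<dots> \<le> sqrt (sum (\<lambda>(v,w). ?f v w) E) * sqrt (sum (\<lambda>(v,w). ?g v w) E)"
      using V x0 y0 k0 by (intro sum_mult_le_sqrt) (auto intro!: mult_nonneg_nonneg zero_le_power divide_nonneg_nonneg)
    finally have main: "(\<Sum>(v,w)\<in>E. x v * y w * (k v * k w)\<^sup>2)
      \<le> sqrt (sum (\<lambda>(v,w). ?f v w) E) * sqrt (sum (\<lambda>(v,w). ?g v w) E)" .
    have f1: "sum (\<lambda>(v,w). ?f v w) E \<le> K * sum x V"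
      by (rule Schur_half[OF V(7,1,2,3,5) x0 y0 _ xe]) (use k0 mean in \<open>auto simp: k_def\<close>)
    have g1: "sum (\<lambda>(v,w). ?g v w) E \<le> K * sum y W"
    proof -
      let ?g' = "\<lambda>(w,v). y w * (sqrt (y w * x v * (real w / real v)) * k v ^ 4)"
      have "sum (\<lambda>(v,w). ?g v w) E = sum ?g' (prod.swap ` E)"
        by (subst sum.reindex) (auto simp: case_prod_unfold)
      also have "\<dots> \<le> K * sum y W"
        by (rule Schur_half[of _ W V]) (use V x0 y0 k0 xe mean in \<open>auto simp: k_def\<close>)
      finally show ?thesis .
    qed
    have "0 \<le> sum (\<lambda>(v,w). ?g v w) E"
      using V x0 y0 k0 by (intro sum_nonneg) (auto intro!: mult_nonneg_nonneg zero_le_power divide_nonneg_nonneg)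
    hence "sqrt (sum (\<lambda>(v,w). ?f v w) E) * sqrt (sum (\<lambda>(v,w). ?g v w) E) \<le> sqrt (K * sum x V) * sqrt (K * sum y W)"
      using K XY by (intro mult_mono real_sqrt_le_mono f1 g1) auto
    also have "sqrt (K * sum x V) * sqrt (K * sum y W) = K * sqrt (sum x V * sum y W)"
      using K by (simp add: real_sqrt_mult mult_ac)
    finally show ?thesis using main by simp
  qed
  have T1: "(\<Sum>(v,w)\<in>E. x v * y w) \<le> sum x V * sum y W"
  proof -
    have "(\<Sum>(v,w)\<in>E. x v * y w) \<le> (\<Sum>(v,w)\<in>V\<times>W. x v * y w)"
      using V x0 y0 by (intro sum_mono2) auto
    also have "\<dots> = sum x V * sum y W" by (simp add: sum_product sum.cartesian_product)
    finally show ?thesis .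
  qed
  define Z where "Z = sum x V * sum y W"
  have Z: "0 \<le> Z" using XY by (simp add: Z_def)
  have "edge_mass \<kappa> \<psi> \<theta> E = (\<Sum>e\<in>E. sqrt (case e of (v,w) \<Rightarrow> x v * y w) *
      sqrt (case e of (v,w) \<Rightarrow> x v * y w * (k v * k w)\<^sup>2))"
    unfolding edge
  proof (intro sum.cong refl, clarify)
    fix v w assume vw: "(v,w) \<in> E"
    hence "v \<in> V" "w \<in> W" using V by auto
    hence p: "0 \<le> x v" "0 \<le> y w" "0 \<le> k v * k w" using x0 y0 k0 by auto
    have "sqrt (x v * y w) * sqrt (x v * y w * (k v * k w)\<^sup>2) = sqrt ((x v * y w * (k v * k w))\<^sup>2)"
      unfolding real_sqrt_mult[symmetric] by (simp add: power2_eq_square mult_ac)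
    also have "\<dots> = x v * y w * (k v * k w)" using p by simp
    finally show "x v * y w * (k v * k w) = sqrt (x v * y w) * sqrt (x v * y w * (k v * k w)\<^sup>2)" by simp
  qed
  also have "\<dots> \<le> sqrt (\<Sum>(v,w)\<in>E. x v * y w) * sqrt (\<Sum>(v,w)\<in>E. x v * y w * (k v * k w)\<^sup>2)"
    using V x0 y0 k0 by (intro sum_mult_le_sqrt) (auto intro!: mult_nonneg_nonneg)
  also have "\<dots> \<le> sqrt Z * sqrt (K * sqrt Z)"
  proof -
    have "0 \<le> (\<Sum>(v,w)\<in>E. x v * y w * (k v * k w)\<^sup>2)"
      using V(7) x0 y0 by (intro sum_nonneg) (auto intro!: mult_nonneg_nonneg)
    thus ?thesis using T1 T2 Z unfolding Z_def[symmetric]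
      by (intro mult_mono real_sqrt_le_mono) auto
  qed
  also have "\<dots> = sqrt K * Z powr (3/4)"
  proof -
    define z where "z = Z powr (1/4)"
    have z: "0 \<le> z" "sqrt Z = z\<^sup>2" "Z powr (3/4) = z ^ 3"
      using powr_quarter[OF Z] by (auto simp: z_def)
    have "sqrt (z\<^sup>2) = z" using z by simp
    thus ?thesis unfolding z real_sqrt_mult by (simp add: power2_eq_square power3_eq_cube)
  qed
  finally show "edge_mass \<kappa> \<psi> \<theta> E \<le> sqrt K * (mass \<psi> V * mass \<theta> W) powr (3/4)"
    by (simp add: mass Z_def)
qed

definition prime_factor_cost :: "nat \<Rightarrow> nat \<Rightarrow> real" where
  "prime_factor_cost t p = (if real p powr (-1/4) \<le> 1/100000
     then 1 + 1000000 * ((real p powr (-1/4)) ^ 5 + (real p powr (-1/4)) ^ 4 * (scale_weight t p - 1)) else 50)"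

lemma prime_factor_cost_ge_1: "1 \<le> prime_factor_cost t p"
  using scale_weight_ge_1[of t p] by (auto simp: prime_factor_cost_def)

lemma bounded_by_primes:
  assumes "finite A" "\<And>p. p \<in> A \<Longrightarrow> prime p" "t \<ge> 1"
  shows "bounded_by A (scale_weight t) (sqrt (2 * exp 320) * (\<Prod>p\<in>A. prime_factor_cost t p))"
  using assms(1,2)
proof (induction A rule: finite_induct)
  case empty
  show ?case
    using bounded_by_coprime[OF scale_weight_ge_1 prime_weight_mean[OF assms(3)]] by simp
next
  case (insert p A)
  have p: "prime p" using insert.prems by simp
  have pos: "0 < sqrt (2 * exp 320) * (\<Prod>p\<in>A. prime_factor_cost t p)"
    by (intro mult_pos_pos prod_pos) (use prime_factor_cost_ge_1[of t] in \<open>auto intro: less_le_trans[of 0 1]\<close>)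
  have sw: "0 \<le> scale_weight t q" for q using scale_weight_ge_1[of t q] by simp
  have "bounded_by (insert p A) (scale_weight t)
     (sqrt (2 * exp 320) * (\<Prod>p\<in>A. prime_factor_cost t p) * prime_factor_cost t p)"
    unfolding prime_factor_cost_def
    by (rule bounded_by_prime[OF insert.IH[unfolded prime_factor_cost_def] pos[unfolded prime_factor_cost_def] p sw scale_weight_ge_1])
      (use insert.prems scale_weight_le(2)[OF assms(3) prime_gt_0_nat[OF p]] in auto)
  thus ?case using insert.hyps by (simp add: mult_ac)
qed

text \<open>The product of the costs converges: the primes with \<open>p powr (-1/4)\<close> above
  1/100000 contribute finitely many factors 50, and the others are at most \<open>exp\<close> of a
  term summable over all primes, uniformly in \<open>t\<close>.\<close>

theorem weighted_overlap_bound: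
  obtains K where "K > 0" "\<And>t. t \<ge> 1 \<Longrightarrow> bounded_by UNIV (scale_weight t) K"
proof
  define B where "B = {n::nat. 1/100000 < real n powr (-1/4)}"
  define C where "C = 50 ^ card B * exp (1000000 * ((\<Sum>n. real n powr (-5/4)) + 4))"
  show "sqrt (2 * exp 320) * C > 0" by (simp add: C_def)
  have finB: "finite B"
  proof (rule finite_subset)
    show "B \<subseteq> {..100000 ^ 4}"
    proof
      fix n assume n: "n \<in> B"
      have n0: "n > 0" using n by (cases n) (auto simp: B_def)
      have e: "real n powr (-1/4) = 1 / real n powr (1/4)" using powr_minus_divide[of "real n" "1/4"] by simp
      define u where "u = real n powr (1/4)"
      have "1/100000 < real n powr (-1/4)" using n by (simp only: B_def mem_Collect_eq)
      hence "1/100000 < 1 / u" unfolding e u_def .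
      hence "u < 100000" using n0 by (simp add: u_def field_simps)
      hence "real n powr (1/4) < 100000" by (simp only: u_def)
      hence "(real n powr (1/4)) ^ 4 \<le> 100000 ^ 4" by (intro power_mono) auto
      hence "real n \<le> 100000 ^ 4" using powr_quarter(1)[of "real n"] by simp
      thus "n \<in> {..100000 ^ 4}" by simp
    qed
  qed simp
  have summ: "summable (\<lambda>n. real n powr (-5/4))" by (simp add: summable_real_powr_iff)
  fix t :: nat assume t: "t \<ge> 1"
  show "bounded_by UNIV (scale_weight t) (sqrt (2 * exp 320) * C)"
    unfolding bounded_by_def
  proof (intro allI impI)
    fix \<psi> \<theta> V W E assume adm: "admissible UNIV \<psi> \<theta> V W E"
    \<comment> \<open>A finite graph sees only finitely many primes: those dividing a gcd are at
      most the largest vertex. The constant does not depend on this set.\<close>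
    define A where "A = {p. prime p \<and> p \<le> Max (insert 0 V)}"
    have finA: "finite A" by (simp add: A_def)
    have V: "finite V" "\<And>v. v \<in> V \<Longrightarrow> 0 < v" "E \<subseteq> V \<times> W" using adm by (auto simp: admissible_def)
    have "q \<in> A" if "(v,w) \<in> E" "prime q" "q dvd gcd v w" for v w q
    proof -
      have "v \<in> V" using that V by auto
      hence "q \<le> v" "v \<le> Max (insert 0 V)" using that V dvd_imp_le[of q v] by auto
      thus ?thesis using that by (simp add: A_def)
    qed
    hence "admissible A \<psi> \<theta> V W E" using adm unfolding admissible_def by fastforce
    hence "edge_mass (scale_weight t) \<psi> \<theta> E \<le> sqrt (2 * exp 320) * (\<Prod>p\<in>A. prime_factor_cost t p)
        * (mass \<psi> V * mass \<theta> W) powr (3/4)"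
      using bounded_by_primes[OF finA _ t] unfolding bounded_by_def A_def by blast
    also have "(\<Prod>p\<in>A. prime_factor_cost t p) \<le> C"
    proof -
      define a where "a = (\<lambda>p::nat. 1000000 * (real p powr (-5/4) + (if p \<ge> t then 2 * (real t / (real p)\<^sup>2) else 0)))"
      have a0: "0 \<le> a p" for p by (simp add: a_def)
      have "prime_factor_cost t p \<le> (if p \<in> B then 50 else 1) * exp (a p)" if "p \<in> A" for p
      proof (cases "p \<in> B")
        case True
        have "50 * 1 \<le> 50 * exp (a p)" using a0[of p] by (intro mult_left_mono) auto
        thus ?thesis using True by (auto simp: prime_factor_cost_def B_def)
      next
        case False
        have p: "p > 0" using that by (auto simp: A_def prime_gt_0_nat)
        have r5: "(real p powr (-1/4)) ^ 5 = real p powr (-5/4)" using p by (simp add: powr_power)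
        have r4: "(real p powr (-1/4)) ^ 4 = 1 / real p"
        proof -
          have "(real p powr (-1/4)) ^ 4 = real p powr ((-1/4) * real 4)" using p by (subst powr_power) auto
          also have "(-1/4) * real 4 = -1" by simp
          also have "real p powr (-1) = 1 / real p" using p by (simp add: powr_neg_one)
          finally show ?thesis .
        qed
        have "1 / real p * (scale_weight t p - 1) \<le> 1 / real p * (if p \<ge> t then 2 * (real t / real p) else 0)"
          using scale_weight_le(1)[OF t p] by (intro mult_left_mono) auto
        also have "\<dots> = (if p \<ge> t then 2 * (real t / (real p)\<^sup>2) else 0)" by (simp add: power2_eq_square)
        finally have q: "1 / real p * (scale_weight t p - 1) \<le> (if p \<ge> t then 2 * (real t / (real p)\<^sup>2) else 0)" .
        have "1 + 1000000 * ((real p powr (-1/4)) ^ 5 + (real p powr (-1/4)) ^ 4 * (scale_weight t p - 1)) \<le> 1 + a p"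
          unfolding r5 r4 a_def by (intro add_left_mono mult_left_mono q) simp
        also have "\<dots> \<le> exp (a p)" by (rule exp_ge_add_one_self)
        finally show ?thesis using False by (auto simp: prime_factor_cost_def B_def)
      qed
      hence "(\<Prod>p\<in>A. prime_factor_cost t p) \<le> (\<Prod>p\<in>A. (if p \<in> B then 50 else 1) * exp (a p))"
        using prime_factor_cost_ge_1[of t] by (intro prod_mono) (auto intro: order_trans[of 0 1])
      also have "\<dots> = (\<Prod>p\<in>A. if p \<in> B then 50 else 1) * exp (\<Sum>p\<in>A. a p)"
        using finA by (simp add: prod.distrib exp_sum)
      also have "(\<Prod>p\<in>A. if p \<in> B then 50 else 1) = (50::real) ^ card (A \<inter> B)"
        using finA by (simp add: prod.If_cases)
      also have "\<dots> \<le> 50 ^ card B" using finB by (intro power_increasing card_mono) auto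
      also have "(\<Sum>p\<in>A. a p) \<le> 1000000 * ((\<Sum>n. real n powr (-5/4)) + 4)"
      proof -
        have "(\<Sum>p\<in>A. real p powr (-5/4)) \<le> (\<Sum>n. real n powr (-5/4))"
          using summ finA by (intro sum_le_suminf) auto
        moreover have "(\<Sum>p\<in>A. if p \<ge> t then 2 * (real t / (real p)\<^sup>2) else 0) \<le> 4"
        proof -
          have "(\<Sum>p\<in>A. if p \<ge> t then 2 * (real t / (real p)\<^sup>2) else 0) = 2 * (\<Sum>p\<in>{p\<in>A. p \<ge> t}. real t / (real p)\<^sup>2)"
            using finA by (auto simp: sum_distrib_left sum.inter_filter intro!: sum.cong)
          also have "\<dots> \<le> 2 * 2" using finA t by (intro mult_left_mono sum_inverse_squares_le) auto
          finally show ?thesis by simp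
        qed
        moreover have "(\<Sum>p\<in>A. a p) = 1000000 * ((\<Sum>p\<in>A. real p powr (-5/4)) +
            (\<Sum>p\<in>A. if p \<ge> t then 2 * (real t / (real p)\<^sup>2) else 0))"
          by (simp only: a_def sum_distrib_left[symmetric] sum.distrib)
        ultimately show ?thesis by simp
      qed
      finally show ?thesis by (simp add: C_def mult_left_mono)
    qed
    finally show "edge_mass (scale_weight t) \<psi> \<theta> E \<le> sqrt (2 * exp 320) * C * (mass \<psi> V * mass \<theta> W) powr (3/4)"
      by (simp add: mult_left_mono mult_right_mono)
  qed
qed

section \<open>Summation over dyadic ranges of the overlap scale\<close>

text \<open>The scale in the overlap estimate of Pollington and Vaughan: two intervals with
  denominators \<open>m\<close> and \<open>n\<close> can meet only if \<open>a * n - b * m\<close>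
  is less than \<open>2 * overlap_scale \<psi> m n\<close> in absolute value, in units of the
  gcd.\<close>

definition overlap_scale :: "(nat \<Rightarrow> real) \<Rightarrow> nat \<Rightarrow> nat \<Rightarrow> real" where
  "overlap_scale \<psi> m n = max (real m * \<psi> n) (real n * \<psi> m) / real (gcd m n)"

definition large_prime_sum :: "(nat \<Rightarrow> real) \<Rightarrow> nat \<Rightarrow> nat \<Rightarrow> real" where
  "large_prime_sum \<psi> m n = (\<Sum>p | p \<in> diff_primes m n \<and> overlap_scale \<psi> m n < real p. 1 / real p)"

lemma powr_square_three_quarters:
  fixes x :: real assumes "0 \<le> x" shows "(x * x) powr (3/4) = x * sqrt x"
proof -
  define w where "w = x powr (1/4)"
  have w: "w ^ 4 = x" "x powr (3/4) = w ^ 3" "sqrt x = w\<^sup>2" using powr_quarter[OF assms] by (auto simp: w_def)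
  have "(x * x) powr (3/4) = x powr (3/4) * x powr (3/4)" by (rule powr_mult)
  also have "\<dots> = w ^ 4 * w\<^sup>2" unfolding w(2) by (simp flip: power_add)
  finally show ?thesis using w by simp
qed

lemma exp_le_pair_weight:
  assumes "0 < m" "0 < n" and t: "\<And>p. prime p \<Longrightarrow> d < real p \<Longrightarrow> t \<le> p"
  shows "exp (real t * (\<Sum>p | p \<in> diff_primes m n \<and> d < real p. 1 / real p)) \<le> pair_weight (scale_weight t) m n"
proof -
  have fin: "finite (diff_primes m n)" using assms by (intro finite_diff_primes)
  define L where "L = {p. p \<in> diff_primes m n \<and> d < real p}"
  have "exp (real t * (\<Sum>p\<in>L. 1 / real p)) = (\<Prod>p\<in>L. exp (real t / real p))"
    using fin by (simp add: exp_sum sum_distrib_left L_def)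
  also have "\<dots> = (\<Prod>p\<in>L. scale_weight t p)"
    using t by (intro prod.cong) (auto simp: scale_weight_def L_def diff_primes_def)
  also have "\<dots> \<le> (\<Prod>p\<in>diff_primes m n. scale_weight t p)"
    using fin scale_weight_ge_1[of t] by (intro prod_mono2) (auto simp: L_def intro: order_trans[of 0 1])
  finally show ?thesis by (simp add: pair_weight_def L_def)
qed

text \<open>Pairs with large-prime sum at most 1 cost only \<open>exp 1\<close>. For the others on
  level \<open>j\<close>, rescaling by \<open>X = 2 ^ j\<close> costs \<open>sqrt X\<close>, and the
  surplus in the tilted weight gains a factor exponential in \<open>2 ^ j\<close>, so the levels sum
  to a constant.\<close>

theorem weighted_pair_sum_bound:
  obtains K where "K > 0" "\<And>S \<psi>. finite S \<Longrightarrow> (\<And>n. n \<in> S \<Longrightarrow> 0 < n \<and> 0 \<le> \<psi> n) \<Longrightarrow> 1 \<le> mass \<psi> S \<Longrightarrow>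
     (\<Sum>(m,n)\<in>S\<times>S. (tot_ratio m * \<psi> m) * (tot_ratio n * \<psi> n) * exp (large_prime_sum \<psi> m n)) \<le> K * (mass \<psi> S)\<^sup>2"
proof -
  obtain K where K: "K > 0" "\<And>t. t \<ge> 1 \<Longrightarrow> bounded_by UNIV (scale_weight t) K"
    using weighted_overlap_bound by blast
  define G where "G = 1 / (1 - exp (- (1/2::real)))"
  have G: "G > 0" by (simp add: G_def)
  define K' where "K' = exp 1 + K * (4 * exp 1 * G)"
  have K'0: "K' > 0" using K G by (simp add: K'_def add_pos_pos)
  have "(\<Sum>(m,n)\<in>S\<times>S. (tot_ratio m * \<psi> m) * (tot_ratio n * \<psi> n) * exp (large_prime_sum \<psi> m n)) \<le> K' * (mass \<psi> S)\<^sup>2"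
    if S: "finite S" "\<And>n. n \<in> S \<Longrightarrow> 0 < n \<and> 0 \<le> \<psi> n" and M1: "1 \<le> mass \<psi> S" for S \<psi>
  proof -
    define M where "M = mass \<psi> S"
    define \<mu> where "\<mu> = (\<lambda>n. tot_ratio n * \<psi> n)"
    have mu0: "0 \<le> \<mu> n" if "n \<in> S" for n using S(2)[OF that] by (simp add: \<mu>_def)
    define D where "D = overlap_scale \<psi>"
    define J where "J = large_prime_sum \<psi>"
    define F where "F = (\<lambda>(m,n). \<mu> m * \<mu> n * exp (J m n))"
    have F0: "0 \<le> F x" if "x \<in> S \<times> S" for x using that mu0 by (auto simp: F_def)
    define lev where "lev = (\<lambda>(m,n). LEAST j. D m n \<le> 2 ^ j)"
    have lev: "D m n \<le> 2 ^ lev (m,n)" for m n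
    proof -
      obtain j where "D m n < 2 ^ j" using real_arch_pow[of 2 "D m n"] by auto
      hence "D m n \<le> 2 ^ j" by simp
      thus ?thesis unfolding lev_def prod.case by (rule LeastI[of "\<lambda>j. D m n \<le> 2 ^ j"])
    qed
    have lev': "2 ^ j < D m n" if "j < lev (m,n)" for j m n
      using not_less_Least[of j "\<lambda>j. D m n \<le> 2 ^ j"] that by (simp add: lev_def)
    define T1 where "T1 = {(m,n)\<in>S\<times>S. J m n \<le> 1}"
    define T2 where "T2 = {(m,n)\<in>S\<times>S. 1 < J m n}"
    have finT: "finite T1" "finite T2"
      using S(1) by (auto simp: T1_def T2_def intro!: finite_subset[OF _ finite_cartesian_product[OF S(1) S(1)]])
    define N where "N = Max (insert 0 (lev ` T2))"
    have sumT1: "sum F T1 \<le> exp 1 * M\<^sup>2"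
    proof -
      have "sum F T1 \<le> (\<Sum>(m,n)\<in>T1. exp 1 * (\<mu> m * \<mu> n))"
      proof (intro sum_mono, clarify)
        fix m n assume "(m,n) \<in> T1"
        hence "J m n \<le> 1" "0 \<le> \<mu> m * \<mu> n" using mu0 by (auto simp: T1_def)
        thus "F (m,n) \<le> exp 1 * (\<mu> m * \<mu> n)" by (simp add: F_def mult.commute mult_right_mono)
      qed
      also have "\<dots> \<le> (\<Sum>(m,n)\<in>S\<times>S. exp 1 * (\<mu> m * \<mu> n))"
        using S mu0 by (intro sum_mono2) (auto simp: T1_def)
      also have "\<dots> = exp 1 * M\<^sup>2"
      proof -
        have "(\<Sum>(m,n)\<in>S\<times>S. exp 1 * (\<mu> m * \<mu> n)) = exp 1 * (\<Sum>(m,n)\<in>S\<times>S. \<mu> m * \<mu> n)"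
          by (simp add: sum_distrib_left case_prod_unfold)
        moreover have "(\<Sum>(m,n)\<in>S\<times>S. \<mu> m * \<mu> n) = sum \<mu> S * sum \<mu> S"
          by (simp add: sum_product sum.cartesian_product)
        moreover have "M = sum \<mu> S" by (simp add: M_def mass_def \<mu>_def)
        ultimately show ?thesis by (simp add: power2_eq_square)
      qed
      finally show ?thesis .
    qed
    have level: "sum F {x\<in>T2. lev x = j} \<le> K * M\<^sup>2 * (4 * exp 1 * exp (- (1/2)) ^ j)" for j
    proof -
      define Tj where "Tj = {x\<in>T2. lev x = j}"
      \<comment> \<open>For \<open>j \<ge> 1\<close> minimality of the level gives
        \<open>D > 2 ^ (j - 1)\<close>, so every prime above \<open>D\<close> exceeds
        \<open>t\<close>. For \<open>j = 0\<close> truncated subtraction gives \<open>t = 1\<close>,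
        below every prime.\<close>
      define t where "t = (2::nat) ^ (j - 1)"
      define X where "X = (2::real) ^ j"
      have t1: "t \<ge> 1" by (simp add: t_def)
      have X: "X \<ge> 1" "X \<le> 2 * real t" by (auto simp: X_def t_def power_Suc[symmetric] simp del: power_Suc intro!: power_increasing)
      have TS: "Tj \<subseteq> S \<times> S" by (auto simp: Tj_def T2_def)
      \<comment> \<open>Dividing \<open>\<psi>\<close> by \<open>X\<close> turns the condition that
        the overlap scale is at most \<open>X\<close> into the edge condition.\<close>
      have adm: "admissible UNIV (\<lambda>n. \<psi> n / X) (\<lambda>n. \<psi> n / X) S S Tj"
      proof -
        have "real n * (\<psi> m / X) \<le> real (gcd m n) \<and> real m * (\<psi> n / X) \<le> real (gcd m n)" if mn: "(m,n) \<in> Tj" for m n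
        proof -
          have "D m n \<le> X" using lev[of m n] mn by (simp add: Tj_def X_def)
          moreover have "real (gcd m n) > 0" using mn TS S(2) by force
          ultimately have "max (real m * \<psi> n) (real n * \<psi> m) \<le> X * real (gcd m n)"
            by (simp add: D_def overlap_scale_def pos_divide_le_eq)
          thus ?thesis using X(1) by (simp add: pos_divide_le_eq mult.commute)
        qed
        thus ?thesis unfolding admissible_def using S X TS by (auto intro!: divide_nonneg_nonneg)
      qed
      have "edge_mass (scale_weight t) (\<lambda>n. \<psi> n / X) (\<lambda>n. \<psi> n / X) Tj
         \<le> K * (mass (\<lambda>n. \<psi> n / X) S * mass (\<lambda>n. \<psi> n / X) S) powr (3/4)"
        using K(2)[OF t1] adm unfolding bounded_by_def by blast
      also have "mass (\<lambda>n. \<psi> n / X) S = M / X" by (simp add: mass_def M_def sum_divide_distrib)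
      also have "(M / X * (M / X)) powr (3/4) = M / X * sqrt (M / X)"
        using M1 X by (intro powr_square_three_quarters) (auto simp: M_def)
      finally have E: "edge_mass (scale_weight t) (\<lambda>n. \<psi> n / X) (\<lambda>n. \<psi> n / X) Tj \<le> K * (M / X * sqrt (M / X))" .
      have "sum F Tj \<le> (\<Sum>(m,n)\<in>Tj. exp (1 - real t) * X\<^sup>2 * ((tot_ratio m * (\<psi> m / X)) * (tot_ratio n * (\<psi> n / X)) * pair_weight (scale_weight t) m n))"
      proof (intro sum_mono, clarify)
        fix m n assume mn: "(m,n) \<in> Tj"
        hence pos: "0 < m" "0 < n" "m \<in> S" "n \<in> S" using TS S(2) by auto
        have J1: "1 < J m n" using mn by (simp add: Tj_def T2_def)
        have tp: "t \<le> p" if "prime p" "D m n < real p" for p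
        proof (cases "j = 0")
          case True
          thus ?thesis using prime_ge_1_nat[OF that(1)] by (simp add: t_def)
        next
          case False
          hence "2 ^ (j - 1) < D m n" using lev'[of "j - 1" m n] mn by (simp add: Tj_def)
          moreover have "2 ^ (j - 1) = real t" by (simp add: t_def)
          ultimately have "real t < real p" using that(2) by linarith
          thus ?thesis by simp
        qed
        \<comment> \<open>Here \<open>J > 1\<close> enters: it lets the plain inflation be traded
          for the tilted one at the price \<open>exp (1 - t)\<close>.\<close>
        have "J m n \<le> (1 - real t) + real t * J m n"
        proof -
          have "0 \<le> (real t - 1) * (J m n - 1)" using t1 J1 by (intro mult_nonneg_nonneg) auto
          thus ?thesis by (simp add: algebra_simps)
        qed
        hence "exp (J m n) \<le> exp (1 - real t) * exp (real t * J m n)" by (simp add: exp_add[symmetric])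
        also have "exp (real t * J m n) \<le> pair_weight (scale_weight t) m n"
          unfolding J_def large_prime_sum_def D_def[symmetric] using pos tp by (intro exp_le_pair_weight) auto
        finally have "exp (J m n) \<le> exp (1 - real t) * pair_weight (scale_weight t) m n" by simp
        hence "\<mu> m * \<mu> n * exp (J m n) \<le> \<mu> m * \<mu> n * (exp (1 - real t) * pair_weight (scale_weight t) m n)"
          using mu0 pos by (intro mult_left_mono) auto
        also have "\<dots> = exp (1 - real t) * X\<^sup>2 * ((tot_ratio m * (\<psi> m / X)) * (tot_ratio n * (\<psi> n / X)) * pair_weight (scale_weight t) m n)"
          using X by (simp add: \<mu>_def power2_eq_square)
        finally show "F (m,n) \<le> exp (1 - real t) * X\<^sup>2 * ((tot_ratio m * (\<psi> m / X)) * (tot_ratio n * (\<psi> n / X)) * pair_weight (scale_weight t) m n)"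
          by (simp add: F_def)
      qed
      also have "\<dots> = exp (1 - real t) * X\<^sup>2 * edge_mass (scale_weight t) (\<lambda>n. \<psi> n / X) (\<lambda>n. \<psi> n / X) Tj"
        by (simp add: edge_mass_def sum_distrib_left case_prod_unfold)
      also have "\<dots> \<le> exp (1 - real t) * X\<^sup>2 * (K * (M / X * sqrt (M / X)))"
        using E by (intro mult_left_mono) auto
      \<comment> \<open>The square of \<open>X\<close> undoes the rescaling of the two functions,
        against the power 3/2 inside the bound; the net loss is \<open>sqrt X\<close>.\<close>
      also have "\<dots> = exp (1 - real t) * (K * (M * sqrt M * sqrt X))"
      proof -
        have "X * sqrt (M / X) = sqrt M * sqrt X"
          using X by (simp add: real_sqrt_divide field_simps)
        hence e: "X\<^sup>2 * (M / X * sqrt (M / X)) = M * (sqrt M * sqrt X)"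
          using X by (simp add: power2_eq_square mult_ac)
        have "exp (1 - real t) * X\<^sup>2 * (K * (M / X * sqrt (M / X)))
            = exp (1 - real t) * (K * (X\<^sup>2 * (M / X * sqrt (M / X))))" by (simp only: mult_ac)
        also have "\<dots> = exp (1 - real t) * (K * (M * sqrt M * sqrt X))" unfolding e by (simp only: mult_ac)
        finally show ?thesis .
      qed
      also have "\<dots> \<le> exp (1 - real t) * (K * (M * M * (4 * exp (real t / 2))))"
      proof (intro mult_left_mono mult_mono)
        \<comment> \<open>The bound has order \<open>M powr (3/2)\<close>; a total mass of at least
          1 turns it into the square that the second moment method can use.\<close>
        show "sqrt M \<le> M" using M1 real_sqrt_le_mono[of M "M * M"] by (simp add: M_def)
        have "sqrt X \<le> X" using X real_sqrt_le_mono[of X "X * X"] by simp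
        also have "X \<le> 4 * (1 + real t / 2)" using X by simp
        also have "\<dots> \<le> 4 * exp (real t / 2)" by (intro mult_left_mono exp_ge_add_one_self) auto
        finally show "sqrt X \<le> 4 * exp (real t / 2)" .
      qed (use M1 K X in \<open>auto simp: M_def\<close>)
      also have "\<dots> = K * M\<^sup>2 * (4 * (exp (1 - real t) * exp (real t / 2)))"
        by (simp add: power2_eq_square)
      also have "exp (1 - real t) * exp (real t / 2) = exp 1 * exp (- (real t / 2))"
        by (simp add: exp_add[symmetric])
      also have "K * M\<^sup>2 * (4 * (exp 1 * exp (- (real t / 2)))) \<le> K * M\<^sup>2 * (4 * (exp 1 * exp (- (1/2)) ^ j))"
      proof -
        have "j \<le> t"
        proof (cases j)
          case (Suc i)
          moreover have "i < 2 ^ i" by (rule less_exp)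
          ultimately show ?thesis by (simp add: t_def Suc_le_eq)
        qed simp
        hence "exp (- (real t / 2)) \<le> exp (real j * (- (1/2)))" by simp
        also have "\<dots> = exp (- (1/2)) ^ j" by (rule exp_of_nat_mult)
        finally show ?thesis using K by (intro mult_left_mono) auto
      qed
      finally show ?thesis by (simp add: Tj_def mult_ac)
    qed
    have "sum F T2 = (\<Sum>j\<le>N. sum F {x\<in>T2. lev x = j})"
    proof (rule sum.group[symmetric])
      show "lev ` T2 \<subseteq> {..N}" using finT by (auto simp: N_def)
    qed (use finT in auto)
    also have "\<dots> \<le> (\<Sum>j\<le>N. K * M\<^sup>2 * (4 * exp 1 * exp (- (1/2)) ^ j))" by (intro sum_mono level)
    also have "\<dots> = K * M\<^sup>2 * (4 * exp 1 * (\<Sum>j\<le>N. exp (- (1/2)) ^ j))" by (simp add: sum_distrib_left)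
    also have "\<dots> \<le> K * M\<^sup>2 * (4 * exp 1 * G)"
    proof (intro mult_left_mono)
      have "(\<Sum>j<Suc N. exp (- (1/2::real)) ^ j) = (1 - exp (- (1/2)) ^ Suc N) / (1 - exp (- (1/2)))"
        by (subst sum_gp_strict) auto
      also have "\<dots> \<le> G" unfolding G_def by (intro divide_right_mono) auto
      finally show "(\<Sum>j\<le>N. exp (- (1/2::real)) ^ j) \<le> G" by (simp add: lessThan_Suc_atMost)
    qed (use K in auto)
    finally have sumT2: "sum F T2 \<le> K * M\<^sup>2 * (4 * exp 1 * G)" .
    have "sum F (S \<times> S) \<le> exp 1 * M\<^sup>2 + K * M\<^sup>2 * (4 * exp 1 * G)"
      by (rule sum_le_sum_Un[OF finT _ _ sumT1 sumT2]) (use F0 in \<open>auto simp: T1_def T2_def\<close>)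
    also have "\<dots> = K' * M\<^sup>2" by (simp add: K'_def algebra_simps)
    finally show ?thesis by (simp add: F_def \<mu>_def J_def M_def case_prod_unfold)
  qed
  thus ?thesis using that K'0 by blast
qed

subsection \<open>Chebyshev and Mertens bounds\<close>

lemma prod_primes_dvd:
  fixes n :: nat
  assumes "finite S" "\<And>p. p \<in> S \<Longrightarrow> prime p \<and> p dvd n"
  shows "\<Prod>S dvd n"
  using assms
proof (induction S rule: finite_induct)
  case (insert p S)
  have "coprime p (\<Prod>S)"
    using insert by (intro prod_coprime_right) (auto intro!: primes_coprime)
  thus ?case using insert by (auto intro!: divides_mult)
qed simp

definition prime_theta :: "nat \<Rightarrow> real" where
  "prime_theta N = (\<Sum>p | prime p \<and> p \<le> N. ln (real p))"

lemma ln_prime_nonneg: "prime (p::nat) \<Longrightarrow> 0 \<le> ln (real p)"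
  using prime_ge_1_nat[of p] by (intro ln_ge_zero) auto

lemma finite_primes_le [simp]: "finite {p::nat. prime p \<and> p \<le> N}"
  by (rule finite_subset[of _ "{..N}"]) auto

text \<open>All primes in \<open>{m<..2*m}\<close> divide the central binomial coefficient, which is
  at most \<open>2 ^ (2 * m)\<close>.\<close>

lemma prime_theta_double: "prime_theta (2 * m) \<le> prime_theta m + real (2 * m) * ln 2"
proof -
  define S where "S = {p::nat. prime p \<and> m < p \<and> p \<le> 2 * m}"
  have fin: "finite S" by (rule finite_subset[of _ "{..2*m}"]) (auto simp: S_def)
  have "p dvd (2 * m choose m)" if "p \<in> S" for p
  proof -
    have p: "prime p" "m < p" "p \<le> 2 * m" using that by (auto simp: S_def)
    have "fact m * fact (2 * m - m) * (2 * m choose m) = (fact (2 * m) :: nat)"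
      by (intro binomial_fact_lemma) auto
    moreover have "p dvd (fact (2 * m) :: nat)" using p by (simp add: prime_dvd_fact_iff)
    ultimately have "p dvd (fact m * fact (2 * m - m) * (2 * m choose m) :: nat)" by simp
    moreover have "2 * m - m = m" by simp
    moreover have "\<not> p dvd (fact m :: nat)" using p by (simp add: prime_dvd_fact_iff)
    ultimately show ?thesis using p(1) by (metis prime_dvd_mult_iff)
  qed
  hence "\<Prod>S dvd (2 * m choose m)" using fin by (intro prod_primes_dvd) (auto simp: S_def)
  hence "\<Prod>S \<le> (2 * m choose m)" by (rule dvd_imp_le) simp
  also have "\<dots> \<le> 2 ^ (2 * m)" by (rule binomial_le_pow2)
  finally have "real (\<Prod>S) \<le> real (2 ^ (2 * m))" by (simp only: of_nat_le_iff)
  hence "real (\<Prod>S) \<le> 2 ^ (2 * m)" by (simp only: of_nat_power of_nat_numeral)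
  moreover have pos: "0 < p" if "p \<in> S" for p using that by (auto simp: S_def prime_gt_0_nat)
  hence "0 < real (\<Prod>S)" using fin by (auto intro!: prod_pos)
  ultimately have "ln (real (\<Prod>S)) \<le> ln (2 ^ (2 * m))" by simp
  also have "\<dots> = real (2 * m) * ln 2" by (rule ln_realpow)
  also have "ln (real (\<Prod>S)) = (\<Sum>p\<in>S. ln (real p))"
    using fin pos by (simp add: ln_prod)
  finally have "(\<Sum>p\<in>S. ln (real p)) \<le> real (2 * m) * ln 2" .
  moreover have "prime_theta (2 * m) = prime_theta m + (\<Sum>p\<in>S. ln (real p))"
  proof -
    have "{p::nat. prime p \<and> p \<le> 2 * m} = {p. prime p \<and> p \<le> m} \<union> S" by (auto simp: S_def)
    thus ?thesis unfolding prime_theta_def using fin by (simp add: sum.union_disjoint S_def disjoint_iff)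
  qed
  ultimately show ?thesis by simp
qed

lemma prime_theta_mono: "m \<le> n \<Longrightarrow> prime_theta m \<le> prime_theta n"
  unfolding prime_theta_def by (intro sum_mono2) (auto simp: ln_prime_nonneg)

lemma prime_theta_le: "prime_theta n \<le> 3 * real n"
proof (induction n rule: less_induct)
  case (less n)
  consider "n < 2" | "n = 2" | "n \<ge> 3" by linarith
  thus ?case
  proof cases
    case 1
    have "\<not> prime p" if "p \<le> n" for p :: nat using that 1 prime_ge_2_nat[of p] by auto
    hence e: "{p::nat. prime p \<and> p \<le> n} = {}" by auto
    have "prime_theta n = 0" by (simp only: prime_theta_def e sum.empty)
    thus ?thesis by simp
  next
    case 2
    have "{p::nat. prime p \<and> p \<le> 2} = {2}" by (auto dest: prime_ge_2_nat)
    thus ?thesis using 2 ln2_le_25_over_36 by (simp add: prime_theta_def)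
  next
    case 3
    define m where "m = (n + 1) div 2"
    have m: "m < n" "n \<le> 2 * m" "2 * m \<le> n + 1" using 3 by (auto simp: m_def)
    have "prime_theta n \<le> prime_theta (2 * m)" by (rule prime_theta_mono) fact
    also have "\<dots> \<le> prime_theta m + real (2 * m) * ln 2" by (rule prime_theta_double)
    also have "\<dots> \<le> 3 * real m + real (2 * m) * (25/36)"
      using less.IH[OF m(1)] ln2_le_25_over_36 by (intro add_mono mult_left_mono) auto
    \<comment> \<open>158/72 = 3/2 + 25/36, and \<open>158/72 * (n + 1) \<le> 3 * n\<close> holds
      exactly from \<open>n = 3\<close> on, which fixes the base cases.\<close>
    also have "\<dots> = (158/72) * real (2 * m)" by simp
    also have "\<dots> \<le> (158/72) * (real n + 1)" 
    proof (rule mult_left_mono)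
      have "real (2 * m) \<le> real (n + 1)" using m(3) by (simp only: of_nat_le_iff)
      thus "real (2 * m) \<le> real n + 1" by simp
    qed simp
    also have "\<dots> \<le> 3 * real n" using 3 by simp
    finally show ?thesis .
  qed
qed

text \<open>Index set of Chebyshev's psi function. Pairs rather than their values
  \<open>p ^ j\<close> keep the prime, hence the von Mangoldt weight \<open>ln p\<close>,
  readable.\<close>

definition prime_powers_le :: "real \<Rightarrow> (nat \<times> nat) set" where
  "prime_powers_le Y = {(p,j). prime p \<and> 1 \<le> j \<and> real (p ^ j) \<le> Y}"

lemma finite_prime_powers_le [simp]: "finite (prime_powers_le Y)"
proof (rule finite_subset)
  show "prime_powers_le Y \<subseteq> {..nat \<lfloor>Y\<rfloor>} \<times> {..nat \<lfloor>Y\<rfloor>}"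
  proof clarify
    fix p j assume "(p,j) \<in> prime_powers_le Y"
    hence pj: "prime p" "1 \<le> j" "real (p ^ j) \<le> Y" by (auto simp: prime_powers_le_def)
    have "p ^ j \<le> nat \<lfloor>Y\<rfloor>" using pj(3) by (rule le_nat_floor)
    moreover have "p \<le> p ^ j" using pj prime_ge_1_nat[of p] by (intro self_le_power) auto
    moreover have "j < p ^ j" by (rule power_gt_expt) (use prime_gt_1_nat[OF pj(1)] in simp)
    ultimately show "p \<in> {..nat \<lfloor>Y\<rfloor>} \<and> j \<in> {..nat \<lfloor>Y\<rfloor>}" by auto
  qed
qed simp

lemma ln_le_2_sqrt: "0 < Y \<Longrightarrow> ln Y \<le> 2 * sqrt Y"
  using ln_le_minus_one[of "sqrt Y"] by (simp add: ln_sqrt)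

text \<open>Proper powers occur only for \<open>p \<le> sqrt Y\<close>, and each such prime
  contributes at most \<open>ln Y \<le> 2 * sqrt Y\<close> in all: 2 is added to Chebyshev's
  constant 3.\<close>

lemma sum_prime_powers_le:
  assumes Y: "1 \<le> Y"
  shows "(\<Sum>(p,j)\<in>prime_powers_le Y. ln (real p)) \<le> 5 * Y"
proof -
  define Q1 where "Q1 = {(p,j)\<in>prime_powers_le Y. j = 1}"
  define P where "P = {p::nat. prime p \<and> (real p)\<^sup>2 \<le> Y}"
  define J where "J = (\<lambda>p::nat. {j. 2 \<le> j \<and> real (p ^ j) \<le> Y})"
  have nn: "0 \<le> (case x of (p,j) \<Rightarrow> ln (real p))" if "x \<in> prime_powers_le Y" for x :: "nat \<times> nat"
    using that by (auto simp: prime_powers_le_def ln_prime_nonneg)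
  have finP: "finite P"
  proof (rule finite_subset)
    show "P \<subseteq> {..nat \<lfloor>sqrt Y\<rfloor>}"
      by (auto simp: P_def intro!: le_nat_floor real_le_rsqrt)
  qed simp
  have cardP: "real (card P) \<le> sqrt Y"
  proof -
    have "P \<subseteq> {1..nat \<lfloor>sqrt Y\<rfloor>}"
      by (auto simp: P_def Suc_le_eq prime_gt_0_nat intro!: le_nat_floor real_le_rsqrt)
    hence "card P \<le> card {1..nat \<lfloor>sqrt Y\<rfloor>}" by (intro card_mono) auto
    hence "real (card P) \<le> real (nat \<lfloor>sqrt Y\<rfloor>)" by simp
    also have "\<dots> \<le> sqrt Y" using Y by simp
    finally show ?thesis .
  qed
  have finJ: "finite (J p)" if "prime p" for p
  proof -
    have "j \<le> nat \<lfloor>Y\<rfloor>" if "j \<in> J p" for j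
    proof -
      have "p ^ j \<le> nat \<lfloor>Y\<rfloor>" using that by (intro le_nat_floor) (auto simp: J_def)
      moreover have "j < p ^ j" by (rule power_gt_expt) (use prime_gt_1_nat[OF \<open>prime p\<close>] in simp)
      ultimately show ?thesis by simp
    qed
    thus ?thesis by (meson finite_atMost finite_subset atMost_iff subsetI)
  qed
  have J: "real (card (J p)) * ln (real p) \<le> ln Y" if "prime p" for p
  proof (cases "J p = {}")
    case False
    define m where "m = Max (J p)"
    have m: "m \<in> J p" unfolding m_def using finJ[OF that] False by (intro Max_in)
    have "J p \<subseteq> {1..m}" using finJ[OF that] by (auto simp: m_def J_def)
    hence "card (J p) \<le> m" using card_mono[of "{1..m}" "J p"] by simp
    hence "real (card (J p)) * ln (real p) \<le> real m * ln (real p)"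
      using prime_ge_1_nat[OF that] by (intro mult_right_mono) auto
    also have "\<dots> = ln (real (p ^ m))" using prime_gt_0_nat[OF that] by (simp add: ln_realpow)
    also have "\<dots> \<le> ln Y"
    proof -
      have *: "real (p ^ m) \<le> Y" "0 < real (p ^ m)" using m prime_gt_0_nat[OF that] by (auto simp: J_def)
      show ?thesis by (rule iffD2[OF ln_le_cancel_iff[OF *(2) less_le_trans[OF *(2,1)]] *(1)])
    qed
    finally show ?thesis .
  qed (use Y in simp)
  have "(\<Sum>(p,j)\<in>prime_powers_le Y. ln (real p)) \<le> 3 * Y + sqrt Y * ln Y"
  proof (rule sum_le_sum_Un[of Q1 "SIGMA p:P. J p"])
    show "finite Q1" unfolding Q1_def by (rule finite_subset[OF _ finite_prime_powers_le[of Y]]) auto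
    show "finite (SIGMA p:P. J p)" using finP finJ by (auto simp: P_def)
    show "prime_powers_le Y \<subseteq> Q1 \<union> (SIGMA p:P. J p)"
    proof -
      have "(p,j) \<in> Q1" if pj: "(p,j) \<in> prime_powers_le Y" "(p,j) \<notin> Sigma P J" for p j
      proof -
      have *: "prime p" "1 \<le> j" "real (p ^ j) \<le> Y" using pj by (auto simp: prime_powers_le_def)
      have "j = 1"
      proof (rule ccontr)
        assume "j \<noteq> 1"
        hence j: "2 \<le> j" using * by simp
        have "p ^ 2 \<le> p ^ j" using j prime_ge_1_nat[OF *(1)] by (intro power_increasing) auto
        hence "real (p ^ 2) \<le> Y" using *(3) by (metis of_nat_le_iff order_trans)
        hence "p \<in> P" using * by (simp add: P_def)
        thus False using pj j * by (auto simp: J_def)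
      qed
      thus ?thesis using pj by (simp add: Q1_def)
      qed
      thus ?thesis by auto
    qed
    show "(\<Sum>(p,j)\<in>Q1. ln (real p)) \<le> 3 * Y"
    proof -
      have "(\<Sum>(p,j)\<in>Q1. ln (real p)) = prime_theta (nat \<lfloor>Y\<rfloor>)"
        unfolding prime_theta_def
      proof (rule sum.reindex_bij_witness[of _ "\<lambda>p. (p,1)" fst])
        show "fst a \<in> {p. prime p \<and> p \<le> nat \<lfloor>Y\<rfloor>}" if "a \<in> Q1" for a
          using that by (auto simp: Q1_def prime_powers_le_def intro!: le_nat_floor)
        show "(p, 1) \<in> Q1" if "p \<in> {p. prime p \<and> p \<le> nat \<lfloor>Y\<rfloor>}" for p :: nat
        proof -
          have "real p \<le> real (nat \<lfloor>Y\<rfloor>)" using that by simp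
          also have "\<dots> \<le> Y" using Y by simp
          finally show ?thesis using that by (simp add: Q1_def prime_powers_le_def)
        qed
      qed (auto simp: Q1_def)
      also have "\<dots> \<le> 3 * real (nat \<lfloor>Y\<rfloor>)" by (rule prime_theta_le)
      also have "\<dots> \<le> 3 * Y" using Y by simp
      finally show ?thesis .
    qed
    show "(\<Sum>(p,j)\<in>(SIGMA p:P. J p). ln (real p)) \<le> sqrt Y * ln Y"
    proof -
      have "(\<Sum>(p,j)\<in>(SIGMA p:P. J p). ln (real p)) = (\<Sum>p\<in>P. \<Sum>j\<in>J p. ln (real p))"
        using finP finJ by (subst sum.Sigma) (auto simp: P_def)
      also have "\<dots> \<le> (\<Sum>p\<in>P. ln Y)"
        using J by (intro sum_mono) (auto simp: P_def)
      also have "\<dots> = real (card P) * ln Y" by simp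
      also have "\<dots> \<le> sqrt Y * ln Y" using cardP Y by (intro mult_right_mono) auto
      finally show ?thesis .
    qed
    fix x :: "nat \<times> nat" assume "x \<in> prime_powers_le Y \<union> Q1 \<union> (SIGMA p:P. J p)"
    hence "prime (fst x)" by (auto simp: Q1_def prime_powers_le_def P_def)
    thus "0 \<le> (case x of (p,j) \<Rightarrow> ln (real p))" by (cases x) (simp add: ln_prime_nonneg)
  qed
  also have "sqrt Y * ln Y \<le> sqrt Y * (2 * sqrt Y)"
    using Y ln_le_2_sqrt[of Y] by (intro mult_left_mono) auto
  also have "sqrt Y * (2 * sqrt Y) = 2 * Y" using Y by simp
  finally show ?thesis by linarith
qed

text \<open>The identity of \<open>ln\<close> with the divisor sum of the von Mangoldt function. The
  parameter \<open>Y\<close> provides one index set for all \<open>c\<close> at once, so that sums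
  can be interchanged.\<close>

lemma ln_eq_sum_prime_powers:
  assumes "1 \<le> c" "real c \<le> Y"
  shows "ln (real c) = (\<Sum>(p,j)\<in>{(p,j)\<in>prime_powers_le Y. p ^ j dvd c}. ln (real p))"
proof -
  have "{(p,j)\<in>prime_powers_le Y. p ^ j dvd c} = (SIGMA p:prime_factors c. {1..multiplicity p c})"
  proof -
    have "prime p \<and> 1 \<le> j \<and> real (p ^ j) \<le> Y \<and> p ^ j dvd c \<longleftrightarrow> p \<in> prime_factors c \<and> j \<in> {1..multiplicity p c}" for p j
    proof
      assume *: "prime p \<and> 1 \<le> j \<and> real (p ^ j) \<le> Y \<and> p ^ j dvd c"
      hence "j \<le> multiplicity p c" using assms prime_gt_1_nat[of p] by (intro multiplicity_geI) auto
      thus "p \<in> prime_factors c \<and> j \<in> {1..multiplicity p c}" using * by (auto simp: prime_factors_multiplicity)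
    next
      assume *: "p \<in> prime_factors c \<and> j \<in> {1..multiplicity p c}"
      hence "p ^ j dvd c" by (auto intro: multiplicity_dvd')
      moreover from this have "real (p ^ j) \<le> Y" using assms dvd_imp_le[of "p ^ j" c]
        by (metis of_nat_le_iff order_trans less_le_trans zero_less_one)
      ultimately show "prime p \<and> 1 \<le> j \<and> real (p ^ j) \<le> Y \<and> p ^ j dvd c" using * by auto
    qed
    thus ?thesis by (auto simp: prime_powers_le_def)
  qed
  hence "(\<Sum>(p,j)\<in>{(p,j)\<in>prime_powers_le Y. p ^ j dvd c}. ln (real p)) =
     (\<Sum>(p,j)\<in>(SIGMA p:prime_factors c. {1..multiplicity p c}). ln (real p))"
    by (simp only:)
  also have "\<dots> = (\<Sum>p\<in>prime_factors c. \<Sum>j\<in>{1..multiplicity p c}. ln (real p))"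
    by (rule sum.Sigma[symmetric]) auto
  also have "\<dots> = (\<Sum>p\<in>prime_factors c. ln (real (p ^ multiplicity p c)))"
    by (intro sum.cong) (auto simp: ln_realpow prime_gt_0_nat prime_factors_dvd)
  also have "\<dots> = ln (\<Prod>p\<in>prime_factors c. real (p ^ multiplicity p c))"
    by (intro ln_prod[symmetric]) (auto dest!: in_prime_factors_imp_prime prime_gt_0_nat)
  also have "(\<Prod>p\<in>prime_factors c. real (p ^ multiplicity p c)) = real c"
  proof -
    have e: "c = (\<Prod>p\<in>prime_factors c. p ^ multiplicity p c)"
      using assms by (intro prime_factorization_nat) auto
    have "(\<Prod>p\<in>prime_factors c. real (p ^ multiplicity p c)) = real (\<Prod>p\<in>prime_factors c. p ^ multiplicity p c)"
      by (rule of_nat_prod[symmetric])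
    thus ?thesis by (simp only: e[symmetric])
  qed
  finally show ?thesis by simp
qed

text \<open>Mertens' argument: the logarithms of the squarefree kernels of the numbers up to
  \<open>N\<close> sum to at most \<open>N * ln N\<close>. Counting multiples of each prime instead
  gives the sum in question, up to an error \<open>prime_theta N \<le> 3 * N\<close>.\<close>

lemma sum_ln_prime_over_prime:
  assumes "1 \<le> N"
  shows "(\<Sum>p | prime p \<and> p \<le> N. ln (real p) / real p) \<le> ln (real N) + 3"
proof -
  define P where "P = {p::nat. prime p \<and> p \<le> N}"
  have lnc: "(\<Sum>p\<in>P. if p dvd c then ln (real p) else 0) \<le> ln (real N)" if c: "c \<in> {1..N}" for c
  proof -
    have "(\<Sum>p\<in>P. if p dvd c then ln (real p) else 0) = (\<Sum>p\<in>{p\<in>P. p dvd c}. ln (real p))"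
      by (rule sum.inter_filter[symmetric]) (simp add: P_def)
    also have "\<dots> = ln (\<Prod>p\<in>{p\<in>P. p dvd c}. real p)"
      by (intro ln_prod[symmetric]) (auto simp: P_def prime_gt_0_nat)
    also have "(\<Prod>p\<in>{p\<in>P. p dvd c}. real p) = real (\<Prod>{p\<in>P. p dvd c})" by simp
    also have "ln \<dots> \<le> ln (real N)"
    proof -
      have "\<Prod>{p\<in>P. p dvd c} dvd c" by (intro prod_primes_dvd) (auto simp: P_def)
      hence "\<Prod>{p\<in>P. p dvd c} \<le> c" using c by (intro dvd_imp_le) auto
      hence "\<Prod>{p\<in>P. p dvd c} \<le> N" using c by simp
      moreover have "0 < \<Prod>{p\<in>P. p dvd c}" by (intro prod_pos) (auto simp: P_def prime_gt_0_nat)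
      moreover have "ln (real z) \<le> ln (real N)" if "z \<le> N" "0 < z" for z using that by simp
      ultimately show ?thesis by blast
    qed
    finally show ?thesis .
  qed
  have cnt: "real N / real p - 1 \<le> real (card {c\<in>{1..N}. p dvd c})" if "p \<in> P" for p
  proof -
    have p: "p > 0" using that by (auto simp: P_def prime_gt_0_nat)
    have "(\<lambda>i. p * i) ` {1..N div p} \<subseteq> {c\<in>{1..N}. p dvd c}"
      using p by (auto simp: less_eq_div_iff_mult_less_eq mult.commute)
    hence "card ((\<lambda>i. p * i) ` {1..N div p}) \<le> card {c\<in>{1..N}. p dvd c}" by (intro card_mono) auto
    moreover have "card ((\<lambda>i. p * i) ` {1..N div p}) = N div p"
      using p by (subst card_image) (auto simp: inj_on_def)
    ultimately have "real (N div p) \<le> real (card {c\<in>{1..N}. p dvd c})" by simp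
    moreover have "real N / real p - 1 \<le> real (N div p)"
    proof -
      have "N < p + p * (N div p)" using p by (rule dividend_less_times_div)
      hence "real N < real (p + p * (N div p))" by (simp only: of_nat_less_iff)
      hence "real N < real p + real p * real (N div p)" by simp
      thus ?thesis using p by (simp add: field_simps)
    qed
    ultimately show ?thesis by linarith
  qed
  have "(\<Sum>p\<in>P. ln (real p) * (real N / real p - 1)) \<le> (\<Sum>p\<in>P. ln (real p) * real (card {c\<in>{1..N}. p dvd c}))"
    using cnt by (intro sum_mono mult_left_mono) (auto simp: P_def ln_prime_nonneg)
  also have "\<dots> = (\<Sum>p\<in>P. \<Sum>c\<in>{1..N}. if p dvd c then ln (real p) else 0)"
    by (intro sum.cong refl) (simp add: sum.If_cases Int_def mult.commute)
  also have "\<dots> = (\<Sum>c\<in>{1..N}. \<Sum>p\<in>P. if p dvd c then ln (real p) else 0)" by (rule sum.swap)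
  also have "\<dots> \<le> (\<Sum>c\<in>{1..N}. ln (real N))" using lnc by (intro sum_mono) auto
  also have "\<dots> = real N * ln (real N)" by simp
  also have "(\<Sum>p\<in>P. ln (real p) * (real N / real p - 1)) = real N * (\<Sum>p\<in>P. ln (real p) / real p) - prime_theta N"
    unfolding prime_theta_def P_def[symmetric] by (simp add: sum_distrib_left sum_subtractf[symmetric] algebra_simps)
  finally have "real N * (\<Sum>p\<in>P. ln (real p) / real p) \<le> real N * (ln (real N) + 3)"
    using prime_theta_le[of N] by (simp add: algebra_simps)
  thus ?thesis using assms by (simp add: P_def)
qed

text \<open>Partial summation carried out as induction on \<open>N\<close>:
  \<open>B N - A N / ln N\<close> changes only through \<open>1 / ln N\<close>, and
  \<open>1 - a / b \<le> ln b - ln a\<close> makes the main term telescope to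
  \<open>ln (ln N)\<close>.\<close>

lemma sum_inverse_primes_le:
  assumes "2 \<le> N"
  shows "(\<Sum>p | prime p \<and> p \<le> N. 1 / real p) \<le> ln (ln (real N)) + (1 + 6 / ln 2 - ln (ln 2))"
proof -
  define A where "A = (\<lambda>N. \<Sum>p | prime p \<and> p \<le> N. ln (real p) / real p)"
  define B where "B = (\<lambda>N. \<Sum>p::nat | prime p \<and> p \<le> N. 1 / real p)"
  have set_Suc: "{p::nat. prime p \<and> p \<le> Suc N} = (if prime (Suc N) then insert (Suc N) {p. prime p \<and> p \<le> N} else {p. prime p \<and> p \<le> N})" for N
    by (auto simp: le_Suc_eq)
  have ASuc: "A (Suc N) = A N + (if prime (Suc N) then ln (real (Suc N)) / real (Suc N) else 0)" for N
    unfolding A_def set_Suc by auto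
  have BSuc: "B (Suc N) = B N + (if prime (Suc N) then 1 / real (Suc N) else 0)" for N
    unfolding B_def set_Suc by auto
  have "B N - A N / ln (real N) \<le> ln (ln (real N)) - ln (ln 2) + 3 * (1 / ln 2 - 1 / ln (real N))"
    using assms
  proof (induction N rule: dec_induct)
    case base
    have "{p::nat. prime p \<and> p \<le> 2} = {2}" by (auto dest: prime_ge_2_nat)
    thus ?case by (simp add: A_def B_def)
  next
    case (step N)
    define a where "a = ln (real N)"
    define b where "b = ln (real (Suc N))"
    have ab: "0 < a" "a \<le> b" "0 < b" using step by (auto simp: a_def b_def)
    have "B (Suc N) - A (Suc N) / b = B N - A N / b"
      unfolding ASuc BSuc using ab by (auto simp: b_def add_divide_distrib)
    also have "\<dots> = (B N - A N / a) + A N * (1 / a - 1 / b)" by (simp add: algebra_simps)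
    also have "A N * (1 / a - 1 / b) \<le> (a + 3) * (1 / a - 1 / b)"
      using sum_ln_prime_over_prime[of N] step ab
      by (intro mult_right_mono) (auto simp: A_def a_def frac_le)
    also have "(a + 3) * (1 / a - 1 / b) = (1 - a / b) + 3 * (1 / a - 1 / b)"
      using ab by (simp add: field_simps)
    also have "1 - a / b \<le> ln b - ln a"
    proof -
      have "ln (a / b) \<le> a / b - 1" using ab by (intro ln_le_minus_one) auto
      thus ?thesis using ab by (simp add: ln_div)
    qed
    finally show ?case using step.IH unfolding a_def[symmetric] b_def[symmetric] by simp
  qed
  moreover have "A N / ln (real N) \<le> 1 + 3 / ln (real N)"
    using sum_ln_prime_over_prime[of N] assms by (simp add: A_def field_simps)
  moreover have "3 / ln 2 \<le> 6 / ln (2::real)" by (simp add: divide_right_mono)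
  moreover have "3 * (1 / ln 2 - 1 / ln (real N)) = 3 / ln 2 - 3 / ln (real N)" by (simp add: algebra_simps)
  ultimately have "B N \<le> ln (ln (real N)) + (1 + 6 / ln 2 - ln (ln 2))" by linarith
  thus ?thesis by (simp add: B_def)
qed

lemma sum_inverse_pronic_le:
  assumes "finite A" "\<And>n. n \<in> A \<Longrightarrow> n \<ge> (2::nat)"
  shows "(\<Sum>n\<in>A. 1 / (real n * (real n - 1))) \<le> 1"
proof -
  have ind: "(\<Sum>n\<in>{2..N}. 1 / (real n * (real n - 1))) \<le> 1 - 1 / real N" if "N \<ge> 2" for N
    using that
  proof (induction N rule: dec_induct)
    case (step N)
    have "(\<Sum>n\<in>{2..Suc N}. 1 / (real n * (real n - 1))) = (\<Sum>n\<in>{2..N}. 1 / (real n * (real n - 1))) + 1 / ((real N + 1) * real N)"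
      using step by (simp add: sum.cl_ivl_Suc add.commute)
    also have "\<dots> \<le> 1 - 1 / real N + 1 / ((real N + 1) * real N)" using step.IH by simp
    also have "1 / ((real N + 1) * real N) = 1 / real N - 1 / (real N + 1)"
      using step by (simp add: field_simps)
    also have "1 - 1 / real N + (1 / real N - 1 / (real N + 1)) = 1 - 1 / real (Suc N)"
      by (simp add: add.commute)
    finally show ?case .
  qed simp
  define N where "N = Max (insert 2 A)"
  have "A \<subseteq> {2..N}" "N \<ge> 2" using assms by (auto simp: N_def)
  hence "(\<Sum>n\<in>A. 1 / (real n * (real n - 1))) \<le> (\<Sum>n\<in>{2..N}. 1 / (real n * (real n - 1)))"
    by (intro sum_mono2) auto
  also have "\<dots> \<le> 1 - 1 / real N" by (rule ind) fact
  also have "\<dots> \<le> 1" by simp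
  finally show ?thesis .
qed

lemma prod_inverse_one_minus_le_exp:
  assumes "finite A" "\<And>p. p \<in> A \<Longrightarrow> p \<ge> (2::nat)"
  shows "(\<Prod>p\<in>A. 1 / (1 - 1 / real p)) \<le> exp 1 * exp (\<Sum>p\<in>A. 1 / real p)"
proof -
  have e: "1 / (1 - 1 / real p) = 1 + (1 / real p + 1 / (real p * (real p - 1)))" if "p \<in> A" for p
    using assms(2)[OF that] by (simp add: field_simps)
  have "(\<Prod>p\<in>A. 1 / (1 - 1 / real p)) = (\<Prod>p\<in>A. 1 + (1 / real p + 1 / (real p * (real p - 1))))"
    using e by (intro prod.cong) auto
  also have "\<dots> \<le> exp (\<Sum>p\<in>A. 1 / real p + 1 / (real p * (real p - 1)))"
    using assms(2) by (intro prod_le_exp_sum) force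
  also have "\<dots> \<le> exp (1 + (\<Sum>p\<in>A. 1 / real p))"
    using sum_inverse_pronic_le[OF assms] by (simp add: sum.distrib)
  finally show ?thesis by (simp add: exp_add)
qed

lemma prime_product_upper:
  assumes "2 \<le> N"
  shows "(\<Prod>p | prime p \<and> p \<le> N. 1 / (1 - 1 / real p)) \<le> exp (2 + 6 / ln 2 - ln (ln 2)) * ln (real N)"
proof -
  have "(\<Prod>p | prime p \<and> p \<le> N. 1 / (1 - 1 / real p)) \<le> exp 1 * exp (\<Sum>p | prime p \<and> p \<le> N. 1 / real p)"
    by (rule prod_inverse_one_minus_le_exp) (auto simp: prime_ge_2_nat)
  also have "\<dots> \<le> exp 1 * exp (ln (ln (real N)) + (1 + 6 / ln 2 - ln (ln 2)))"
    using sum_inverse_primes_le[OF assms] by simp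
  also have "\<dots> = exp (ln (ln (real N))) * exp (2 + 6 / ln 2 - ln (ln 2))"
    by (simp add: exp_add[symmetric])
  also have "exp (ln (ln (real N))) = ln (real N)" using assms by simp
  finally show ?thesis by (simp add: mult.commute)
qed

subsection \<open>A sieve bound\<close>

text \<open>The summand is \<open>1 / totient n\<close>. Splitting off the exact power of
  \<open>p\<close> leaves a sum over the remaining primes, and the powers of \<open>p\<close> form a
  geometric series, with the extra factor \<open>1 / (1 - 1 / p)\<close> for positive exponents
  only.\<close>

lemma euler_product_bound:
  assumes "finite P" "\<And>p. p \<in> P \<Longrightarrow> prime p" "finite F"
    "\<And>n. n \<in> F \<Longrightarrow> 0 < n \<and> prime_factors n \<subseteq> P"
  shows "(\<Sum>n\<in>F. 1 / (real n * tot_ratio n)) \<le> (\<Prod>p\<in>P. 1 + 1 / (1 - 1 / real p) * (1 / (real p - 1)))"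
  using assms
proof (induction P arbitrary: F rule: finite_induct)
  case empty
  have "n = 1" if n: "n \<in> F" for n
  proof (rule ccontr)
    assume "n \<noteq> 1"
    then obtain p where "prime p" "p dvd n" using prime_factor_nat by blast
    moreover have "n > 0" "prime_factors n \<subseteq> {}" using empty.prems(3)[OF n] by blast+
    ultimately show False by (auto simp: prime_factors_dvd)
  qed
  hence "F \<subseteq> {1}" by auto
  hence "(\<Sum>n\<in>F. 1 / (real n * tot_ratio n)) \<le> (\<Sum>n\<in>{1}. 1 / (real n * tot_ratio n))"
    by (intro sum_mono2) auto
  thus ?case by (simp add: tot_ratio_def)
next
  case (insert p P)
  have p: "prime p" "p \<ge> 2" "p > 0" using insert.prems prime_ge_2_nat prime_gt_0_nat by auto
  define h where "h = (\<lambda>n. 1 / (real n * tot_ratio n))"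
  have h0: "0 \<le> h n" for n by (simp add: h_def)
  define PP where "PP = (\<Prod>p\<in>P. 1 + 1 / (1 - 1 / real p) * (1 / (real p - 1)))"
  have PP0: "0 \<le> PP"
    unfolding PP_def
  proof (intro prod_nonneg ballI)
    fix q assume "q \<in> P"
    hence "q \<ge> 2" using insert.prems prime_ge_2_nat by auto
    thus "0 \<le> 1 + 1 / (1 - 1 / real q) * (1 / (real q - 1))" by (auto intro!: add_nonneg_nonneg mult_nonneg_nonneg)
  qed
  define w where "w = (\<lambda>i::nat. if i = 0 then 1 else 1 / (1 - 1 / real p) * (1 / real p) ^ i)"
  define N where "N = Max (insert 0 (multiplicity p ` F))"
  have part: "sum h {n\<in>F. multiplicity p n = i} \<le> w i * PP" for i
  proof -
    define Fi where "Fi = {n\<in>F. multiplicity p n = i}"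
    have dec: "p ^ i * (n div p ^ i) = n" "0 < n div p ^ i" "\<not> p dvd n div p ^ i"
       "prime_factors (n div p ^ i) \<subseteq> P" if "n \<in> Fi" for n
    proof -
      have n: "n > 0" "prime_factors n \<subseteq> insert p P" "multiplicity p n = i"
        using that insert.prems(3) by (auto simp: Fi_def)
      have "p ^ i dvd n" using n(3) by (auto simp: multiplicity_dvd)
      thus e: "p ^ i * (n div p ^ i) = n" by simp
      show pos: "0 < n div p ^ i" using e n(1) by (metis mult_0_right neq0_conv)
      show nd: "\<not> p dvd n div p ^ i" using n(1,3) multiplicity_decompose[of n p] p by auto
      show "prime_factors (n div p ^ i) \<subseteq> P"
      proof
        fix q assume q: "q \<in> prime_factors (n div p ^ i)"
        hence q': "prime q" "q dvd n div p ^ i" by (auto simp: prime_factors_dvd)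
        hence "q dvd n" using e by (metis dvd_mult)
        hence "q \<in> insert p P" using n q' by (auto simp: prime_factors_dvd)
        moreover have "q \<noteq> p" using nd q' by auto
        ultimately show "q \<in> P" by simp
      qed
    qed
    have inj: "inj_on (\<lambda>n. n div p ^ i) Fi"
      by (rule inj_on_inverseI[where g = "\<lambda>n. p ^ i * n"]) (use dec(1) in simp)
    have "sum h Fi = (\<Sum>n\<in>Fi. w i * h (n div p ^ i))"
    proof (intro sum.cong refl)
      fix n assume n: "n \<in> Fi"
      define u where "u = n div p ^ i"
      have u: "n = p ^ i * u" "0 < u" "\<not> p dvd u" using dec[OF n] by (auto simp: u_def)
      have "h (p ^ i * u) = w i * h u"
        unfolding h_def tot_ratio_prime_power_mult[OF p(1) u(3,2)] w_def
        using p u(2) by (simp add: field_simps)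
      thus "h n = w i * h (n div p ^ i)" by (simp only: u(1)[symmetric] u_def[symmetric])
    qed
    also have "\<dots> = w i * sum h ((\<lambda>n. n div p ^ i) ` Fi)"
      by (subst sum.reindex[OF inj]) (simp add: sum_distrib_left)
    also have "\<dots> \<le> w i * PP"
    proof (rule mult_left_mono)
      show "0 \<le> w i" using p by (auto simp: w_def)
      show "sum h ((\<lambda>n. n div p ^ i) ` Fi) \<le> PP"
        unfolding h_def PP_def
      proof (rule insert.IH)
        show "prime q" if "q \<in> P" for q using insert.prems(1) that by simp
        show "finite ((\<lambda>n. n div p ^ i) ` Fi)" using insert.prems by (simp add: Fi_def)
        show "0 < m \<and> prime_factors m \<subseteq> P" if "m \<in> (\<lambda>n. n div p ^ i) ` Fi" for m
          using that dec(2,4) by blast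
      qed
    qed
    finally show ?thesis by (simp add: Fi_def)
  qed
  have "sum h F = (\<Sum>i\<le>N. sum h {n\<in>F. multiplicity p n = i})"
  proof (rule sum.group[symmetric])
    show "multiplicity p ` F \<subseteq> {..N}" using insert.prems by (auto simp: N_def)
  qed (use insert.prems in auto)
  also have "\<dots> \<le> (\<Sum>i\<le>N. w i * PP)" by (intro sum_mono part)
  also have "\<dots> = (\<Sum>i\<le>N. w i) * PP" by (simp add: sum_distrib_right)
  also have "\<dots> \<le> (1 + 1 / (1 - 1 / real p) * (1 / (real p - 1))) * PP"
  proof (rule mult_right_mono)
    have "{..N} = insert 0 {0<..N}" by auto
    hence "(\<Sum>i\<le>N. w i) = 1 + (\<Sum>i\<in>{0<..N}. 1 / (1 - 1 / real p) * (1 / real p) ^ (i - 0))"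
      by (simp add: w_def)
    also have "(\<Sum>i\<in>{0<..N}. 1 / (1 - 1 / real p) * (1 / real p) ^ (i - 0))
       = 1 / (1 - 1 / real p) * (\<Sum>i\<in>{0<..N}. (1 / real p) ^ (i - 0))" by (rule sum_distrib_left[symmetric])
    also have "\<dots> \<le> 1 / (1 - 1 / real p) * ((1 / real p) / (1 - 1 / real p))"
      using p by (intro mult_left_mono sum_power_above_le) auto
    also have "(1 / real p) / (1 - 1 / real p) = 1 / (real p - 1)" using p by (simp add: field_simps)
    finally show "(\<Sum>i\<le>N. w i) \<le> 1 + 1 / (1 - 1 / real p) * (1 / (real p - 1))" by simp
  qed (rule PP0)
  also have "\<dots> = (\<Prod>p\<in>insert p P. 1 + 1 / (1 - 1 / real p) * (1 / (real p - 1)))"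
    using insert.hyps by (simp add: PP_def)
  finally show ?case by (simp add: h_def)
qed

text \<open>The weight \<open>1 / tot_ratio c\<close> is the arithmetic factor with which an offset
  \<open>c\<close> between two fractions occurs in \<open>card_lattice_pairs_le\<close>; offsets
  sharing a prime with \<open>k\<close> do not occur there.\<close>

definition sieve_sum :: "nat \<Rightarrow> real \<Rightarrow> real" where
  "sieve_sum k X = (\<Sum>c | c \<in> upto_set X \<and> coprime c k. 1 / tot_ratio c)"

lemma tot_ratio_pos: "0 < n \<Longrightarrow> 0 < tot_ratio n"
  by (simp add: tot_ratio_def)

lemma tot_ratio_prime_power_mult_ge:
  assumes "prime p" "0 < b"
  shows "tot_ratio (p ^ j * b) \<ge> tot_ratio b / 2"
proof -
  have "1 / real p \<le> 1 / 2" using prime_ge_2_nat[OF assms(1)] by simp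
  hence "1/2 * tot_ratio b \<le> (1 - 1 / real p) * tot_ratio b" by (intro mult_right_mono) auto
  thus ?thesis
    using tot_ratio_prime_power_mult[OF assms(1) _ assms(2), of j] tot_ratio_prime_power_mult_dvd[OF assms(1) _ assms(2), of j]
    by (cases "p dvd b") (auto split: if_splits)
qed

text \<open>Hall's device: \<open>ln c\<close> is spread over the prime powers dividing \<open>c\<close>, and the sum over the prime power is
  carried out first, by Chebyshev's bound.\<close>

lemma sieve_sum_log:
  assumes X: "1 \<le> X" and k: "0 < k"
  shows "sieve_sum k X * ln X \<le> 11 * X * (\<Sum>b | b \<in> upto_set X \<and> coprime b k. 1 / (real b * tot_ratio b))"
proof -
  define f where "f = (\<lambda>c. if coprime c k then 1 / tot_ratio c else 0)"
  define U where "U = upto_set X"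
  define Q where "Q = prime_powers_le X"
  have fin: "finite U" "finite Q" by (simp_all add: U_def Q_def)
  have f0: "0 \<le> f c" for c by (simp add: f_def)
  have U: "1 \<le> c" "0 < c" "real c \<le> X" if "c \<in> U" for c using that by (auto simp: U_def upto_set_def)
  \<comment> \<open>A new prime changes the totient ratio by \<open>1 - 1 / p \<ge> 1/2\<close>,
    hence the uniform factor 2. With Chebyshev's 5 this yields the coefficient 10 below.\<close>
  have fsub: "f (p ^ j * b) \<le> 2 * f b" if "prime p" "0 < b" for p j b
  proof (cases "coprime (p ^ j * b) k")
    case True
    hence "coprime b k" by simp
    moreover have "1 / tot_ratio (p ^ j * b) \<le> 1 / (tot_ratio b / 2)"
      using tot_ratio_prime_power_mult_ge[OF that] tot_ratio_pos[OF that(2)]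
        tot_ratio_pos[of "p ^ j * b"] that prime_gt_0_nat[OF that(1)] by (intro divide_left_mono) auto
    ultimately show ?thesis using True by (simp add: f_def)
  next
    case False
    hence "f (p ^ j * b) = 0" by (simp only: f_def if_False)
    thus ?thesis using f0[of b] by simp
  qed
  have S: "sieve_sum k X = sum f U"
    unfolding sieve_sum_def f_def U_def[symmetric] using fin by (intro sum.mono_neutral_cong_left) auto
  have R: "(\<Sum>b | b \<in> upto_set X \<and> coprime b k. 1 / (real b * tot_ratio b)) = (\<Sum>b\<in>U. f b / real b)"
    unfolding f_def U_def[symmetric] using fin by (intro sum.mono_neutral_cong_left) auto
  have inner: "(\<Sum>c\<in>U. if p ^ j dvd c then f c else 0) \<le> (\<Sum>b\<in>U. if real (p ^ j) \<le> X / real b then 2 * f b else 0)"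
    if pj: "(p,j) \<in> Q" for p j
  proof -
    have p: "prime p" "0 < p ^ j" using pj by (auto simp: Q_def prime_powers_le_def prime_gt_0_nat)
    have "(\<Sum>c\<in>U. if p ^ j dvd c then f c else 0) = (\<Sum>c\<in>{c\<in>U. p ^ j dvd c}. f c)"
      using fin by (simp add: sum.inter_filter)
    also have "\<dots> = (\<Sum>b\<in>{b\<in>U. real (p ^ j) \<le> X / real b}. f (p ^ j * b))"
    proof (rule sum.reindex_bij_witness[of _ "\<lambda>b. p ^ j * b" "\<lambda>c. c div p ^ j"])
      fix c assume "c \<in> {c\<in>U. p ^ j dvd c}"
      hence c: "c \<in> U" "p ^ j dvd c" by auto
      then obtain b where b: "c = p ^ j * b" by blast
      have bp: "0 < b" using b U[OF c(1)] by (cases b) auto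
      show "p ^ j * (c div p ^ j) = c" using c by simp
      show "f (p ^ j * (c div p ^ j)) = f c" using c by simp
      have cd: "c div p ^ j = b" using b p by simp
      have "1 * b \<le> p ^ j * b" using p(2) by (intro mult_le_mono1) auto
      hence "real b \<le> real c" unfolding b by (simp only: mult_1 of_nat_le_iff)
      hence "b \<in> U" using U[OF c(1)] bp by (auto simp: U_def upto_set_def)
      moreover have "real (p ^ j) * real b \<le> X" using U(3)[OF c(1)] b by simp
      hence "real (p ^ j) \<le> X / real b" using bp by (simp add: pos_le_divide_eq)
      ultimately show "c div p ^ j \<in> {b\<in>U. real (p ^ j) \<le> X / real b}" using cd by simp
    next
      fix b assume "b \<in> {b\<in>U. real (p ^ j) \<le> X / real b}"
      hence b: "b \<in> U" "real (p ^ j) \<le> X / real b" by auto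
      show "p ^ j * b div p ^ j = b" using p by simp
      have "real (p ^ j) * real b \<le> X" using b U[OF b(1)] by (simp add: pos_le_divide_eq)
      hence "real (p ^ j * b) \<le> X" by simp
      moreover have "1 \<le> p ^ j * b" using U(2)[OF b(1)] p by (simp add: Suc_le_eq)
      ultimately show "p ^ j * b \<in> {c\<in>U. p ^ j dvd c}" unfolding U_def upto_set_def by simp
    qed
    also have "\<dots> \<le> (\<Sum>b\<in>{b\<in>U. real (p ^ j) \<le> X / real b}. 2 * f b)"
      using fsub p U by (intro sum_mono) auto
    also have "\<dots> = (\<Sum>b\<in>U. if real (p ^ j) \<le> X / real b then 2 * f b else 0)"
      using fin by (intro sum.inter_filter)
    finally show ?thesis .
  qed
  have "(\<Sum>c\<in>U. f c * ln (real c)) = (\<Sum>c\<in>U. \<Sum>x\<in>Q. case x of (p,j) \<Rightarrow> ln (real p) * (if p ^ j dvd c then f c else 0))"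
  proof (intro sum.cong refl)
    fix c assume c: "c \<in> U"
    have "ln (real c) = (\<Sum>(p,j)\<in>{x\<in>Q. (case x of (p,j) \<Rightarrow> p ^ j dvd c)}. ln (real p))"
      using ln_eq_sum_prime_powers[OF U(1,3)[OF c]] by (simp add: Q_def case_prod_unfold)
    also have "\<dots> = (\<Sum>x\<in>Q. if (case x of (p,j) \<Rightarrow> p ^ j dvd c) then (case x of (p,j) \<Rightarrow> ln (real p)) else 0)"
      using fin by (intro sum.inter_filter)
    finally show "f c * ln (real c) = (\<Sum>x\<in>Q. case x of (p,j) \<Rightarrow> ln (real p) * (if p ^ j dvd c then f c else 0))"
      by (simp add: sum_distrib_left case_prod_unfold if_distrib mult.commute cong: if_cong)
  qed
  also have "\<dots> = (\<Sum>x\<in>Q. \<Sum>c\<in>U. case x of (p,j) \<Rightarrow> ln (real p) * (if p ^ j dvd c then f c else 0))" by (rule sum.swap)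
  also have "\<dots> \<le> (\<Sum>x\<in>Q. \<Sum>b\<in>U. case x of (p,j) \<Rightarrow> ln (real p) * (if real (p ^ j) \<le> X / real b then 2 * f b else 0))"
  proof (rule sum_mono)
    fix x assume x: "x \<in> Q"
    obtain p j where pj: "x = (p,j)" by (cases x)
    have "0 \<le> ln (real p)" using x pj by (auto simp: Q_def prime_powers_le_def ln_prime_nonneg)
    hence "ln (real p) * (\<Sum>c\<in>U. if p ^ j dvd c then f c else 0)
       \<le> ln (real p) * (\<Sum>b\<in>U. if real (p ^ j) \<le> X / real b then 2 * f b else 0)"
      using inner x pj by (intro mult_left_mono) auto
    thus "(\<Sum>c\<in>U. case x of (p,j) \<Rightarrow> ln (real p) * (if p ^ j dvd c then f c else 0)) \<le>
       (\<Sum>b\<in>U. case x of (p,j) \<Rightarrow> ln (real p) * (if real (p ^ j) \<le> X / real b then 2 * f b else 0))"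
      by (simp only: pj prod.case sum_distrib_left)
  qed
  also have "\<dots> = (\<Sum>b\<in>U. \<Sum>x\<in>Q. case x of (p,j) \<Rightarrow> ln (real p) * (if real (p ^ j) \<le> X / real b then 2 * f b else 0))" by (rule sum.swap)
  also have "\<dots> \<le> (\<Sum>b\<in>U. 10 * X * (f b / real b))"
  proof (intro sum_mono)
    fix b assume b: "b \<in> U"
    have b1: "1 \<le> X / real b" "X / real b \<le> X" using U[OF b] X by (simp_all add: field_simps)
    have "(\<Sum>x\<in>Q. case x of (p,j) \<Rightarrow> ln (real p) * (if real (p ^ j) \<le> X / real b then 2 * f b else 0))
       = 2 * f b * (\<Sum>x\<in>Q. if (case x of (p,j) \<Rightarrow> real (p ^ j) \<le> X / real b) then (case x of (p,j) \<Rightarrow> ln (real p)) else 0)"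
      unfolding sum_distrib_left by (intro sum.cong refl) (auto split: prod.splits)
    also have "(\<Sum>x\<in>Q. if (case x of (p,j) \<Rightarrow> real (p ^ j) \<le> X / real b) then (case x of (p,j) \<Rightarrow> ln (real p)) else 0)
       = (\<Sum>(p,j)\<in>{x\<in>Q. (case x of (p,j) \<Rightarrow> real (p ^ j) \<le> X / real b)}. ln (real p))"
      using fin by (intro sum.inter_filter[symmetric])
    also have "{x\<in>Q. (case x of (p,j) \<Rightarrow> real (p ^ j) \<le> X / real b)} = prime_powers_le (X / real b)"
      using b1 unfolding Q_def prime_powers_le_def by fastforce
    also have "2 * f b * (\<Sum>(p,j)\<in>prime_powers_le (X / real b). ln (real p)) \<le> 2 * f b * (5 * (X / real b))"
      using b1 f0 by (intro mult_left_mono sum_prime_powers_le) auto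
    finally show "(\<Sum>x\<in>Q. case x of (p,j) \<Rightarrow> ln (real p) * (if real (p ^ j) \<le> X / real b then 2 * f b else 0))
       \<le> 10 * X * (f b / real b)" by (simp add: mult_ac)
  qed
  also have "\<dots> = 10 * X * (\<Sum>b\<in>U. f b / real b)" by (simp add: sum_distrib_left)
  finally have 1: "(\<Sum>c\<in>U. f c * ln (real c)) \<le> 10 * X * (\<Sum>b\<in>U. f b / real b)" .
  \<comment> \<open>The part of \<open>ln X\<close> not carried by \<open>ln c\<close> is estimated
    trivially and already has the right order; it raises the coefficient from 10 to 11.\<close>
  have "(\<Sum>c\<in>U. f c * ln (X / real c)) \<le> (\<Sum>c\<in>U. f c * (X / real c))"
  proof (intro sum_mono mult_left_mono)
    fix c assume "c \<in> U"
    hence "0 < X / real c" using U X by auto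
    thus "ln (X / real c) \<le> X / real c" using ln_le_minus_one[of "X / real c"] by simp
  qed (rule f0)
  also have "\<dots> = X * (\<Sum>b\<in>U. f b / real b)" by (simp add: sum_distrib_left mult_ac)
  finally have 2: "(\<Sum>c\<in>U. f c * ln (X / real c)) \<le> X * (\<Sum>b\<in>U. f b / real b)" .
  have "sum f U * ln X = (\<Sum>c\<in>U. f c * ln (real c) + f c * ln (X / real c))"
    unfolding sum_distrib_right
  proof (intro sum.cong refl)
    fix c assume "c \<in> U"
    hence "ln X = ln (real c) + ln (X / real c)" using U X by (simp add: ln_div)
    thus "f c * ln X = f c * ln (real c) + f c * ln (X / real c)" by (simp add: distrib_left)
  qed
  also have "\<dots> \<le> 10 * X * (\<Sum>b\<in>U. f b / real b) + X * (\<Sum>b\<in>U. f b / real b)"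
    unfolding sum.distrib using 1 2 by (rule add_mono)
  finally show ?thesis unfolding S R by simp
qed

text \<open>By Mertens, the Euler product over the primes up to \<open>X\<close> not dividing
  \<open>k\<close> is at most a constant times \<open>ln X\<close> and the product in the claim;
  \<open>ln X\<close> cancels the one gained in \<open>sieve_sum_log\<close>. Primes above
  \<open>X\<close> give no saving, which is where the inflation originates.\<close>

theorem sieve_sum_bound:
  obtains C where "C > 0" "\<And>k X. 0 < k \<Longrightarrow> 1 \<le> X \<Longrightarrow>
     sieve_sum k X \<le> C * X * (\<Prod>p | p \<in> prime_factors k \<and> real p \<le> X. 1 - 1 / real p)"
proof -
  define C0 where "C0 = exp (2 + 6 / ln 2 - ln (ln (2::real)))"
  define C where "C = 1 + 11 * exp 1 * C0"
  have C0: "C0 > 0" by (simp add: C0_def)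
  have C: "C > 0" using C0 by (simp add: C_def add_pos_pos)
  have "sieve_sum k X \<le> C * X * (\<Prod>p | p \<in> prime_factors k \<and> real p \<le> X. 1 - 1 / real p)"
    if k: "0 < k" and X: "1 \<le> X" for k X
  \<comment> \<open>Below 2 the product is empty and only \<open>c = 1\<close> is summed; from 2 on,
    \<open>ln X\<close> is positive and may be divided out.\<close>
  proof (cases "X < 2")
    case True
    have "c = 1" if "c \<in> upto_set X" for c using that True by (auto simp: upto_set_def)
    hence "{c. c \<in> upto_set X \<and> coprime c k} \<subseteq> {1}" by auto
    hence "sieve_sum k X \<le> (\<Sum>c\<in>{1::nat}. 1 / tot_ratio c)"
      unfolding sieve_sum_def by (intro sum_mono2) auto
    also have "\<dots> = 1" by (simp add: tot_ratio_def)
    also have "1 \<le> C * X"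
    proof -
      have "1 * 1 \<le> C * X" using X C0 by (intro mult_mono) (auto simp: C_def)
      thus ?thesis by simp
    qed
    finally have S1: "sieve_sum k X \<le> C * X" .
    have e: "{p. p \<in> prime_factors k \<and> real p \<le> X} = {}"
      using True by (auto dest!: in_prime_factors_imp_prime prime_ge_2_nat)
    have "C * X = C * X * (\<Prod>p | p \<in> prime_factors k \<and> real p \<le> X. 1 - 1 / real p)"
      by (simp only: e prod.empty mult_1_right)
    thus ?thesis using S1 by (simp only:)
  next
    case False
    define N where "N = nat \<lfloor>X\<rfloor>"
    have N: "N \<ge> 2" "real N \<le> X" using False by (auto simp: N_def le_nat_iff le_floor_iff)
    have leN: "p \<le> N \<longleftrightarrow> real p \<le> X" for p
    proof
      assume "p \<le> N"
      hence "real p \<le> real N" by simp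
      thus "real p \<le> X" using N by simp
    next
      assume "real p \<le> X" thus "p \<le> N" unfolding N_def by (rule le_nat_floor)
    qed
    define P where "P = {p. prime p \<and> p \<le> N \<and> \<not> p dvd k}"
    define P' where "P' = {p. prime p \<and> p \<le> N \<and> p dvd k}"
    have fin: "finite P" "finite P'" by (auto simp: P_def P'_def intro: finite_subset[of _ "{..N}"])
    have P2: "p \<ge> 2" if "p \<in> P \<union> P'" for p using that prime_ge_2_nat by (auto simp: P_def P'_def)
    have "(\<Sum>b | b \<in> upto_set X \<and> coprime b k. 1 / (real b * tot_ratio b))
       \<le> (\<Prod>p\<in>P. 1 + 1 / (1 - 1 / real p) * (1 / (real p - 1)))"
    proof (rule euler_product_bound)
      show "finite {b. b \<in> upto_set X \<and> coprime b k}" by simp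
      fix b assume "b \<in> {b. b \<in> upto_set X \<and> coprime b k}"
      hence b: "0 < b" "real b \<le> X" "coprime b k" by (auto simp: upto_set_def)
      have "q \<in> P" if "prime q" "q dvd b" for q
      proof -
        have "q \<le> b" using that b dvd_imp_le by blast
        hence "real q \<le> X" using b by linarith
        moreover have "\<not> q dvd k" using that b(3) by (meson coprime_common_divisor not_prime_unit)
        ultimately show ?thesis using that leN by (simp add: P_def)
      qed
      thus "0 < b \<and> prime_factors b \<subseteq> P" using b by (auto simp: prime_factors_dvd)
    qed (use fin in \<open>auto simp: P_def\<close>)
    also have "\<dots> = (\<Prod>p\<in>P. 1 / (1 - 1 / real p)) * (\<Prod>p\<in>P. 1 + 1 / (real p * (real p - 1)))"
      unfolding prod.distrib[symmetric]
    proof (intro prod.cong refl)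
      fix p assume "p \<in> P"
      hence "p \<ge> 2" using P2 by simp
      moreover have "1 + 1 / (1 - 1 / x) * (1 / (x - 1)) = 1 / (1 - 1 / x) * (1 + 1 / (x * (x - 1)))" if "2 \<le> x" for x :: real
      proof -
        define y where "y = x - 1"
        have y: "y > 0" "x = y + 1" using that by (auto simp: y_def)
        have "1 / (1 - 1 / x) = (y + 1) / y" using y by (simp add: field_simps)
        moreover have "1 + (y + 1) / y * (1 / y) = (y + 1) / y * (1 + 1 / ((y + 1) * y))"
        proof -
          have "(y + 1) / y * (1 / ((y + 1) * y)) = 1 / (y * y)" using y(1) by simp
          hence "(y + 1) / y * (1 + 1 / ((y + 1) * y)) = (y + 1) / y + 1 / (y * y)"
            by (simp only: distrib_left mult_1_right)
          moreover have "1 + (y + 1) / y * (1 / y) = (y + 1) / y + 1 / (y * y)"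
            using y(1) by (simp add: field_simps)
          ultimately show ?thesis by simp
        qed
        ultimately show ?thesis using y by simp
      qed
      ultimately show "1 + 1 / (1 - 1 / real p) * (1 / (real p - 1)) = 1 / (1 - 1 / real p) * (1 + 1 / (real p * (real p - 1)))"
        by simp
    qed
    also have "\<dots> \<le> (\<Prod>p\<in>P. 1 / (1 - 1 / real p)) * exp 1"
    proof (rule mult_left_mono)
      have "(\<Prod>p\<in>P. 1 + 1 / (real p * (real p - 1))) \<le> exp (\<Sum>p\<in>P. 1 / (real p * (real p - 1)))"
        using P2 by (intro prod_le_exp_sum) force
      also have "\<dots> \<le> exp 1" using sum_inverse_pronic_le[of P] fin P2 by auto
      finally show "(\<Prod>p\<in>P. 1 + 1 / (real p * (real p - 1))) \<le> exp 1" .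
      show "0 \<le> (\<Prod>p\<in>P. 1 / (1 - 1 / real p))" using P2 by (intro prod_nonneg) force
    qed
    also have "(\<Prod>p\<in>P. 1 / (1 - 1 / real p)) = (\<Prod>p | prime p \<and> p \<le> N. 1 / (1 - 1 / real p)) * (\<Prod>p\<in>P'. 1 - 1 / real p)"
    proof -
      have "{p. prime p \<and> p \<le> N} = P \<union> P'" by (auto simp: P_def P'_def)
      hence "(\<Prod>p | prime p \<and> p \<le> N. 1 / (1 - 1 / real p)) = (\<Prod>p\<in>P. 1 / (1 - 1 / real p)) * (\<Prod>p\<in>P'. 1 / (1 - 1 / real p))"
        using fin by (simp add: prod.union_disjoint P_def P'_def disjoint_iff)
      moreover have "(\<Prod>p\<in>P'. 1 / (1 - 1 / real p)) * (\<Prod>p\<in>P'. 1 - 1 / real p) = 1"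
        unfolding prod.distrib[symmetric] using P2 by (intro prod.neutral ballI) force
      ultimately show ?thesis by (simp add: mult.assoc)
    qed
    also have "\<dots> \<le> (C0 * ln X) * (\<Prod>p\<in>P'. 1 - 1 / real p)"
    proof (rule mult_right_mono)
      have "(\<Prod>p | prime p \<and> p \<le> N. 1 / (1 - 1 / real p)) \<le> C0 * ln (real N)"
        unfolding C0_def by (rule prime_product_upper) (rule N)
      also have "ln (real N) \<le> ln X" using N by simp
      finally show "(\<Prod>p | prime p \<and> p \<le> N. 1 / (1 - 1 / real p)) \<le> C0 * ln X" using C0 by (simp add: mult_left_mono)
      show "0 \<le> (\<Prod>p\<in>P'. 1 - 1 / real p)" using P2 by (intro prod_nonneg) force
    qed
    finally have R: "(\<Sum>b | b \<in> upto_set X \<and> coprime b k. 1 / (real b * tot_ratio b))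
        \<le> (C0 * ln X) * (\<Prod>p\<in>P'. 1 - 1 / real p) * exp 1" by simp
    define PP where "PP = (\<Prod>p\<in>P'. 1 - 1 / real p)"
    have PP0: "0 \<le> PP" unfolding PP_def using P2 by (intro prod_nonneg) force
    have "sieve_sum k X * ln X \<le> 11 * X * ((C0 * ln X) * PP * exp 1)"
    proof (rule order_trans[OF sieve_sum_log[OF X k]])
      show "11 * X * (\<Sum>b | b \<in> upto_set X \<and> coprime b k. 1 / (real b * tot_ratio b)) \<le> 11 * X * (C0 * ln X * PP * exp 1)"
        unfolding PP_def using X by (intro mult_left_mono R) auto
    qed
    also have "\<dots> = (11 * exp 1 * C0 * X * PP) * ln X" by simp
    finally have "sieve_sum k X \<le> 11 * exp 1 * C0 * X * PP" using False by (simp add: mult_le_cancel_right)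
    also have "\<dots> \<le> C * X * PP" using X PP0 by (intro mult_right_mono) (auto simp: C_def)
    also have "P' = {p. p \<in> prime_factors k \<and> real p \<le> X}"
      using k leN by (auto simp: P'_def prime_factors_dvd)
    hence "PP = (\<Prod>p | p \<in> prime_factors k \<and> real p \<le> X. 1 - 1 / real p)" by (simp add: PP_def)
    finally show ?thesis .
  qed
  thus ?thesis using that C by blast
qed

subsection \<open>Counting close pairs of fractions\<close>

lemma mod_solve:
  fixes u s p :: nat
  assumes "coprime u p" "0 < p"
  obtains r where "r < p" "(s + u * r) mod p = t mod p"
proof -
  obtain x where x: "[u * x = 1] (mod p)" using cong_solve_coprime_nat[OF assms(1)] by auto
  define k where "k = t + s * (p - 1)"
  have "[s + u * ((x * k) mod p) = s + u * (x * k)] (mod p)"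
    by (intro cong_add cong_mult cong_refl) (simp add: cong_def)
  also have "s + u * (x * k) = s + (u * x) * k" by simp
  also have "[\<dots> = s + 1 * k] (mod p)" using x by (intro cong_add cong_mult cong_refl)
  also have "s + 1 * k = t + s * p" using assms(2) by (cases p) (auto simp: k_def)
  also have "[\<dots> = t] (mod p)" by (simp add: cong_def)
  finally have "(s + u * ((x * k) mod p)) mod p = t mod p" by (simp add: cong_def)
  thus ?thesis using that[of "(x * k) mod p"] assms(2) by simp
qed

text \<open>Adding the product of the earlier primes, modulo \<open>N\<close>, preserves their
  conditions and moves transitively through the residues mod \<open>p\<close>. So all residue
  classes mod \<open>p\<close> contain equally many survivors, and excluding
  \<open>card (R p)\<close> of them multiplies the count exactly.\<close>

lemma CRT_count:
  fixes S :: "nat set" and R :: "nat \<Rightarrow> nat set"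
  assumes "finite S" "\<And>p. p \<in> S \<Longrightarrow> prime p \<and> p dvd N \<and> R p \<subseteq> {..<p}" "0 < N"
  shows "real (card {k. k < N \<and> (\<forall>p\<in>S. k mod p \<notin> R p)}) = real N * (\<Prod>p\<in>S. 1 - real (card (R p)) / real p)"
  using assms(1,2)
proof (induction S rule: finite_induct)
  case empty
  thus ?case by simp
next
  case (insert p S)
  have p: "prime p" "p dvd N" "R p \<subseteq> {..<p}" "0 < p" using insert.prems[of p] by (auto simp: prime_gt_0_nat)
  define A where "A = {k. k < N \<and> (\<forall>q\<in>S. k mod q \<notin> R q)}"
  define B where "B = (\<lambda>r. {k\<in>A. k mod p = r})"
  define P where "P = \<Prod>S"
  have finA: "finite A" by (auto simp: A_def)
  have cop: "coprime P p"
    unfolding P_def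
  proof (rule prod_coprime_left)
    fix q assume "q \<in> S"
    thus "coprime q p" using insert.prems insert.hyps p(1) by (intro primes_coprime) auto
  qed
  have step: "card (B r) \<le> card (B ((r + P) mod p))" for r
  proof (rule card_inj_on_le[of "\<lambda>k. (k + P) mod N"])
    show "inj_on (\<lambda>k. (k + P) mod N) (B r)"
    proof (rule inj_onI)
      fix k l assume kl: "k \<in> B r" "l \<in> B r" "(k + P) mod N = (l + P) mod N"
      hence "[k + P = l + P] (mod N)" by (simp add: cong_def)
      hence "[k = l] (mod N)" by (simp add: cong_add_rcancel_nat)
      thus "k = l" using kl by (simp add: cong_def B_def A_def)
    qed
    show "(\<lambda>k. (k + P) mod N) ` B r \<subseteq> B ((r + P) mod p)"
    proof clarify
      fix k assume k: "k \<in> B r"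
      have "(k + P) mod N mod q = k mod q" if q: "q \<in> S" for q
      proof -
        have "q dvd N" using q insert.prems by auto
        have "q dvd P" unfolding P_def using insert.hyps(1) q by (intro dvd_prodI[where f = "\<lambda>x. x", simplified])
        from \<open>q dvd P\<close> obtain s where s: "P = q * s" by blast
        have "(k + P) mod N mod q = (k + P) mod q" using \<open>q dvd N\<close> by (rule mod_mod_cancel)
        thus ?thesis unfolding s by simp
      qed
      moreover have "(k + P) mod N mod p = (r + P) mod p"
      proof -
        have "(k + P) mod N mod p = (k + P) mod p" using p(2) by (rule mod_mod_cancel)
        also have "\<dots> = (k mod p + P) mod p" by (rule mod_add_left_eq[symmetric])
        finally show ?thesis using k by (simp add: B_def)
      qed
      ultimately show "(k + P) mod N \<in> B ((r + P) mod p)"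
        using k assms(3) by (auto simp: B_def A_def)
    qed
    show "finite (B ((r + P) mod p))" using finA by (simp add: B_def)
  qed
  have iter: "card (B r) \<le> card (B ((r + P * j) mod p))" if "r < p" for r j
  proof (induction j)
    case 0 thus ?case using that by simp
  next
    case (Suc j)
    have "((r + P * j) mod p + P) mod p = (r + P * Suc j) mod p"
    proof -
      have "((r + P * j) mod p + P) mod p = (r + P * j + P) mod p" by (rule mod_add_left_eq)
      also have "r + P * j + P = r + P * Suc j" by simp
      finally show ?thesis .
    qed
    thus ?case using Suc step[of "(r + P * j) mod p"] by simp
  qed
  have le: "card (B r) \<le> card (B r')" if "r < p" "r' < p" for r r'
  proof -
    obtain j where "(r + P * j) mod p = r' mod p" using mod_solve[OF cop p(4)] by blast
    thus ?thesis using iter[OF that(1), of j] that(2) by simp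
  qed
  have eq: "card (B r) = card (B 0)" if "r < p" for r
    using le[OF that p(4)] le[OF p(4) that] by simp
  have cU: "card (\<Union>r\<in>I. B r) = card I * card (B 0)" if "I \<subseteq> {..<p}" for I
  proof -
    have "card (\<Union>r\<in>I. B r) = (\<Sum>r\<in>I. card (B r))"
      using that finA by (intro card_UN_disjoint) (auto simp: B_def intro: finite_subset)
    also have "\<dots> = (\<Sum>r\<in>I. card (B 0))" using that eq by (intro sum.cong) auto
    finally show ?thesis by simp
  qed
  have "(\<Union>r\<in>{..<p}. B r) = A" using p(4) by (auto simp: B_def)
  hence cA: "card A = p * card (B 0)" using cU[of "{..<p}"] by simp
  have "{k. k < N \<and> (\<forall>q\<in>insert p S. k mod q \<notin> R q)} = (\<Union>r\<in>{..<p} - R p. B r)"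
    using p(4) by (auto simp: B_def A_def)
  hence "card {k. k < N \<and> (\<forall>q\<in>insert p S. k mod q \<notin> R q)} = (p - card (R p)) * card (B 0)"
    using cU[of "{..<p} - R p"] p(3) by (simp add: card_Diff_subset finite_subset)
  moreover have "card (R p) \<le> p" using card_mono[OF _ p(3)] by simp
  ultimately have "real (card {k. k < N \<and> (\<forall>q\<in>insert p S. k mod q \<notin> R q)}) = (real p - real (card (R p))) * real (card (B 0))"
    by (simp add: of_nat_diff)
  also have "\<dots> = (1 - real (card (R p)) / real p) * real (card A)"
    using p(4) unfolding cA by (simp add: field_simps)
  also have "real (card A) = real N * (\<Prod>p\<in>S. 1 - real (card (R p)) / real p)"
    unfolding A_def using insert.prems by (intro insert.IH) auto
  finally show ?case using insert.hyps by simp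
qed

text \<open>Numerators with \<open>a * n - b * m = c * gcd m n\<close>: the offset is measured in
  units of the gcd.\<close>

definition lattice_pairs :: "nat \<Rightarrow> nat \<Rightarrow> int \<Rightarrow> (nat \<times> nat) set" where
  "lattice_pairs m n c = {(a,b). a \<in> {1..m} \<and> b \<in> {1..n} \<and> coprime a m \<and> coprime b n \<and>
     int a * int (n div gcd m n) - int b * int (m div gcd m n) = c}"

lemma finite_lattice_pairs [simp]: "finite (lattice_pairs m n c)"
  by (rule finite_subset[of _ "{1..m}\<times>{1..n}"]) (auto simp: lattice_pairs_def)

lemma tot_ratio_eq_prod: "0 < n \<Longrightarrow> tot_ratio n = (\<Prod>p\<in>prime_factors n. 1 - 1 / real p)"
  by (simp add: tot_ratio_def totient_formula2)

text \<open>Solutions lie on one line \<open>(a1 + m' * j, b1 + n' * j)\<close> with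
  \<open>j < gcd m n\<close>. Coprimality excludes residues of \<open>j\<close> modulo each prime of
  the gcd: at least one, and two if the prime divides neither \<open>k\<close> nor \<open>c\<close>.
  As \<open>j\<close> runs through a full period of all these primes, the sieve is exact.\<close>

lemma card_lattice_pairs_le:
  assumes m: "0 < m" and n: "0 < n" and c: "c \<noteq> 0"
  defines "k \<equiv> (m div gcd m n) * (n div gcd m n)"
  shows "real (card (lattice_pairs m n c)) \<le> (if coprime (nat \<bar>c\<bar>) k then
     real (gcd m n) * tot_ratio m * tot_ratio n / tot_ratio k / tot_ratio (nat \<bar>c\<bar>) else 0)"
proof (cases "lattice_pairs m n c = {}")
  case True
  thus ?thesis by (simp only: card.empty) simp
next
  case False
  define d where "d = gcd m n"
  define m' where "m' = m div d"
  define n' where "n' = n div d"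
  have d: "0 < d" "m = d * m'" "n = d * n'" using m by (auto simp: d_def m'_def n'_def)
  have m'n': "0 < m'" "0 < n'" using d m n by auto
  have cop: "coprime m' n'" unfolding m'_def n'_def d_def using m n by (intro div_gcd_coprime) auto
  have k: "k = m' * n'" by (simp add: k_def m'_def n'_def d_def)
  define L where "L = lattice_pairs m n c"
  have L: "1 \<le> a" "a \<le> m" "1 \<le> b" "b \<le> n" "coprime a m" "coprime b n" "int a * int n' - int b * int m' = c"
    if "(a,b) \<in> L" for a b using that by (auto simp: L_def lattice_pairs_def n'_def m'_def d_def)
  have finL: "finite L" by (simp add: L_def)
  \<comment> \<open>The solution with least \<open>a\<close> is taken as base point, so that all
    others have a natural number as parameter \<open>j\<close>.\<close>
  define a1 where "a1 = Min (fst ` L)"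
  have "a1 \<in> fst ` L" unfolding a1_def using False finL by (intro Min_in) (auto simp: L_def)
  then obtain b1 where ab1: "(a1,b1) \<in> L" by auto
  have a1: "a1 \<le> a" if "(a,b) \<in> L" for a b
    unfolding a1_def using that finL by (intro Min_le) (auto intro: rev_image_eqI)
  note L1 = L[OF ab1]
  have cc: "coprime (nat \<bar>c\<bar>) k"
  proof (rule ccontr)
    assume "\<not> coprime (nat \<bar>c\<bar>) k"
    hence "gcd (nat \<bar>c\<bar>) k \<noteq> 1" by (simp only: coprime_iff_gcd_eq_1 not_False_eq_True)
    then obtain p where p0: "prime p" "p dvd gcd (nat \<bar>c\<bar>) k" using prime_factor_nat by blast
    have p: "prime p" "p dvd nat \<bar>c\<bar>" "p dvd k"
      using p0(1) dvd_trans[OF p0(2) gcd_dvd1] dvd_trans[OF p0(2) gcd_dvd2] by blast+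
    have pc: "int p dvd c" using p(2) by (simp add: int_dvd_int_iff[symmetric])
    have "p dvd m' \<or> p dvd n'" using p k by (simp add: prime_dvd_mult_iff)
    thus False
    proof
      assume pm: "p dvd m'"
      hence "int p dvd int b1 * int m'" by simp
      hence "int p dvd c + int b1 * int m'" using pc by (rule dvd_add[rotated])
      moreover have "c + int b1 * int m' = int (a1 * n')" using L1(7) by simp
      ultimately have "int p dvd int (a1 * n')" by (simp only:)
      hence "p dvd a1 * n'" by (simp only: int_dvd_int_iff)
      moreover have "\<not> p dvd n'" using cop pm p(1) by (meson coprime_common_divisor not_prime_unit)
      ultimately have "p dvd a1" using p(1) by (simp add: prime_dvd_mult_iff)
      moreover have "p dvd m" using pm d by simp
      ultimately show False using L1(5) p(1) by (meson coprime_common_divisor not_prime_unit)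
    next
      assume pn: "p dvd n'"
      hence "int p dvd int a1 * int n'" by simp
      hence "int p dvd int a1 * int n' - c" using pc by (rule dvd_diff)
      moreover have "int a1 * int n' - c = int (b1 * m')" using L1(7) by simp
      ultimately have "int p dvd int (b1 * m')" by (simp only:)
      hence "p dvd b1 * m'" by (simp only: int_dvd_int_iff)
      moreover have "\<not> p dvd m'" using cop pn p(1) by (meson coprime_common_divisor not_prime_unit)
      ultimately have "p dvd b1" using p(1) by (simp add: prime_dvd_mult_iff)
      moreover have "p dvd n" using pn d by simp
      ultimately show False using L1(6) p(1) by (meson coprime_common_divisor not_prime_unit)
    qed
  qed
  define S where "S = prime_factors d"
  \<comment> \<open>The residues of \<open>j\<close> at which \<open>p\<close> would divide one of
    the two numerators, although it divides both denominators.\<close>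
  define R where "R = (\<lambda>p. {r. r < p \<and> (p dvd a1 + m' * r \<or> p dvd b1 + n' * r)})"
  define K where "K = {j. j < d \<and> (\<forall>p\<in>S. j mod p \<notin> R p)}"
  have S: "prime p" "p dvd d" "0 < p" "2 \<le> p" if "p \<in> S" for p
    using that prime_gt_0_nat prime_ge_2_nat by (auto simp: S_def prime_factors_dvd)
  have shift: "\<exists>j. a = a1 + m' * j \<and> b = b1 + n' * j \<and> j < d" if ab: "(a,b) \<in> L" for a b
  proof -
    have eq: "int (a - a1) * int n' = (int b - int b1) * int m'"
      using L(7)[OF ab] L1(7) a1[OF ab] by (simp add: of_nat_diff algebra_simps)
    have "int m' dvd int (a - a1) * int n'" unfolding eq by simp
    hence "m' dvd (a - a1) * n'" by (simp only: of_nat_mult[symmetric] int_dvd_int_iff)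
    hence "m' dvd a - a1" using cop by (simp add: coprime_dvd_mult_left_iff)
    then obtain j where j: "a - a1 = m' * j" by blast
    have a: "a = a1 + m' * j" using j a1[OF ab] by simp
    have "int m' * (int j * int n') = int m' * (int b - int b1)" using eq unfolding j by (simp add: algebra_simps)
    hence "int j * int n' = int b - int b1" using m'n' by simp
    hence "int b = int (b1 + n' * j)" by (simp add: algebra_simps)
    hence b: "b = b1 + n' * j" by (simp only: of_nat_eq_iff)
    have "a1 + m' * j \<le> m' * d" using a L(2)[OF ab] d(2) by (simp add: mult.commute)
    hence "m' * j < m' * d" using L1(1) by linarith
    hence "j < d" by simp
    thus ?thesis using a b by blast
  qed
  have "L \<subseteq> (\<lambda>j. (a1 + m' * j, b1 + n' * j)) ` K"
  proof clarify
    fix a b assume ab: "(a,b) \<in> L"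
    then obtain j where j: "a = a1 + m' * j" "b = b1 + n' * j" "j < d" using shift by blast
    have "j mod p \<notin> R p" if p: "p \<in> S" for p
    proof
      assume r: "j mod p \<in> R p"
      have e: "(s + u * (j mod p)) mod p = (s + u * j) mod p" for s u :: nat
        by (metis mod_add_right_eq mod_mult_right_eq)
      have "p dvd a \<or> p dvd b"
        using r e[of a1 m'] e[of b1 n'] unfolding R_def j by (auto simp: dvd_eq_mod_eq_0)
      moreover have "p dvd m" "p dvd n" using S(2)[OF p] d by auto
      ultimately show False using L(5,6)[OF ab] S(1)[OF p] by (meson coprime_common_divisor not_prime_unit)
    qed
    hence "j \<in> K" using j by (simp add: K_def)
    thus "(a,b) \<in> (\<lambda>j. (a1 + m' * j, b1 + n' * j)) ` K" using j by blast
  qed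
  hence "card L \<le> card K"
    by (rule surj_card_le[rotated]) (auto simp: K_def)
  hence "real (card L) \<le> real (card K)" by simp
  also have "\<dots> = real d * (\<Prod>p\<in>S. 1 - real (card (R p)) / real p)"
    unfolding K_def using S d by (intro CRT_count) (auto simp: S_def R_def)
  also have "\<dots> \<le> real d * (tot_ratio m * tot_ratio n / tot_ratio k / tot_ratio (nat \<bar>c\<bar>))"
  proof (rule mult_left_mono)
    define U where "U = prime_factors (m * n)"
    define C where "C = nat \<bar>c\<bar>"
    have C: "0 < C" using c by (simp add: C_def)
    have finU: "finite U" by (simp add: U_def)
    have U: "prime p" "2 \<le> p" if "p \<in> U" for p
      using that prime_ge_2_nat by (auto simp: U_def prime_factors_dvd)
    have k0: "0 < k" using k m'n' by simp
    have ext: "(\<Prod>p\<in>prime_factors x. g p) = (\<Prod>p\<in>U. if p dvd x then g p else 1)"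
      if "0 < x" "prime_factors x \<subseteq> U" for x and g :: "nat \<Rightarrow> real"
      using that finU by (intro prod.mono_neutral_cong_left) (auto simp: U_def prime_factors_dvd)
    have subs: "prime_factors m \<subseteq> U" "prime_factors n \<subseteq> U" "prime_factors d \<subseteq> U" "prime_factors k \<subseteq> U"
      using m n d k m'n' by (auto simp: U_def prime_factors_dvd prime_dvd_mult_iff)
    define g where "g = (\<lambda>p. 1 - 1 / real p)"
    have g: "0 < g p" "g p \<le> 1" if "p \<in> U" for p using U(2)[OF that] by (auto simp: g_def)
    \<comment> \<open>The local comparison only sees primes of \<open>m * n\<close>; further primes
      of \<open>c\<close> can only increase \<open>1 / tot_ratio C\<close>.\<close>
    have trC: "1 / tot_ratio C \<ge> (\<Prod>p\<in>U. if p dvd C then 1 / g p else 1)"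
    proof -
      have "(\<Prod>p\<in>U. if p dvd C then 1 / g p else 1) = (\<Prod>p\<in>{p\<in>U. p dvd C}. 1 / g p)"
        using finU by (simp add: prod.inter_filter)
      also have "\<dots> \<le> (\<Prod>p\<in>prime_factors C. 1 / g p)"
      proof (rule prod_mono2)
        show "{p \<in> U. p dvd C} \<subseteq> prime_factors C" using C U by (auto simp: prime_factors_dvd)
        fix p assume "p \<in> prime_factors C - {p \<in> U. p dvd C}"
        hence "p \<ge> 2" using prime_ge_2_nat by (auto simp: prime_factors_dvd)
        thus "1 \<le> 1 / g p" by (simp add: g_def field_simps)
      qed (use g in \<open>auto intro: less_imp_le\<close>)
      also have "\<dots> = 1 / tot_ratio C" using C by (simp add: tot_ratio_eq_prod g_def prod_dividef)
      finally show ?thesis .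
    qed
    have tr: "tot_ratio x = (\<Prod>p\<in>U. if p dvd x then g p else 1)" if "0 < x" "prime_factors x \<subseteq> U" for x
      unfolding tot_ratio_eq_prod[OF that(1)] ext[OF that] g_def by simp
    have "(\<Prod>p\<in>S. 1 - real (card (R p)) / real p) = (\<Prod>p\<in>U. if p dvd d then 1 - real (card (R p)) / real p else 1)"
      unfolding S_def using d subs by (intro ext) auto
    also have "\<dots> \<le> (\<Prod>p\<in>U. (if p dvd m then g p else 1) * (if p dvd n then g p else 1) / (if p dvd k then g p else 1)
        * (if p dvd C then 1 / g p else 1))"
    \<comment> \<open>Prime by prime: off \<open>d\<close>, exactly one of \<open>m\<close>,
      \<open>n\<close> is divisible and the factor cancels with that of \<open>k\<close>. On
      \<open>d\<close>, one excluded residue matches \<open>g p\<close> when \<open>p\<close>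
      divides \<open>k\<close> or \<open>C\<close>, and otherwise two are needed to match
      \<open>g p * g p\<close>.\<close>
    proof (rule prod_mono, rule conjI)
      fix p assume pU: "p \<in> U"
      note gp = g[OF pU] and Up = U[OF pU]
      have cardR: "card (R p) \<le> p" using card_mono[of "{..<p}" "R p"] by (auto simp: R_def)
      have finR: "finite (R p)" by (simp add: R_def)
      show "0 \<le> (if p dvd d then 1 - real (card (R p)) / real p else 1)"
        using cardR Up by (auto simp: field_simps)
      have g1: "1 \<le> 1 / g p" using gp by (simp add: field_simps)
      show "(if p dvd d then 1 - real (card (R p)) / real p else 1) \<le>
        (if p dvd m then g p else 1) * (if p dvd n then g p else 1) / (if p dvd k then g p else 1) * (if p dvd C then 1 / g p else 1)"
      proof (cases "p dvd d")
        case False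
        have "p dvd m * n" using pU by (simp add: U_def in_prime_factors_imp_dvd)
        hence "p dvd m \<or> p dvd n" using prime_dvd_mult_iff[OF Up(1)] by simp
        moreover have "\<not> (p dvd m \<and> p dvd n)" using False by (auto simp: d_def)
        moreover have "p dvd k" using \<open>p dvd m \<or> p dvd n\<close> False d k Up(1) by (auto simp: prime_dvd_mult_iff)
        ultimately show ?thesis using False g1 gp by auto
      next
        case True
        hence pmn: "p dvd m" "p dvd n" using d by auto
        have ra: "\<exists>r<p. p dvd a1 + m' * r" if "\<not> p dvd m'"
        proof -
          have "coprime p m'" using that Up(1) by (simp add: prime_imp_coprime)
          hence "coprime m' p" by (simp add: coprime_commute)
          then obtain r where "r < p" "(a1 + m' * r) mod p = 0 mod p" using mod_solve[of m' p a1 0] Up by auto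
          thus ?thesis by (auto simp: dvd_eq_mod_eq_0)
        qed
        have rb: "\<exists>r<p. p dvd b1 + n' * r" if "\<not> p dvd n'"
        proof -
          have "coprime p n'" using that Up(1) by (simp add: prime_imp_coprime)
          hence "coprime n' p" by (simp add: coprime_commute)
          then obtain r where "r < p" "(b1 + n' * r) mod p = 0 mod p" using mod_solve[of n' p b1 0] Up by auto
          thus ?thesis by (auto simp: dvd_eq_mod_eq_0)
        qed
        have nb: "\<not> p dvd m' \<or> \<not> p dvd n'" using cop Up(1) by (meson coprime_common_divisor not_prime_unit)
        have R1: "1 \<le> card (R p)"
        proof -
          have "R p \<noteq> {}" using ra rb nb by (auto simp: R_def)
          thus ?thesis using finR by (simp add: Suc_le_eq card_gt_0_iff)
        qed
        have l1: "1 - real (card (R p)) / real p \<le> g p"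
          using R1 Up by (simp add: g_def divide_right_mono)
        show ?thesis
        proof (cases "p dvd k \<or> p dvd C")
          case True
          have "g p \<le> g p * g p / (if p dvd k then g p else 1) * (if p dvd C then 1 / g p else 1)"
            using True gp g1 by (auto simp: field_simps)
          thus ?thesis using l1 \<open>p dvd d\<close> pmn by simp
        next
          case False
          hence nd: "\<not> p dvd m'" "\<not> p dvd n'" using k by auto
          obtain s where s: "s < p" "p dvd a1 + m' * s" using ra nd by blast
          obtain t where t: "t < p" "p dvd b1 + n' * t" using rb nd by blast
          \<comment> \<open>If one \<open>j\<close> made both numerators divisible by
            \<open>p\<close>, then \<open>p\<close> would divide their fixed offset
            \<open>c\<close>.\<close>
          have "s \<noteq> t"
          proof
            assume "s = t"
            hence "int p dvd int (a1 + m' * s) * int n' - int (b1 + n' * s) * int m'"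
              using s t by (intro dvd_diff dvd_mult2) (simp_all only: int_dvd_int_iff)
            also have "int (a1 + m' * s) * int n' - int (b1 + n' * s) * int m' = c"
              using L1(7) by (simp add: algebra_simps)
            finally have "p dvd C" by (simp add: C_def int_dvd_int_iff[symmetric])
            thus False using False by simp
          qed
          moreover have "{s,t} \<subseteq> R p" using s t by (auto simp: R_def)
          ultimately have "2 \<le> card (R p)" using card_mono[OF finR, of "{s,t}"] by simp
          hence "1 - real (card (R p)) / real p \<le> 1 - 2 / real p" using Up by (simp add: divide_right_mono)
          also have "\<dots> \<le> g p * g p" using Up by (simp add: g_def field_simps)
          finally show ?thesis using False \<open>p dvd d\<close> pmn by simp
        qed
      qed
    qed
    also have "\<dots> = tot_ratio m * tot_ratio n / tot_ratio k * (\<Prod>p\<in>U. if p dvd C then 1 / g p else 1)"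
      unfolding tr[OF m subs(1)] tr[OF n subs(2)] tr[OF k0 subs(4)]
      by (simp only: prod.distrib prod_dividef)
    also have "\<dots> \<le> tot_ratio m * tot_ratio n / tot_ratio k * (1 / tot_ratio C)"
      using trC by (intro mult_left_mono) auto
    finally show "(\<Prod>p\<in>S. 1 - real (card (R p)) / real p) \<le> tot_ratio m * tot_ratio n / tot_ratio k / tot_ratio (nat \<bar>c\<bar>)"
      by (simp add: C_def)
  qed simp
  finally show ?thesis using cc by (simp add: L_def d_def mult_ac)
qed

lemma diff_primes_eq:
  assumes "0 < m" "0 < n"
  shows "diff_primes m n = prime_factors ((m div gcd m n) * (n div gcd m n))"
proof -
  define d where "d = gcd m n"
  define m' where "m' = m div d"
  define n' where "n' = n div d"
  have d: "0 < d" "m = d * m'" "n = d * n'" using assms by (auto simp: d_def m'_def n'_def)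
  have m'n': "0 < m'" "0 < n'" using d assms by auto
  have cop: "coprime m' n'" unfolding m'_def n'_def d_def using assms by (intro div_gcd_coprime) auto
  have "p \<in> diff_primes m n \<longleftrightarrow> p \<in> prime_factors (m' * n')" for p
  proof (cases "prime p")
    case True
    have "multiplicity p m = multiplicity p d + multiplicity p m'" "multiplicity p n = multiplicity p d + multiplicity p n'"
      unfolding d(2) d(3) using True d m'n' by (auto intro!: prime_elem_multiplicity_mult_distrib)
    hence "p \<in> diff_primes m n \<longleftrightarrow> multiplicity p m' \<noteq> multiplicity p n'"
      using True by (simp add: diff_primes_def)
    moreover have "multiplicity p m' > 0 \<longleftrightarrow> p dvd m'" "multiplicity p n' > 0 \<longleftrightarrow> p dvd n'"
      using True m'n' by (simp_all add: prime_multiplicity_gt_zero_iff)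
    moreover have "\<not> (p dvd m' \<and> p dvd n')" using cop True by (meson coprime_common_divisor not_prime_unit)
    ultimately have "p \<in> diff_primes m n \<longleftrightarrow> p dvd m' \<or> p dvd n'" by (metis gr0I less_numeral_extra(3))
    thus ?thesis using True m'n' by (auto simp: prime_factors_dvd prime_dvd_mult_iff)
  next
    case False
    thus ?thesis by (auto simp: diff_primes_def dest: in_prime_factors_imp_prime)
  qed
  thus ?thesis unfolding m'_def n'_def d_def by blast
qed

text \<open>The condition, with denominators cleared, under which intervals around distinct
  fractions \<open>a / m\<close> and \<open>b / n\<close> can meet.\<close>

definition near_pairs :: "(nat \<Rightarrow> real) \<Rightarrow> nat \<Rightarrow> nat \<Rightarrow> (nat \<times> nat) set" where
  "near_pairs \<psi> m n = {(a,b). a \<in> {1..m} \<and> b \<in> {1..n} \<and> coprime a m \<and> coprime b n \<and>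
     \<bar>real a * real n - real b * real m\<bar> < real m * \<psi> n + real n * \<psi> m \<and> a * n \<noteq> b * m}"

text \<open>Close pairs have a nonzero offset below \<open>2 * D\<close>, and summing the count per
  offset gives \<open>sieve_sum k (2 * D) / tot_ratio k\<close>. The sieve saving cancels the primes
  of \<open>k\<close> up to \<open>2 * D\<close> in the denominator; those beyond leave the
  exponential.\<close>

lemma card_near_pairs_le:
  obtains K where "K > 0" "\<And>m n \<psi>. 0 < m \<Longrightarrow> 0 < n \<Longrightarrow> 0 \<le> \<psi> m \<Longrightarrow> 0 \<le> \<psi> n \<Longrightarrow>
    real (card (near_pairs \<psi> m n)) \<le>
      K * max (real m * \<psi> n) (real n * \<psi> m) * (tot_ratio m * tot_ratio n) * exp (large_prime_sum \<psi> m n)"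
proof -
  obtain C where C: "C > 0" "\<And>k X. 0 < k \<Longrightarrow> 1 \<le> X \<Longrightarrow>
     sieve_sum k X \<le> C * X * (\<Prod>p | p \<in> prime_factors k \<and> real p \<le> X. 1 - 1 / real p)"
    using sieve_sum_bound by blast
  define K where "K = 4 * C * exp 1"
  have K0: "K > 0" using C by (simp add: K_def)
  have "real (card (near_pairs \<psi> m n)) \<le>
      K * max (real m * \<psi> n) (real n * \<psi> m) * (tot_ratio m * tot_ratio n) * exp (large_prime_sum \<psi> m n)"
    if mn: "0 < m" "0 < n" and psi: "0 \<le> \<psi> m" "0 \<le> \<psi> n" for m n \<psi>
  proof -
    define d where "d = gcd m n"
    define k where "k = (m div gcd m n) * (n div gcd m n)"
    define Z where "Z = max (real m * \<psi> n) (real n * \<psi> m)"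
    define D where "D = overlap_scale \<psi> m n"
    have d0: "0 < d" using mn by (simp add: d_def)
    have DZ: "real d * D = Z" using d0 by (simp add: D_def overlap_scale_def Z_def d_def)
    have Z0: "0 \<le> Z" using psi mn by (simp add: Z_def le_max_iff_disj)
    have D0: "0 \<le> D" using DZ Z0 d0 by (metis zero_le_mult_iff of_nat_0_less_iff not_less order.asym)
    have k0: "0 < k" using mn by (auto simp: k_def div_greater_zero_iff intro: gcd_le1_nat gcd_le2_nat)
    have PF: "prime_factors k = diff_primes m n" using diff_primes_eq[OF mn] by (simp add: k_def)
    define B where "B = (\<lambda>c. if coprime c k then real d * tot_ratio m * tot_ratio n / tot_ratio k / tot_ratio c else 0)"
    have B0: "0 \<le> B c" for c by (simp add: B_def)
    define U where "U = upto_set (2 * D)"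
    have finU: "finite U" by (simp add: U_def)
    define Cs where "Cs = int ` U \<union> (\<lambda>c. - int c) ` U"
    have "near_pairs \<psi> m n \<subseteq> (\<Union>c\<in>Cs. lattice_pairs m n c)"
    proof clarify
      fix a b assume "(a,b) \<in> near_pairs \<psi> m n"
      hence ab: "a \<in> {1..m}" "b \<in> {1..n}" "coprime a m" "coprime b n"
        "\<bar>real a * real n - real b * real m\<bar> < real m * \<psi> n + real n * \<psi> m" "a * n \<noteq> b * m"
        by (auto simp: near_pairs_def)
      define c where "c = int a * int (n div d) - int b * int (m div d)"
      have nd: "n = d * (n div d)" "m = d * (m div d)" by (simp_all add: d_def)
      have "int d * c = int a * int (d * (n div d)) - int b * int (d * (m div d))"
        unfolding c_def by (simp only: of_nat_mult right_diff_distrib mult_ac)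
      hence dc: "int d * c = int a * int n - int b * int m" by (simp only: nd[symmetric])
      have "int (a * n) \<noteq> int (b * m)" using ab(6) by (simp only: of_nat_eq_iff not_False_eq_True)
      hence c0: "c \<noteq> 0" using dc by auto
      have "real d * real_of_int \<bar>c\<bar> = \<bar>real_of_int (int d * c)\<bar>" by (simp add: abs_mult)
      also have "\<dots> = \<bar>real a * real n - real b * real m\<bar>" unfolding dc by simp
      also have "\<dots> < real m * \<psi> n + real n * \<psi> m" by (rule ab)
      also have "\<dots> \<le> 2 * Z" by (simp add: Z_def)
      also have "\<dots> = real d * (2 * D)" using DZ by simp
      finally have "real_of_int \<bar>c\<bar> < 2 * D" using d0 by simp
      hence "nat \<bar>c\<bar> \<in> U" using c0 by (simp add: U_def upto_set_def)
      moreover have "c = int (nat \<bar>c\<bar>) \<or> c = - int (nat \<bar>c\<bar>)" by linarith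
      ultimately have "c \<in> Cs" unfolding Cs_def by blast
      moreover have "(a,b) \<in> lattice_pairs m n c" using ab by (simp add: lattice_pairs_def c_def d_def)
      ultimately show "(a,b) \<in> (\<Union>c\<in>Cs. lattice_pairs m n c)" by blast
    qed
    hence "card (near_pairs \<psi> m n) \<le> card (\<Union>c\<in>Cs. lattice_pairs m n c)"
      using finU by (intro card_mono) (auto simp: Cs_def)
    also have "\<dots> \<le> (\<Sum>c\<in>Cs. card (lattice_pairs m n c))"
      using finU by (intro card_UN_le) (auto simp: Cs_def)
    finally have "real (card (near_pairs \<psi> m n)) \<le> (\<Sum>c\<in>Cs. real (card (lattice_pairs m n c)))"
      by (simp only: of_nat_sum[symmetric] of_nat_le_iff)
    also have "\<dots> \<le> (\<Sum>c\<in>Cs. B (nat \<bar>c\<bar>))"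
    proof (rule sum_mono)
      fix c assume "c \<in> Cs"
      hence "c \<noteq> 0" by (auto simp: Cs_def U_def upto_set_def)
      thus "real (card (lattice_pairs m n c)) \<le> B (nat \<bar>c\<bar>)"
        using card_lattice_pairs_le[OF mn] unfolding B_def k_def d_def by blast
    qed
    also have "\<dots> \<le> (\<Sum>c\<in>int ` U. B (nat \<bar>c\<bar>)) + (\<Sum>c\<in>(\<lambda>c. - int c) ` U. B (nat \<bar>c\<bar>))"
      using finU B0 by (intro sum_Un_le) (auto simp: Cs_def)
    also have "(\<Sum>c\<in>int ` U. B (nat \<bar>c\<bar>)) = (\<Sum>c\<in>U. B c)"
      by (subst sum.reindex) (auto simp: inj_on_def)
    also have "(\<Sum>c\<in>(\<lambda>c. - int c) ` U. B (nat \<bar>c\<bar>)) = (\<Sum>c\<in>U. B c)"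
      by (subst sum.reindex) (auto simp: inj_on_def)
    also have "(\<Sum>c\<in>U. B c) = real d * tot_ratio m * tot_ratio n / tot_ratio k * sieve_sum k (2 * D)"
    proof -
      have "(\<Sum>c\<in>U. B c) = (\<Sum>c | c \<in> U \<and> coprime c k. real d * tot_ratio m * tot_ratio n / tot_ratio k * (1 / tot_ratio c))"
        unfolding B_def using finU by (intro sum.mono_neutral_cong_right) auto
      thus ?thesis by (simp only: sieve_sum_def U_def sum_distrib_left)
    qed
    finally have card1: "real (card (near_pairs \<psi> m n)) \<le> 2 * (real d * tot_ratio m * tot_ratio n / tot_ratio k * sieve_sum k (2 * D))"
      by (simp only: mult_2)
    show ?thesis
    proof (cases "2 * D < 1")
      case True
      hence "{c. c \<in> upto_set (2 * D) \<and> coprime c k} = {}" by (auto simp: upto_set_def)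
      hence "sieve_sum k (2 * D) = 0" by (simp only: sieve_sum_def sum.empty)
      hence "real (card (near_pairs \<psi> m n)) \<le> 0" using card1 by simp
      also have "0 \<le> K * Z * (tot_ratio m * tot_ratio n) * exp (large_prime_sum \<psi> m n)"
        using K0 Z0 by (intro mult_nonneg_nonneg) auto
      finally show ?thesis by (simp add: Z_def)
    next
      case False
      define P1 where "P1 = {p. p \<in> prime_factors k \<and> real p \<le> 2 * D}"
      define P2 where "P2 = {p. p \<in> prime_factors k \<and> 2 * D < real p}"
      have fin: "finite P1" "finite P2" by (simp_all add: P1_def P2_def)
      have ge2: "p \<ge> 2" if "p \<in> P1 \<union> P2" for p
        using that by (auto simp: P1_def P2_def dest!: in_prime_factors_imp_prime prime_ge_2_nat)
      have trk: "tot_ratio k = (\<Prod>p\<in>P1. 1 - 1 / real p) * (\<Prod>p\<in>P2. 1 - 1 / real p)"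
      proof -
        have e: "prime_factors k = P1 \<union> P2" by (auto simp: P1_def P2_def)
        show ?thesis unfolding tot_ratio_eq_prod[OF k0] e
          by (rule prod.union_disjoint) (use fin in \<open>auto simp: P1_def P2_def\<close>)
      qed
      have fac: "0 < 1 - 1 / real p" if "p \<in> P1 \<union> P2" for p
      proof -
        have "2 \<le> real p" using ge2[OF that] by simp
        thus ?thesis by (simp add: field_simps)
      qed
      have pos: "0 < (\<Prod>p\<in>P1. 1 - 1 / real p)" "0 < (\<Prod>p\<in>P2. 1 - 1 / real p)"
        by (rule prod_pos, rule fac, simp)+
      have "sieve_sum k (2 * D) / tot_ratio k \<le> C * (2 * D) * (\<Prod>p\<in>P1. 1 - 1 / real p) / tot_ratio k"
        using C(2)[OF k0, of "2 * D"] False unfolding P1_def by (intro divide_right_mono) auto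
      also have "\<dots> = C * (2 * D) * (\<Prod>p\<in>P2. 1 / (1 - 1 / real p))"
        unfolding trk using pos by (simp add: prod_dividef)
      also have "\<dots> \<le> C * (2 * D) * (exp 1 * exp (\<Sum>p\<in>P2. 1 / real p))"
        using C D0 fin ge2 by (intro mult_left_mono prod_inverse_one_minus_le_exp) auto
      also have "\<dots> \<le> C * (2 * D) * (exp 1 * exp (large_prime_sum \<psi> m n))"
      proof -
        \<comment> \<open>Only primes beyond \<open>2 * D\<close> survive, and they are among the
          primes beyond \<open>D\<close> counted by \<open>large_prime_sum\<close>.\<close>
        have "(\<Sum>p\<in>P2. 1 / real p) \<le> large_prime_sum \<psi> m n"
          unfolding large_prime_sum_def P2_def PF D_def[symmetric]
          using finite_diff_primes[OF mn] D0 by (intro sum_mono2) auto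
        thus ?thesis using C D0 by (intro mult_left_mono) auto
      qed
      finally have "real d * tot_ratio m * tot_ratio n * (sieve_sum k (2 * D) / tot_ratio k)
          \<le> real d * tot_ratio m * tot_ratio n * (C * (2 * D) * (exp 1 * exp (large_prime_sum \<psi> m n)))"
        by (intro mult_left_mono) auto
      hence "real (card (near_pairs \<psi> m n)) \<le> 2 * (real d * tot_ratio m * tot_ratio n * (C * (2 * D) * (exp 1 * exp (large_prime_sum \<psi> m n))))"
        using card1 by simp
      also have "\<dots> = K * (real d * D) * (tot_ratio m * tot_ratio n) * exp (large_prime_sum \<psi> m n)"
        by (simp add: K_def)
      finally show ?thesis unfolding DZ Z_def .
    qed
  qed
  thus ?thesis using that K0 by blast
qed

section \<open>Cauchy--Schwarz for the measure of a union\<close>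

text \<open>The counting function of the sets is supported on their union. Its squared distance to a
  multiple \<open>c\<close> of the indicator of the union is nonnegative, and
  \<open>c = s1 / u\<close> is the optimal choice.\<close>

lemma second_moment_union:
  fixes I :: "'i \<Rightarrow> 'a set"
  assumes fin: "finite T" and I: "\<And>i. i \<in> T \<Longrightarrow> I i \<in> fmeasurable M"
  shows "(\<Sum>i\<in>T. measure M (I i))\<^sup>2 \<le> measure M (\<Union>i\<in>T. I i) * (\<Sum>i\<in>T. \<Sum>j\<in>T. measure M (I i \<inter> I j))"
proof -
  define U where "U = (\<Union>i\<in>T. I i)"
  define s1 where "s1 = (\<Sum>i\<in>T. measure M (I i))"
  define s2 where "s2 = (\<Sum>i\<in>T. \<Sum>j\<in>T. measure M (I i \<inter> I j))"
  define u where "u = measure M U"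
  have U: "U \<in> fmeasurable M" unfolding U_def using fin I by (intro fmeasurable.finite_UN) auto
  have IU: "I i \<subseteq> U" if "i \<in> T" for i using that by (auto simp: U_def)
  have Iij: "I i \<inter> I j \<in> fmeasurable M" if "i \<in> T" "j \<in> T" for i j
    using I[OF that(1)] I[OF that(2)] by (intro fmeasurable_Int_fmeasurable) (auto simp: fmeasurableD)
  have int: "integrable M (indicator A :: 'a \<Rightarrow> real)" "integral\<^sup>L M (indicator A) = measure M A" if "A \<in> fmeasurable M" for A
    using that fmeasurableD2[OF that] fmeasurableD[OF that] sets.Int_space_eq2[OF fmeasurableD[OF that]]
    by (auto simp: less_top)
  have u0: "0 \<le> u" by (simp add: u_def)
  have quad: "0 \<le> s2 - 2 * c * s1 + c\<^sup>2 * u" for c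
  proof -
    define F where "F = (\<lambda>x. \<Sum>i\<in>T. indicator (I i) x :: real)"
    have "0 \<le> (\<integral>x. (F x - c * indicator U x)\<^sup>2 \<partial>M)" by (intro integral_nonneg_AE) auto
    also have "(\<lambda>x. (F x - c * indicator U x)\<^sup>2) =
       (\<lambda>x. (\<Sum>i\<in>T. \<Sum>j\<in>T. indicator (I i \<inter> I j) x) - 2 * c * (\<Sum>i\<in>T. indicator (I i) x) + c\<^sup>2 * indicator U x)"
    proof
      fix x
      have "F x * indicator U x = F x"
        unfolding F_def sum_distrib_right using IU by (intro sum.cong) (auto simp: indicator_def)
      moreover have "(indicator U x)\<^sup>2 = (indicator U x :: real)" by (simp add: indicator_def)
      moreover have "(F x)\<^sup>2 = (\<Sum>i\<in>T. \<Sum>j\<in>T. indicator (I i \<inter> I j) x)"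
        unfolding F_def power2_eq_square sum_product by (simp add: indicator_inter_arith)
      moreover have "(F x - c * indicator U x)\<^sup>2 = (F x)\<^sup>2 - 2 * c * (F x * indicator U x) + c\<^sup>2 * (indicator U x)\<^sup>2"
        by (simp add: power2_eq_square algebra_simps)
      ultimately show "(F x - c * indicator U x)\<^sup>2 =
        (\<Sum>i\<in>T. \<Sum>j\<in>T. indicator (I i \<inter> I j) x) - 2 * c * (\<Sum>i\<in>T. indicator (I i) x) + c\<^sup>2 * indicator U x"
        by (simp add: F_def)
    qed
    also have "(\<integral>x. (\<Sum>i\<in>T. \<Sum>j\<in>T. indicator (I i \<inter> I j) x) - 2 * c * (\<Sum>i\<in>T. indicator (I i) x) + c\<^sup>2 * indicator U x \<partial>M)
      = s2 - 2 * c * s1 + c\<^sup>2 * u"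
    proof -
      have i2: "integrable M (\<lambda>x. \<Sum>i\<in>T. \<Sum>j\<in>T. indicator (I i \<inter> I j) x :: real)"
        using int Iij by (intro Bochner_Integration.integrable_sum) auto
      have i1: "integrable M (\<lambda>x. \<Sum>i\<in>T. indicator (I i) x :: real)"
        using int I by (intro Bochner_Integration.integrable_sum) auto
      have e2: "(\<integral>x. (\<Sum>i\<in>T. \<Sum>j\<in>T. indicator (I i \<inter> I j) x :: real) \<partial>M) = s2"
        unfolding s2_def using int Iij
        by (subst Bochner_Integration.integral_sum) (auto intro!: Bochner_Integration.integrable_sum sum.cong simp: Bochner_Integration.integral_sum)
      have e1: "(\<integral>x. (\<Sum>i\<in>T. indicator (I i) x :: real) \<partial>M) = s1"
        unfolding s1_def using int I by (subst Bochner_Integration.integral_sum) auto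
      show ?thesis using i1 i2 int[OF U] e1 e2 by (simp add: u_def)
    qed
    finally show ?thesis .
  qed
  have "s1\<^sup>2 \<le> u * s2"
  proof (cases "u = 0")
    case True
    have "measure M (I i) = 0" if "i \<in> T" for i
      using measure_mono_fmeasurable[OF IU[OF that] fmeasurableD[OF I[OF that]] U] True
      by (simp add: u_def measure_le_0_iff)
    hence "s1 = 0" by (simp add: s1_def)
    thus ?thesis using True by simp
  next
    case False
    hence u: "u > 0" using u0 by simp
    have "0 \<le> s2 - 2 * (s1 / u) * s1 + (s1 / u)\<^sup>2 * u" by (rule quad)
    also have "\<dots> = s2 - s1\<^sup>2 / u" using u by (simp add: field_simps power2_eq_square)
    finally show ?thesis using u by (simp add: field_simps)
  qed
  thus ?thesis by (simp add: s1_def s2_def u_def U_def)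
qed

subsection \<open>The second moment and positive measure\<close>

lemma coprime_add_multiple_iff:
  fixes a k n :: int
  shows "coprime (a + k * n) n \<longleftrightarrow> coprime a n"
proof -
  have "gcd n (a + k * n) = gcd n a" by (subst add.commute) (rule gcd_add_mult)
  thus ?thesis unfolding coprime_iff_gcd_eq_1 by (simp only: gcd.commute[of _ n])
qed

section \<open>The periodic limsup set on the real line\<close>

definition near_set :: "(nat \<Rightarrow> real) \<Rightarrow> nat \<Rightarrow> real set" where
  "near_set \<psi> n = {x. \<exists>a::int. coprime a (int n) \<and> \<bar>real n * x - of_int a\<bar> < \<psi> n}"

definition near_limsup :: "(nat \<Rightarrow> real) \<Rightarrow> real set" where
  "near_limsup \<psi> = (\<Inter>N. \<Union>n\<in>{N..}. near_set \<psi> n)"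

lemma near_limsup_iff: "x \<in> near_limsup \<psi> \<longleftrightarrow> (\<exists>\<^sub>\<infinity>n. x \<in> near_set \<psi> n)"
  unfolding near_limsup_def INFM_nat_le by auto

lemma open_near_set: "open (near_set \<psi> n)"
proof -
  have "near_set \<psi> n = (\<Union>a\<in>{a. coprime a (int n)}. {x. \<bar>real n * x - of_int a\<bar> < \<psi> n})"
    by (auto simp: near_set_def)
  moreover have "open {x. \<bar>real n * x - of_int a\<bar> < \<psi> n}" for a :: int
    by (intro open_Collect_less continuous_intros)
  ultimately show ?thesis by auto
qed

lemma near_limsup_borel: "near_limsup \<psi> \<in> sets borel"
proof -
  have "(\<Union>n\<in>{N..}. near_set \<psi> n) \<in> sets borel" for N
    by (intro borel_open open_UN ballI open_near_set)
  thus ?thesis unfolding near_limsup_def by (intro sets.countable_INT'') auto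
qed

lemma near_set_shift: "x + 1 \<in> near_set \<psi> n \<longleftrightarrow> x \<in> near_set \<psi> n"
proof
  assume "x + 1 \<in> near_set \<psi> n"
  then obtain a where a: "coprime a (int n)" "\<bar>real n * (x + 1) - of_int a\<bar> < \<psi> n" by (auto simp: near_set_def)
  have "coprime (a - int n) (int n)" using a(1) by (metis coprime_iff_gcd_eq_1 gcd.commute gcd_diff1)
  moreover have "real n * x - of_int (a - int n) = real n * (x + 1) - of_int a" by (simp add: algebra_simps)
  ultimately show "x \<in> near_set \<psi> n" unfolding near_set_def using a(2) by (metis (mono_tags, lifting) mem_Collect_eq)
next
  assume "x \<in> near_set \<psi> n"
  then obtain a where a: "coprime a (int n)" "\<bar>real n * x - of_int a\<bar> < \<psi> n" by (auto simp: near_set_def)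
  have "coprime (a + int n) (int n)" using a(1) by (simp add: coprime_iff_gcd_eq_1)
  moreover have "real n * (x + 1) - of_int (a + int n) = real n * x - of_int a" by (simp add: algebra_simps)
  ultimately show "x + 1 \<in> near_set \<psi> n" unfolding near_set_def using a(2) by (metis (mono_tags, lifting) mem_Collect_eq)
qed

lemma near_limsup_shift: "x + 1 \<in> near_limsup \<psi> \<longleftrightarrow> x \<in> near_limsup \<psi>"
  by (simp add: near_limsup_iff near_set_shift)

lemma fmeasurable_bounded:
  fixes A :: "real set"
  assumes "A \<in> sets borel" "bounded A"
  shows "A \<in> fmeasurable lborel"
  using assms emeasure_bounded_finite[OF assms(2)] by (intro fmeasurableI) auto

lemma fmeasurable_subset_Icc:
  fixes A :: "real set"
  assumes "A \<in> sets borel" "A \<subseteq> {a..b}"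
  shows "A \<in> fmeasurable lborel"
  using assms(1) bounded_subset[OF bounded_closed_interval assms(2)] by (rule fmeasurable_bounded)

lemma lebesgue_translate:
  fixes A :: "real set"
  assumes "A \<in> sets borel"
  shows "(\<lambda>x. x + c) -` A \<in> sets borel" "emeasure lborel ((\<lambda>x. x + c) -` A) = emeasure lborel A"
proof -
  have m: "(\<lambda>x. x + c) \<in> borel_measurable borel" by simp
  show 1: "(\<lambda>x. x + c) -` A \<in> sets borel" using measurable_sets[OF m assms] by simp
  have "lborel = distr lborel borel (\<lambda>x. c + x)" by (rule lborel_distr_plus[symmetric])
  hence "emeasure lborel A = emeasure (distr lborel borel (\<lambda>x. c + x)) A" by simp
  also have "\<dots> = emeasure lborel ((\<lambda>x. c + x) -` A \<inter> space lborel)"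
    using assms by (intro emeasure_distr) auto
  finally show "emeasure lborel ((\<lambda>x. x + c) -` A) = emeasure lborel A" by (simp add: add.commute)
qed

lemma periodic_measure_interval:
  fixes A :: "real set"
  assumes A: "A \<in> sets borel" and per: "\<And>x. x + 1 \<in> A \<longleftrightarrow> x \<in> A"
  shows "emeasure lborel (A \<inter> {c..<c+1}) = emeasure lborel (A \<inter> {0..<1})"
proof -
  have perz: "x + of_int k \<in> A \<longleftrightarrow> x \<in> A" for x and k :: int
  proof (induction k rule: int_induct[where k = 0])
    case (step1 i)
    have "x + of_int (i + 1) = (x + of_int i) + 1" by simp
    thus ?case using per step1 by metis
  next
    case (step2 i)
    have "x + of_int i = (x + of_int (i - 1)) + 1" by simp
    thus ?case using per step2 by metis
  qed simp
  define k where "k = \<lceil>c\<rceil>"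
  have k: "c \<le> of_int k" "of_int k < c + 1" unfolding k_def by linarith+
  define L where "L = A \<inter> {c..<of_int k}"
  define R where "R = A \<inter> {of_int k..<c+1}"
  have meas: "L \<in> sets borel" "R \<in> sets borel" using A by (auto simp: L_def R_def)
  have "A \<inter> {c..<c+1} = L \<union> R" "L \<inter> R = {}" using k by (auto simp: L_def R_def)
  hence e1: "emeasure lborel (A \<inter> {c..<c+1}) = emeasure lborel L + emeasure lborel R"
    using meas by (simp add: plus_emeasure)
  have L': "(\<lambda>x. x + of_int (k - 1)) -` L = A \<inter> {c - of_int (k - 1)..<1}"
    using perz[of _ "k - 1"] by (auto simp: L_def)
  have R': "(\<lambda>x. x + of_int k) -` R = A \<inter> {0..<c + 1 - of_int k}"
    using perz[of _ k] by (auto simp: R_def)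
  have "A \<inter> {0..<1} = (A \<inter> {0..<c + 1 - of_int k}) \<union> (A \<inter> {c - of_int (k - 1)..<1})"
    "(A \<inter> {0..<c + 1 - of_int k}) \<inter> (A \<inter> {c - of_int (k - 1)..<1}) = {}" using k by auto
  hence "emeasure lborel (A \<inter> {0..<1}) = emeasure lborel (A \<inter> {0..<c + 1 - of_int k}) + emeasure lborel (A \<inter> {c - of_int (k - 1)..<1})"
    using A by (simp add: plus_emeasure)
  also have "\<dots> = emeasure lborel R + emeasure lborel L"
    using lebesgue_translate(2)[OF meas(1), of "of_int (k - 1)"] lebesgue_translate(2)[OF meas(2), of "of_int k"]
    unfolding L' R' by simp
  finally show ?thesis using e1 by (simp add: add.commute)
qed

lemma measure_Ico_split:
  fixes A :: "real set"
  assumes "A \<in> sets borel" "a \<le> b" "b \<le> c"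
  shows "measure lborel (A \<inter> {a..<c}) = measure lborel (A \<inter> {a..<b}) + measure lborel (A \<inter> {b..<c})"
proof -
  have fm: "A \<inter> {a..<b} \<in> fmeasurable lborel" for a b :: real
    using assms(1) by (intro fmeasurable_subset_Icc[of _ a b]) auto
  have "A \<inter> {a..<c} = (A \<inter> {a..<b}) \<union> (A \<inter> {b..<c})" "(A \<inter> {a..<b}) \<inter> (A \<inter> {b..<c}) = {}" using assms by auto
  thus ?thesis using fm by (simp add: measure_Un_AE measure_Union' fmeasurable_def less_top)
qed

text \<open>A set that is almost invariant under arbitrarily short translations \<open>1 / q\<close> has the same density
  in every interval, hence meets itself as if it were independent of itself.\<close>

lemma zero_one_of_short_periods:
  fixes A :: "real set"
  assumes A: "A \<in> sets borel" and per: "\<And>x. x + 1 \<in> A \<longleftrightarrow> x \<in> A"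
    and short: "\<And>N::nat. \<exists>q\<ge>N. 0 < q \<and> (\<forall>s::real. emeasure lborel (A \<inter> {s..<s + 1 / real q}) = emeasure lborel (A \<inter> {0..<1 / real q}))"
  shows "emeasure lborel (A \<inter> {0..<1}) = 0 \<or> emeasure lborel (A \<inter> {0..<1}) = 1"
proof -
  define \<mu> where "\<mu> = measure lborel (A \<inter> {0..<1})"
  define f where "f = (\<lambda>a b. measure lborel (A \<inter> {a..<b}))"
  have fm: "A \<inter> {a..<b} \<in> fmeasurable lborel" for a b :: real
    using A by (intro fmeasurable_subset_Icc[of _ a b]) auto
  have fadd: "f a c = f a b + f b c" if "a \<le> b" "b \<le> c" for a b c
    unfolding f_def by (rule measure_Ico_split[OF A that])
  have f0: "0 \<le> f a b" for a b by (simp add: f_def)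
  have fmono: "f a b \<le> f a' b'" if "a' \<le> a" "b \<le> b'" for a b a' b'
    unfolding f_def using that fm A by (intro measure_mono_fmeasurable) auto
  \<comment> \<open>A translate of length \<open>1 / q\<close> has measure \<open>\<mu> / q\<close>
    wherever it lies; filling \<open>{a..<b}\<close> with such blocks is wrong by at most one
    block.\<close>
  have step: "f a b \<le> (b - a) * \<mu> + 1 / real q" and step': "(b - a) * \<mu> - 1 / real q \<le> f a b"
    if q: "0 < q" "\<forall>s::real. emeasure lborel (A \<inter> {s..<s + 1 / real q}) = emeasure lborel (A \<inter> {0..<1 / real q})"
      and ab: "a \<le> b" for a b and q :: nat
  proof -
    define t where "t = f 0 (1 / real q)"
    have ft: "f s (s + 1 / real q) = t" for s using q(2) by (simp add: f_def t_def measure_def)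
    have block: "f s (s + real j / real q) = real j * t" for s j
    proof (induction j)
      case 0 thus ?case by (simp add: f_def)
    next
      case (Suc j)
      have e: "s + real (Suc j) / real q = s + real j / real q + 1 / real q" by (simp add: add_divide_distrib)
      have "f s (s + real (Suc j) / real q) = f s (s + real j / real q) + f (s + real j / real q) (s + real j / real q + 1 / real q)"
        unfolding e by (intro fadd) auto
      also have "\<dots> = real j * t + t" by (simp only: ft Suc)
      finally show ?case by (simp add: algebra_simps)
    qed
    have "\<mu> = f 0 (0 + real q / real q)" using q(1) by (simp add: \<mu>_def f_def)
    also have "\<dots> = real q * t" by (rule block)
    finally have t: "t = \<mu> / real q" using q(1) by simp
    have \<mu>1: "\<mu> \<le> 1"
    proof -
      have "\<mu> \<le> measure lborel {0..<1::real}" unfolding \<mu>_def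
        using A by (intro measure_mono_fmeasurable fmeasurable_subset_Icc[of _ 0 1]) auto
      thus ?thesis by simp
    qed
    have \<mu>0: "0 \<le> \<mu>" by (simp add: \<mu>_def)
    define j where "j = nat \<lfloor>(b - a) * real q\<rfloor>"
    have j: "real j \<le> (b - a) * real q" "(b - a) * real q \<le> real (Suc j)"
      using ab q(1) by (auto simp: j_def intro: mult_nonneg_nonneg) linarith+
    have "f a b \<le> f a (a + real (Suc j) / real q)"
      using j q(1) by (intro fmono) (auto simp: field_simps)
    also have "\<dots> = real (Suc j) * t" by (rule block)
    also have "\<dots> \<le> ((b - a) * real q + 1) * t" using j t \<mu>0 q(1) by (intro mult_right_mono) auto
    also have "\<dots> = (b - a) * \<mu> + \<mu> / real q" using q(1) unfolding t by (simp add: field_simps)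
    also have "\<mu> / real q \<le> 1 / real q" using \<mu>1 by (intro divide_right_mono) auto
    finally show "f a b \<le> (b - a) * \<mu> + 1 / real q" by simp
    have "(b - a) * \<mu> - 1 / real q \<le> (b - a) * \<mu> - \<mu> / real q" using \<mu>1 by (simp add: divide_right_mono)
    also have "\<dots> = ((b - a) * real q - 1) * t" using q(1) unfolding t by (simp add: field_simps)
    also have "\<dots> \<le> real j * t" using j t \<mu>0 q(1) by (intro mult_right_mono) auto
    also have "\<dots> = f a (a + real j / real q)" by (rule block[symmetric])
    also have "\<dots> \<le> f a b" using j q(1) by (intro fmono) (auto simp: field_simps)
    finally show "(b - a) * \<mu> - 1 / real q \<le> f a b" .
  qed
  have dens: "f a b = (b - a) * \<mu>" if ab: "a \<le> b" for a b
  proof -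
    have le: "\<bar>f a b - (b - a) * \<mu>\<bar> \<le> e" if "e > 0" for e
    proof -
      obtain N :: nat where N: "1 / e < real N" using reals_Archimedean2 by blast
      obtain q where q: "q \<ge> N" "0 < q" "\<forall>s::real. emeasure lborel (A \<inter> {s..<s + 1 / real q}) = emeasure lborel (A \<inter> {0..<1 / real q})"
        using short by blast
      have "1 / e < real q" using N q(1) by linarith
      hence "1 / real q \<le> e" using that q(2) by (simp add: field_simps)
      thus ?thesis using step[OF q(2,3) ab] step'[OF q(2,3) ab] by linarith
    qed
    have "\<bar>f a b - (b - a) * \<mu>\<bar> \<le> 0"
    proof (rule field_le_epsilon)
      fix e :: real assume "0 < e"
      from le[OF this] show "\<bar>f a b - (b - a) * \<mu>\<bar> \<le> 0 + e" by (simp only: add_0_left)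
    qed
    thus ?thesis by simp
  qed
  have sb: "sets borel = sigma_sets UNIV (range (\<lambda>(a,b). {a..<b::real}))"
    unfolding borel_eq_atLeastLessThan by (rule sets_measure_of) simp
  \<comment> \<open>Intervals generate the Borel sets, so the constant density extends from
    intervals to every Borel set, in particular to the set under consideration.\<close>
  have "density lborel (indicator A) = scale_measure (ennreal \<mu>) lborel"
  proof (rule measure_eqI_generator_eq[where E = "range (\<lambda>(a,b). {a..<b::real})" and \<Omega> = UNIV and A = "\<lambda>i. {- real i..<real i}"])
    show "Int_stable (range (\<lambda>(a,b). {a..<b::real}))"
    proof (rule Int_stableI)
      fix X Y assume "X \<in> range (\<lambda>(a,b). {a..<b::real})" "Y \<in> range (\<lambda>(a,b). {a..<b::real})"
      then obtain a b c d where "X = {a..<b}" "Y = {c..<d}" by auto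
      hence "X \<inter> Y = {max a c..<min b d}" by auto
      thus "X \<inter> Y \<in> range (\<lambda>(a,b). {a..<b::real})" by auto
    qed
    show "range (\<lambda>(a,b). {a..<b::real}) \<subseteq> Pow UNIV" by simp
    fix X assume "X \<in> range (\<lambda>(a,b). {a..<b::real})"
    then obtain a b where X: "X = {a..<b::real}" by auto
    have "emeasure (density lborel (indicator A)) X = emeasure lborel (A \<inter> X)"
      using A X by (subst emeasure_density) (auto simp: indicator_inter_arith[symmetric] nn_integral_indicator simp flip: indicator_inter_arith)
    also have "\<dots> = ennreal (f a b)" unfolding f_def X using fm[of a b] by (intro emeasure_eq_measure2) 
    also have "\<dots> = emeasure (scale_measure (ennreal \<mu>) lborel) X"
    proof (cases "a \<le> b")
      case True
      thus ?thesis using dens[OF True] X by (simp add: emeasure_lborel_Ico ennreal_mult[symmetric] mult.commute \<mu>_def)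
    next
      case False
      thus ?thesis using X by (simp add: f_def)
    qed
    finally show "emeasure (density lborel (indicator A)) X = emeasure (scale_measure (ennreal \<mu>) lborel) X" .
  next
    show "sets (density lborel (indicator A)) = sigma_sets UNIV (range (\<lambda>(a,b). {a..<b::real}))"
      using sb by simp
    show "sets (scale_measure (ennreal \<mu>) lborel) = sigma_sets UNIV (range (\<lambda>(a,b). {a..<b::real}))"
      using sb by simp
    show "range (\<lambda>i::nat. {- real i..<real i}) \<subseteq> range (\<lambda>(a,b). {a..<b::real})" by auto
    show "(\<Union>i::nat. {- real i..<real i}) = UNIV"
    proof -
      have "\<exists>i::nat. - real i \<le> x \<and> x < real i" for x :: real
      proof -
        obtain i :: nat where "\<bar>x\<bar> < real i" using reals_Archimedean2 by blast
        thus ?thesis by (intro exI[of _ i]) auto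
      qed
      thus ?thesis by auto
    qed
    fix i :: nat
    have "emeasure (density lborel (indicator A)) {- real i..<real i} = emeasure lborel (A \<inter> {- real i..<real i})"
      using A by (subst emeasure_density) (auto simp flip: indicator_inter_arith)
    also have "\<dots> < \<infinity>" using fm[of "- real i" "real i"] by (simp add: fmeasurable_def)
    finally show "emeasure (density lborel (indicator A)) {- real i..<real i} \<noteq> \<infinity>" by simp
  qed
  note eq = this
  have em: "emeasure lborel (A \<inter> {0..<1}) = ennreal \<mu>" unfolding \<mu>_def using fm by (intro emeasure_eq_measure2)
  have m0: "0 \<le> \<mu>" by (simp add: \<mu>_def)
  \<comment> \<open>Testing the measure identity on \<open>A \<inter> {0..<1}\<close> itself yields
    \<open>\<mu> = \<mu> * \<mu>\<close>.\<close>
  have "ennreal \<mu> = emeasure lborel (A \<inter> (A \<inter> {0..<1}))" by (simp add: em flip: Int_assoc)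
  also have "\<dots> = emeasure (density lborel (indicator A)) (A \<inter> {0..<1})"
    using A by (subst emeasure_density) (auto simp flip: indicator_inter_arith)
  also have "\<dots> = ennreal \<mu> * emeasure lborel (A \<inter> {0..<1})" unfolding eq by simp
  also have "\<dots> = ennreal (\<mu> * \<mu>)" unfolding em using m0 by (simp add: ennreal_mult)
  finally have "\<mu> = \<mu> * \<mu>" using m0 by (simp add: ennreal_inj)
  hence "\<mu> = 0 \<or> \<mu> = 1" by simp
  thus ?thesis using em by auto
qed

text \<open>Two intervals overlap in length at most twice the minimum, and the number of close pairs
  carries the maximum as a factor; their product is exactly the independent size.\<close>

lemma min_mult_max:
  fixes x y m n :: real
  assumes "0 < m" "0 < n"
  shows "min (x / m) (y / n) * max (m * y) (n * x) = x * y"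
proof (cases "n * x \<le> m * y")
  case True
  hence "x / m \<le> y / n" using assms by (simp add: field_simps)
  thus ?thesis using assms True by (simp add: min_absorb1 max_absorb1)
next
  case False
  hence "y / n \<le> x / m" using assms by (simp add: field_simps)
  thus ?thesis using assms False by (simp add: min_absorb2 max_absorb2)
qed

text \<open>Second moment method on the individual intervals. Pairs around distinct fractions
  contribute \<open>O(M\<^sup>2)\<close> by the counting and averaging bounds, and the diagonal
  contributes \<open>2 * M\<close>.\<close>

lemma near_set_union_measure:
  obtains c where "c > 0" "\<And>S \<psi>. finite S \<Longrightarrow> (\<And>n. n \<in> S \<Longrightarrow> 0 < n \<and> 0 \<le> \<psi> n \<and> \<psi> n \<le> real n) \<Longrightarrow>
     1 \<le> mass \<psi> S \<Longrightarrow> c \<le> measure lborel ((\<Union>n\<in>S. near_set \<psi> n) \<inter> {-1..2})"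
proof -
  obtain K1 where K1: "K1 > 0" "\<And>m n \<psi>. 0 < m \<Longrightarrow> 0 < n \<Longrightarrow> 0 \<le> \<psi> m \<Longrightarrow> 0 \<le> \<psi> n \<Longrightarrow>
    real (card (near_pairs \<psi> m n)) \<le>
      K1 * max (real m * \<psi> n) (real n * \<psi> m) * (tot_ratio m * tot_ratio n) * exp (large_prime_sum \<psi> m n)"
    using card_near_pairs_le by blast
  obtain K2 where K2: "K2 > 0" "\<And>S \<psi>. finite S \<Longrightarrow> (\<And>n. n \<in> S \<Longrightarrow> 0 < n \<and> 0 \<le> \<psi> n) \<Longrightarrow> 1 \<le> mass \<psi> S \<Longrightarrow>
     (\<Sum>(m,n)\<in>S\<times>S. (tot_ratio m * \<psi> m) * (tot_ratio n * \<psi> n) * exp (large_prime_sum \<psi> m n)) \<le> K2 * (mass \<psi> S)\<^sup>2"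
    using weighted_pair_sum_bound by blast
  \<comment> \<open>The square of the first moment \<open>2 * M\<close> over the second moment bound
    \<open>(2 * K1 * K2 + 2) * M\<^sup>2\<close>.\<close>
  define c where "c = 4 / (2 * K1 * K2 + 2)"
  have c0: "c > 0" using K1 K2 by (simp add: c_def add_pos_pos)
  have "c \<le> measure lborel ((\<Union>n\<in>S. near_set \<psi> n) \<inter> {-1..2})"
    if fin: "finite S" and S: "\<And>n. n \<in> S \<Longrightarrow> 0 < n \<and> 0 \<le> \<psi> n \<and> \<psi> n \<le> real n" and M1: "1 \<le> mass \<psi> S" for S \<psi>
  proof -
    define M where "M = mass \<psi> S"
    define T where "T = Sigma S totatives"
    define I where "I = (\<lambda>(n,a). {(real a - \<psi> n) / real n <..< (real a + \<psi> n) / real n})"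
    have finT: "finite T" using fin by (simp add: T_def)
    have mI: "measure lborel (I (n,a)) = 2 * (\<psi> n / real n)" if "n \<in> S" for n a
      using S[OF that] by (simp add: I_def divide_right_mono diff_divide_distrib add_divide_distrib)
    have Ifm: "I i \<in> fmeasurable lborel" for i 
  proof (cases i)
    case (Pair n a)
    show ?thesis unfolding Pair I_def prod.case
      by (rule fmeasurable_subset_Icc[of _ "(real a - \<psi> n) / real n" "(real a + \<psi> n) / real n"]) auto
  qed
    have inI: "x \<in> I (n,a) \<longleftrightarrow> \<bar>real n * x - real a\<bar> < \<psi> n" if "n \<in> S" for n a x
      using S[OF that] by (auto simp: I_def field_simps abs_less_iff)
    have sub: "(\<Union>i\<in>T. I i) \<subseteq> (\<Union>n\<in>S. near_set \<psi> n) \<inter> {-1..2}"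
    proof clarify
      fix x n a assume "(n,a) \<in> T" and x: "x \<in> I (n,a)"
      hence n: "n \<in> S" and a: "0 < a" "a \<le> n" "coprime a n" by (auto simp: T_def totatives_def)
      have ax: "\<bar>real n * x - real a\<bar> < \<psi> n" using x inI[OF n] by simp
      have nn: "0 < n" "\<psi> n \<le> real n" using S[OF n] by auto
      have ar: "0 < real a" "real a \<le> real n" using a by simp_all
      have "coprime (int a) (int n)" using a by simp
      hence "x \<in> near_set \<psi> n" unfolding near_set_def using ax by (intro CollectI exI[of _ "int a"]) simp
      \<comment> \<open>The centre lies in \<open>{0<..1}\<close> and
        \<open>\<psi> n \<le> n\<close> bounds the radius by 1; this fixes the window
        \<open>{-1..2}\<close>.\<close>
      moreover have "real n * (-1) \<le> real n * x" "real n * x \<le> real n * 2" using ax nn a ar unfolding abs_less_iff by linarith+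
      hence "-1 \<le> x" "x \<le> 2" using nn by (simp_all only: mult_le_cancel_left_pos of_nat_0_less_iff)
      ultimately show "x \<in> (\<Union>n\<in>S. near_set \<psi> n) \<inter> {-1..2}" using n by auto
    qed
    define g where "g = (\<lambda>m n a b. if (a,b) \<in> near_pairs \<psi> m n then 2 * min (\<psi> m / real m) (\<psi> n / real n) else 0)"
    have pair: "measure lborel (I (m,a) \<inter> I (n,b)) \<le> g m n a b + (if (m,a) = (n,b) then measure lborel (I (m,a)) else 0)"
      if i: "(m,a) \<in> T" and j: "(n,b) \<in> T" for m a n b
    proof -
      have mn: "m \<in> S" "n \<in> S" "a \<in> {1..m}" "b \<in> {1..n}" "coprime a m" "coprime b n"
        using i j by (auto simp: T_def totatives_def)
      have pos: "0 < m" "0 < n" "0 \<le> \<psi> m" "0 \<le> \<psi> n" using S mn by auto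
      have g0: "0 \<le> g m n a b" using pos by (simp add: g_def)
      have le: "measure lborel (I (m,a) \<inter> I (n,b)) \<le> 2 * min (\<psi> m / real m) (\<psi> n / real n)"
      proof -
        have "measure lborel (I (m,a) \<inter> I (n,b)) \<le> measure lborel (I (m,a))"
          "measure lborel (I (m,a) \<inter> I (n,b)) \<le> measure lborel (I (n,b))"
          using Ifm by (auto intro!: measure_mono_fmeasurable sets.Int fmeasurableD)
        thus ?thesis using mI mn by simp
      qed
      consider "I (m,a) \<inter> I (n,b) = {}" | "(a,b) \<in> near_pairs \<psi> m n" | "(m,a) = (n,b)"
      proof (cases "I (m,a) \<inter> I (n,b) = {}")
        case False
        then obtain x where x: "\<bar>real m * x - real a\<bar> < \<psi> m" "\<bar>real n * x - real b\<bar> < \<psi> n" using inI mn by blast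
        have "real a * real n - real b * real m = real m * (real n * x - real b) - real n * (real m * x - real a)"
          by (simp add: algebra_simps)
        also have "\<bar>\<dots>\<bar> \<le> real m * \<bar>real n * x - real b\<bar> + real n * \<bar>real m * x - real a\<bar>"
          by (rule order_trans[OF abs_triangle_ineq4]) (simp add: abs_mult)
        also have "\<dots> < real m * \<psi> n + real n * \<psi> m"
          using x pos by (intro add_strict_mono mult_strict_left_mono) auto
        finally have close: "\<bar>real a * real n - real b * real m\<bar> < real m * \<psi> n + real n * \<psi> m" .
        show ?thesis
        proof (cases "a * n = b * m")
          case True
          have "m dvd a * n" "n dvd b * m" using True by (metis dvd_triv_right)+
          \<comment> \<open>Both fractions are reduced, so equality of the values forces equality of
            the denominators and then of the numerators.\<close>
          hence "m dvd n" "n dvd m" using mn by (metis coprime_commute coprime_dvd_mult_right_iff)+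
          hence "m = n" by (rule dvd_antisym)
          thus ?thesis using that(3) True pos by simp
        next
          case False
          thus ?thesis using that(2) close mn by (simp add: near_pairs_def)
        qed
      qed (use that in blast)
      thus ?thesis
      proof cases
        case 1 thus ?thesis using g0 by simp
      next
        case 2 thus ?thesis using le pos by (simp add: g_def)
      next
        case 3 thus ?thesis using g0 by simp
      qed
    qed
    have ST: "(\<Sum>i\<in>T. f (fst i) (snd i)) = (\<Sum>m\<in>S. \<Sum>a\<in>totatives m. f m a)" for f :: "nat \<Rightarrow> nat \<Rightarrow> real"
      unfolding T_def using fin by (subst sum.Sigma) (auto simp: case_prod_beta)
    have s1: "(\<Sum>i\<in>T. measure lborel (I i)) = 2 * M"
    proof -
      have "(\<Sum>i\<in>T. measure lborel (I i)) = (\<Sum>n\<in>S. \<Sum>a\<in>totatives n. measure lborel (I (n,a)))"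
        unfolding T_def using fin by (subst sum.Sigma) auto
      also have "\<dots> = (\<Sum>n\<in>S. 2 * (tot_ratio n * \<psi> n))"
        by (intro sum.cong refl) (simp add: mI tot_ratio_def totient_def)
      finally show ?thesis by (simp add: M_def mass_def sum_distrib_left)
    qed
    have block: "(\<Sum>a\<in>totatives m. \<Sum>b\<in>totatives n. g m n a b) \<le>
        2 * K1 * ((tot_ratio m * \<psi> m) * (tot_ratio n * \<psi> n) * exp (large_prime_sum \<psi> m n))" if "m \<in> S" "n \<in> S" for m n
    proof -
      have pos: "0 < m" "0 < n" "0 \<le> \<psi> m" "0 \<le> \<psi> n" using S that by auto
      define u where "u = min (\<psi> m / real m) (\<psi> n / real n)"
      have u0: "0 \<le> u" using pos by (simp add: u_def)
      have NPsub: "near_pairs \<psi> m n \<subseteq> {1..m} \<times> {1..n}" by (auto simp: near_pairs_def)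
      have "(\<Sum>a\<in>totatives m. \<Sum>b\<in>totatives n. g m n a b) = (\<Sum>z\<in>totatives m \<times> totatives n. if z \<in> near_pairs \<psi> m n then 2 * u else 0)"
        unfolding sum.cartesian_product by (intro sum.cong refl) (auto simp: g_def u_def)
      also have "\<dots> = 2 * u * real (card ((totatives m \<times> totatives n) \<inter> near_pairs \<psi> m n))"
        by (simp add: sum.If_cases)
      also have "\<dots> \<le> 2 * u * real (card (near_pairs \<psi> m n))"
        using u0 finite_subset[OF NPsub] by (intro mult_left_mono) (auto intro!: card_mono)
      also have "\<dots> \<le> 2 * u * (K1 * max (real m * \<psi> n) (real n * \<psi> m) * (tot_ratio m * tot_ratio n) * exp (large_prime_sum \<psi> m n))"
        using u0 K1(2)[OF pos] by (intro mult_left_mono) auto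
      also have "\<dots> = 2 * K1 * (u * max (real m * \<psi> n) (real n * \<psi> m)) * (tot_ratio m * tot_ratio n) * exp (large_prime_sum \<psi> m n)"
        by (simp only: mult_ac)
      also have "u * max (real m * \<psi> n) (real n * \<psi> m) = \<psi> m * \<psi> n"
        unfolding u_def using pos by (intro min_mult_max) auto
      finally show ?thesis by (simp only: mult_ac)
    qed
    have s2: "(\<Sum>i\<in>T. \<Sum>j\<in>T. measure lborel (I i \<inter> I j)) \<le> (2 * K1 * K2 + 2) * M\<^sup>2"
    proof -
      have "(\<Sum>i\<in>T. \<Sum>j\<in>T. measure lborel (I i \<inter> I j)) \<le>
          (\<Sum>i\<in>T. \<Sum>j\<in>T. g (fst i) (fst j) (snd i) (snd j) + (if i = j then measure lborel (I i) else 0))"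
      proof (rule sum_mono, rule sum_mono)
        fix i j assume "i \<in> T" "j \<in> T"
        thus "measure lborel (I i \<inter> I j) \<le> g (fst i) (fst j) (snd i) (snd j) + (if i = j then measure lborel (I i) else 0)"
          by (rule pair[of "fst i" "snd i" "fst j" "snd j", unfolded prod.collapse])
      qed
      also have "\<dots> = (\<Sum>i\<in>T. \<Sum>j\<in>T. g (fst i) (fst j) (snd i) (snd j)) + 2 * M"
        using finT s1 by (simp add: sum.distrib sum.delta)
      also have "(\<Sum>i\<in>T. \<Sum>j\<in>T. g (fst i) (fst j) (snd i) (snd j)) = (\<Sum>i\<in>T. \<Sum>n\<in>S. \<Sum>b\<in>totatives n. g (fst i) n (snd i) b)"
      proof (rule sum.cong[OF refl])
        fix i show "(\<Sum>j\<in>T. g (fst i) (fst j) (snd i) (snd j)) = (\<Sum>n\<in>S. \<Sum>b\<in>totatives n. g (fst i) n (snd i) b)"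
          by (rule ST[of "\<lambda>n b. g (fst i) n (snd i) b"])
      qed
      also have "\<dots> = (\<Sum>m\<in>S. \<Sum>a\<in>totatives m. \<Sum>n\<in>S. \<Sum>b\<in>totatives n. g m n a b)"
        by (rule ST[of "\<lambda>m a. \<Sum>n\<in>S. \<Sum>b\<in>totatives n. g m n a b"])
      also have "\<dots> = (\<Sum>m\<in>S. \<Sum>n\<in>S. \<Sum>a\<in>totatives m. \<Sum>b\<in>totatives n. g m n a b)"
        by (rule sum.cong[OF refl], rule sum.swap)
      also have "\<dots> \<le> (\<Sum>m\<in>S. \<Sum>n\<in>S. 2 * K1 * ((tot_ratio m * \<psi> m) * (tot_ratio n * \<psi> n) * exp (large_prime_sum \<psi> m n)))"
        by (rule sum_mono, rule sum_mono, rule block)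
      also have "\<dots> = 2 * K1 * (\<Sum>(m,n)\<in>S\<times>S. (tot_ratio m * \<psi> m) * (tot_ratio n * \<psi> n) * exp (large_prime_sum \<psi> m n))"
        by (simp only: sum_distrib_left[symmetric] sum.cartesian_product)
      also have "\<dots> \<le> 2 * K1 * (K2 * M\<^sup>2)"
        using K1 K2(2)[OF fin _ M1] S unfolding M_def by (intro mult_left_mono) auto
      finally have "(\<Sum>i\<in>T. \<Sum>j\<in>T. measure lborel (I i \<inter> I j)) \<le> 2 * K1 * (K2 * M\<^sup>2) + 2 * M" by simp
      moreover have "M \<le> M\<^sup>2" using M1 by (simp add: M_def power2_eq_square)
      ultimately show ?thesis by (simp add: algebra_simps)
    qed
    define u where "u = measure lborel (\<Union>i\<in>T. I i)"
    have "(2 * M)\<^sup>2 \<le> u * (\<Sum>i\<in>T. \<Sum>j\<in>T. measure lborel (I i \<inter> I j))"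
      unfolding s1[symmetric] u_def by (rule second_moment_union[OF finT Ifm])
    also have "\<dots> \<le> u * ((2 * K1 * K2 + 2) * M\<^sup>2)" using s2 by (intro mult_left_mono) (auto simp: u_def)
    finally have "M\<^sup>2 * 4 \<le> M\<^sup>2 * (u * (2 * K1 * K2 + 2))" by (simp add: power_mult_distrib mult_ac)
    hence "4 \<le> u * (2 * K1 * K2 + 2)" using M1 by (subst (asm) mult_le_cancel_left_pos) (auto simp: M_def)
    hence "c \<le> u" using K1 K2 by (simp add: c_def divide_le_eq add_pos_pos)
    also have "u \<le> measure lborel ((\<Union>n\<in>S. near_set \<psi> n) \<inter> {-1..2})"
      unfolding u_def
    proof (rule measure_mono_fmeasurable[OF sub])
      show "(\<Union>i\<in>T. I i) \<in> sets lborel" by (rule sets.finite_UN[OF finT fmeasurableD[OF Ifm]])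
      show "(\<Union>n\<in>S. near_set \<psi> n) \<inter> {-1..2} \<in> fmeasurable lborel"
      proof (rule fmeasurable_subset_Icc[of _ "-1" 2])
        have "open (\<Union>n\<in>S. near_set \<psi> n)" by (intro open_UN ballI open_near_set)
        thus "(\<Union>n\<in>S. near_set \<psi> n) \<inter> {-1..2} \<in> sets borel" by (rule sets.Int[OF borel_open]) simp
      qed auto
    qed
    finally show ?thesis .
  qed
  thus ?thesis using that c0 by blast
qed

text \<open>The constant \<open>c\<close> is the same for every tail of the denominators, so
  continuity from above carries it to the limsup set; the bounded window keeps the measures
  finite.\<close>

lemma near_limsup_not_null:
  assumes \<psi>: "\<And>n. 0 < n \<Longrightarrow> 0 \<le> \<psi> n \<and> \<psi> n \<le> real n"
    and div: "\<And>N. \<exists>S. finite S \<and> S \<subseteq> {N..} \<and> 1 \<le> mass \<psi> S"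
  shows "measure lborel (near_limsup \<psi> \<inter> {-1..2}) > 0"
proof -
  obtain c where c: "c > 0" "\<And>S \<psi>. finite S \<Longrightarrow> (\<And>n. n \<in> S \<Longrightarrow> 0 < n \<and> 0 \<le> \<psi> n \<and> \<psi> n \<le> real n) \<Longrightarrow>
     1 \<le> mass \<psi> S \<Longrightarrow> c \<le> measure lborel ((\<Union>n\<in>S. near_set \<psi> n) \<inter> {-1..2})"
    using near_set_union_measure by blast
  define A where "A = (\<lambda>N. (\<Union>n\<in>{N..}. near_set \<psi> n) \<inter> {-1..2})"
  have opn: "open (\<Union>n\<in>B. near_set \<psi> n)" for B by (intro open_UN ballI open_near_set)
  have fm: "(\<Union>n\<in>B. near_set \<psi> n) \<inter> {-1..2} \<in> fmeasurable lborel" for B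
    using fmeasurable_Int_fmeasurable[OF fmeasurable_cbox[of "-1" "2::real"], of "\<Union>n\<in>B. near_set \<psi> n"] opn[of B]
    by (simp add: Int_commute)
  have big: "c \<le> measure lborel (A N)" for N
  proof -
    obtain S where S: "finite S" "S \<subseteq> {max 1 N..}" "1 \<le> mass \<psi> S" using div by blast
    have "c \<le> measure lborel ((\<Union>n\<in>S. near_set \<psi> n) \<inter> {-1..2})" using S \<psi> by (intro c(2)) auto
    also have "\<dots> \<le> measure lborel (A N)" unfolding A_def
    proof (rule measure_mono_fmeasurable)
      have "S \<subseteq> {N..}" using S(2) by auto
      thus "(\<Union>n\<in>S. near_set \<psi> n) \<inter> {-1..2} \<subseteq> (\<Union>n\<in>{N..}. near_set \<psi> n) \<inter> {-1..2}" by blast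
    qed (rule fmeasurableD, rule fm, rule fm)
    finally show ?thesis .
  qed
  have "(\<lambda>N. measure lborel (A N)) \<longlonglongrightarrow> measure lborel (\<Inter>N. A N)"
  proof (rule Lim_measure_decseq)
    have "A N \<in> sets lborel" for N unfolding A_def by (rule fmeasurableD, rule fm)
    thus "range A \<subseteq> sets lborel" by blast
    show "decseq A" unfolding A_def decseq_def by (intro allI impI Int_mono UN_mono) auto
    show "emeasure lborel (A N) \<noteq> \<infinity>" for N using fm[of "{N..}"] by (auto simp: A_def fmeasurable_def)
  qed
  hence "c \<le> measure lborel (\<Inter>N. A N)" by (rule LIMSEQ_le_const) (use big in blast)
  also have "(\<Inter>N. A N) = near_limsup \<psi> \<inter> {-1..2}" by (auto simp: A_def near_limsup_def)
  finally show ?thesis using c(1) by simp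
qed

subsection \<open>Cassels scaling\<close>

text \<open>A form of the Lebesgue density theorem: no point of a non-null set can see it thinned out by a
  fixed factor at arbitrarily small scales.\<close>

lemma null_of_thin_balls:
  fixes Z :: "real set"
  assumes Z: "Z \<in> lmeasurable" and c: "0 < c"
    and thin: "\<And>x e. x \<in> Z \<Longrightarrow> 0 < e \<Longrightarrow> \<exists>d. 0 < d \<and> d < e \<and>
      measure lebesgue (Z \<inter> ball x d) \<le> (1 - c) * measure lebesgue (ball x d)"
  shows "measure lebesgue Z = 0"
proof (rule ccontr)
  define m where "m = measure lebesgue Z"
  assume "measure lebesgue Z \<noteq> 0"
  hence m: "m > 0" by (simp add: m_def zero_less_measure_iff)
  \<comment> \<open>Vitali balls chosen inside a tight open \<open>G\<close> cover almost all of
    \<open>Z\<close>, while each is filled by \<open>Z\<close> to a proportion of at most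
    \<open>1 - c\<close>. An excess of \<open>G\<close> below \<open>c * m\<close> is just small
    enough for a contradiction.\<close>
  obtain G where G0: "open G" "Z \<subseteq> G" "G - Z \<in> lmeasurable" "emeasure lebesgue (G - Z) < ennreal (c * m)"
    using sets_lebesgue_outer_open[OF fmeasurableD[OF Z] mult_pos_pos[OF c m]] .
  have "G = Z \<union> (G - Z)" using G0(2) by auto
  moreover have "Z \<union> (G - Z) \<in> lmeasurable" using Z G0(3) by (rule fmeasurable.Un)
  ultimately have Gm: "G \<in> lmeasurable" by simp
  have "measure lebesgue (G - Z) < c * m"
    using G0(3,4) c m by (simp add: emeasure_eq_measure2 ennreal_less_iff)
  moreover have "measure lebesgue (G - Z) = measure lebesgue G - m"
    unfolding m_def using Gm Z G0(2) by (intro measurable_measure_Diff) (auto simp: fmeasurableD)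
  ultimately have G: "open G" "Z \<subseteq> G" "G \<in> lmeasurable" "measure lebesgue G < m + c * m"
    using G0 Gm by auto
  define K where "K = {(x,d). x \<in> Z \<and> 0 < d \<and> ball x d \<subseteq> G \<and>
      measure lebesgue (Z \<inter> ball x d) \<le> (1 - c) * measure lebesgue (ball x d)}"
  have cover: "\<exists>i. i \<in> K \<and> x \<in> ball (fst i) (snd i) \<and> snd i < e" if x: "x \<in> Z" and e: "0 < e" for x e
  proof -
    obtain g where g: "0 < g" "ball x g \<subseteq> G" using G x by (meson open_contains_ball subsetD)
    obtain d where d: "0 < d" "d < min e g" "measure lebesgue (Z \<inter> ball x d) \<le> (1 - c) * measure lebesgue (ball x d)"
      using thin[OF x, of "min e g"] e g by auto
    have "ball x d \<subseteq> G" using d g by (auto intro: order_trans[OF subset_ball])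
    thus ?thesis using d x by (intro exI[of _ "(x,d)"]) (auto simp: K_def)
  qed
  obtain C where C: "countable C" "C \<subseteq> K"
     "pairwise (\<lambda>i j. disjnt (ball (fst i) (snd i)) (ball (fst j) (snd j))) C"
     "negligible (Z - (\<Union>i \<in> C. ball (fst i) (snd i)))"
    by (rule Vitali_covering_theorem_balls[of Z K fst snd, OF cover]; (assumption | rule that; assumption))
  define B where "B = (\<lambda>i. ball (fst i) (snd i) :: real set)"
  have BG: "B i \<subseteq> G" if "i \<in> C" for i
  proof -
    have "i \<in> K" using that C(2) by blast
    thus ?thesis by (cases i) (simp add: K_def B_def)
  qed
  have Bm: "B i \<in> lmeasurable" for i by (simp add: B_def)
  have fin_bound: "measure lebesgue (Z \<inter> (\<Union>i\<in>F. B i)) \<le> (1 - c) * measure lebesgue G" if F: "F \<subseteq> C" "finite F" "F \<noteq> {}" for F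
  proof -
    have disj: "disjoint_family_on B F"
      using C(3) F(1) unfolding disjoint_family_on_def pairwise_def B_def disjnt_def by blast
    have c1: "0 \<le> 1 - c"
    proof -
      obtain i where i: "i \<in> F" using F by blast
      hence "i \<in> K" using F C by blast
      hence "measure lebesgue (Z \<inter> B i) \<le> (1 - c) * measure lebesgue (B i)" "0 < snd i" by (auto simp: K_def B_def)
      moreover have "0 < measure lebesgue (B i)" using \<open>0 < snd i\<close> by (simp add: B_def content_ball_pos)
      ultimately show ?thesis using measure_nonneg[of lebesgue "Z \<inter> B i"] by (smt (verit) mult_neg_pos)
    qed
    have "measure lebesgue (Z \<inter> (\<Union>i\<in>F. B i)) \<le> (\<Sum>i\<in>F. measure lebesgue (Z \<inter> B i))"
    proof -
      have "Z \<inter> (\<Union>i\<in>F. B i) = (\<Union>i\<in>F. Z \<inter> B i)" by auto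
      thus ?thesis using measure_UNION_le[OF F(2), of "\<lambda>i. Z \<inter> B i" lebesgue] Z Bm by (auto simp: fmeasurableD)
    qed
    also have "\<dots> \<le> (\<Sum>i\<in>F. (1 - c) * measure lebesgue (B i))"
      using F C(2) by (intro sum_mono) (auto simp: K_def B_def)
    also have "\<dots> = (1 - c) * measure lebesgue (\<Union>i\<in>F. B i)"
      using measure_UNION'[OF F(2), of B lebesgue] Bm disj
      by (simp add: sum_distrib_left disjoint_family_on_def pairwise_def disjnt_def)
    also have "\<dots> \<le> (1 - c) * measure lebesgue G"
      using c1 BG F G(3) Bm by (intro mult_left_mono measure_mono_fmeasurable) (auto intro!: sets.finite_UN simp: fmeasurableD F(2))
    finally show ?thesis .
  qed
  have all: "measure lebesgue (Z \<inter> (\<Union>i\<in>C. B i)) = m"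
  proof -
    have "negligible (Z - (Z \<inter> (\<Union>i\<in>C. B i)))" using C(4) by (simp add: B_def Diff_Int)
    thus ?thesis unfolding m_def
      using measure_negligible_symdiff[of Z "Z \<inter> (\<Union>i\<in>C. B i)"] Z
      by (simp add: Un_absorb1 Diff_Int)
  qed
  have Cne: "C \<noteq> {}" using all m by auto
  define e where "e = from_nat_into C"
  define U where "U = (\<lambda>n. Z \<inter> (\<Union>i\<in>e ` {..n}. B i))"
  have ran: "range e = C" unfolding e_def using Cne C(1) by (rule range_from_nat_into)
  have "(\<lambda>n. measure lebesgue (U n)) \<longlonglongrightarrow> measure lebesgue (\<Union>n. U n)"
  proof (rule Lim_measure_incseq)
    have "U n \<in> sets lebesgue" for n
      unfolding U_def by (rule sets.Int[OF fmeasurableD[OF Z]], rule sets.finite_UN) (simp, rule fmeasurableD[OF Bm])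
    thus "range U \<subseteq> sets lebesgue" by blast
    show "incseq U" unfolding U_def incseq_def by (intro allI impI Int_mono UN_mono image_mono) auto
    have "emeasure lebesgue (\<Union>n. U n) \<le> emeasure lebesgue Z" using Z by (intro emeasure_mono) (auto simp: U_def fmeasurableD)
    thus "emeasure lebesgue (\<Union>n. U n) \<noteq> \<infinity>" using Z by (auto simp: fmeasurable_def top_unique)
  qed
  moreover have "(\<Union>n. U n) = Z \<inter> (\<Union>i\<in>C. B i)" unfolding U_def ran[symmetric] by auto
  ultimately have lim: "(\<lambda>n. measure lebesgue (U n)) \<longlonglongrightarrow> m" using all by simp
  have "m \<le> (1 - c) * measure lebesgue G"
  proof (rule LIMSEQ_le_const2[OF lim])
    show "\<exists>N. \<forall>n\<ge>N. measure lebesgue (U n) \<le> (1 - c) * measure lebesgue G"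
      using fin_bound[of "e ` {..n}" for n] ran unfolding U_def by (intro exI[of _ 0]) auto
  qed
  also have "\<dots> \<le> (1 - c) * (m + c * m)"
  proof (cases "c \<le> 1")
    case True
    thus ?thesis using G(4) by (intro mult_left_mono) auto
  next
    case False
    have "(1 - c) * measure lebesgue G \<le> 0" using False by (simp add: mult_nonpos_nonneg)
    with calculation m show ?thesis by linarith
  qed
  also have "\<dots> = m - c\<^sup>2 * m" by (simp add: algebra_simps power2_eq_square)
  also have "\<dots> < m" using c m by simp
  finally show False by simp
qed

text \<open>Cassels' lemma, in the form that passing from a limsup set of short intervals to the limsup set of
  the intervals shrunk by a constant factor loses only a null set.\<close>

lemma Cassels_scaling:
  fixes c r :: "nat \<Rightarrow> nat \<Rightarrow> real" and Q :: "nat \<Rightarrow> nat set" and C :: real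
  assumes C: "1 \<le> C" and small: "\<rho> \<longlonglongrightarrow> 0"
    and pos: "\<And>n. 0 \<le> \<rho> n"
    and I: "\<And>n. E n = (\<Union>a\<in>P n. ball (a::real) (\<rho> n))"
    and J: "\<And>n. E' n = (\<Union>a\<in>P n. ball a (C * \<rho> n))"
  shows "(\<Inter>N. \<Union>n\<in>{N..}. E' n) - (\<Inter>N. \<Union>n\<in>{N..}. E n) \<in> null_sets lebesgue"
proof -
  have opE: "open (E n)" "open (E' n)" for n by (auto simp: I J)
  define W where "W = (\<Inter>N. \<Union>n\<in>{N..}. E' n)"
  define V where "V = (\<lambda>N. \<Union>n\<in>{N..}. E n)"
  have Wm: "W \<in> sets borel" unfolding W_def using opE by (auto intro!: sets.countable_INT'')
  have Vm: "open (V N)" for N unfolding V_def using opE by auto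
  have null: "(W - V N) \<inter> ball 0 (real k) \<in> null_sets lebesgue" for N k
  proof -
    define Z where "Z = (W - V N) \<inter> ball 0 (real k)"
    have Zb: "Z \<in> sets borel" using Wm Vm by (auto simp: Z_def)
    have Zm: "Z \<in> lmeasurable"
    proof (rule bounded_set_imp_lmeasurable)
      show "bounded Z" by (rule bounded_subset[of "ball 0 (real k)"]) (auto simp: Z_def)
      show "Z \<in> sets lebesgue" using Zb by simp
    qed
    have "measure lebesgue Z = 0"
    proof (rule null_of_thin_balls[OF Zm, of "1 / (C + 1)"])
      show "0 < 1 / (C + 1)" using C by simp
      fix x e :: real assume x: "x \<in> Z" and e: "0 < e"
      have "eventually (\<lambda>n. \<rho> n < e / (C + 1)) sequentially"
        using small e C by (intro order_tendstoD(2)) auto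
      then obtain M where M: "\<And>n. n \<ge> M \<Longrightarrow> \<rho> n < e / (C + 1)" by (auto simp: eventually_sequentially)
      have "x \<in> (\<Union>n\<in>{max M N..}. E' n)" using x by (auto simp: Z_def W_def)
      then obtain n where n: "n \<ge> M" "n \<ge> N" "x \<in> E' n" by auto
      then obtain a where a: "a \<in> P n" "x \<in> ball a (C * \<rho> n)" by (auto simp: J)
      have \<rho>0: "0 < \<rho> n"
      proof -
        have "0 < C * \<rho> n" using a by (auto intro: le_less_trans[OF zero_le_dist])
        thus ?thesis using C by (simp add: zero_less_mult_iff)
      qed
      \<comment> \<open>The smallest radius about \<open>x\<close> sure to contain the ball of
        radius \<open>\<rho> n\<close> about \<open>a\<close>. That ball misses \<open>Z\<close> and
        makes up the proportion \<open>1 / (C + 1)\<close>.\<close>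
      define d where "d = (C + 1) * \<rho> n"
      have d: "0 < d" using \<rho>0 C by (simp add: d_def)
      have d': "d < e" using \<rho>0 C M[OF n(1)] by (simp add: d_def field_simps)
      have sub: "ball a (\<rho> n) \<subseteq> ball x d"
      proof
        fix y assume "y \<in> ball a (\<rho> n)"
        hence "dist a y < \<rho> n" "dist a x < C * \<rho> n" using a by auto
        thus "y \<in> ball x d" using dist_triangle2[of x y a] by (simp add: d_def algebra_simps dist_commute)
      qed
      have disj: "Z \<inter> ball a (\<rho> n) = {}" using n a by (auto simp: Z_def V_def I)
      have len: "measure lebesgue (ball t s) = 2 * s" if "0 \<le> s" for t s :: real
        using that by (simp add: ball_eq_greaterThanLessThan)
      have "measure lebesgue (Z \<inter> ball x d) \<le> measure lebesgue (ball x d - ball a (\<rho> n))"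
        using Zm disj by (intro measure_mono_fmeasurable) (auto simp: fmeasurableD)
      also have "\<dots> = measure lebesgue (ball x d) - measure lebesgue (ball a (\<rho> n))"
        using sub by (intro measurable_measure_Diff) auto
      also have "\<dots> = (1 - 1 / (C + 1)) * measure lebesgue (ball x d)"
      proof -
        have l: "measure lebesgue (ball x d) = 2 * d" "measure lebesgue (ball a (\<rho> n)) = 2 * \<rho> n"
          by (rule len, rule less_imp_le, fact)+
        show ?thesis unfolding l unfolding d_def using C by (simp add: field_simps)
      qed
      finally show "\<exists>d. 0 < d \<and> d < e \<and> measure lebesgue (Z \<inter> ball x d) \<le> (1 - 1 / (C + 1)) * measure lebesgue (ball x d)"
        using d d' by blast
    qed
    hence "emeasure lebesgue Z = 0" using emeasure_eq_measure2[OF Zm] by simp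
    hence "Z \<in> null_sets lebesgue" using fmeasurableD[OF Zm] by (rule null_setsI)
    thus ?thesis unfolding Z_def .
  qed
  \<comment> \<open>Cutting by the bounded windows \<open>ball 0 k\<close> gives pieces of finite
    measure, as the density argument requires.\<close>
  have "W - (\<Inter>N. V N) = (\<Union>N. \<Union>k. (W - V N) \<inter> ball 0 (real k))"
  proof (intro equalityI subsetI)
    fix x assume "x \<in> W - (\<Inter>N. V N)"
    then obtain N where N: "x \<in> W" "x \<notin> V N" by auto
    obtain k :: nat where "\<bar>x\<bar> < real k" using reals_Archimedean2 by blast
    thus "x \<in> (\<Union>N. \<Union>k. (W - V N) \<inter> ball 0 (real k))"
      using N by (intro UN_I[of N] UN_I[of k]) auto
  next
    fix x assume "x \<in> (\<Union>N. \<Union>k. (W - V N) \<inter> ball 0 (real k))"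
    thus "x \<in> W - (\<Inter>N. V N)" by (elim UN_E) auto
  qed
  also have "\<dots> \<in> null_sets lebesgue" using null by (intro null_sets_UN) auto
  finally show ?thesis by (simp add: W_def V_def)
qed

subsection \<open>The zero-one law\<close>

lemma near_limsup_mono:
  assumes "\<And>n. \<psi> n \<le> \<theta> n" shows "near_limsup \<psi> \<subseteq> near_limsup \<theta>"
proof -
  have "near_set \<psi> n \<subseteq> near_set \<theta> n" for n
    unfolding near_set_def using assms[of n] by (auto intro: less_le_trans)
  thus ?thesis unfolding near_limsup_def by blast
qed

lemma near_limsup_scale:
  assumes "1 \<le> C" "\<And>n. 0 \<le> \<psi> n" "\<psi> 0 = 0" "(\<lambda>n. \<psi> n / real n) \<longlonglongrightarrow> 0"
  shows "near_limsup (\<lambda>n. C * \<psi> n) - near_limsup \<psi> \<in> null_sets lborel"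
proof -
  define P where "P = (\<lambda>n. {of_int a / real n |a. coprime a (int n)})"
  have eq: "near_set (\<lambda>n. c * \<psi> n) n = (\<Union>a\<in>P n. ball a (c * (\<psi> n / real n)))" for c n
  proof (cases "n = 0")
    case True
    thus ?thesis using assms(3) by (auto simp: near_set_def)
  next
    case False
    have "x \<in> ball (of_int a / real n) (c * (\<psi> n / real n)) \<longleftrightarrow> \<bar>real n * x - of_int a\<bar> < c * \<psi> n" for x :: real and a :: int
    proof -
      have "\<bar>real n * x - of_int a\<bar> = real n * \<bar>x - of_int a / real n\<bar>"
      proof -
        have "real n * x - of_int a = real n * (x - of_int a / real n)" using False by (simp add: right_diff_distrib)
        thus ?thesis by (simp only: abs_mult abs_of_nat)
      qed
      thus ?thesis using False by (auto simp: dist_real_def abs_minus_commute field_simps)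
    qed
    thus ?thesis by (auto simp: near_set_def P_def)
  qed
  have "near_limsup (\<lambda>n. C * \<psi> n) - near_limsup (\<lambda>n. 1 * \<psi> n) \<in> null_sets lebesgue"
    unfolding near_limsup_def
    by (rule Cassels_scaling[where \<rho> = "\<lambda>n. \<psi> n / real n" and P = P, OF assms(1) assms(4)])
      (use assms(2) eq eq[of 1, simplified] in auto)
  moreover have "near_limsup (\<lambda>n. C * \<psi> n) - near_limsup (\<lambda>n. 1 * \<psi> n) \<in> sets borel"
    using near_limsup_borel by (intro sets.Diff)
  ultimately show ?thesis by (simp add: null_sets_def)
qed

lemma lebesgue_affine:
  fixes X :: "real set"
  assumes "X \<in> sets borel" "0 < q"
  shows "emeasure lborel X = ennreal q * emeasure lborel {x. q * x + s \<in> X}"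
proof -
  have e: "lborel = density (distr lborel borel (\<lambda>x. s + q * x)) (\<lambda>_. ennreal \<bar>q\<bar>)"
    using assms(2) by (intro lborel_real_affine) simp
  have "emeasure lborel X = emeasure (density (distr lborel borel (\<lambda>x. s + q * x)) (\<lambda>_. ennreal \<bar>q\<bar>)) X"
    by (subst e) (rule refl)
  also have "\<dots> = ennreal q * emeasure (distr lborel borel (\<lambda>x. s + q * x)) X"
    using assms by (subst emeasure_density) (auto simp: nn_integral_cmult_indicator)
  also have "emeasure (distr lborel borel (\<lambda>x. s + q * x)) X = emeasure lborel ((\<lambda>x. s + q * x) -` X \<inter> space lborel)"
    using assms(1) by (intro emeasure_distr) auto
  also have "(\<lambda>x. s + q * x) -` X \<inter> space lborel = {x. q * x + s \<in> X}" by (auto simp: add.commute)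
  finally show ?thesis .
qed

lemma periodic_measure_integer_interval:
  fixes A :: "real set"
  assumes A: "A \<in> sets borel" and per: "\<And>x. x + 1 \<in> A \<longleftrightarrow> x \<in> A"
  shows "measure lborel (A \<inter> {c..<c + real j}) = real j * measure lborel (A \<inter> {0..<1})"
proof (induction j)
  case (Suc j)
  have e: "c + real (Suc j) = c + real j + 1" by simp
  have "measure lborel (A \<inter> {c..<c + real (Suc j)}) = measure lborel (A \<inter> {c..<c + real j}) + measure lborel (A \<inter> {c + real j..<c + real j + 1})"
    unfolding e by (rule measure_Ico_split[OF A]) auto
  also have "measure lborel (A \<inter> {c + real j..<c + real j + 1}) = measure lborel (A \<inter> {0..<1})"
    unfolding measure_def periodic_measure_interval[OF A per] ..
  finally show ?case using Suc by (simp add: algebra_simps)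
qed simp

text \<open>The preimage of \<open>A\<close> under the affine map contains \<open>A\<close> and has
  measure \<open>j * \<mu> / q\<close> in every interval of length \<open>j / q\<close>. So
  \<open>A\<close> is nowhere denser than average at this scale, and since its total over a unit
  interval is \<open>\<mu>\<close>, it is nowhere thinner either.\<close>

lemma expanding_map_density:
  fixes A :: "real set" and q :: nat
  assumes A: "A \<in> sets borel" and per: "\<And>x. x + 1 \<in> A \<longleftrightarrow> x \<in> A" and q: "0 < q"
    and exp: "\<And>x. x \<in> A \<Longrightarrow> real q * x + s \<in> A"
  shows "emeasure lborel (A \<inter> {t..<t + 1 / real q}) = emeasure lborel (A \<inter> {0..<1 / real q})"
proof -
  define \<mu> where "\<mu> = measure lborel (A \<inter> {0..<1})"
  define B where "B = {x. real q * x + s \<in> A}"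
  have "(\<lambda>x. real q * x + s) -` A \<inter> space borel \<in> sets borel" using A by (intro measurable_sets[of _ _ borel]) auto
  hence B: "B \<in> sets borel" by (simp add: B_def vimage_def)
  have AB: "A \<subseteq> B" using exp by (auto simp: B_def)
  have fm: "X \<inter> {a..<b} \<in> fmeasurable lborel" if "X \<in> sets borel" for a b :: real and X
    using that by (intro fmeasurable_subset_Icc[of _ a b]) auto
  have Bm: "measure lborel (B \<inter> {u..<u + real j / real q}) = real j * \<mu> / real q" for u j
  proof -
    have "B \<inter> {u..<u + real j / real q} = {x. real q * x + s \<in> A \<inter> {real q * u + s..<real q * u + s + real j}}"
      using q by (auto simp: B_def field_simps)
    hence "emeasure lborel (A \<inter> {real q * u + s..<real q * u + s + real j}) = ennreal (real q) * emeasure lborel (B \<inter> {u..<u + real j / real q})"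
      using A q by (subst lebesgue_affine[of _ "real q" s]) auto
    hence "real j * \<mu> = real q * measure lborel (B \<inter> {u..<u + real j / real q})"
      using periodic_measure_integer_interval[OF A per, of "real q * u + s" j] by (simp add: measure_def enn2real_mult \<mu>_def)
    thus ?thesis using q by (simp add: field_simps)
  qed
  have mono: "measure lborel (A \<inter> {u..<v}) \<le> measure lborel (B \<inter> {u..<v})" for u v
    by (rule measure_mono_fmeasurable[OF _ fmeasurableD[OF fm[OF A]] fm[OF B]]) (use AB in auto)
  \<comment> \<open>The upper bounds for a block and for the rest of a unit interval add up to
    exactly \<open>\<mu>\<close>, so both are attained.\<close>
  have Ae: "measure lborel (A \<inter> {t..<t + 1 / real q}) = \<mu> / real q" for t
  proof -
    have w: "t + real (q - 1) / real q + 1 / real q = t + 1" "t + 1 / real q + real (q - 1) / real q = t + 1"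
      using q by (simp_all add: field_simps)
    have le1: "measure lborel (A \<inter> {t..<t + 1 / real q}) \<le> \<mu> / real q"
      using mono[of t "t + 1 / real q"] Bm[of t 1] by simp
    have le2: "measure lborel (A \<inter> {t + 1 / real q..<t + 1}) \<le> real (q - 1) * \<mu> / real q"
      using mono[of "t + 1 / real q" "t + 1"] Bm[of "t + 1 / real q" "q - 1"] unfolding w by simp
    have "1 / real q \<le> 1" using q by simp
    hence "measure lborel (A \<inter> {t..<t + 1}) = measure lborel (A \<inter> {t..<t + 1 / real q}) + measure lborel (A \<inter> {t + 1 / real q..<t + 1})"
      using q by (intro measure_Ico_split[OF A]) auto
    hence "\<mu> = measure lborel (A \<inter> {t..<t + 1 / real q}) + measure lborel (A \<inter> {t + 1 / real q..<t + 1})"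
      using periodic_measure_integer_interval[OF A per, of t 1] by (simp add: \<mu>_def)
    moreover have "\<mu> / real q + real (q - 1) * \<mu> / real q = \<mu>" using q by (simp add: field_simps)
    ultimately show ?thesis using le1 le2 by linarith
  qed
  have "measure lborel (A \<inter> {t..<t + 1 / real q}) = measure lborel (A \<inter> {0..<0 + 1 / real q})" unfolding Ae ..
  thus ?thesis using fm[OF A] by (simp add: emeasure_eq_measure2)
qed

lemma zero_one_of_expanding_map:
  fixes A :: "real set" and p :: nat
  assumes A: "A \<in> sets borel" and per: "\<And>x. x + 1 \<in> A \<longleftrightarrow> x \<in> A" and p: "2 \<le> p"
    and exp: "\<And>x. x \<in> A \<Longrightarrow> real p * x + s \<in> A"
  shows "emeasure lborel (A \<inter> {0..<1}) = 0 \<or> emeasure lborel (A \<inter> {0..<1}) = 1"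
proof (rule zero_one_of_short_periods[OF A per])
  fix N :: nat
  have "\<exists>s. \<forall>x\<in>A. real (p ^ k) * x + s \<in> A" for k
  proof (induction k)
    case 0 show ?case by (intro exI[of _ 0]) simp
  next
    case (Suc k)
    then obtain u where u: "\<And>x. x \<in> A \<Longrightarrow> real (p ^ k) * x + u \<in> A" by blast
    have "real (p ^ Suc k) * x + (real p * u + s) \<in> A" if "x \<in> A" for x
      using exp[OF u[OF that]] by (simp add: algebra_simps)
    thus ?case by blast
  qed
  then obtain u where u: "\<And>x. x \<in> A \<Longrightarrow> real (p ^ N) * x + u \<in> A" by blast
  have pN: "0 < p ^ N" using p by simp
  moreover have "N \<le> p ^ N"
  proof -
    have "N < 2 ^ N" by (rule less_exp)
    also have "2 ^ N \<le> p ^ N" using p by (rule power_mono) simp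
    finally show ?thesis by simp
  qed
  moreover have "\<forall>t. emeasure lborel (A \<inter> {t..<t + 1 / real (p ^ N)}) = emeasure lborel (A \<inter> {0..<1 / real (p ^ N)})"
    using expanding_map_density[OF A per pN u] by blast
  ultimately show "\<exists>q\<ge>N. 0 < q \<and> (\<forall>s::real. emeasure lborel (A \<inter> {s..<s + 1 / real q}) = emeasure lborel (A \<inter> {0..<1 / real q}))"
    by blast
qed

lemma emeasure_eq_of_null_diff:
  assumes "A \<subseteq> B" "B - A \<in> null_sets M" "A \<in> sets M" "B \<in> sets M" "X \<in> sets M"
  shows "emeasure M (B \<inter> X) = emeasure M (A \<inter> X)"
proof -
  have "B \<inter> X = (A \<inter> X) \<union> ((B - A) \<inter> X)" using assms(1) by auto
  moreover have "(B - A) \<inter> X \<in> null_sets M" using assms(2,5) by (rule null_set_Int2)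
  ultimately show ?thesis using assms by (simp add: emeasure_Un_null_set)
qed

text \<open>Applying \<open>x \<mapsto> p x + s\<close> multiplies the quality of an approximation by \<open>p\<close>; by Cassels' lemma the
  union over all qualities \<open>p^k \<psi>\<close> differs from the original limsup set by a null set only.\<close>

lemma zero_one_near_limsup_map:
  fixes p :: nat
  assumes \<psi>: "\<And>n. 0 \<le> \<psi> n" "\<psi> 0 = 0" "(\<lambda>n. \<psi> n / real n) \<longlonglongrightarrow> 0" and p: "2 \<le> p"
    and map: "\<And>x n c. x \<in> near_set (\<lambda>n. c * \<psi> n) n \<Longrightarrow> real p * x + s \<in> near_set (\<lambda>n. (real p * c) * \<psi> n) n"
  shows "emeasure lborel (near_limsup \<psi> \<inter> {0..<1}) = 0 \<or> emeasure lborel (near_limsup \<psi> \<inter> {0..<1}) = 1"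
proof -
  define A where "A = (\<Union>k. near_limsup (\<lambda>n. real p ^ k * \<psi> n))"
  have A: "A \<in> sets borel" unfolding A_def using near_limsup_borel by (intro sets.countable_UN) auto
  have per: "x + 1 \<in> A \<longleftrightarrow> x \<in> A" for x by (simp add: A_def near_limsup_shift)
  have exp: "real p * x + s \<in> A" if x: "x \<in> A" for x
  proof -
    obtain k where "x \<in> near_limsup (\<lambda>n. real p ^ k * \<psi> n)" using x by (auto simp: A_def)
    hence "real p * x + s \<in> near_limsup (\<lambda>n. (real p * real p ^ k) * \<psi> n)"
      unfolding near_limsup_iff using map by (rule INFM_mono)
    thus ?thesis unfolding A_def by (intro UN_I[of "Suc k"]) auto
  qed
  have sub: "near_limsup \<psi> \<subseteq> A" unfolding A_def by (auto intro!: exI[of _ 0])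
  have "A - near_limsup \<psi> = (\<Union>k. near_limsup (\<lambda>n. real p ^ k * \<psi> n) - near_limsup \<psi>)" by (auto simp: A_def)
  also have "\<dots> \<in> null_sets lborel"
    using p by (intro null_sets_UN near_limsup_scale[OF _ \<psi>] one_le_power) auto
  finally have "emeasure lborel (A \<inter> {0..<1}) = emeasure lborel (near_limsup \<psi> \<inter> {0..<1})"
    using sub A near_limsup_borel by (intro emeasure_eq_of_null_diff) auto
  thus ?thesis using zero_one_of_expanding_map[OF A per p exp] by simp
qed

section \<open>Classes of denominators according to divisibility by a prime\<close>

definition restricted :: "(nat \<Rightarrow> bool) \<Rightarrow> (nat \<Rightarrow> real) \<Rightarrow> nat \<Rightarrow> real" where
  "restricted P \<psi> n = (if P n then \<psi> n else 0)"

lemma near_set_restricted: "x \<in> near_set (\<lambda>n. c * restricted P \<psi> n) n \<longleftrightarrow> P n \<and> x \<in> near_set (\<lambda>n. c * \<psi> n) n"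
  by (auto simp: near_set_def restricted_def)

lemma near_limsup_restricted:
  "x \<in> near_limsup (restricted P \<psi>) \<longleftrightarrow> (\<exists>\<^sub>\<infinity>n. P n \<and> x \<in> near_set \<psi> n)"
  using near_set_restricted[of x 1 P \<psi>] by (simp add: near_limsup_iff)

lemma tendsto_restricted:
  assumes "(\<lambda>n. \<psi> n / real n) \<longlonglongrightarrow> 0" "\<And>n. 0 \<le> \<psi> n"
  shows "(\<lambda>n. restricted P \<psi> n / real n) \<longlonglongrightarrow> 0"
  by (rule tendsto_sandwich[OF _ _ tendsto_const assms(1)]) (auto simp: restricted_def assms(2))

text \<open>The map \<open>x \<mapsto> p * x\<close> sends the numerator \<open>a\<close> to
  \<open>p * a\<close>, which stays coprime to \<open>n\<close> because \<open>p\<close> does not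
  divide \<open>n\<close>.\<close>

lemma zero_one_coprime_class:
  assumes \<psi>: "\<And>n. 0 \<le> \<psi> n" "\<psi> 0 = 0" "(\<lambda>n. \<psi> n / real n) \<longlonglongrightarrow> 0" and p: "prime (p::nat)"
  defines "W \<equiv> near_limsup (restricted (\<lambda>n. \<not> p dvd n) \<psi>)"
  shows "emeasure lborel (W \<inter> {0..<1}) = 0 \<or> emeasure lborel (W \<inter> {0..<1}) = 1"
  unfolding W_def
proof (rule zero_one_near_limsup_map[where p = p and s = 0])
  fix x :: real and n :: nat and c :: real
  assume "x \<in> near_set (\<lambda>n. c * restricted (\<lambda>n. \<not> p dvd n) \<psi> n) n"
  hence n: "\<not> p dvd n" and "x \<in> near_set (\<lambda>n. c * \<psi> n) n" by (simp_all add: near_set_restricted)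
  then obtain a where a: "coprime a (int n)" "\<bar>real n * x - of_int a\<bar> < c * \<psi> n" by (auto simp: near_set_def)
  have "coprime (int p) (int n)" using prime_imp_coprime[OF p n] by simp
  hence "coprime (int p * a) (int n)" using a(1) by simp
  moreover have "\<bar>real n * (real p * x + 0) - of_int (int p * a)\<bar> < (real p * c) * \<psi> n"
  proof -
    have "real n * (real p * x + 0) - of_int (int p * a) = real p * (real n * x - of_int a)" by (simp add: algebra_simps)
    thus ?thesis using a(2) prime_gt_0_nat[OF p] by (simp add: abs_mult mult.assoc)
  qed
  ultimately have "real p * x + 0 \<in> near_set (\<lambda>n. (real p * c) * \<psi> n) n"
    unfolding near_set_def by (intro CollectI exI[of _ "int p * a"] conjI)
  thus "real p * x + 0 \<in> near_set (\<lambda>n. (real p * c) * restricted (\<lambda>n. \<not> p dvd n) \<psi> n) n"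
    unfolding near_set_restricted using n by (intro conjI)
qed (use \<psi> prime_ge_2_nat[OF p] tendsto_restricted[OF \<psi>(3,1), where P = "\<lambda>n. \<not> p dvd n"] in
      \<open>simp_all add: restricted_def\<close>)

text \<open>For \<open>n = p * m\<close> the shift by \<open>1 / p\<close> adds \<open>m\<close> to
  the numerator \<open>p * a\<close>. The sum is coprime to \<open>p\<close> because
  \<open>m\<close> is, and coprime to \<open>m\<close> because \<open>p * a\<close> is.\<close>

lemma zero_one_exact_class:
  assumes \<psi>: "\<And>n. 0 \<le> \<psi> n" "\<psi> 0 = 0" "(\<lambda>n. \<psi> n / real n) \<longlonglongrightarrow> 0" and p: "prime (p::nat)"
  defines "W \<equiv> near_limsup (restricted (\<lambda>n. p dvd n \<and> \<not> p ^ 2 dvd n) \<psi>)"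
  shows "emeasure lborel (W \<inter> {0..<1}) = 0 \<or> emeasure lborel (W \<inter> {0..<1}) = 1"
  unfolding W_def
proof (rule zero_one_near_limsup_map[where p = p and s = "1 / real p"])
  fix x :: real and n :: nat and c :: real
  let ?P = "\<lambda>n. p dvd n \<and> \<not> p ^ 2 dvd n"
  have p0: "0 < p" using p by (rule prime_gt_0_nat)
  assume "x \<in> near_set (\<lambda>n. c * restricted ?P \<psi> n) n"
  hence n: "p dvd n" "\<not> p ^ 2 dvd n" and "x \<in> near_set (\<lambda>n. c * \<psi> n) n" by (simp_all add: near_set_restricted)
  then obtain a where a: "coprime a (int n)" "\<bar>real n * x - of_int a\<bar> < c * \<psi> n" by (auto simp: near_set_def)
  obtain m where m: "n = p * m" using n(1) by blast
  have "\<not> p dvd m" using n(2) p0 by (simp add: m power2_eq_square)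
  hence pm: "coprime (int p) (int m)" using prime_imp_coprime[OF p] by simp
  have "gcd (int p) (a * int p + int m) = 1" using pm unfolding gcd_add_mult by simp
  hence c1: "coprime (a * int p + int m) (int p)" by (subst coprime_commute) (rule coprime_iff_gcd_eq_1[THEN iffD2])
  have "gcd (int m) (1 * int m + int p * a) = 1"
    using pm a(1) unfolding gcd_add_mult by (simp add: m coprime_commute)
  hence c2: "coprime (1 * int m + int p * a) (int m)" by (subst coprime_commute) (rule coprime_iff_gcd_eq_1[THEN iffD2])
  have e: "a * int p + int m = int p * a + int m" "1 * int m + int p * a = int p * a + int m" by simp_all
  have "coprime (int p * a + int m) (int n)"
    unfolding m of_nat_mult coprime_mult_right_iff using c1 c2 unfolding e by (rule conjI)
  moreover have "\<bar>real n * (real p * x + 1 / real p) - of_int (int p * a + int m)\<bar> < (real p * c) * \<psi> n"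
  proof -
    have "real n * (real p * x + 1 / real p) - of_int (int p * a + int m) = real p * (real n * x - of_int a)"
      using p0 by (simp add: m algebra_simps)
    thus ?thesis using a(2) p0 by (simp add: abs_mult mult.assoc)
  qed
  ultimately have "real p * x + 1 / real p \<in> near_set (\<lambda>n. (real p * c) * \<psi> n) n"
    unfolding near_set_def by (intro CollectI exI[of _ "int p * a + int m"] conjI)
  thus "real p * x + 1 / real p \<in> near_set (\<lambda>n. (real p * c) * restricted ?P \<psi> n) n"
    unfolding near_set_restricted using n by (intro conjI)
qed (use \<psi> prime_ge_2_nat[OF p] tendsto_restricted[OF \<psi>(3,1), where P = "\<lambda>n. p dvd n \<and> \<not> p ^ 2 dvd n"] in
      \<open>simp_all add: restricted_def\<close>)

text \<open>Shifting by \<open>e / p\<close> adds a multiple of \<open>n / p\<close> to the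
  numerator. Since \<open>p ^ 2\<close> divides \<open>n\<close>, every prime of \<open>n\<close>
  divides \<open>n / p\<close>, so coprimality is preserved.\<close>

lemma near_set_short_shift:
  fixes p :: nat
  assumes p: "0 < p" "p ^ 2 dvd n" and x: "x \<in> near_set \<psi> n"
  shows "x + of_int e / real p \<in> near_set \<psi> n"
proof -
  obtain a where a: "coprime a (int n)" "\<bar>real n * x - of_int a\<bar> < \<psi> n" using x by (auto simp: near_set_def)
  obtain l where "n = p ^ 2 * l" using p(2) by blast
  then obtain m where m: "n = p * m" "p dvd m" by (intro that[of "p * l"]) (auto simp: power2_eq_square mult.assoc)
  have "coprime a (int m)" using a(1) by (simp add: m)
  hence "gcd (int m) (e * int m + a) = 1" unfolding gcd_add_mult by (simp add: coprime_commute coprime_iff_gcd_eq_1[symmetric])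
  hence cm: "coprime (a + e * int m) (int m)" by (simp add: coprime_iff_gcd_eq_1 gcd.commute add.commute)
  have "coprime (a + e * int m) (int p)" by (rule coprime_divisors[OF dvd_refl _ cm]) (use m(2) in simp)
  hence "coprime (a + e * int m) (int n)" using cm by (simp add: m)
  moreover have "real n * (x + of_int e / real p) - of_int (a + e * int m) = real n * x - of_int a"
    using p(1) by (simp add: m algebra_simps)
  ultimately show ?thesis unfolding near_set_def using a(2) by (intro CollectI exI[of _ "a + e * int m"]) simp
qed

lemma square_class_periodic:
  fixes \<psi> :: "nat \<Rightarrow> real" and p :: nat
  assumes "0 < p"
  defines "W \<equiv> near_limsup (restricted (\<lambda>n. p ^ 2 dvd n) \<psi>)"
  shows "emeasure lborel (W \<inter> {s..<s + 1 / real p}) = emeasure lborel (W \<inter> {0..<1 / real p})"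
proof -
  have fwd: "x + of_int e / real p \<in> W" if "x \<in> W" for x e
    using that near_set_short_shift[OF assms(1)] unfolding W_def near_limsup_restricted
    by (auto elim!: INFM_mono)
  have shift: "x + 1 / real p \<in> W \<longleftrightarrow> x \<in> W" for x
    using fwd[of x 1] fwd[of "x + 1 / real p" "-1"] by auto
  \<comment> \<open>Stretching by \<open>p\<close> turns the period \<open>1 / p\<close> into 1, for
    which interval measures have already been compared.\<close>
  define A where "A = {y. y / real p \<in> W}"
  have Wb: "W \<in> sets borel" unfolding W_def by (rule near_limsup_borel)
  have "(\<lambda>y. y / real p) -` W \<inter> space borel \<in> sets borel" by (rule measurable_sets[OF _ Wb]) simp
  hence A: "A \<in> sets borel" by (simp add: A_def vimage_def)
  have per: "y + 1 \<in> A \<longleftrightarrow> y \<in> A" for y using shift[of "y / real p"] by (simp add: A_def add_divide_distrib)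
  have sc: "emeasure lborel (A \<inter> {real p * t..<real p * t + 1}) = ennreal (real p) * emeasure lborel (W \<inter> {t..<t + 1 / real p})" for t
  proof -
    have "{x. real p * x + 0 \<in> A \<inter> {real p * t..<real p * t + 1}} = W \<inter> {t..<t + 1 / real p}"
      using assms(1) by (auto simp: A_def field_simps)
    thus ?thesis using lebesgue_affine[of "A \<inter> {real p * t..<real p * t + 1}" "real p" 0] A assms(1) by simp
  qed
  have "ennreal (real p) * emeasure lborel (W \<inter> {s..<s + 1 / real p}) = ennreal (real p) * emeasure lborel (W \<inter> {0..<0 + 1 / real p})"
    unfolding sc[symmetric] periodic_measure_interval[OF A per] by simp
  thus ?thesis using assms(1) by (simp add: ennreal_mult_cancel_left)
qed

text \<open>If one of the first two classes is full for some prime, so is the whole set. Otherwise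
  both are null for every prime, and the set has the interval measures of a set of period
  \<open>1 / p\<close> for arbitrarily large \<open>p\<close>.\<close>

theorem near_limsup_zero_one:
  assumes \<psi>: "\<And>n. 0 \<le> \<psi> n" "\<psi> 0 = 0" "(\<lambda>n. \<psi> n / real n) \<longlonglongrightarrow> 0"
  shows "emeasure lborel (near_limsup \<psi> \<inter> {0..<1}) = 0 \<or> emeasure lborel (near_limsup \<psi> \<inter> {0..<1}) = 1"
proof -
  define W where "W = near_limsup \<psi>"
  define A where "A = (\<lambda>p::nat. near_limsup (restricted (\<lambda>n. \<not> p dvd n) \<psi>))"
  define B where "B = (\<lambda>p::nat. near_limsup (restricted (\<lambda>n. p dvd n \<and> \<not> p ^ 2 dvd n) \<psi>))"
  define C where "C = (\<lambda>p::nat. near_limsup (restricted (\<lambda>n. p ^ 2 dvd n) \<psi>))"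
  have meas: "W \<in> sets borel" "A p \<in> sets borel" "B p \<in> sets borel" "C p \<in> sets borel" for p
    by (simp_all add: W_def A_def B_def C_def near_limsup_borel)
  have sub: "A p \<subseteq> W" "B p \<subseteq> W" "C p \<subseteq> W" for p
    unfolding A_def B_def C_def W_def using \<psi>(1) by (auto intro!: near_limsup_mono simp: restricted_def)
  have cover: "x \<in> A p \<or> x \<in> B p \<or> x \<in> C p" if "x \<in> W" for x p
  proof -
    have "\<exists>\<^sub>\<infinity>n. (\<not> p dvd n \<and> x \<in> near_set \<psi> n) \<or> (p dvd n \<and> \<not> p ^ 2 dvd n \<and> x \<in> near_set \<psi> n) \<or> (p ^ 2 dvd n \<and> x \<in> near_set \<psi> n)"
      using that unfolding W_def near_limsup_iff by (rule INFM_mono) blast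
    thus ?thesis unfolding A_def B_def C_def near_limsup_restricted INFM_disj_distrib by simp
  qed
  have full: "emeasure lborel (W \<inter> {0..<1}) = 1" if "X \<subseteq> W" "emeasure lborel (X \<inter> {0..<1}) = 1" for X
  proof (rule antisym)
    show "1 \<le> emeasure lborel (W \<inter> {0..<1})"
      unfolding that(2)[symmetric] using that(1) meas(1) by (intro emeasure_mono) auto
    have "emeasure lborel (W \<inter> {0..<1}) \<le> emeasure lborel {0..<1::real}" using meas(1) by (intro emeasure_mono) auto
    thus "emeasure lborel (W \<inter> {0..<1}) \<le> 1" by simp
  qed
  show ?thesis
  proof (cases "\<exists>p. prime p \<and> (emeasure lborel (A p \<inter> {0..<1}) = 1 \<or> emeasure lborel (B p \<inter> {0..<1}) = 1)")
    case True
    thus ?thesis using full sub unfolding W_def by blast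
  next
    case False
    have null: "emeasure lborel (A p \<inter> {0..<1}) = 0" "emeasure lborel (B p \<inter> {0..<1}) = 0" if "prime p" for p
      using False that zero_one_coprime_class[OF \<psi> that] zero_one_exact_class[OF \<psi> that] unfolding A_def B_def by blast+
    have null': "near_limsup \<theta> \<inter> {s..<s + 1 / real p} \<in> null_sets lborel"
      if "emeasure lborel (near_limsup \<theta> \<inter> {0..<1}) = 0" "0 < p" for \<theta> s p
    proof (rule null_sets_subset)
      have "emeasure lborel (near_limsup \<theta> \<inter> {s..<s + 1}) = 0"
        using that periodic_measure_interval[OF near_limsup_borel near_limsup_shift] by simp
      thus "near_limsup \<theta> \<inter> {s..<s + 1} \<in> null_sets lborel" using near_limsup_borel by (auto simp: null_sets_def)
      have "1 / real p \<le> 1" using that(2) by simp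
      thus "near_limsup \<theta> \<inter> {s..<s + 1 / real p} \<subseteq> near_limsup \<theta> \<inter> {s..<s + 1}" by auto
    qed (use near_limsup_borel in auto)
    have WC: "emeasure lborel (W \<inter> {s..<s + 1 / real p}) = emeasure lborel (C p \<inter> {s..<s + 1 / real p})" if p: "prime p" for p s
    proof -
      define J where "J = {s..<s + 1 / real p}"
      have p0: "0 < p" using p by (rule prime_gt_0_nat)
      have "(A p \<inter> J) \<union> (B p \<inter> J) \<in> null_sets lborel"
        using null'[OF _ p0] null[OF p] unfolding A_def B_def J_def by (intro null_sets.Un) auto
      hence "W \<inter> J - C p \<inter> J \<in> null_sets lborel"
      proof (rule null_sets_subset)
        show "W \<inter> J - C p \<inter> J \<in> sets lborel" using meas by (simp add: J_def)
        show "W \<inter> J - C p \<inter> J \<subseteq> (A p \<inter> J) \<union> (B p \<inter> J)" using cover[of _ p] by blast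
      qed
      hence "emeasure lborel (W \<inter> J \<inter> UNIV) = emeasure lborel (C p \<inter> J \<inter> UNIV)"
        using sub(3)[of p] meas(1) meas(4)[of p] by (intro emeasure_eq_of_null_diff) (auto simp: J_def)
      thus ?thesis by (simp add: J_def)
    qed
    have "emeasure lborel (W \<inter> {0..<1}) = 0 \<or> emeasure lborel (W \<inter> {0..<1}) = 1"
    proof (rule zero_one_of_short_periods[OF meas(1)])
      show "x + 1 \<in> W \<longleftrightarrow> x \<in> W" for x by (simp add: W_def near_limsup_shift)
      fix N :: nat
      obtain p where p: "prime p" "p > N" using bigger_prime by blast
      have "emeasure lborel (W \<inter> {s..<s + 1 / real p}) = emeasure lborel (W \<inter> {0..<1 / real p})" for s
        using WC[OF p(1), of s] WC[OF p(1), of 0] square_class_periodic[OF prime_gt_0_nat[OF p(1)]] by (simp add: C_def)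
      thus "\<exists>q\<ge>N. 0 < q \<and> (\<forall>s::real. emeasure lborel (W \<inter> {s..<s + 1 / real q}) = emeasure lborel (W \<inter> {0..<1 / real q}))"
        using p prime_gt_0_nat by (intro exI[of _ p]) auto
    qed
    thus ?thesis by (simp add: W_def)
  qed
qed

subsection \<open>Conclusion\<close>

text \<open>The local factor \<open>(1 - 1 / p)\<^sup>2 * p\<close> is at least 1 for every prime
  except 2, where it is 1/2; higher powers of a prime only enlarge \<open>n\<close>.\<close>

lemma totient_square_lower_bound:
  assumes "0 < n"
  shows "1 / 2 \<le> (tot_ratio n)\<^sup>2 * real n"
proof -
  define P where "P = prime_factors n"
  have fin: "finite P" by (simp add: P_def)
  have pr: "prime p" if "p \<in> P" for p using that by (auto simp: P_def)
  have "real (\<Prod>p\<in>P. p) \<le> real n"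
  proof -
    have "(\<Prod>p\<in>P. p) \<le> (\<Prod>p\<in>P. p ^ multiplicity p n)"
    proof (rule prod_mono)
      fix p assume p: "p \<in> P"
      have "1 \<le> multiplicity p n" using p assms by (simp add: P_def prime_factors_multiplicity Suc_le_eq)
      thus "0 \<le> p \<and> p \<le> p ^ multiplicity p n" using prime_gt_0_nat[OF pr[OF p]] by (auto intro: self_le_power)
    qed
    also have "\<dots> = n" unfolding P_def using assms by (rule prime_factorization_nat[symmetric])
    finally show ?thesis unfolding of_nat_le_iff .
  qed
  moreover have "1 / 2 \<le> (\<Prod>p\<in>P. (1 - 1 / real p)\<^sup>2 * real p)"
  proof -
    have "1 / 2 \<le> (\<Prod>p\<in>P. if p = 2 then 1 / 2 else (1::real))" using fin by (simp add: prod.delta)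
    also have "\<dots> \<le> (\<Prod>p\<in>P. (1 - 1 / real p)\<^sup>2 * real p)"
    proof (rule prod_mono)
      fix p assume p: "p \<in> P"
      show "0 \<le> (if p = 2 then 1 / 2 else (1::real)) \<and> (if p = 2 then 1 / 2 else 1) \<le> (1 - 1 / real p)\<^sup>2 * real p"
      proof (cases "p = 2")
        case False
        hence p3: "3 \<le> real p" using prime_ge_2_nat[OF pr[OF p]] by simp
        have "3 * real p \<le> real p * real p" using p3 by (rule mult_right_mono) simp
        moreover have "(real p - 1)\<^sup>2 = real p * real p - 2 * real p + 1" by (simp add: power2_eq_square algebra_simps)
        ultimately have "real p \<le> (real p - 1)\<^sup>2" by linarith
        moreover have "(1 - 1 / real p)\<^sup>2 * real p = (real p - 1)\<^sup>2 / real p"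
          using p3 by (simp add: power2_eq_square field_simps)
        ultimately show ?thesis using False p3 by (simp add: le_divide_eq)
      qed (simp add: power2_eq_square)
    qed
    finally show ?thesis .
  qed
  moreover have "(\<Prod>p\<in>P. (1 - 1 / real p)\<^sup>2 * real p) = (tot_ratio n)\<^sup>2 * real (\<Prod>p\<in>P. p)"
    unfolding tot_ratio_eq_prod[OF assms] P_def by (simp add: prod.distrib prod_power_distrib)
  ultimately show ?thesis using mult_left_mono[of "real (\<Prod>p\<in>P. p)" "real n" "(tot_ratio n)\<^sup>2"] by simp
qed

lemma tot_ratio_sqrt_lower_bound:
  assumes "0 < n"
  shows "1 / 2 \<le> tot_ratio n * sqrt (real n)"
proof (rule power2_le_imp_le)
  show "(1 / 2)\<^sup>2 \<le> (tot_ratio n * sqrt (real n))\<^sup>2"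
    using totient_square_lower_bound[OF assms] by (simp add: power_mult_distrib power2_eq_square[of "1 / 2"])
qed (use tot_ratio_pos[OF assms] in simp)

text \<open>The cut at the square root is low enough for \<open>\<psi> n / n\<close> to tend to 0,
  as the scaling lemma needs, and high enough that each truncated denominator still contributes at
  least 1/2 to the mass.\<close>

definition truncated :: "(nat \<Rightarrow> real) \<Rightarrow> nat \<Rightarrow> real" where
  "truncated \<psi> n = (if n = 0 then 0 else min (\<psi> n) (sqrt (real n)))"

lemma mass_truncated_unbounded:
  assumes nonneg: "\<And>n. n \<ge> 1 \<Longrightarrow> 0 \<le> \<psi> n"
    and diverges: "filterlim (\<lambda>N. \<Sum>n=1..N. \<psi> n * real (totient n) / real n) at_top sequentially"
  shows "\<exists>S. finite S \<and> S \<subseteq> {N..} \<and> 1 \<le> mass (truncated \<psi>) S"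
proof (cases "\<exists>\<^sub>\<infinity>n. sqrt (real n) \<le> \<psi> n")
  case True
  \<comment> \<open>Two truncated denominators beyond \<open>N\<close> suffice, at 1/2 each.\<close>
  obtain a where a: "a > N" "sqrt (real a) \<le> \<psi> a" using True by (auto simp: INFM_nat)
  obtain b where b: "b > a" "sqrt (real b) \<le> \<psi> b" using True by (auto simp: INFM_nat)
  have t: "truncated \<psi> a = sqrt (real a)" "truncated \<psi> b = sqrt (real b)" using a b by (auto simp: truncated_def)
  have "mass (truncated \<psi>) {a,b} = tot_ratio a * sqrt (real a) + tot_ratio b * sqrt (real b)"
    using b(1) by (simp add: mass_def t)
  also have "\<dots> \<ge> 1" using tot_ratio_sqrt_lower_bound[of a] tot_ratio_sqrt_lower_bound[of b] a b by simp
  finally show ?thesis using a b by (intro exI[of _ "{a,b}"]) auto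
next
  case False
  then obtain L where L: "\<And>n. n > L \<Longrightarrow> \<psi> n < sqrt (real n)" by (auto simp: INFM_nat not_le)
  define f where "f = (\<lambda>n. \<psi> n * real (totient n) / real n)"
  define k where "k = max N L + 1"
  obtain M where M: "M \<ge> k" "(\<Sum>n=1..M. f n) \<ge> (\<Sum>n=1..<k. f n) + 1"
  proof -
    have "eventually (\<lambda>M. (\<Sum>n=1..M. f n) \<ge> (\<Sum>n=1..<k. f n) + 1) sequentially"
      using diverges unfolding f_def filterlim_at_top by blast
    then obtain M0 where "\<And>M. M \<ge> M0 \<Longrightarrow> (\<Sum>n=1..M. f n) \<ge> (\<Sum>n=1..<k. f n) + 1" by (auto simp: eventually_sequentially)
    thus ?thesis using that[of "max M0 k"] by simp
  qed
  have e: "{1..M} = {1..<k} \<union> {k..M}" using M(1) by (auto simp: k_def)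
  have "(\<Sum>n=1..M. f n) = (\<Sum>n=1..<k. f n) + (\<Sum>n=k..M. f n)"
    unfolding e by (rule sum.union_disjoint) auto
  hence "1 \<le> (\<Sum>n=k..M. f n)" using M(2) by simp
  also have "\<dots> = mass (truncated \<psi>) {k..M}"
    unfolding mass_def
  proof (rule sum.cong[OF refl])
    fix n assume "n \<in> {k..M}"
    hence "L < n" unfolding k_def atLeastAtMost_iff by linarith
    hence "truncated \<psi> n = \<psi> n" using L[of n] by (simp add: truncated_def)
    thus "f n = tot_ratio n * truncated \<psi> n" by (simp add: f_def tot_ratio_def)
  qed
  finally show ?thesis by (intro exI[of _ "{k..M}"]) (auto simp: k_def)
qed

lemma approx_set_iff_near_set:
  assumes n: "1 \<le> n"
  shows "(\<exists>k::int. x + of_int k \<in> approx_set \<psi> n) \<longleftrightarrow> x \<in> near_set \<psi> n"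
proof
  assume "\<exists>k::int. x + of_int k \<in> approx_set \<psi> n"
  then obtain k :: int and a where a: "coprime a n"
    "(real a - \<psi> n) / real n < x + of_int k" "x + of_int k < (real a + \<psi> n) / real n"
    by (auto simp: approx_set_def)
  have ab: "real a - \<psi> n < real n * (x + of_int k)" "real n * (x + of_int k) < real a + \<psi> n"
    using a(2,3) n by (simp_all add: field_simps)
  have "coprime (int a - k * int n) (int n)" using coprime_add_multiple_iff[of "int a" "- k" "int n"] a(1) by simp
  moreover have "\<bar>real n * x - of_int (int a - k * int n)\<bar> < \<psi> n"
    using ab by (simp add: abs_less_iff algebra_simps)
  ultimately show "x \<in> near_set \<psi> n" unfolding near_set_def by blast
next
  assume "x \<in> near_set \<psi> n"
  then obtain a where a: "coprime a (int n)" "\<bar>real n * x - of_int a\<bar> < \<psi> n" by (auto simp: near_set_def)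
  \<comment> \<open>Numerators range over \<open>{1..n}\<close> rather than \<open>{0..<n}\<close>,
    hence the shift by 1 around the division; for \<open>n = 1\<close> it selects the numerator
    1.\<close>
  define q where "q = (a - 1) div int n"
  define b where "b = nat ((a - 1) mod int n + 1)"
  have bi: "int b = (a - 1) mod int n + 1" using n by (simp add: b_def)
  have dm: "int n * q + (a - 1) mod int n = a - 1" unfolding q_def by (rule mult_div_mod_eq)
  have ib: "int b = a - q * int n" using bi dm by (simp add: mult.commute)
  have "0 \<le> (a - 1) mod int n" "(a - 1) mod int n < int n" using n by simp_all
  hence b: "1 \<le> b" "b \<le> n" using bi by linarith+
  have "coprime (int b) (int n)" unfolding ib using coprime_add_multiple_iff[of a "- q" "int n"] a(1) by simp
  hence cb: "coprime b n" by simp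
  have rb: "real b = of_int a - of_int q * real n" using arg_cong[OF ib, of real_of_int] by simp
  have "x + of_int (- q) \<in> {(real b - \<psi> n) / real n <..< (real b + \<psi> n) / real n}"
    using a(2) n by (simp add: rb abs_less_iff field_simps)
  hence "x + of_int (- q) \<in> approx_set \<psi> n" unfolding approx_set_def using b cb by blast
  thus "\<exists>k::int. x + of_int k \<in> approx_set \<psi> n" by blast
qed

text \<open>Putting the value 0 at \<open>n = 0\<close> empties \<open>near_set\<close> there, which
  encodes the restriction to positive denominators.\<close>

lemma limsup_set_eq: "limsup_set \<psi> = near_limsup (\<lambda>n. if n = 0 then 0 else \<psi> n) \<inter> {0..1}"
proof -
  have "infinite {n. n \<ge> 1 \<and> (\<exists>k::int. x + of_int k \<in> approx_set \<psi> n)} \<longleftrightarrow> x \<in> near_limsup (\<lambda>n. if n = 0 then 0 else \<psi> n)" for x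
  proof -
    have "(n \<ge> 1 \<and> (\<exists>k::int. x + of_int k \<in> approx_set \<psi> n)) \<longleftrightarrow> x \<in> near_set (\<lambda>n. if n = 0 then 0 else \<psi> n) n" for n
    proof (cases "n = 0")
      case False
      have "near_set (\<lambda>n. if n = 0 then 0 else \<psi> n) n = near_set \<psi> n" using False by (simp add: near_set_def)
      thus ?thesis using approx_set_iff_near_set[of n x \<psi>] False by simp
    qed (simp add: near_set_def)
    thus ?thesis by (simp add: near_limsup_iff frequently_cofinite)
  qed
  thus ?thesis unfolding limsup_set_def by blast
qed

theorem theorem3:
  fixes \<psi> :: "nat \<Rightarrow> real"
  assumes nonneg: "\<And>n. n \<ge> 1 \<Longrightarrow> 0 \<le> \<psi> n"
    and diverges: "filterlim (\<lambda>N. \<Sum>n=1..N. \<psi> n * real (totient n) / real n) at_top sequentially"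
    and extra: "\<exists>\<eta>>0. \<exists>C>0. \<forall>h::nat. \<forall>r::real. h \<ge> 1 \<longrightarrow> r \<ge> 1 \<longrightarrow>
      (\<Sum>n | 2 ^ h < real n \<and> real n \<le> 2 ^ h * real h powr \<eta> \<and>
             inverse r * real h powr (- \<eta>) < \<psi> n \<and> \<psi> n \<le> inverse r.
         \<psi> n * real (totient n) / real n) \<le> C / Log (Log (real h))"
  shows "emeasure lebesgue (limsup_set \<psi>) = 1"
proof -
  define \<theta> where "\<theta> = truncated \<psi>"
  define W where "W = near_limsup \<theta>"
  have W: "W \<in> sets borel" unfolding W_def by (rule near_limsup_borel)
  have fm: "W \<inter> {a..<b} \<in> fmeasurable lborel" for a b :: real
    using W by (intro fmeasurable_subset_Icc[of _ a b]) auto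
  have \<theta>0: "\<theta> 0 = 0" "0 \<le> \<theta> n" "\<theta> n \<le> sqrt (real n)" for n
    using nonneg by (auto simp: \<theta>_def truncated_def)
  have sqrt_le: "sqrt (real n) \<le> real n" for n
    by (cases "n = 0") (auto simp: real_le_lsqrt power2_eq_square)
  have lim: "(\<lambda>n. \<theta> n / real n) \<longlonglongrightarrow> 0"
  proof (rule tendsto_sandwich[OF _ _ tendsto_const])
    show "(\<lambda>n. sqrt (real n) / real n) \<longlonglongrightarrow> 0" by real_asymp
  qed (auto simp: \<theta>0 divide_right_mono)
  have "measure lborel (W \<inter> {-1..2}) > 0"
    unfolding W_def
  proof (rule near_limsup_not_null)
    show "0 \<le> \<theta> n \<and> \<theta> n \<le> real n" for n using \<theta>0(2,3)[of n] sqrt_le[of n] by linarith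
    show "\<exists>S. finite S \<and> S \<subseteq> {N..} \<and> 1 \<le> mass \<theta> S" for N
      unfolding \<theta>_def by (rule mass_truncated_unbounded[OF nonneg diverges])
  qed
  \<comment> \<open>The half-open interval ends at 3: it contains the closed window and has integer
    length, so periodicity reduces it to four copies of \<open>{0..<1}\<close>.\<close>
  also have "measure lborel (W \<inter> {-1..2}) \<le> measure lborel (W \<inter> {-1..<-1 + real 4})"
    using W by (intro measure_mono_fmeasurable[OF _ _ fm]) auto
  also have "\<dots> = 4 * measure lborel (W \<inter> {0..<1})"
    using periodic_measure_integer_interval[OF W, of "-1" 4] near_limsup_shift by (simp add: W_def)
  finally have "emeasure lborel (W \<inter> {0..<1}) \<noteq> 0" by (auto simp: measure_def)
  hence one: "emeasure lborel (W \<inter> {0..<1}) = 1"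
    using near_limsup_zero_one[of \<theta>] \<theta>0 lim unfolding W_def by blast
  define V where "V = near_limsup (\<lambda>n. if n = 0 then 0 else \<psi> n) \<inter> {0..1}"
  have V: "V \<in> sets borel" unfolding V_def using near_limsup_borel by (intro sets.Int) auto
  \<comment> \<open>Truncation only shrinks the sets, so full measure passes from the truncated
    function back to \<open>\<psi>\<close>.\<close>
  have "W \<subseteq> near_limsup (\<lambda>n. if n = 0 then 0 else \<psi> n)"
    unfolding W_def by (rule near_limsup_mono) (simp add: \<theta>_def truncated_def)
  hence "W \<inter> {0..<1} \<subseteq> V" by (auto simp: V_def)
  hence "1 \<le> emeasure lborel V" unfolding one[symmetric] using V by (intro emeasure_mono) auto
  moreover have "emeasure lborel V \<le> emeasure lborel {0..1::real}" by (intro emeasure_mono) (auto simp: V_def)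
  ultimately have "emeasure lborel V = 1" by (intro antisym) auto
  thus ?thesis unfolding limsup_set_eq V_def[symmetric] using V by simp
qed

end
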